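(* Let $n\ge 3$, let $p\ge 1+\frac{4}{n-1}$, and let $M=H^n(-1)$ be the hyperbolic $n$-space. Let $u_0\in H^1(M)$ and let $u$ be a solution of $$iu_t=\Delta u+|u|^{p-1}u\ \text{ on } M,\qquad u(0)=u_0,$$ with maximal existence time $T\in(0,\infty]$, satisfying $$u\in C^1([0,T),L^2(M))\cap C([0,T),H^2(M)\cap H^1_0(M)\cap L^{p+1}(M)).$$ If $$E_0=\int_M\Big(|\nabla u_0|^2-\frac{2}{p+1}|u_0|^{p+1}\Big)<0,$$ then $u$ blows up in finite time, i.e. $T<\infty$.
   Context: $H^n(-1)$ is the complete simply connected $n$-dimensional Riemannian manifold of constant sectional curvature $-1$; in geodesic polar coordinates its metric is $g=dr^2+\sinh^2 r\,g_{S^{n-1}}$. $\Delta$ is the Laplace–Beltrami operator, with sign convention $\Delta u=u''$ on $\mathbb{R}$. Solutions are complex-valued, and $|\nabla u|^2=g(\nabla u,\nabla\bar u)$ with $g$ extended complex-bilinearly. "Blows up in finite time" means that the maximal existence time $T$ in the stated regularity class is finite. *)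

theory Defs
  imports "HOL-Analysis.Analysis"
begin

section \<open>Riemannian metrics in a global chart\<close>

text \<open>
  A Riemannian manifold covered by one chart is given by an open set \<open>\<Omega>\<close> of \<open>\<real>\<^sup>n\<close>
  (\<open>n = CARD('n)\<close>) and the matrix field \<open>g\<close> of its metric in that chart.  Functions on the
  manifold are functions on \<open>\<real>\<^sup>n\<close>, of which only the values on \<open>\<Omega>\<close> matter.
\<close>

type_synonym 'n metric_field = "real^'n \<Rightarrow> real^'n^'n"

definition partial :: "'n::finite \<Rightarrow> (real^'n \<Rightarrow> 'b::real_normed_vector) \<Rightarrow> real^'n \<Rightarrow> 'b" where
  "partial i f x = frechet_derivative f (at x) (axis i 1)"

definition riem_vol :: "(real^'n) set \<Rightarrow> 'n::finite metric_field \<Rightarrow> (real^'n) measure" where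
  "riem_vol \<Omega> g = density (lebesgue_on \<Omega>) (\<lambda>x. ennreal (sqrt (det (g x))))"

definition cometric :: "'n::finite metric_field \<Rightarrow> real^'n \<Rightarrow> 'n \<Rightarrow> 'n \<Rightarrow> real" where
  "cometric g x i j = matrix_inv (g x) $ i $ j"

text \<open>\<open>christoffel g x k i j\<close> is \<open>\<Gamma>\<^sup>k\<^sub>i\<^sub>j\<close>.\<close>

definition christoffel :: "'n::finite metric_field \<Rightarrow> real^'n \<Rightarrow> 'n \<Rightarrow> 'n \<Rightarrow> 'n \<Rightarrow> real" where
  "christoffel g x k i j =
     (1/2) * (\<Sum>l\<in>UNIV. cometric g x k l *
        (partial i (\<lambda>y. g y $ j $ l) x + partial j (\<lambda>y. g y $ i $ l) x
           - partial l (\<lambda>y. g y $ i $ j) x))"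


section \<open>Weak derivatives\<close>

primrec Ck :: "nat \<Rightarrow> (real^'n::finite \<Rightarrow> 'b::real_normed_vector) \<Rightarrow> bool" where
  "Ck 0 f \<longleftrightarrow> continuous_on UNIV f"
| "Ck (Suc k) f \<longleftrightarrow> f differentiable_on UNIV \<and> (\<forall>i. Ck k (partial i f))"

definition test_functions :: "(real^'n::finite) set \<Rightarrow> (real^'n \<Rightarrow> complex) set" where
  "test_functions \<Omega> =
     {\<phi>. (\<forall>k. Ck k \<phi>) \<and> compact (closure {x. \<phi> x \<noteq> 0}) \<and> closure {x. \<phi> x \<noteq> 0} \<subseteq> \<Omega>}"

definition locally_integrable :: "(real^'n::finite) set \<Rightarrow> (real^'n \<Rightarrow> complex) \<Rightarrow> bool" where
  "locally_integrable \<Omega> f \<longleftrightarrow> (\<forall>K. compact K \<and> K \<subseteq> \<Omega> \<longrightarrow> f absolutely_integrable_on K)"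

definition has_weak_partial ::
    "(real^'n::finite) set \<Rightarrow> 'n \<Rightarrow> (real^'n \<Rightarrow> complex) \<Rightarrow> (real^'n \<Rightarrow> complex) \<Rightarrow> bool" where
  "has_weak_partial \<Omega> i f w \<longleftrightarrow>
     locally_integrable \<Omega> f \<and> locally_integrable \<Omega> w \<and>
     (\<forall>\<phi>\<in>test_functions \<Omega>.
        (LINT x|lebesgue_on \<Omega>. f x * partial i \<phi> x) = - (LINT x|lebesgue_on \<Omega>. w x * \<phi> x))"

text \<open>
  A weak partial derivative is unique up to null sets; everything below depends on the chosen
  representative only up to null sets.
\<close>

definition weak_partial ::
    "(real^'n::finite) set \<Rightarrow> 'n \<Rightarrow> (real^'n \<Rightarrow> complex) \<Rightarrow> real^'n \<Rightarrow> complex" where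
  "weak_partial \<Omega> i f = (SOME w. has_weak_partial \<Omega> i f w)"


section \<open>Gradient, Hessian and Laplace--Beltrami operator\<close>

text \<open>
  \<open>g(\<nabla>f, \<nabla>(cnj f))\<close> with \<open>g\<close> extended complex-bilinearly; the sum is real.
\<close>

definition grad_sq ::
    "(real^'n::finite) set \<Rightarrow> 'n metric_field \<Rightarrow> (real^'n \<Rightarrow> complex) \<Rightarrow> real^'n \<Rightarrow> real" where
  "grad_sq \<Omega> g f x =
     Re (\<Sum>i\<in>UNIV. \<Sum>j\<in>UNIV. of_real (cometric g x i j) *
           (weak_partial \<Omega> i f x * cnj (weak_partial \<Omega> j f x)))"

definition hess ::
    "(real^'n::finite) set \<Rightarrow> 'n metric_field \<Rightarrow> (real^'n \<Rightarrow> complex) \<Rightarrow> real^'n \<Rightarrow> 'n \<Rightarrow> 'n \<Rightarrow> complex"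
  where
  "hess \<Omega> g f x i j =
     weak_partial \<Omega> i (weak_partial \<Omega> j f) x
       - (\<Sum>k\<in>UNIV. of_real (christoffel g x k i j) * weak_partial \<Omega> k f x)"

definition hess_sq ::
    "(real^'n::finite) set \<Rightarrow> 'n metric_field \<Rightarrow> (real^'n \<Rightarrow> complex) \<Rightarrow> real^'n \<Rightarrow> real" where
  "hess_sq \<Omega> g f x =
     Re (\<Sum>i\<in>UNIV. \<Sum>j\<in>UNIV. \<Sum>k\<in>UNIV. \<Sum>l\<in>UNIV.
           of_real (cometric g x i k * cometric g x j l) *
             (hess \<Omega> g f x i j * cnj (hess \<Omega> g f x k l)))"

definition laplace_beltrami ::
    "(real^'n::finite) set \<Rightarrow> 'n metric_field \<Rightarrow> (real^'n \<Rightarrow> complex) \<Rightarrow> real^'n \<Rightarrow> complex" where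
  "laplace_beltrami \<Omega> g f x =
     (\<Sum>i\<in>UNIV. \<Sum>j\<in>UNIV. of_real (cometric g x i j) * hess \<Omega> g f x i j)"


section \<open>Lebesgue and Sobolev spaces\<close>

text \<open>Elements are representatives; all notions below respect almost-everywhere equality.\<close>

definition Lp_space :: "'a measure \<Rightarrow> real \<Rightarrow> ('a \<Rightarrow> complex) set" where
  "Lp_space M q = {f \<in> borel_measurable M. integrable M (\<lambda>x. norm (f x) powr q)}"

definition Lp_norm :: "'a measure \<Rightarrow> real \<Rightarrow> ('a \<Rightarrow> complex) \<Rightarrow> real" where
  "Lp_norm M q f = (LINT x|M. norm (f x) powr q) powr (1 / q)"

definition H1_space ::
    "(real^'n::finite) set \<Rightarrow> 'n metric_field \<Rightarrow> (real^'n \<Rightarrow> complex) set" where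
  "H1_space \<Omega> g =
     {f \<in> Lp_space (riem_vol \<Omega> g) 2.
        (\<forall>i. \<exists>w. has_weak_partial \<Omega> i f w) \<and> integrable (riem_vol \<Omega> g) (grad_sq \<Omega> g f)}"

definition H1_norm ::
    "(real^'n::finite) set \<Rightarrow> 'n metric_field \<Rightarrow> (real^'n \<Rightarrow> complex) \<Rightarrow> real" where
  "H1_norm \<Omega> g f = sqrt (LINT x|riem_vol \<Omega> g. (norm (f x))\<^sup>2 + grad_sq \<Omega> g f x)"

definition H10_space ::
    "(real^'n::finite) set \<Rightarrow> 'n metric_field \<Rightarrow> (real^'n \<Rightarrow> complex) set" where
  "H10_space \<Omega> g =
     {f \<in> H1_space \<Omega> g. \<exists>\<phi>. (\<forall>m. \<phi> m \<in> test_functions \<Omega>) \<and>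
        (\<lambda>m::nat. H1_norm \<Omega> g (\<lambda>x. f x - \<phi> m x)) \<longlonglongrightarrow> 0}"

definition H2_space ::
    "(real^'n::finite) set \<Rightarrow> 'n metric_field \<Rightarrow> (real^'n \<Rightarrow> complex) set" where
  "H2_space \<Omega> g =
     {f \<in> H1_space \<Omega> g.
        (\<forall>i j. \<exists>w. has_weak_partial \<Omega> i (weak_partial \<Omega> j f) w) \<and>
        integrable (riem_vol \<Omega> g) (hess_sq \<Omega> g f)}"

definition H2_norm ::
    "(real^'n::finite) set \<Rightarrow> 'n metric_field \<Rightarrow> (real^'n \<Rightarrow> complex) \<Rightarrow> real" where
  "H2_norm \<Omega> g f =
     sqrt (LINT x|riem_vol \<Omega> g. (norm (f x))\<^sup>2 + grad_sq \<Omega> g f x + hess_sq \<Omega> g f x)"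


section \<open>Curves in function spaces\<close>

definition continuous_wrt ::
    "(('a \<Rightarrow> complex) \<Rightarrow> real) \<Rightarrow> real set \<Rightarrow> (real \<Rightarrow> 'a \<Rightarrow> complex) \<Rightarrow> bool" where
  "continuous_wrt N I u \<longleftrightarrow>
     (\<forall>t\<in>I. ((\<lambda>s. N (\<lambda>x. u s x - u t x)) \<longlongrightarrow> 0) (at t within I))"

definition derivative_wrt ::
    "(('a \<Rightarrow> complex) \<Rightarrow> real) \<Rightarrow> real set \<Rightarrow> (real \<Rightarrow> 'a \<Rightarrow> complex) \<Rightarrow> (real \<Rightarrow> 'a \<Rightarrow> complex) \<Rightarrow> bool"
  where
  "derivative_wrt N I u v \<longleftrightarrow>
     (\<forall>t\<in>I. ((\<lambda>s. N (\<lambda>x. (u s x - u t x) /\<^sub>R (s - t) - v t x)) \<longlongrightarrow> 0) (at t within I))"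

definition C1_L2_curve ::
    "'a measure \<Rightarrow> real set \<Rightarrow> (real \<Rightarrow> 'a \<Rightarrow> complex) \<Rightarrow> (real \<Rightarrow> 'a \<Rightarrow> complex) \<Rightarrow> bool" where
  "C1_L2_curve M I u v \<longleftrightarrow>
     (\<forall>t\<in>I. u t \<in> Lp_space M 2 \<and> v t \<in> Lp_space M 2) \<and>
     derivative_wrt (Lp_norm M 2) I u v \<and> continuous_wrt (Lp_norm M 2) I v"


section \<open>The nonlinear Schroedinger equation\<close>

definition time_interval :: "ereal \<Rightarrow> real set" where
  "time_interval T = {t. 0 \<le> t \<and> ereal t < T}"

text \<open>
  The topology on \<open>H\<^sup>2 \<inter> H\<^sup>1\<^sub>0 \<inter> L\<^sup>p\<^sup>+\<^sup>1\<close> is that of the sum of the norms;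
  \<^const>\<open>H2_norm\<close> dominates \<^const>\<open>H1_norm\<close>.
\<close>

definition nls_solution ::
    "(real^'n::finite) set \<Rightarrow> 'n metric_field \<Rightarrow> real \<Rightarrow> (real^'n \<Rightarrow> complex) \<Rightarrow> ereal
       \<Rightarrow> (real \<Rightarrow> real^'n \<Rightarrow> complex) \<Rightarrow> bool" where
  "nls_solution \<Omega> g p u0 T u \<longleftrightarrow>
     (\<forall>t\<in>time_interval T.
        u t \<in> H2_space \<Omega> g \<inter> H10_space \<Omega> g \<inter> Lp_space (riem_vol \<Omega> g) (p + 1)) \<and>
     continuous_wrt (H2_norm \<Omega> g) (time_interval T) u \<and>
     continuous_wrt (Lp_norm (riem_vol \<Omega> g) (p + 1)) (time_interval T) u \<and>
     (\<exists>ut. C1_L2_curve (riem_vol \<Omega> g) (time_interval T) u ut \<and>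
        (\<forall>t\<in>time_interval T. AE x in riem_vol \<Omega> g.
           \<i> * ut t x =
             laplace_beltrami \<Omega> g (u t) x + of_real (norm (u t x) powr (p - 1)) * u t x)) \<and>
     (AE x in riem_vol \<Omega> g. u 0 x = u0 x)"

definition maximal_nls_solution ::
    "(real^'n::finite) set \<Rightarrow> 'n metric_field \<Rightarrow> real \<Rightarrow> (real^'n \<Rightarrow> complex) \<Rightarrow> ereal
       \<Rightarrow> (real \<Rightarrow> real^'n \<Rightarrow> complex) \<Rightarrow> bool" where
  "maximal_nls_solution \<Omega> g p u0 T u \<longleftrightarrow>
     nls_solution \<Omega> g p u0 T u \<and>
     \<not> (\<exists>T' v. T < T' \<and> nls_solution \<Omega> g p u0 T' v \<and>
          (\<forall>t\<in>time_interval T. AE x in riem_vol \<Omega> g. v t x = u t x))"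

definition nls_energy ::
    "(real^'n::finite) set \<Rightarrow> 'n metric_field \<Rightarrow> real \<Rightarrow> (real^'n \<Rightarrow> complex) \<Rightarrow> real" where
  "nls_energy \<Omega> g p f =
     (LINT x|riem_vol \<Omega> g. grad_sq \<Omega> g f x - 2 / (p + 1) * norm (f x) powr (p + 1))"


section \<open>Hyperbolic space\<close>

text \<open>The Poincare ball model.\<close>

definition hyp_domain :: "(real^'n::finite) set" where
  "hyp_domain = ball 0 1"

definition hyp_metric :: "'n::finite metric_field" where
  "hyp_metric x = mat (4 / (1 - (norm x)\<^sup>2)\<^sup>2)"

text \<open>
  In the polar coordinates \<open>(r, \<theta>) \<mapsto> tanh (r/2) \<theta>\<close> the metric is
  \<open>dr\<^sup>2 + sinh\<^sup>2 r g\<^bsub>S\<^esub>\<close>: the image of the tangent vector \<open>(a, v)\<close>, where \<open>v\<close> is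
  orthogonal to \<open>\<theta>\<close>, has squared length \<open>a\<^sup>2 + sinh\<^sup>2 r |v|\<^sup>2\<close>.
\<close>

lemma hyp_polar_derivative:
  fixes \<theta> :: "real^'n::finite"
  shows "((\<lambda>s. tanh (s/2) *\<^sub>R \<theta>) has_vector_derivative
            ((1 - (tanh (r/2))\<^sup>2) / 2) *\<^sub>R \<theta>) (at r)"
proof -
  have "((\<lambda>s::real. tanh (s/2)) has_field_derivative (1 - (tanh (r/2))\<^sup>2) / 2) (at r)"
    by (auto intro!: derivative_eq_intros)
  then show ?thesis
    by (auto intro!: derivative_eq_intros)
qed

lemma hyp_metric_polar:
  fixes \<theta> v :: "real^'n::finite" and r a :: real
  assumes "norm \<theta> = 1" and "\<theta> \<bullet> v = 0"
  defines "w \<equiv> a *\<^sub>R (((1 - (tanh (r/2))\<^sup>2) / 2) *\<^sub>R \<theta>) + tanh (r/2) *\<^sub>R v"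
  shows "w \<bullet> (hyp_metric (tanh (r/2) *\<^sub>R \<theta>) *v w) = a\<^sup>2 + (sinh r)\<^sup>2 * (norm v)\<^sup>2"
proof -
  define c where "c = (1 - (tanh (r/2))\<^sup>2)"
  have ch: "cosh (r/2) \<noteq> 0" by (metis cosh_real_nonzero)
  have csq: "(cosh (r/2))\<^sup>2 - (sinh (r/2))\<^sup>2 = 1" by (simp add: cosh_square_eq)
  have c: "c = 1 / (cosh (r/2))\<^sup>2"
  proof -
    have "c = ((cosh (r/2))\<^sup>2 - (sinh (r/2))\<^sup>2) / (cosh (r/2))\<^sup>2"
      using ch by (simp add: c_def tanh_def power_divide diff_divide_distrib)
    then show ?thesis by (simp only: csq)
  qed
  have s: "sinh r = 2 * sinh (r/2) * cosh (r/2)"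
    using sinh_double[of "r/2"] by simp
  have mv: "mat k *v y = k *\<^sub>R y" for k and y :: "real^'n"
    by (simp add: vec_eq_iff matrix_vector_mult_def mat_def mult_delta_left)
  have "\<theta> \<bullet> \<theta> = 1" "v \<bullet> \<theta> = 0"
    using assms by (simp_all add: dot_square_norm inner_commute)
  moreover have w: "w = (a * c / 2) *\<^sub>R \<theta> + tanh (r/2) *\<^sub>R v"
    by (simp add: w_def c_def)
  ultimately have ww: "w \<bullet> w = (a * c / 2)\<^sup>2 + (tanh (r/2))\<^sup>2 * (norm v)\<^sup>2"
    using assms(2) unfolding w inner_add_left inner_add_right inner_scaleR_left inner_scaleR_right
    by (simp add: power2_norm_eq_inner power2_eq_square[of "tanh _"] power2_eq_square[of "a * c / 2"])
  have "w \<bullet> (hyp_metric (tanh (r/2) *\<^sub>R \<theta>) *v w) = 4 / c\<^sup>2 * (w \<bullet> w)"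
    using assms(1) by (simp add: hyp_metric_def mv c_def)
  also have "\<dots> = a\<^sup>2 + (sinh r)\<^sup>2 * (norm v)\<^sup>2"
    using ch by (simp add: ww c s tanh_def field_simps power2_eq_square)
  finally show ?thesis .
qed

end

theory Submission
  imports Defs
begin

text \<open>
  The proof is a virial argument with a bounded vector field.  Let \<open>r\<close> be the distance to the
  origin of the ball and put
  \<open>X = F(r) \<partial>\<^sub>r\<close> with \<open>F(r) = (n - 1) (\<integral>\<^sub>0\<^sup>r sinh\<^sup>n\<^sup>-\<^sup>1) / sinh\<^sup>n\<^sup>-\<^sup>1 r\<close>,
  the radial field that is regular at the origin and has divergence \<open>n - 1\<close>.  Because volumes
  in hyperbolic space grow no faster than the areas of spheres, \<open>|X| \<le> 1\<close>; Euclidean space has no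
  bounded field of constant positive divergence.  Hence the momentum \<open>J = Im \<integral> (X u) cnj(u)\<close> makes
  sense for every function in \<open>H\<^sup>1\<close>, without any decay of \<open>u\<close> at infinity, and
  \<open>J\<^sup>2 \<le> \<parallel>X u\<parallel>\<^sup>2 \<parallel>u\<parallel>\<^sup>2\<close>.

  For a solution, \<open>J' = 2 Re\<langle>Xu, \<Delta>u\<rangle> + 2 Re\<langle>Xu, |u|\<^sup>p\<^sup>-\<^sup>1 u\<rangle> - (n - 1)(\<parallel>\<nabla>u\<parallel>\<^sup>2 - \<integral> |u|\<^sup>p\<^sup>+\<^sup>1)\<close>.  As \<open>X\<close>
  has constant divergence, the term with the nonlinearity is \<open>- 2(n - 1)/(p + 1) \<integral> |u|\<^sup>p\<^sup>+\<^sup>1\<close>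
  (\<open>vfield_power\<close>).  Two integrations by parts turn \<open>2 Re\<langle>Xu, \<Delta>u\<rangle>\<close> into
  \<open>\<integral> ((n - 1)|\<nabla>u|\<^sup>2 - 2 (\<nabla>X)(\<nabla>u, \<nabla>u))\<close>.  The symmetric tensor \<open>\<nabla>X\<close> has the tangential eigenvalue
  \<open>c = F coth r\<close> and the radial eigenvalue \<open>F' = (n - 1)(1 - c)\<close>.  Since \<open>(n - 1)/n \<le> c \<le> 1\<close> and
  \<open>|X| \<le> 1\<close>, it is at most the identity minus \<open>(1/n) X \<otimes> X\<close>, so that
  \<open>2 Re\<langle>Xu, \<Delta>u\<rangle> \<ge> (n - 3) \<parallel>\<nabla>u\<parallel>\<^sup>2 + (2/n) \<parallel>Xu\<parallel>\<^sup>2\<close> (\<open>virial_lower_bound\<close>).  Eliminating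
  \<open>\<integral> |u|\<^sup>p\<^sup>+\<^sup>1\<close> by means of the conserved energy \<open>E < 0\<close>, and using \<open>(n - 1)(p - 1)/2 \<ge> 2\<close>, one gets
  \<open>J' \<ge> (2/n) \<parallel>Xu\<parallel>\<^sup>2 + 2|E|\<close> (\<open>virial_growth\<close>).  Together with conservation of mass this is a Riccati
  inequality \<open>J' \<ge> a J\<^sup>2 + b\<close> with \<open>a, b > 0\<close>, which has no solution on \<open>[0, \<infinity>)\<close>
  (\<open>riccati_not_global\<close>).

  The rest of the text justifies these manipulations for weak derivatives and for a curve that is
  only \<open>C\<^sup>1\<close> into \<open>L\<^sup>2\<close>.  In space, mollification gives product and chain rules against compactly
  supported coefficients (\<open>weak_product_rule\<close>, \<open>weak_chain_rule\<close>); cutoffs that depend logarithmically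
  on the distance to the boundary sphere have a hyperbolic gradient of size \<open>O(1/k)\<close>, so
  nothing is lost at infinity (\<open>wdiv_integral_zero\<close>).  In time, the derivatives of mass, energy and
  \<open>J\<close> are limits of difference quotients, rewritten by polarised integrations by parts so that the
  quotient of \<open>u\<close> only ever enters as one factor of an \<open>L\<^sup>2\<close> inner product; the potential energy is
  squeezed between two such expressions by convexity of \<open>|z|\<^sup>p\<^sup>+\<^sup>1\<close>.
\<close>

section \<open>Square-integrable functions\<close>

definition square_integrable :: "'a measure \<Rightarrow> ('a \<Rightarrow> complex) set" where
  "square_integrable M = {f \<in> borel_measurable M. integrable M (\<lambda>x. (norm (f x))\<^sup>2)}"

definition l2norm :: "'a measure \<Rightarrow> ('a \<Rightarrow> complex) \<Rightarrow> real" where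
  "l2norm M f = sqrt (LINT x|M. (norm (f x))\<^sup>2)"

definition l2inner :: "'a measure \<Rightarrow> ('a \<Rightarrow> complex) \<Rightarrow> ('a \<Rightarrow> complex) \<Rightarrow> complex" where
  "l2inner M f g = (LINT x|M. f x * cnj (g x))"

lemma borel_measurable_cnj [measurable]: "cnj \<in> borel_measurable borel"
  by (intro borel_measurable_continuous_onI continuous_intros)

lemma square_integrableD:
  assumes "f \<in> square_integrable M"
  shows "f \<in> borel_measurable M" "integrable M (\<lambda>x. (norm (f x))\<^sup>2)"
  using assms by (auto simp: square_integrable_def)

lemma square_integrable_bound:
  assumes "f \<in> square_integrable M" "g \<in> borel_measurable M"
    and "AE x in M. norm (g x) \<le> C * norm (f x)"
  shows "g \<in> square_integrable M"
proof -
  have i: "integrable M (\<lambda>x. C\<^sup>2 * (norm (f x))\<^sup>2)" using square_integrableD(2)[OF assms(1)] by simp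
  have b: "AE x in M. norm ((norm (g x))\<^sup>2) \<le> norm (C\<^sup>2 * (norm (f x))\<^sup>2)"
    using assms(3)
  proof eventually_elim
    case (elim x)
    from power_mono[OF elim norm_ge_zero, of 2] show ?case by (simp add: power_mult_distrib)
  qed
  have "(\<lambda>x. (norm (g x))\<^sup>2) \<in> borel_measurable M" using assms(2) by measurable
  from Bochner_Integration.integrable_bound[OF i this b] assms(2)
  show ?thesis by (simp add: square_integrable_def)
qed

lemma square_integrable_add:
  assumes "f \<in> square_integrable M" "g \<in> square_integrable M"
  shows "(\<lambda>x. f x + g x) \<in> square_integrable M"
proof -
  note [measurable] = square_integrableD(1)[OF assms(1)] square_integrableD(1)[OF assms(2)]
  have i: "integrable M (\<lambda>x. 2 * (norm (f x))\<^sup>2 + 2 * (norm (g x))\<^sup>2)"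
    using assms by (simp add: square_integrable_def)
  have b: "(norm (f x + g x))\<^sup>2 \<le> 2 * (norm (f x))\<^sup>2 + 2 * (norm (g x))\<^sup>2" for x
  proof -
    have "(norm (f x + g x))\<^sup>2 \<le> (norm (f x) + norm (g x))\<^sup>2"
      by (intro power_mono norm_triangle_ineq) auto
    also have "\<dots> \<le> 2 * (norm (f x))\<^sup>2 + 2 * (norm (g x))\<^sup>2"
      using sum_squares_bound[of "norm (f x)" "norm (g x)"] by (simp add: power2_sum)
    finally show ?thesis .
  qed
  have "integrable M (\<lambda>x. (norm (f x + g x))\<^sup>2)"
    by (rule Bochner_Integration.integrable_bound[OF i]) (use b in \<open>auto intro!: AE_I2\<close>)
  then show ?thesis by (simp add: square_integrable_def)
qed

lemma square_integrable_uminus: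
  "f \<in> square_integrable M \<Longrightarrow> (\<lambda>x. - f x) \<in> square_integrable M"
  by (auto simp: square_integrable_def)

lemma square_integrable_diff:
  assumes "f \<in> square_integrable M" "g \<in> square_integrable M"
  shows "(\<lambda>x. f x - g x) \<in> square_integrable M"
  using square_integrable_add[OF assms(1) square_integrable_uminus[OF assms(2)]] by simp

lemma square_integrable_cmult:
  "f \<in> square_integrable M \<Longrightarrow> (\<lambda>x. c * f x) \<in> square_integrable M"
  by (auto simp: square_integrable_def norm_mult power_mult_distrib)

lemma square_integrable_cnj:
  "f \<in> square_integrable M \<Longrightarrow> (\<lambda>x. cnj (f x)) \<in> square_integrable M"
  by (auto simp: square_integrable_def)

lemma square_integrable_sum:
  assumes "\<And>i. i \<in> I \<Longrightarrow> f i \<in> square_integrable M"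
  shows "(\<lambda>x. \<Sum>i\<in>I. f i x) \<in> square_integrable M"
  using assms
proof (induction I rule: infinite_finite_induct)
  case (insert i I)
  then show ?case by (auto intro!: square_integrable_add)
qed (auto simp: square_integrable_def)

lemma square_integrable_cong_AE:
  assumes "f \<in> square_integrable M" "g \<in> borel_measurable M" "AE x in M. f x = g x"
  shows "g \<in> square_integrable M"
  by (rule square_integrable_bound[OF assms(1,2), of 1]) (use assms(3) in auto)

lemma integrable_prod:
  assumes "f \<in> square_integrable M" "g \<in> square_integrable M"
  shows "integrable M (\<lambda>x. f x * g x)"
proof -
  note [measurable] = square_integrableD(1)[OF assms(1)] square_integrableD(1)[OF assms(2)]
  have i: "integrable M (\<lambda>x. (norm (f x))\<^sup>2 + (norm (g x))\<^sup>2)"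
    using assms by (simp add: square_integrable_def)
  have b: "norm (f x * g x) \<le> (norm (f x))\<^sup>2 + (norm (g x))\<^sup>2" for x
    using sum_squares_bound[of "norm (f x)" "norm (g x)"]
      mult_nonneg_nonneg[OF norm_ge_zero[of "f x"] norm_ge_zero[of "g x"]]
    unfolding norm_mult by linarith
  show ?thesis
    by (rule Bochner_Integration.integrable_bound[OF i]) (use b in \<open>auto intro!: AE_I2\<close>)
qed

lemma integrable_prod_cnj:
  assumes "f \<in> square_integrable M" "g \<in> square_integrable M"
  shows "integrable M (\<lambda>x. f x * cnj (g x))"
  by (rule integrable_prod[OF assms(1) square_integrable_cnj[OF assms(2)]])

lemma l2norm_nonneg: "0 \<le> l2norm M f"
  by (simp add: l2norm_def)

lemma l2norm_power2: "(l2norm M f)\<^sup>2 = (LINT x|M. (norm (f x))\<^sup>2)"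
  by (simp add: l2norm_def)

text \<open>Cauchy--Schwarz for functions that are not identified up to null sets, so that no quotient space
  has to be formed.\<close>

lemma integral_norm_prod_le:
  assumes f: "f \<in> square_integrable M" and g: "g \<in> square_integrable M"
  shows "(LINT x|M. norm (f x * g x)) \<le> l2norm M f * l2norm M g"
proof -
  note [measurable] = square_integrableD(1)[OF f] square_integrableD(1)[OF g]
  define A B C where "A = (LINT x|M. (norm (f x))\<^sup>2)" and "B = (LINT x|M. norm (f x * g x))"
    and "C = (LINT x|M. (norm (g x))\<^sup>2)"
  have nn: "0 \<le> A" "0 \<le> B" "0 \<le> C" by (simp_all add: A_def B_def C_def)
  have q: "0 \<le> A - 2 * t * B + t\<^sup>2 * C" for t
  proof -
    have "0 \<le> (LINT x|M. (norm (f x) - t * norm (g x))\<^sup>2)" by simp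
    also have "(\<lambda>x. (norm (f x) - t * norm (g x))\<^sup>2) =
       (\<lambda>x. (norm (f x))\<^sup>2 - 2 * t * norm (f x * g x) + t\<^sup>2 * (norm (g x))\<^sup>2)"
      by (auto simp: power2_eq_square norm_mult algebra_simps)
    also have "(LINT x|M. (norm (f x))\<^sup>2 - 2 * t * norm (f x * g x) + t\<^sup>2 * (norm (g x))\<^sup>2) = A - 2 * t * B + t\<^sup>2 * C"
      using square_integrableD(2)[OF f] square_integrableD(2)[OF g] integrable_norm[OF integrable_prod[OF f g]]
      by (simp add: A_def B_def C_def)
    finally show ?thesis .
  qed
  have "B\<^sup>2 \<le> A * C"
  proof (cases "C = 0")
    case True
    have "B = 0"
    proof (rule ccontr)
      assume "B \<noteq> 0"
      with q[of "(A + 1) / (2 * B)"] True show False by simp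
    qed
    with True show ?thesis by simp
  next
    case False
    with nn have "C > 0" by simp
    with q[of "B / C"] have "0 \<le> (A - B\<^sup>2 / C) * C"
      by (intro mult_nonneg_nonneg) (auto simp: power2_eq_square)
    with \<open>C > 0\<close> show ?thesis by (simp add: algebra_simps)
  qed
  then have "B \<le> sqrt (A * C)" by (rule real_le_rsqrt)
  then show ?thesis by (simp add: A_def B_def C_def l2norm_def real_sqrt_mult)
qed

lemma norm_l2inner_le:
  assumes f: "f \<in> square_integrable M" and g: "g \<in> square_integrable M"
  shows "norm (l2inner M f g) \<le> l2norm M f * l2norm M g"
proof -
  have "norm (l2inner M f g) \<le> (LINT x|M. norm (f x * cnj (g x)))"
    unfolding l2inner_def by (rule integral_norm_bound)
  also have "\<dots> \<le> l2norm M f * l2norm M (\<lambda>x. cnj (g x))"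
    by (rule integral_norm_prod_le[OF f square_integrable_cnj[OF g]])
  finally show ?thesis by (simp add: l2norm_def)
qed

lemma l2norm_triangle:
  assumes f: "f \<in> square_integrable M" and g: "g \<in> square_integrable M"
  shows "l2norm M (\<lambda>x. f x + g x) \<le> l2norm M f + l2norm M g"
proof -
  have "(l2norm M (\<lambda>x. f x + g x))\<^sup>2 \<le> (LINT x|M. (norm (f x))\<^sup>2 + 2 * norm (f x * g x) + (norm (g x))\<^sup>2)"
    unfolding l2norm_power2
  proof (rule integral_mono)
    show "integrable M (\<lambda>x. (norm (f x + g x))\<^sup>2)"
      using square_integrable_add[OF f g] by (rule square_integrableD)
    show "integrable M (\<lambda>x. (norm (f x))\<^sup>2 + 2 * norm (f x * g x) + (norm (g x))\<^sup>2)"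
      using square_integrableD(2)[OF f] square_integrableD(2)[OF g] integrable_norm[OF integrable_prod[OF f g]] by simp
    show "(norm (f x + g x))\<^sup>2 \<le> (norm (f x))\<^sup>2 + 2 * norm (f x * g x) + (norm (g x))\<^sup>2" for x
      using power_mono[OF norm_triangle_ineq[of "f x" "g x"] norm_ge_zero, of 2]
      by (simp add: power2_sum norm_mult)
  qed
  also have "\<dots> = (l2norm M f)\<^sup>2 + 2 * (LINT x|M. norm (f x * g x)) + (l2norm M g)\<^sup>2"
    using square_integrableD(2)[OF f] square_integrableD(2)[OF g] integrable_norm[OF integrable_prod[OF f g]]
    by (simp add: l2norm_power2)
  also have "\<dots> \<le> (l2norm M f + l2norm M g)\<^sup>2"
    using integral_norm_prod_le[OF f g] by (simp add: power2_sum)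
  finally show ?thesis
    by (rule power2_le_imp_le) (simp add: l2norm_nonneg)
qed

text \<open>Mean-square convergence along an arbitrary filter: it is used for sequences of mollifications and
  for times approaching a given time within \<open>[0, \<infinity>)\<close>.\<close>

definition l2_tendsto :: "'a measure \<Rightarrow> 'b filter \<Rightarrow> ('b \<Rightarrow> 'a \<Rightarrow> complex) \<Rightarrow> ('a \<Rightarrow> complex) \<Rightarrow> bool" where
  "l2_tendsto M F f f0 \<longleftrightarrow> f0 \<in> square_integrable M \<and> (\<forall>\<^sub>F s in F. f s \<in> square_integrable M) \<and>
     ((\<lambda>s. l2norm M (\<lambda>x. f s x - f0 x)) \<longlongrightarrow> 0) F"

lemma l2inner_add_left:
  assumes "f \<in> square_integrable M" "g \<in> square_integrable M" "h \<in> square_integrable M"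
  shows "l2inner M (\<lambda>x. f x + g x) h = l2inner M f h + l2inner M g h"
  unfolding l2inner_def distrib_right
  by (intro Bochner_Integration.integral_add integrable_prod_cnj assms)

lemma l2inner_diff_left:
  assumes "f \<in> square_integrable M" "g \<in> square_integrable M" "h \<in> square_integrable M"
  shows "l2inner M (\<lambda>x. f x - g x) h = l2inner M f h - l2inner M g h"
  unfolding l2inner_def left_diff_distrib
  by (intro Bochner_Integration.integral_diff integrable_prod_cnj assms)

lemma l2inner_cmult_left: "l2inner M (\<lambda>x. c * f x) h = c * l2inner M f h"
  unfolding l2inner_def by (simp add: mult.assoc)

lemma l2inner_commute: "l2inner M f g = cnj (l2inner M g f)"
proof -
  have "cnj (l2inner M g f) = (LINT x|M. cnj (g x * cnj (f x)))"
    unfolding l2inner_def by (rule Bochner_Integration.integral_cnj[symmetric])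
  then show ?thesis by (simp add: l2inner_def mult.commute)
qed

lemma l2inner_diff_right:
  assumes "f \<in> square_integrable M" "g \<in> square_integrable M" "h \<in> square_integrable M"
  shows "l2inner M h (\<lambda>x. f x - g x) = l2inner M h f - l2inner M h g"
  using l2inner_diff_left[OF assms] by (metis complex_cnj_diff l2inner_commute)

lemma l2inner_cong_AE:
  assumes "f \<in> borel_measurable M" "f' \<in> borel_measurable M" "AE x in M. f x = f' x"
    and "g \<in> borel_measurable M" "g' \<in> borel_measurable M" "AE x in M. g x = g' x"
  shows "l2inner M f g = l2inner M f' g'"
  unfolding l2inner_def by (intro integral_cong_AE) (use assms in auto)

lemma l2norm_cong_AE:
  assumes "f \<in> borel_measurable M" "f' \<in> borel_measurable M" "AE x in M. f x = f' x"
  shows "l2norm M f = l2norm M f'"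
proof -
  have "(LINT x|M. (norm (f x))\<^sup>2) = (LINT x|M. (norm (f' x))\<^sup>2)"
    by (intro integral_cong_AE) (use assms in auto)
  then show ?thesis by (simp add: l2norm_def)
qed

lemma l2inner_self: "l2inner M f f = of_real ((l2norm M f)\<^sup>2)"
proof -
  have "l2inner M f f = (LINT x|M. complex_of_real ((norm (f x))\<^sup>2))"
    unfolding l2inner_def by (intro Bochner_Integration.integral_cong) (auto simp: complex_norm_square[symmetric])
  then show ?thesis by (simp only: integral_complex_of_real l2norm_power2)
qed

text \<open>Both factors may vary, which is what passes to the limit in the bilinear integral identities.\<close>

lemma l2_tendsto_inner:
  assumes "l2_tendsto M F f f0" "l2_tendsto M F g g0"
  shows "((\<lambda>s. l2inner M (f s) (g s)) \<longlongrightarrow> l2inner M f0 g0) F"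
proof -
  have f0: "f0 \<in> square_integrable M" and g0: "g0 \<in> square_integrable M"
    using assms by (auto simp: l2_tendsto_def)
  define B where "B s = l2norm M (\<lambda>x. f s x - f0 x) * (l2norm M (\<lambda>x. g s x - g0 x) + l2norm M g0)
      + l2norm M f0 * l2norm M (\<lambda>x. g s x - g0 x)" for s
  have "((\<lambda>s. B s) \<longlongrightarrow> 0 * (0 + l2norm M g0) + l2norm M f0 * 0) F"
    unfolding B_def using assms by (intro tendsto_intros) (auto simp: l2_tendsto_def)
  then have B: "(B \<longlongrightarrow> 0) F" by simp
  have ev: "\<forall>\<^sub>F s in F. f s \<in> square_integrable M \<and> g s \<in> square_integrable M"
    using assms by (auto simp: l2_tendsto_def eventually_conj)
  have "\<forall>\<^sub>F s in F. norm (l2inner M (f s) (g s) - l2inner M f0 g0) \<le> B s"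
    using ev
  proof eventually_elim
    case (elim s)
    then have fs: "f s \<in> square_integrable M" and gs: "g s \<in> square_integrable M" by auto
    note d = square_integrable_diff[OF fs f0] square_integrable_diff[OF gs g0]
    have "l2inner M (f s) (g s) - l2inner M f0 g0
       = l2inner M (\<lambda>x. f s x - f0 x) (g s) + l2inner M f0 (\<lambda>x. g s x - g0 x)"
      by (simp add: l2inner_diff_left l2inner_diff_right fs gs f0 g0)
    also have "norm \<dots> \<le> norm (l2inner M (\<lambda>x. f s x - f0 x) (g s)) + norm (l2inner M f0 (\<lambda>x. g s x - g0 x))"
      by (rule norm_triangle_ineq)
    also have "\<dots> \<le> l2norm M (\<lambda>x. f s x - f0 x) * l2norm M (g s) + l2norm M f0 * l2norm M (\<lambda>x. g s x - g0 x)"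
      by (intro add_mono norm_l2inner_le d f0 gs)
    also have "l2norm M (g s) \<le> l2norm M (\<lambda>x. g s x - g0 x) + l2norm M g0"
      using l2norm_triangle[OF d(2) g0] by simp
    finally show ?case
      by (auto simp: B_def l2norm_nonneg mult_left_mono)
  qed
  then have "((\<lambda>s. l2inner M (f s) (g s) - l2inner M f0 g0) \<longlongrightarrow> 0) F"
    by (rule Lim_null_comparison[OF _ B])
  then show ?thesis by (simp add: LIM_zero_iff)
qed

lemma l2_tendsto_mult_bounded:
  assumes "l2_tendsto M F f f0" "c \<in> borel_measurable M" "AE x in M. norm (c x) \<le> C"
  shows "l2_tendsto M F (\<lambda>s x. c x * f s x) (\<lambda>x. c x * f0 x)"
proof -
  have sq: "(\<lambda>x. c x * g x) \<in> square_integrable M \<and> l2norm M (\<lambda>x. c x * g x) \<le> \<bar>C\<bar> * l2norm M g"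
    if g: "g \<in> square_integrable M" for g
  proof -
    note [measurable] = assms(2) square_integrableD(1)[OF g]
    have b: "AE x in M. norm (c x * g x) \<le> \<bar>C\<bar> * norm (g x)"
      using assms(3) by eventually_elim (simp add: norm_mult mult_right_mono)
    have 1: "(\<lambda>x. c x * g x) \<in> square_integrable M"
      by (rule square_integrable_bound[OF g _ b]) measurable
    have "(l2norm M (\<lambda>x. c x * g x))\<^sup>2 \<le> (LINT x|M. \<bar>C\<bar>\<^sup>2 * (norm (g x))\<^sup>2)"
      unfolding l2norm_power2
    proof (rule integral_mono_AE)
      show "integrable M (\<lambda>x. (norm (c x * g x))\<^sup>2)" by (rule square_integrableD(2)[OF 1])
      show "integrable M (\<lambda>x. \<bar>C\<bar>\<^sup>2 * (norm (g x))\<^sup>2)" using square_integrableD(2)[OF g] by simp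
      show "AE x in M. (norm (c x * g x))\<^sup>2 \<le> \<bar>C\<bar>\<^sup>2 * (norm (g x))\<^sup>2"
        using b
      proof eventually_elim
        case (elim x)
        from power_mono[OF elim norm_ge_zero, of 2] show ?case by (simp only: power_mult_distrib)
      qed
    qed
    also have "\<dots> = (\<bar>C\<bar> * l2norm M g)\<^sup>2" by (simp add: l2norm_power2 power_mult_distrib)
    finally show ?thesis using 1 by (auto intro: power2_le_imp_le simp: l2norm_nonneg)
  qed
  have ev: "\<forall>\<^sub>F s in F. f s \<in> square_integrable M" and f0: "f0 \<in> square_integrable M"
    and lim: "((\<lambda>s. l2norm M (\<lambda>x. f s x - f0 x)) \<longlongrightarrow> 0) F"
    using assms(1) by (auto simp: l2_tendsto_def)
  have "((\<lambda>s. l2norm M (\<lambda>x. c x * f s x - c x * f0 x)) \<longlongrightarrow> 0) F"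
  proof (rule Lim_null_comparison)
    show "\<forall>\<^sub>F s in F. norm (l2norm M (\<lambda>x. c x * f s x - c x * f0 x)) \<le> \<bar>C\<bar> * l2norm M (\<lambda>x. f s x - f0 x)"
      using ev
    proof eventually_elim
      case (elim s)
      show ?case using sq[OF square_integrable_diff[OF elim f0]]
        by (simp add: l2norm_nonneg right_diff_distrib)
    qed
    show "((\<lambda>s. \<bar>C\<bar> * l2norm M (\<lambda>x. f s x - f0 x)) \<longlongrightarrow> 0) F"
      using tendsto_mult_left[OF lim, of "\<bar>C\<bar>"] by simp
  qed
  then show ?thesis using ev f0 sq by (auto simp: l2_tendsto_def elim: eventually_mono)
qed

lemma l2_tendsto_const: "f \<in> square_integrable M \<Longrightarrow> l2_tendsto M F (\<lambda>_. f) f"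
  by (simp add: l2_tendsto_def l2norm_def)

lemma l2_tendsto_bound:
  assumes "f0 \<in> square_integrable M" "\<forall>\<^sub>F s in F. f s \<in> square_integrable M"
    and "\<forall>\<^sub>F s in F. l2norm M (\<lambda>x. f s x - f0 x) \<le> b s" "(b \<longlongrightarrow> 0) F"
  shows "l2_tendsto M F f f0"
  unfolding l2_tendsto_def
  by (intro conjI assms tendsto_sandwich[OF _ assms(3) tendsto_const assms(4)]) (simp add: l2norm_nonneg)

lemma l2norm_cmult: "l2norm M (\<lambda>x. c * f x) = norm c * l2norm M f"
  by (simp add: l2norm_def norm_mult power_mult_distrib real_sqrt_mult)

lemma l2norm_triangle_diff:
  assumes "f \<in> square_integrable M" "g \<in> square_integrable M"
  shows "l2norm M (\<lambda>x. f x - g x) \<le> l2norm M f + l2norm M g"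
  using l2norm_triangle[OF assms(1) square_integrable_cmult[OF assms(2), of "-1"]] l2norm_cmult[of M "-1" g] by simp

lemma Lp_space_2: "Lp_space M 2 = square_integrable M"
  by (simp add: Lp_space_def square_integrable_def)

lemma Lp_norm_2: "Lp_norm M 2 f = l2norm M f"
  by (simp add: Lp_norm_def l2norm_def powr_half_sqrt)

lemma square_integrable_cong:
  assumes "f \<in> square_integrable M" "\<And>x. x \<in> space M \<Longrightarrow> f x = g x"
  shows "g \<in> square_integrable M"
proof -
  have "g \<in> borel_measurable M"
    by (rule measurable_cong[THEN iffD1, OF assms(2) square_integrableD(1)[OF assms(1)]])
  then show ?thesis by (rule square_integrable_cong_AE[OF assms(1)]) (use assms(2) in auto)
qed

section \<open>Smooth bump functions\<close>

text \<open>The flat function \<open>exp (- 1/t)\<close> together with its quotients by powers of \<open>t\<close>: the span of this family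
  is closed under differentiation.\<close>

definition flat_exp :: "nat \<Rightarrow> real \<Rightarrow> real" where
  "flat_exp j t = (if t > 0 then exp (- (1/t)) / t ^ j else 0)"

lemma flat_exp_nonneg: "0 \<le> flat_exp j t"
  by (simp add: flat_exp_def)

lemma flat_exp_tendsto_0: "((\<lambda>t. exp (- (1/t)) / t ^ j) \<longlongrightarrow> 0) (at_right (0::real))"
proof -
  have "((\<lambda>x::real. x ^ j / exp x) \<longlongrightarrow> 0) at_top"
    by (rule tendsto_power_div_exp_0)
  then have "((\<lambda>t::real. (inverse t) ^ j / exp (inverse t)) \<longlongrightarrow> 0) (at_right 0)"
    by (rule filterlim_compose[OF _ filterlim_inverse_at_top_right])
  moreover have "(inverse t) ^ j / exp (inverse t) = exp (- (1/t)) / t ^ j" for t :: real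
    by (simp add: exp_minus field_simps power_inverse)
  ultimately show ?thesis by simp
qed

lemma flat_exp_has_real_derivative:
  "(flat_exp j has_real_derivative flat_exp (j+2) t - real j * flat_exp (j+1) t) (at t)"
proof (cases t "0::real" rule: linorder_cases)
  case less
  have "((\<lambda>_::real. 0::real) has_real_derivative 0) (at t)" by simp
  then have "(flat_exp j has_real_derivative 0) (at t)"
    by (rule has_field_derivative_transform_within_open[of _ _ _ "{..<0}"])
      (use less in \<open>auto simp: flat_exp_def\<close>)
  with less show ?thesis by (simp add: flat_exp_def)
next
  case equal
  have "((\<lambda>h. (flat_exp j (0 + h) - flat_exp j 0) / h) \<longlongrightarrow> 0) (at 0)"
  proof (rule filterlim_split_at)
    show "((\<lambda>h. (flat_exp j (0 + h) - flat_exp j 0) / h) \<longlongrightarrow> 0) (at_left 0)"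
      by (rule tendsto_eventually) (auto simp: flat_exp_def eventually_at_filter)
    have "\<forall>\<^sub>F h in at_right 0. exp (- (1/h)) / h ^ Suc j = (flat_exp j (0 + h) - flat_exp j 0) / h"
      by (auto simp: flat_exp_def eventually_at_filter field_simps)
    then show "((\<lambda>h. (flat_exp j (0 + h) - flat_exp j 0) / h) \<longlongrightarrow> 0) (at_right 0)"
      by (rule Lim_transform_eventually[OF flat_exp_tendsto_0])
  qed
  with equal show ?thesis by (simp add: DERIV_def flat_exp_def)
next
  case greater
  have "((\<lambda>s. exp (- (1/s)) / s ^ j) has_real_derivative flat_exp (j+2) t - real j * flat_exp (j+1) t) (at t)"
    using greater
    apply (auto intro!: derivative_eq_intros simp: flat_exp_def)
    apply (cases j)
     apply (auto simp: field_simps power2_eq_square)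
    done
  then show ?thesis
    by (rule has_field_derivative_transform_within_open[of _ _ _ "{0<..}"])
      (use greater in \<open>auto simp: flat_exp_def\<close>)
qed

text \<open>A class of functions supported in the ball of radius \<open>\<epsilon>\<close> around \<open>z\<close> that contains the standard bump
  and is closed under all partial derivatives.  Membership therefore yields \<open>C\<^sup>k\<close> regularity of every
  order by one induction, without computing any higher derivative.\<close>

inductive bump_algebra :: "real^'n::finite \<Rightarrow> real \<Rightarrow> (real^'n \<Rightarrow> complex) \<Rightarrow> bool"
  for z :: "real^'n" and \<epsilon> :: real where
  gen: "bump_algebra z \<epsilon> (\<lambda>x. of_real (flat_exp j (\<epsilon>\<^sup>2 - (x - z) \<bullet> (x - z))))"
| coord: "bump_algebra z \<epsilon> f \<Longrightarrow> bump_algebra z \<epsilon> (\<lambda>x. of_real (x $ i - z $ i) * f x)"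
| add: "bump_algebra z \<epsilon> f \<Longrightarrow> bump_algebra z \<epsilon> g \<Longrightarrow> bump_algebra z \<epsilon> (\<lambda>x. f x + g x)"
| scale: "bump_algebra z \<epsilon> f \<Longrightarrow> bump_algebra z \<epsilon> (\<lambda>x. of_real c * f x)"

lemma flat_exp_ball_has_derivative:
  "((\<lambda>x. complex_of_real (flat_exp j (\<epsilon>\<^sup>2 - (x - z) \<bullet> (x - z)))) has_derivative
     (\<lambda>h. of_real (- 2 * ((x - z) \<bullet> h) *
        (flat_exp (j+2) (\<epsilon>\<^sup>2 - (x - z) \<bullet> (x - z))
          - real j * flat_exp (j+1) (\<epsilon>\<^sup>2 - (x - z) \<bullet> (x - z)))))) (at (x :: real^'n::finite))"
proof -
  have 1: "((\<lambda>x. \<epsilon>\<^sup>2 - (x - z) \<bullet> (x - z)) has_derivative (\<lambda>h. - 2 * ((x - z) \<bullet> h))) (at x)"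
    by (auto intro!: derivative_eq_intros simp: inner_commute)
  from has_derivative_of_real[OF has_derivative_compose[OF 1
      flat_exp_has_real_derivative[unfolded has_field_derivative_def]]]
  show ?thesis by (simp add: mult_ac)
qed

text \<open>The inductive invariant: differentiability is proved together with the fact that the derivative stays
  in the class.\<close>

lemma bump_algebra_derivative:
  assumes "bump_algebra z \<epsilon> f"
  shows "\<exists>D. (\<forall>x. (f has_derivative D x) (at x)) \<and> (\<forall>i. bump_algebra z \<epsilon> (\<lambda>x. D x (axis i 1)))"
  using assms
proof induction
  case (gen j)
  have sc: "bump_algebra z \<epsilon> (\<lambda>x. of_real (- 2) * (of_real (x $ i - z $ i) *
      (of_real (flat_exp (j+2) (\<epsilon>\<^sup>2 - (x - z) \<bullet> (x - z)))
       + of_real (- real j) * of_real (flat_exp (j+1) (\<epsilon>\<^sup>2 - (x - z) \<bullet> (x - z))))))" for i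
    by (intro bump_algebra.intros)
  have eq: "(\<lambda>x. of_real (- 2) * (of_real (x $ i - z $ i) *
      (of_real (flat_exp (j+2) (\<epsilon>\<^sup>2 - (x - z) \<bullet> (x - z)))
       + of_real (- real j) * of_real (flat_exp (j+1) (\<epsilon>\<^sup>2 - (x - z) \<bullet> (x - z))))))
     = (\<lambda>x. complex_of_real (- 2 * ((x - z) \<bullet> axis i 1) *
        (flat_exp (j+2) (\<epsilon>\<^sup>2 - (x - z) \<bullet> (x - z))
          - real j * flat_exp (j+1) (\<epsilon>\<^sup>2 - (x - z) \<bullet> (x - z)))))" for i
    by (simp add: inner_axis algebra_simps)
  show ?case
    by (intro exI conjI allI, rule flat_exp_ball_has_derivative, rule sc[unfolded eq])
next
  case (coord f i)
  then obtain D where D: "\<And>x. (f has_derivative D x) (at x)"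
      "\<And>k. bump_algebra z \<epsilon> (\<lambda>x. D x (axis k 1))" by blast
  have c: "((\<lambda>x. complex_of_real (x $ i - z $ i)) has_derivative (\<lambda>h. of_real (h $ i))) (at x)" for x
    by (rule has_derivative_of_real) (auto intro!: derivative_eq_intros bounded_linear_imp_has_derivative bounded_linear_vec_nth)
  have "((\<lambda>x. of_real (x $ i - z $ i) * f x) has_derivative
      (\<lambda>h. of_real (x $ i - z $ i) * D x h + of_real (h $ i) * f x)) (at x)" for x
    by (rule has_derivative_mult[OF c D(1)])
  moreover have "bump_algebra z \<epsilon> (\<lambda>x. of_real (x $ i - z $ i) * D x (axis k 1)
      + of_real ((axis k 1 :: real^_) $ i) * f x)" for k
    by (intro bump_algebra.add bump_algebra.coord bump_algebra.scale D coord)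
  ultimately show ?case by (intro exI conjI allI)
next
  case (add f g)
  then obtain D E where D: "\<And>x. (f has_derivative D x) (at x)"
      "\<And>k. bump_algebra z \<epsilon> (\<lambda>x. D x (axis k 1))"
      "\<And>x. (g has_derivative E x) (at x)"
      "\<And>k. bump_algebra z \<epsilon> (\<lambda>x. E x (axis k 1))" by blast
  show ?case
    by (rule exI[of _ "\<lambda>x h. D x h + E x h"])
      (auto intro!: has_derivative_add D bump_algebra.add)
next
  case (scale f c)
  then obtain D where D: "\<And>x. (f has_derivative D x) (at x)"
      "\<And>k. bump_algebra z \<epsilon> (\<lambda>x. D x (axis k 1))" by blast
  show ?case
    by (rule exI[of _ "\<lambda>x h. of_real c * D x h"])
      (auto intro!: has_derivative_mult_right D bump_algebra.scale)
qed

lemma partial_eq: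
  "(f has_derivative D) (at x) \<Longrightarrow> partial i f x = D (axis i 1)"
  unfolding partial_def using frechet_derivative_at by metis

lemma bump_algebra_partial:
  assumes "bump_algebra z \<epsilon> f"
  shows "f differentiable_on UNIV" and "bump_algebra z \<epsilon> (partial i f)"
proof -
  obtain D where D: "\<And>x. (f has_derivative D x) (at x)"
      "\<And>k. bump_algebra z \<epsilon> (\<lambda>x. D x (axis k 1))" using bump_algebra_derivative[OF assms] by blast
  show "f differentiable_on UNIV" using D(1) by (auto simp: differentiable_on_def differentiable_def)
  have "partial i f = (\<lambda>x. D x (axis i 1))" using partial_eq[OF D(1)] by auto
  then show "bump_algebra z \<epsilon> (partial i f)" using D(2) by simp
qed

lemma bump_algebra_Ck: "bump_algebra z \<epsilon> f \<Longrightarrow> Ck k f"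
proof (induction k arbitrary: f)
  case 0
  then show ?case
    using differentiable_imp_continuous_on[OF bump_algebra_partial(1)] by simp
next
  case (Suc k)
  show ?case
    using Suc.IH[OF bump_algebra_partial(2)[OF Suc.prems]] bump_algebra_partial(1)[OF Suc.prems] by simp
qed

lemma bump_algebra_eq_0:
  assumes "bump_algebra z \<epsilon> f" "0 \<le> \<epsilon>" "x \<notin> ball z \<epsilon>"
  shows "f x = 0"
  using assms(1)
proof induction
  case (gen j)
  have "\<epsilon>\<^sup>2 \<le> (norm (x - z))\<^sup>2"
    using assms(2,3) by (intro power_mono) (auto simp: dist_norm norm_minus_commute)
  then show ?case by (simp add: flat_exp_def power2_norm_eq_inner)
qed auto

lemma bump_algebra_test_function:
  assumes "bump_algebra z \<epsilon> f" "0 \<le> \<epsilon>" "cball z \<epsilon> \<subseteq> \<Omega>"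
  shows "f \<in> test_functions \<Omega>"
proof -
  have "{x. f x \<noteq> 0} \<subseteq> cball z \<epsilon>"
    using bump_algebra_eq_0[OF assms(1,2)] ball_subset_cball by blast
  then have "closure {x. f x \<noteq> 0} \<subseteq> cball z \<epsilon>" by (simp add: closure_minimal)
  moreover from this have "compact (closure {x. f x \<noteq> 0})"
    by (meson bounded_cball bounded_subset compact_eq_bounded_closed closed_closure)
  ultimately show ?thesis
    using assms bump_algebra_Ck by (auto simp: test_functions_def)
qed

definition bump :: "real \<Rightarrow> real^'n::finite \<Rightarrow> real" where
  "bump \<epsilon> x = flat_exp 0 (\<epsilon>\<^sup>2 - x \<bullet> x)"

definition dbump :: "real \<Rightarrow> 'n \<Rightarrow> real^'n::finite \<Rightarrow> real" where
  "dbump \<epsilon> i x = - 2 * x $ i * flat_exp 2 (\<epsilon>\<^sup>2 - x \<bullet> x)"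

lemma bump_in_algebra: "bump_algebra z \<epsilon> (\<lambda>y. complex_of_real (bump \<epsilon> (y - z)))"
  unfolding bump_def by (rule bump_algebra.gen)

lemma dbump_in_algebra: "bump_algebra z \<epsilon> (\<lambda>y. complex_of_real (dbump \<epsilon> i (y - z)))"
proof -
  have "bump_algebra z \<epsilon> (\<lambda>y. of_real (- 2) * (of_real (y $ i - z $ i) *
      of_real (flat_exp 2 (\<epsilon>\<^sup>2 - (y - z) \<bullet> (y - z)))))"
    by (intro bump_algebra.intros)
  also have "(\<lambda>y. of_real (- 2) * (of_real (y $ i - z $ i) *
      of_real (flat_exp 2 (\<epsilon>\<^sup>2 - (y - z) \<bullet> (y - z))))) = (\<lambda>y. complex_of_real (dbump \<epsilon> i (y - z)))"
    by (simp add: dbump_def fun_eq_iff algebra_simps)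
  finally show ?thesis .
qed

lemma partial_bump: "partial i (\<lambda>y. complex_of_real (bump \<epsilon> (y - z))) y = of_real (dbump \<epsilon> i (y - z))"
proof -
  have "((\<lambda>x. complex_of_real (flat_exp 0 (\<epsilon>\<^sup>2 - (x - z) \<bullet> (x - z)))) has_derivative
     (\<lambda>h. of_real (- 2 * ((y - z) \<bullet> h) * flat_exp 2 (\<epsilon>\<^sup>2 - (y - z) \<bullet> (y - z))))) (at y)"
    using flat_exp_ball_has_derivative[of 0 \<epsilon> z y] by (simp add: numeral_2_eq_2)
  from partial_eq[OF this, of i] show ?thesis
    by (simp add: bump_def dbump_def inner_axis)
qed

text \<open>Written out because the right-hand side is visibly symmetric in \<open>i\<close> and \<open>k\<close>, which is how mixed
  weak derivatives are shown to commute.\<close>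

lemma partial_dbump:
  "partial k (\<lambda>y. complex_of_real (dbump \<epsilon> i (y - z))) y =
     of_real (4 * ((y $ i - z $ i) * (y $ k - z $ k)) *
        (flat_exp 4 (\<epsilon>\<^sup>2 - (y - z) \<bullet> (y - z)) - 2 * flat_exp 3 (\<epsilon>\<^sup>2 - (y - z) \<bullet> (y - z)))
      - (if i = k then 2 else 0) * flat_exp 2 (\<epsilon>\<^sup>2 - (y - z) \<bullet> (y - z)))"
proof -
  have c: "((\<lambda>x. complex_of_real (- 2 * (x $ i - z $ i))) has_derivative (\<lambda>h. of_real (- 2 * (h $ i)))) (at y)"
    by (rule has_derivative_of_real) (auto intro!: derivative_eq_intros bounded_linear_imp_has_derivative bounded_linear_vec_nth)
  have d: "((\<lambda>x. complex_of_real (flat_exp 2 (\<epsilon>\<^sup>2 - (x - z) \<bullet> (x - z)))) has_derivative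
     (\<lambda>h. of_real (- 2 * ((y - z) \<bullet> h) *
        (flat_exp 4 (\<epsilon>\<^sup>2 - (y - z) \<bullet> (y - z)) - 2 * flat_exp 3 (\<epsilon>\<^sup>2 - (y - z) \<bullet> (y - z)))))) (at y)"
    using flat_exp_ball_has_derivative[of 2 \<epsilon> z y] by (simp add: eval_nat_numeral)
  have e: "(\<lambda>y. complex_of_real (dbump \<epsilon> i (y - z))) = (\<lambda>x. complex_of_real (- 2 * (x $ i - z $ i)) *
     complex_of_real (flat_exp 2 (\<epsilon>\<^sup>2 - (x - z) \<bullet> (x - z))))"
    by (simp add: dbump_def fun_eq_iff)
  define F2 F3 F4 where "F2 = flat_exp 2 (\<epsilon>\<^sup>2 - (y - z) \<bullet> (y - z))"
    and "F3 = flat_exp 3 (\<epsilon>\<^sup>2 - (y - z) \<bullet> (y - z))" and "F4 = flat_exp 4 (\<epsilon>\<^sup>2 - (y - z) \<bullet> (y - z))"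
  have ax: "(axis k (1::real)) $ i = (if i = k then 1 else 0)" by (simp add: axis_def)
  have ip: "(y - z) \<bullet> axis k 1 = y $ k - z $ k" by (simp add: inner_axis)
  show ?thesis unfolding e partial_eq[OF has_derivative_mult[OF c d], of k]
    unfolding F2_def[symmetric] F3_def[symmetric] F4_def[symmetric] ax ip
    by (simp add: algebra_simps)
qed

lemma partial_dbump_commute:
  "partial k (\<lambda>y. complex_of_real (dbump \<epsilon> i (y - z))) y = partial i (\<lambda>y. complex_of_real (dbump \<epsilon> k (y - z))) y"
  unfolding partial_dbump by (simp add: mult.commute)

section \<open>Continuity of translations in mean\<close>

lemma nn_integral_lborel_shift:
  fixes f :: "'a::euclidean_space \<Rightarrow> ennreal"
  assumes [measurable]: "f \<in> borel_measurable borel"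
  shows "(\<integral>\<^sup>+ x. f (c + x) \<partial>lborel) = (\<integral>\<^sup>+ x. f x \<partial>lborel)"
proof -
  have "(\<integral>\<^sup>+ x. f x \<partial>lborel) = (\<integral>\<^sup>+ x. f x \<partial>(distr lborel borel ((+) c)))"
    by (simp add: lborel_distr_plus)
  also have "\<dots> = (\<integral>\<^sup>+ x. f (c + x) \<partial>lborel)"
    by (subst nn_integral_distr) auto
  finally show ?thesis by simp
qed

lemma integral_lborel_shift:
  fixes f :: "'a::euclidean_space \<Rightarrow> 'b::{banach, second_countable_topology}"
  assumes [measurable]: "f \<in> borel_measurable borel"
  shows "(LINT x|lborel. f (c + x)) = (LINT x|lborel. f x)"
    and "integrable lborel (\<lambda>x. f (c + x)) \<longleftrightarrow> integrable lborel f"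
proof -
  have "(LINT x|lborel. f x) = (LINT x|(distr lborel borel ((+) c)). f x)"
    by (simp add: lborel_distr_plus)
  also have "\<dots> = (LINT x|lborel. f (c + x))"
    by (subst integral_distr) auto
  finally show "(LINT x|lborel. f (c + x)) = (LINT x|lborel. f x)" by simp
  have "integrable lborel f \<longleftrightarrow> integrable (distr lborel borel ((+) c)) f"
    by (simp add: lborel_distr_plus)
  also have "\<dots> \<longleftrightarrow> integrable lborel (\<lambda>x. f (c + x))"
    by (subst integrable_distr_eq) auto
  finally show "integrable lborel (\<lambda>x. f (c + x)) \<longleftrightarrow> integrable lborel f" by simp
qed

text \<open>Values in the extended reals avoid a case distinction on integrability; \<open>q\<close> will be 1 or 2.\<close>

definition shift_modulus :: "nat \<Rightarrow> ('a::euclidean_space \<Rightarrow> complex) \<Rightarrow> 'a \<Rightarrow> ennreal" where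
  "shift_modulus q f h = (\<integral>\<^sup>+ x. ennreal (norm (f (h + x) - f x) ^ q) \<partial>lborel)"

definition shift_continuous :: "nat \<Rightarrow> ('a::euclidean_space \<Rightarrow> complex) \<Rightarrow> bool" where
  "shift_continuous q f \<longleftrightarrow> (\<forall>\<delta>>0. \<exists>d>0. \<forall>h. norm h < d \<longrightarrow> shift_modulus q f h \<le> ennreal \<delta>)"

lemma shift_continuousD:
  "shift_continuous q f \<Longrightarrow> 0 < \<delta> \<Longrightarrow> \<exists>d>0. \<forall>h. norm h < d \<longrightarrow> shift_modulus q f h \<le> ennreal \<delta>"
  by (simp add: shift_continuous_def)

text \<open>Squeeze the set between a compact and an open set of nearly the same measure.  For a translation
  shorter than the distance of the compact set to the complement of the open one, only points of the
  thin difference can enter or leave the set.\<close>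

lemma shift_continuous_indicator:
  fixes A :: "'a::euclidean_space set" and c :: complex
  assumes A: "A \<in> sets lborel" "emeasure lborel A < \<infinity>"
  shows "shift_continuous 1 (\<lambda>x. indicator A x *\<^sub>R c)"
  unfolding shift_continuous_def
proof (intro allI impI)
  fix \<delta> :: real assume "\<delta> > 0"
  define e where "e = \<delta> / (4 * (norm c + 1))"
  have e: "e > 0" "4 * e * norm c \<le> \<delta>"
  proof -
    have "0 < 4 * (norm c + 1)" by (intro mult_pos_pos add_nonneg_pos) auto
    with \<open>\<delta> > 0\<close> show "e > 0" by (simp add: e_def)
    have "4 * e * norm c \<le> 4 * e * (norm c + 1)" using \<open>e > 0\<close> by simp
    also have "\<dots> = e * (4 * (norm c + 1))" by simp
    also have "\<dots> = \<delta>"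
      unfolding e_def by (rule nonzero_divide_eq_eq[THEN iffD1, OF _ refl, symmetric]) (use \<open>0 < 4 * (norm c + 1)\<close> in simp)
    finally show "4 * e * norm c \<le> \<delta>" .
  qed
  have Ab [measurable]: "A \<in> sets borel" using A by simp
  obtain U where U: "open U" "A \<subseteq> U" "emeasure lborel (U - A) < ennreal e"
    using outer_regular_lborel[OF Ab e(1)] by metis
  define M where "M = density lborel (indicator A)"
  have M: "emeasure M B = emeasure lborel (A \<inter> B)" if "B \<in> sets borel" for B
    using that by (simp add: M_def emeasure_density nn_integral_indicator' flip: indicator_inter_arith)
  have Mf: "emeasure M (space M) \<noteq> \<infinity>" using M[of UNIV] A by (simp add: M_def)
  have sM: "sets M = sets borel" by (simp add: M_def)
  obtain K where K: "compact K" "K \<subseteq> A" "emeasure lborel (A - K) < ennreal e"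
  proof -
    have MA: "emeasure M A = emeasure lborel A" using M[OF Ab] by simp
    have ea: "emeasure lborel A = ennreal (measure lborel A)"
      using A by (simp add: emeasure_eq_ennreal_measure top.not_eq_extremum)
    have "\<exists>K. compact K \<and> K \<subseteq> A \<and> measure lborel A < measure lborel K + e"
    proof (cases "measure lborel A < e")
      case True
      then show ?thesis by (intro exI[of _ "{}"]) auto
    next
      case False
      then have "ennreal (measure lborel A - e) < emeasure M A"
        using e by (simp add: MA ea ennreal_less_iff)
      also have "\<dots> = (SUP K \<in> {K. K \<subseteq> A \<and> compact K}. emeasure M K)"
        using inner_regular[OF sM Mf Ab] by simp
      finally obtain K where K: "K \<subseteq> A" "compact K" "ennreal (measure lborel A - e) < emeasure M K"
        by (auto simp: less_SUP_iff)
      have Kb: "K \<in> sets borel" using K(2) by (simp add: borel_compact)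
      have "emeasure M K = emeasure lborel K" using M[OF Kb] K(1) by (simp add: Int_absorb1)
      also have "\<dots> = ennreal (measure lborel K)"
        using emeasure_lborel_cbox_finite emeasure_compact_finite[OF K(2)]
        by (simp add: emeasure_eq_ennreal_measure top.not_eq_extremum)
      finally show ?thesis using K False by (intro exI[of _ K]) (simp add: ennreal_less_iff)
    qed
    then obtain K where K: "compact K" "K \<subseteq> A" "measure lborel A < measure lborel K + e" by blast
    have Kb [measurable]: "K \<in> sets borel" using K(1) by (simp add: borel_compact)
    have f: "A \<in> fmeasurable lborel" "K \<in> fmeasurable lborel"
      using A emeasure_compact_finite[OF K(1)] by (auto intro!: fmeasurableI Kb)
    have "measure lborel (A - K) = measure lborel A - measure lborel K"
      using K(2) f by (intro measurable_measure_Diff) auto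
    then have "emeasure lborel (A - K) < ennreal e"
      using K(3) f e by (simp add: emeasure_eq_measure2 fmeasurable.Diff ennreal_lessI)
    with K that show ?thesis by blast
  qed
  show "\<exists>d>0. \<forall>h. norm h < d \<longrightarrow> shift_modulus 1 (\<lambda>x. indicator A x *\<^sub>R c) h \<le> ennreal \<delta>"
  proof -
    obtain d where d: "d > 0" "(\<Union>x\<in>K. ball x d) \<subseteq> U"
      using compact_subset_open_imp_ball_epsilon_subset[OF K(1) U(1)] K(2) U(2) by blast
    have Ub [measurable]: "U \<in> sets borel" and Kb [measurable]: "K \<in> sets borel"
      using U K by (auto simp: borel_compact)
    have "shift_modulus 1 (\<lambda>x. indicator A x *\<^sub>R c) h \<le> ennreal \<delta>" if h: "norm h < d" for h
    proof -
      define V where "V = (A - K) \<union> (U - A)"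
      have Vb [measurable]: "V \<in> sets borel" by (simp add: V_def)
      have V: "emeasure lborel V \<le> ennreal (2 * e)"
      proof -
        have "emeasure lborel V \<le> emeasure lborel (A - K) + emeasure lborel (U - A)"
          unfolding V_def by (rule emeasure_subadditive) auto
        also have "\<dots> \<le> ennreal e + ennreal e" using K(3) U(3) by (intro add_mono) auto
        finally show ?thesis using e by (simp flip: ennreal_plus)
      qed
      have near: "y \<in> U" if "x \<in> K" "y = h + x \<or> x = h + y" for x y
        using d(2) that h by (force simp: dist_norm norm_minus_commute)
      have "ennreal (norm (indicator A (h + x) *\<^sub>R c - indicator A x *\<^sub>R c))
          \<le> ennreal (norm c) * (indicator V (h + x) + indicator V x)" for x
      proof -
        have "(h + x \<in> A) \<noteq> (x \<in> A) \<Longrightarrow> h + x \<in> V \<or> x \<in> V"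
          using near[of x "h + x"] near[of "h + x" x] unfolding V_def by blast
        then show ?thesis by (auto simp: indicator_def distrib_left intro: order_trans[OF _ add_increasing])
      qed
      then have "shift_modulus 1 (\<lambda>x. indicator A x *\<^sub>R c) h
          \<le> (\<integral>\<^sup>+ x. ennreal (norm c) * (indicator V (h + x) + indicator V x) \<partial>lborel)"
        unfolding shift_modulus_def power_one_right by (intro nn_integral_mono) auto
      also have "\<dots> = ennreal (norm c) * ((\<integral>\<^sup>+ x. indicator V (h + x) \<partial>lborel) + (\<integral>\<^sup>+ x. indicator V x \<partial>lborel))"
        by (simp add: nn_integral_cmult nn_integral_add)
      also have "\<dots> = ennreal (norm c) * (emeasure lborel V + emeasure lborel V)"
        using nn_integral_lborel_shift[of "indicator V" h] by simp
      also have "\<dots> \<le> ennreal (norm c) * (ennreal (2 * e) + ennreal (2 * e))"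
        by (intro mult_left_mono add_mono V) auto
      also have "\<dots> = ennreal (4 * e * norm c)"
        using e by (simp flip: ennreal_plus ennreal_mult add: algebra_simps)
      also have "\<dots> \<le> ennreal \<delta>" using e by (intro ennreal_leI)
      finally show ?thesis .
    qed
    with d(1) show ?thesis by blast
  qed
qed

lemma shift_modulus_add_le:
  assumes [measurable]: "f \<in> borel_measurable borel" "g \<in> borel_measurable borel"
  shows "shift_modulus 1 (\<lambda>x. f x + g x) h \<le> shift_modulus 1 f h + shift_modulus 1 g h"
proof -
  have "shift_modulus 1 (\<lambda>x. f x + g x) h \<le>
     (\<integral>\<^sup>+ x. ennreal (norm (f (h + x) - f x)) + ennreal (norm (g (h + x) - g x)) \<partial>lborel)"
    unfolding shift_modulus_def power_one_right
  proof (rule nn_integral_mono)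
    fix x
    have "norm (f (h + x) + g (h + x) - (f x + g x)) \<le> norm (f (h + x) - f x) + norm (g (h + x) - g x)"
      by norm
    then show "ennreal (norm (f (h + x) + g (h + x) - (f x + g x)))
       \<le> ennreal (norm (f (h + x) - f x)) + ennreal (norm (g (h + x) - g x))"
      by (simp flip: ennreal_plus add: ennreal_leI)
  qed
  also have "\<dots> = shift_modulus 1 f h + shift_modulus 1 g h"
    unfolding shift_modulus_def power_one_right by (rule nn_integral_add) auto
  finally show ?thesis .
qed

lemma shift_modulus_le:
  assumes [measurable]: "f \<in> borel_measurable borel"
  shows "shift_modulus 1 f h \<le> 2 * (\<integral>\<^sup>+ x. ennreal (norm (f x)) \<partial>lborel)"
proof -
  have "shift_modulus 1 f h \<le> (\<integral>\<^sup>+ x. ennreal (norm (f (h + x))) + ennreal (norm (f x)) \<partial>lborel)"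
    unfolding shift_modulus_def power_one_right
    by (intro nn_integral_mono) (simp flip: ennreal_plus add: ennreal_leI norm_triangle_ineq4)
  also have "\<dots> = (\<integral>\<^sup>+ x. ennreal (norm (f (h + x))) \<partial>lborel) + (\<integral>\<^sup>+ x. ennreal (norm (f x)) \<partial>lborel)"
    by (rule nn_integral_add) auto
  also have "(\<integral>\<^sup>+ x. ennreal (norm (f (h + x))) \<partial>lborel) = (\<integral>\<^sup>+ x. ennreal (norm (f x)) \<partial>lborel)"
    by (rule nn_integral_lborel_shift) auto
  finally show ?thesis by (simp add: mult_2)
qed

text \<open>Functions whose translations are continuous in mean form a closed subspace, so the case of indicator
  functions suffices.\<close>

lemma shift_continuous_L1:
  fixes f :: "'a::euclidean_space \<Rightarrow> complex"
  assumes "integrable lborel f"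
  shows "shift_continuous 1 f"
  using assms
proof (induction rule: integrable_induct)
  case (base A c)
  then show ?case by (intro shift_continuous_indicator) auto
next
  case (add f g)
  have m: "f \<in> borel_measurable borel" "g \<in> borel_measurable borel" using add.hyps by auto
  show ?case unfolding shift_continuous_def
  proof (intro allI impI)
    fix \<delta> :: real assume "\<delta> > 0"
    then have "\<delta> / 2 > 0" by simp
    obtain d1 where d1: "d1 > 0" "\<And>h. norm h < d1 \<Longrightarrow> shift_modulus 1 f h \<le> ennreal (\<delta>/2)"
      using shift_continuousD[OF add.IH(1) \<open>\<delta> / 2 > 0\<close>] by auto
    obtain d2 where d2: "d2 > 0" "\<And>h. norm h < d2 \<Longrightarrow> shift_modulus 1 g h \<le> ennreal (\<delta>/2)"
      using shift_continuousD[OF add.IH(2) \<open>\<delta> / 2 > 0\<close>] by auto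
    note d = d1 d2
    show "\<exists>d>0. \<forall>h. norm h < d \<longrightarrow> shift_modulus 1 (\<lambda>x. f x + g x) h \<le> ennreal \<delta>"
    proof (intro exI conjI allI impI)
      show "min d1 d2 > 0" using d by simp
      fix h :: 'a assume "norm h < min d1 d2"
      then have "shift_modulus 1 f h + shift_modulus 1 g h \<le> ennreal (\<delta>/2) + ennreal (\<delta>/2)"
        using d by (intro add_mono) auto
      also have "\<dots> = ennreal \<delta>" using \<open>\<delta> > 0\<close> by (simp flip: ennreal_plus)
      finally show "shift_modulus 1 (\<lambda>x. f x + g x) h \<le> ennreal \<delta>"
        using shift_modulus_add_le[OF m, of h] by order
    qed
  qed
next
  case (lim f s)
  have m [measurable]: "f \<in> borel_measurable borel" "\<And>i. s i \<in> borel_measurable borel" using lim.hyps by auto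
  have conv: "(\<lambda>i. \<integral>\<^sup>+ x. ennreal (norm (f x - s i x)) \<partial>lborel) \<longlonglongrightarrow> 0"
  proof (rule nn_integral_dominated_convergence_norm)
    show "AE x in lborel. norm (s j x) \<le> 2 * norm (f x)" for j using lim.hyps by auto
    show "(\<integral>\<^sup>+ x. ennreal (2 * norm (f x)) \<partial>lborel) < \<infinity>"
    proof -
      have "integrable lborel (\<lambda>x. 2 * f x)" using lim.hyps by simp
      then show ?thesis by (simp add: integrable_iff_bounded norm_mult)
    qed
    show "AE x in lborel. (\<lambda>i. s i x) \<longlonglongrightarrow> f x" using lim.hyps by auto
  qed auto
  show ?case unfolding shift_continuous_def
  proof (intro allI impI)
    fix \<delta> :: real assume "\<delta> > 0"
    then have "\<forall>\<^sub>F i in sequentially. (\<integral>\<^sup>+ x. ennreal (norm (f x - s i x)) \<partial>lborel) < ennreal (\<delta>/4)"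
      by (intro order_tendstoD[OF conv]) auto
    then obtain i where i: "(\<integral>\<^sup>+ x. ennreal (norm (f x - s i x)) \<partial>lborel) < ennreal (\<delta>/4)"
      using eventually_happens'[OF sequentially_bot] by blast
    have "\<delta>/2 > 0" using \<open>\<delta> > 0\<close> by simp
    then obtain d where d: "d > 0" "\<And>h. norm h < d \<Longrightarrow> shift_modulus 1 (s i) h \<le> ennreal (\<delta>/2)"
      using shift_continuousD[OF lim.IH[of i], of "\<delta>/2"] by auto
    have "shift_modulus 1 f h \<le> ennreal \<delta>" if "norm h < d" for h
    proof -
      have "shift_modulus 1 f h = shift_modulus 1 (\<lambda>x. (f x - s i x) + s i x) h" by simp
      also have "\<dots> \<le> shift_modulus 1 (\<lambda>x. f x - s i x) h + shift_modulus 1 (s i) h"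
        by (rule shift_modulus_add_le) auto
      also have "\<dots> \<le> 2 * ennreal (\<delta>/4) + ennreal (\<delta>/2)"
      proof (rule add_mono)
        have "shift_modulus 1 (\<lambda>x. f x - s i x) h \<le> 2 * (\<integral>\<^sup>+ x. ennreal (norm (f x - s i x)) \<partial>lborel)"
          by (rule shift_modulus_le) auto
        also have "\<dots> \<le> 2 * ennreal (\<delta>/4)" using i by (intro mult_left_mono) auto
        finally show "shift_modulus 1 (\<lambda>x. f x - s i x) h \<le> 2 * ennreal (\<delta>/4)" .
        show "shift_modulus 1 (s i) h \<le> ennreal (\<delta>/2)" by (rule d(2)[OF that])
      qed
      also have "\<dots> = ennreal \<delta>"
      proof -
        have "2 * ennreal (\<delta>/4) = ennreal (\<delta>/2)"
          using \<open>\<delta> > 0\<close> ennreal_mult[of 2 "\<delta>/4"] by simp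
        then show ?thesis using \<open>\<delta> > 0\<close> ennreal_plus[of "\<delta>/2" "\<delta>/2"] by simp
      qed
      finally show ?thesis .
    qed
    with d(1) show "\<exists>d>0. \<forall>h. norm h < d \<longrightarrow> shift_modulus 1 f h \<le> ennreal \<delta>" by blast
  qed
qed

text \<open>Truncating \<open>f\<close> at height \<open>M\<close> reduces to the first power: on the bounded part the square of the increment
  is at most \<open>2M\<close> times its absolute value, and the square of the remainder has small integral.\<close>

lemma shift_continuous_L2:
  fixes f :: "'a::euclidean_space \<Rightarrow> complex"
  assumes f1: "integrable lborel f" and f2: "integrable lborel (\<lambda>x. (norm (f x))\<^sup>2)"
  shows "shift_continuous 2 f"
  unfolding shift_continuous_def
proof (intro allI impI)
  fix \<delta> :: real assume \<delta>: "\<delta> > 0"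
  have m [measurable]: "f \<in> borel_measurable borel" using f1 by auto
  define r where "r M x = (if norm (f x) \<le> real M then 0 else f x)" for M x
  define t where "t M x = (if norm (f x) \<le> real M then f x else 0)" for M x
  have [measurable]: "r M \<in> borel_measurable borel" "t M \<in> borel_measurable borel" for M
    unfolding r_def[abs_def] t_def[abs_def] by measurable
  have ftr: "f x = t M x + r M x" for M x by (simp add: t_def r_def)
  have "(\<lambda>M. LINT x|lborel. (norm (r M x))\<^sup>2) \<longlonglongrightarrow> (LINT x|(lborel::'a measure). 0)"
  proof (rule integral_dominated_convergence[OF _ _ f2])
    show "AE x in lborel. (\<lambda>M. (norm (r M x))\<^sup>2) \<longlonglongrightarrow> 0"
    proof (rule AE_I2)
      fix x
      have "\<forall>\<^sub>F M in sequentially. (norm (r M x))\<^sup>2 = 0"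
        using eventually_ge_at_top[of "nat \<lceil>norm (f x)\<rceil>"]
        by eventually_elim (auto simp: r_def nat_le_iff ceiling_le_iff)
      then show "(\<lambda>M. (norm (r M x))\<^sup>2) \<longlonglongrightarrow> 0" by (rule tendsto_eventually)
    qed
    show "AE x in lborel. norm ((norm (r M x))\<^sup>2) \<le> (norm (f x))\<^sup>2" for M
      by (auto simp: r_def)
  qed auto
  then have "\<forall>\<^sub>F M in sequentially. (LINT x|lborel. (norm (r M x))\<^sup>2) < \<delta>/12"
    using \<delta> by (intro order_tendstoD) auto
  then obtain M where M: "(LINT x|lborel. (norm (r M x))\<^sup>2) < \<delta>/12"
    using eventually_happens'[OF sequentially_bot] by blast
  have ir: "integrable lborel (\<lambda>x. (norm (r M x))\<^sup>2)"
    by (rule Bochner_Integration.integrable_bound[OF f2]) (auto simp: r_def)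
  have R: "(\<integral>\<^sup>+ x. ennreal ((norm (r M x))\<^sup>2) \<partial>lborel) \<le> ennreal (\<delta>/12)"
    using M nn_integral_eq_integral[OF ir] by (simp add: ennreal_leI)
  have it: "integrable lborel (t M)"
    by (rule Bochner_Integration.integrable_bound[OF f1]) (auto simp: t_def)
  \<comment> \<open>three times the largest increment \<open>2M\<close> of the truncated part, enlarged to stay positive for \<open>M = 0\<close>\<close>
  define K where "K = 6 * (real M + 1)"
  have K: "K > 0" by (simp add: K_def add_nonneg_pos)
  obtain d where d: "d > 0" "\<And>h. norm h < d \<Longrightarrow> shift_modulus 1 (t M) h \<le> ennreal (\<delta> / (2 * K))"
    using shift_continuousD[OF shift_continuous_L1[OF it], of "\<delta> / (2 * K)"] \<delta> K by auto
  have "shift_modulus 2 f h \<le> ennreal \<delta>" if h: "norm h < d" for h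
  proof -
    have b: "(norm (f (h + x) - f x))\<^sup>2 \<le>
        K * norm (t M (h + x) - t M x) + (3 * (norm (r M (h + x)))\<^sup>2 + 3 * (norm (r M x))\<^sup>2)" for x
    proof -
      define a b c where "a = norm (t M (h + x) - t M x)" and "b = norm (r M (h + x))" and "c = norm (r M x)"
      have "norm (f (h + x) - f x) \<le> a + b + c"
        unfolding a_def b_def c_def ftr[of "h + x" M] ftr[of x M] by norm
      then have "(norm (f (h + x) - f x))\<^sup>2 \<le> (a + b + c)\<^sup>2" by (intro power_mono) auto
      also have "\<dots> \<le> 3 * a\<^sup>2 + (3 * b\<^sup>2 + 3 * c\<^sup>2)"
        using sum_squares_bound[of a b] sum_squares_bound[of a c] sum_squares_bound[of b c]
        by (simp add: power2_eq_square algebra_simps)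
      also have "3 * a\<^sup>2 \<le> K * a"
      proof -
        have "norm (t M y) \<le> real M" for y by (simp add: t_def)
        then have "a \<le> 2 * real M" unfolding a_def
          by (smt (verit, best) norm_triangle_ineq4)
        then have "3 * a * a \<le> K * a" by (intro mult_right_mono) (auto simp: K_def a_def)
        then show ?thesis by (simp add: power2_eq_square)
      qed
      finally show ?thesis by (simp add: a_def b_def c_def)
    qed
    have "shift_modulus 2 f h \<le> (\<integral>\<^sup>+ x. ennreal K * ennreal (norm (t M (h + x) - t M x)) +
        (3 * ennreal ((norm (r M (h + x)))\<^sup>2) + 3 * ennreal ((norm (r M x))\<^sup>2)) \<partial>lborel)"
      unfolding shift_modulus_def
    proof (rule nn_integral_mono)
      fix x
      have "ennreal ((norm (f (h + x) - f x))\<^sup>2) \<le> ennreal (K * norm (t M (h + x) - t M x) + (3 * (norm (r M (h + x)))\<^sup>2 + 3 * (norm (r M x))\<^sup>2))"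
        by (rule ennreal_leI[OF b])
      also have "\<dots> = ennreal K * ennreal (norm (t M (h + x) - t M x)) +
        (3 * ennreal ((norm (r M (h + x)))\<^sup>2) + 3 * ennreal ((norm (r M x))\<^sup>2))"
        using K by (simp add: ennreal_plus ennreal_mult)
      finally show "ennreal ((norm (f (h + x) - f x))\<^sup>2) \<le> \<dots>" .
    qed
    also have "\<dots> = ennreal K * shift_modulus 1 (t M) h +
       (3 * (\<integral>\<^sup>+ x. ennreal ((norm (r M (h + x)))\<^sup>2) \<partial>lborel) + 3 * (\<integral>\<^sup>+ x. ennreal ((norm (r M x))\<^sup>2) \<partial>lborel))"
      by (simp add: nn_integral_add nn_integral_cmult shift_modulus_def)
    also have "(\<integral>\<^sup>+ x. ennreal ((norm (r M (h + x)))\<^sup>2) \<partial>lborel) = (\<integral>\<^sup>+ x. ennreal ((norm (r M x))\<^sup>2) \<partial>lborel)"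
      by (rule nn_integral_lborel_shift) auto
    also have "ennreal K * shift_modulus 1 (t M) h +
       (3 * (\<integral>\<^sup>+ x. ennreal ((norm (r M x))\<^sup>2) \<partial>lborel) + 3 * (\<integral>\<^sup>+ x. ennreal ((norm (r M x))\<^sup>2) \<partial>lborel))
       \<le> ennreal K * ennreal (\<delta> / (2 * K)) + (3 * ennreal (\<delta>/12) + 3 * ennreal (\<delta>/12))"
      by (intro add_mono mult_left_mono d(2)[OF h] R) auto
    also have "\<dots> = ennreal (K * (\<delta> / (2 * K))) + (ennreal (3 * (\<delta>/12)) + ennreal (3 * (\<delta>/12)))"
      using K \<delta> ennreal_mult[of K "\<delta> / (2 * K)"] ennreal_mult[of 3 "\<delta>/12"] by simp
    also have "\<dots> = ennreal (K * (\<delta> / (2 * K)) + (3 * (\<delta>/12) + 3 * (\<delta>/12)))"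
    proof -
      have "ennreal a + (ennreal b + ennreal b) = ennreal (a + (b + b))" if "0 \<le> a" "0 \<le> b" for a b
        using that by (simp only: ennreal_plus add_nonneg_nonneg)
      then show ?thesis using K \<delta> by (meson divide_nonneg_nonneg less_imp_le mult_nonneg_nonneg zero_le_numeral)
    qed
    also have "K * (\<delta> / (2 * K)) + (3 * (\<delta>/12) + 3 * (\<delta>/12)) = \<delta>"
      using K by (simp add: field_simps)
    finally show ?thesis .
  qed
  with d(1) show "\<exists>d>0. \<forall>h. norm h < d \<longrightarrow> shift_modulus 2 f h \<le> ennreal \<delta>" by blast
qed

section \<open>Mollification\<close>

text \<open>Only directional derivatives along one axis occur in the integrations by parts; asking for no
  more keeps the product rule and the mollified derivative elementary.\<close>

definition pderiv_along :: "'n::finite \<Rightarrow> (real^'n \<Rightarrow> 'b::real_normed_vector) \<Rightarrow> (real^'n \<Rightarrow> 'b) \<Rightarrow> bool" where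
  "pderiv_along i f d \<longleftrightarrow> (\<forall>x. ((\<lambda>t. f (x + t *\<^sub>R axis i 1)) has_vector_derivative d x) (at 0))"

lemma pderiv_alongD:
  assumes "pderiv_along i f d"
  shows "((\<lambda>t. f (x + t *\<^sub>R axis i 1)) has_vector_derivative d (x + t *\<^sub>R axis i 1)) (at t)"
proof -
  have "((\<lambda>s. f ((x + t *\<^sub>R axis i 1) + s *\<^sub>R axis i 1)) has_vector_derivative d (x + t *\<^sub>R axis i 1)) (at (t - t))"
    using assms by (simp add: pderiv_along_def)
  then have "(((\<lambda>s. f ((x + t *\<^sub>R axis i 1) + s *\<^sub>R axis i 1)) \<circ> (\<lambda>s. s - t)) has_vector_derivative
       1 *\<^sub>R d (x + t *\<^sub>R axis i 1)) (at t)"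
    by (intro vector_diff_chain_at) (auto intro!: derivative_eq_intros)
  then show ?thesis by (simp add: o_def algebra_simps)
qed

lemma pderiv_along_lipschitz:
  assumes "pderiv_along i f d" "\<And>x. norm (d x) \<le> B"
  shows "norm (f (x + t *\<^sub>R axis i 1) - f x) \<le> B * \<bar>t\<bar>"
proof -
  have "norm (f (x + t *\<^sub>R axis i 1) - f (x + 0 *\<^sub>R axis i 1)) \<le> B * norm (t - 0)"
  proof (rule differentiable_bound[where S = UNIV])
    show "((\<lambda>t. f (x + t *\<^sub>R axis i 1)) has_derivative (\<lambda>h. h *\<^sub>R d (x + t *\<^sub>R axis i 1))) (at t within UNIV)" for t
      using pderiv_alongD[OF assms(1), of x t] by (simp add: has_vector_derivative_def)
    show "onorm (\<lambda>h. h *\<^sub>R d (x + t *\<^sub>R axis i 1)) \<le> B" for t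
      using assms(2) by (intro onorm_le) (simp, metis mult.commute mult_right_mono abs_ge_zero)
  qed auto
  then show ?thesis by simp
qed

lemma has_vector_derivative_quotient:
  "(f has_vector_derivative d) (at 0) \<longleftrightarrow> ((\<lambda>h. (f h - f 0) /\<^sub>R h) \<longlongrightarrow> d) (at 0)"
proof -
  have e: "norm (f (0 + h) - f 0 - h *\<^sub>R d) / norm h = norm ((f h - f 0) /\<^sub>R h - d)" if "h \<noteq> 0" for h
  proof -
    have "(f h - f 0) /\<^sub>R h - d = (f h - f 0 - h *\<^sub>R d) /\<^sub>R h"
      using that by (simp add: scaleR_diff_right)
    then show ?thesis by (simp add: divide_inverse mult.commute)
  qed
  have "(f has_vector_derivative d) (at 0) \<longleftrightarrow> ((\<lambda>h. norm (f (0 + h) - f 0 - h *\<^sub>R d) / norm h) \<longlongrightarrow> 0) (at 0)"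
    by (simp add: has_vector_derivative_def has_derivative_at bounded_linear_scaleR_left)
  also have "\<dots> \<longleftrightarrow> ((\<lambda>h. norm ((f h - f 0) /\<^sub>R h - d)) \<longlongrightarrow> 0) (at 0)"
    by (rule filterlim_cong) (use e in \<open>auto simp: eventually_at_filter intro!: always_eventually\<close>)
  also have "\<dots> \<longleftrightarrow> ((\<lambda>h. (f h - f 0) /\<^sub>R h) \<longlongrightarrow> d) (at 0)"
    by (simp add: tendsto_norm_zero_iff LIM_zero_iff)
  finally show ?thesis .
qed

lemma pderiv_along_seq:
  assumes "pderiv_along i f d" "\<And>k. h k \<noteq> 0" "h \<longlonglongrightarrow> 0"
  shows "(\<lambda>k. (f (x + h k *\<^sub>R axis i 1) - f x) /\<^sub>R h k) \<longlonglongrightarrow> d x"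
proof -
  have "((\<lambda>t. (f (x + t *\<^sub>R axis i 1) - f x) /\<^sub>R t) \<longlongrightarrow> d x) (at 0)"
    using assms(1) unfolding pderiv_along_def has_vector_derivative_quotient by simp
  then show ?thesis unfolding tendsto_at_iff_sequentially using assms(2,3) by (auto simp: o_def)
qed

lemma pderiv_along_seqI:
  assumes "\<And>x h. (\<And>k. h k \<noteq> 0) \<Longrightarrow> h \<longlonglongrightarrow> 0 \<Longrightarrow> (\<lambda>k. (f (x + h k *\<^sub>R axis i 1) - f x) /\<^sub>R h k) \<longlonglongrightarrow> d x"
  shows "pderiv_along i f d"
  unfolding pderiv_along_def has_vector_derivative_quotient tendsto_at_iff_sequentially
  using assms by (auto simp: o_def)

lemma pderiv_along_mult:
  fixes f g :: "real^'n::finite \<Rightarrow> 'b::real_normed_algebra"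
  assumes "pderiv_along i f f'" "pderiv_along i g g'"
  shows "pderiv_along i (\<lambda>x. f x * g x) (\<lambda>x. f x * g' x + f' x * g x)"
  unfolding pderiv_along_def
proof
  fix x
  show "((\<lambda>t. f (x + t *\<^sub>R axis i 1) * g (x + t *\<^sub>R axis i 1)) has_vector_derivative f x * g' x + f' x * g x) (at 0)"
    using has_vector_derivative_mult[OF assms[unfolded pderiv_along_def, rule_format, of x]] by simp
qed

lemma pderiv_along_bounded_linear:
  assumes "bounded_linear T" "pderiv_along i f f'"
  shows "pderiv_along i (\<lambda>x. T (f x)) (\<lambda>x. T (f' x))"
  using bounded_linear.has_vector_derivative[OF assms(1)] assms(2) by (simp add: pderiv_along_def)

lemma integrable_indicator_cball: "integrable lborel (indicator (cball c R) :: 'a::euclidean_space \<Rightarrow> real)"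
  by (rule integrable_real_indicator) (use emeasure_bounded_finite[OF bounded_cball] in auto)

lemma integrable_bounded_support:
  fixes h :: "'a::euclidean_space \<Rightarrow> complex"
  assumes "h \<in> borel_measurable borel" "\<And>x. norm (h x) \<le> b" "\<And>x. R < norm x \<Longrightarrow> h x = 0"
  shows "integrable lborel h"
proof (rule Bochner_Integration.integrable_bound)
  show "integrable lborel (\<lambda>x. b * indicator (cball 0 R) (x::'a) :: real)"
    by (intro integrable_mult_right integrable_indicator_cball)
  have "0 \<le> b" using order_trans[OF norm_ge_zero assms(2)] .
  then show "AE x in lborel. norm (h x) \<le> norm (b * indicator (cball 0 R) x :: real)"
    using assms(2,3) by (auto simp: indicator_def)
qed (use assms(1) in auto)

text \<open>The integral of a derivative of a compactly supported function vanishes because the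
  Lebesgue measure is invariant under translations.\<close>

lemma integral_pderiv_along_eq_0:
  fixes f :: "real^'n::finite \<Rightarrow> complex"
  assumes d: "pderiv_along i f d" and b: "\<And>x. norm (d x) \<le> B"
    and [measurable]: "f \<in> borel_measurable borel" "d \<in> borel_measurable borel"
    and 0: "\<And>x. R < norm x \<Longrightarrow> f x = 0" and f: "integrable lborel f"
  shows "(LINT x|lborel. d x) = 0"
proof -
  define h where "h k = inverse (real (Suc k))" for k
  have h: "h k \<noteq> 0" "h \<longlonglongrightarrow> 0" "0 < h k" "h k \<le> 1" for k
    using LIMSEQ_inverse_real_of_nat by (auto simp: h_def[abs_def] field_simps)
  have "(\<lambda>k. LINT x|lborel. (f (x + h k *\<^sub>R axis i 1) - f x) /\<^sub>R h k) \<longlonglongrightarrow> (LINT x|lborel. d x)"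
  proof (rule integral_dominated_convergence[where w = "\<lambda>x. B * indicator (cball 0 (R + 1)) x"])
    show "integrable lborel (\<lambda>x::real^'n. B * indicator (cball 0 (R + 1)) x)"
      by (intro integrable_mult_right integrable_indicator_cball)
    show "AE x in lborel. (\<lambda>k. (f (x + h k *\<^sub>R axis i 1) - f x) /\<^sub>R h k) \<longlonglongrightarrow> d x"
      by (intro AE_I2 pderiv_along_seq[OF d] h)
    show "AE x in lborel. norm ((f (x + h k *\<^sub>R axis i 1) - f x) /\<^sub>R h k) \<le> B * indicator (cball 0 (R + 1)) x" for k
    proof (intro AE_I2)
      fix x
      show "norm ((f (x + h k *\<^sub>R axis i 1) - f x) /\<^sub>R h k) \<le> B * indicator (cball 0 (R + 1)) x"
      proof (cases "norm x \<le> R + 1")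
        case True
        then show ?thesis
          using pderiv_along_lipschitz[OF d b, of x "h k"] h(3)[of k]
          by (simp add: divide_le_eq mult.commute flip: divide_inverse_commute)
      next
        case False
        have "norm x \<le> norm (x + h k *\<^sub>R axis i 1) + norm (h k *\<^sub>R axis i 1 :: real^'n)"
          using norm_triangle_ineq4[of "x + h k *\<^sub>R axis i 1" "h k *\<^sub>R axis i 1"] by simp
        then have "R < norm (x + h k *\<^sub>R axis i 1)"
          using False h(3,4)[of k] by (simp)
        with False show ?thesis by (simp add: 0)
      qed
    qed
  qed auto
  moreover have "(LINT x|lborel. (f (x + h k *\<^sub>R axis i 1) - f x) /\<^sub>R h k) = 0" for k
  proof -
    have "(LINT x|lborel. f (h k *\<^sub>R axis i 1 + x) - f x) = 0"
      using f integral_lborel_shift[of f "h k *\<^sub>R axis i 1"] by simp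
    then show ?thesis by (simp only: integral_scaleR_right add.commute scaleR_zero_right)
  qed
  ultimately have "(\<lambda>k::nat. 0) \<longlonglongrightarrow> (LINT x|lborel. d x)" using h(1) by simp
  then show ?thesis by (simp add: LIMSEQ_const_iff)
qed

lemma flat_exp_le:
  "flat_exp 0 t \<le> 1" "flat_exp 2 t \<le> 2"
proof -
  show "flat_exp 0 t \<le> 1" by (simp add: flat_exp_def)
  have "exp (- (1/t)) / t\<^sup>2 \<le> 2" if "t > 0"
  proof -
    have "(1/t)\<^sup>2 / 2 \<le> exp (1/t)"
    proof -
      have "0 \<le> 1/t" using that by simp
      with exp_lower_Taylor_quadratic[OF this] show ?thesis by linarith
    qed
    then have "(1/t)\<^sup>2 \<le> 2 * exp (1/t)" by simp
    then have "(1/t)\<^sup>2 * exp (- (1/t)) \<le> 2 * exp (1/t) * exp (- (1/t))" by (intro mult_right_mono) auto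
    also have "\<dots> = 2" by (simp flip: exp_add)
    finally show ?thesis by (simp add: power_divide mult.commute)
  qed
  then show "flat_exp 2 t \<le> 2" by (simp add: flat_exp_def)
qed

lemma isCont_flat_exp: "isCont (flat_exp j) t"
  using flat_exp_has_real_derivative DERIV_isCont by blast

lemma continuous_flat_exp [continuous_intros]:
  "continuous_on S f \<Longrightarrow> continuous_on S (\<lambda>x. flat_exp j (f x))"
  by (rule continuous_on_compose2[OF continuous_at_imp_continuous_on, of UNIV]) (auto simp: isCont_flat_exp)

lemma bump_measurable [measurable]: "bump \<epsilon> \<in> borel_measurable borel" "dbump \<epsilon> i \<in> borel_measurable borel"
  unfolding bump_def[abs_def] dbump_def[abs_def]
  by (intro borel_measurable_continuous_onI continuous_intros)+

lemma bump_nonneg: "0 \<le> bump \<epsilon> x" and bump_le: "bump \<epsilon> x \<le> 1"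
  by (simp_all add: bump_def flat_exp_nonneg flat_exp_le)

lemma bump_eq_0: assumes "0 \<le> \<epsilon>" "\<epsilon> \<le> norm x" shows "bump \<epsilon> x = 0" "dbump \<epsilon> i x = 0"
proof -
  have "\<epsilon>\<^sup>2 \<le> (norm x)\<^sup>2" using assms by (intro power_mono)
  then show "bump \<epsilon> x = 0" "dbump \<epsilon> i x = 0" by (auto simp: bump_def dbump_def flat_exp_def power2_norm_eq_inner)
qed

lemma dbump_le: assumes "0 \<le> \<epsilon>" shows "\<bar>dbump \<epsilon> i x\<bar> \<le> 4 * \<epsilon>"
proof (cases "\<epsilon> \<le> norm x")
  case True
  then show ?thesis using assms by (simp add: bump_eq_0)
next
  case False
  have "\<bar>dbump \<epsilon> i x\<bar> = 2 * \<bar>x $ i\<bar> * flat_exp 2 (\<epsilon>\<^sup>2 - x \<bullet> x)"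
    by (simp add: dbump_def abs_mult flat_exp_nonneg)
  also have "\<dots> \<le> 2 * \<epsilon> * 2"
    using False component_le_norm_cart[of x i] by (intro mult_mono flat_exp_le) (auto simp: flat_exp_nonneg assms)
  finally show ?thesis by simp
qed

lemma bump_integrable: "0 \<le> \<epsilon> \<Longrightarrow> integrable lborel (bump \<epsilon> :: real^'n::finite \<Rightarrow> real)"
proof (rule Bochner_Integration.integrable_bound)
  show "integrable lborel (\<lambda>x::real^'n. indicator (cball 0 \<epsilon>) x :: real)"
    by (rule integrable_indicator_cball)
  show "AE x in lborel. norm (bump \<epsilon> x) \<le> norm (indicator (cball 0 \<epsilon>) (x::real^'n) :: real)" if "0 \<le> \<epsilon>"
    using that by (intro AE_I2) (auto simp: bump_nonneg bump_le bump_eq_0 indicator_def)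
qed auto

definition bump_mass :: "'n::finite itself \<Rightarrow> real \<Rightarrow> real" where
  "bump_mass _ \<epsilon> = (LINT x|(lborel :: (real^'n) measure). bump \<epsilon> x)"

lemma bump_mass_pos: assumes "0 < \<epsilon>" shows "0 < bump_mass TYPE('n::finite) \<epsilon>"
proof -
  define c where "c = exp (- (1 / (3 * \<epsilon>\<^sup>2 / 4)))"
  have c: "0 < c" by (simp add: c_def)
  have "c * indicator (ball 0 (\<epsilon>/2)) x \<le> bump \<epsilon> x" for x :: "real^'n"
  proof (cases "norm x < \<epsilon>/2")
    case True
    have "x \<bullet> x \<le> (\<epsilon>/2)\<^sup>2" using True unfolding power2_norm_eq_inner[symmetric] by (intro power_mono) auto
    then have t: "3 * \<epsilon>\<^sup>2 / 4 \<le> \<epsilon>\<^sup>2 - x \<bullet> x" by (simp add: power2_eq_square)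
    have "0 < 3 * \<epsilon>\<^sup>2 / 4" using assms by simp
    with t have p: "0 < \<epsilon>\<^sup>2 - x \<bullet> x" by linarith
    have "1 / (\<epsilon>\<^sup>2 - x \<bullet> x) \<le> 1 / (3 * \<epsilon>\<^sup>2 / 4)"
      by (rule divide_left_mono[OF t]) (use p \<open>0 < 3 * \<epsilon>\<^sup>2 / 4\<close> in \<open>auto intro: mult_pos_pos\<close>)
    then show ?thesis using True p by (simp add: bump_def flat_exp_def c_def)
  qed (simp add: bump_nonneg)
  then have "(LINT x|(lborel :: (real^'n) measure). c * indicator (ball 0 (\<epsilon>/2)) x) \<le> bump_mass TYPE('n) \<epsilon>"
    unfolding bump_mass_def using assms
    by (intro integral_mono bump_integrable) (auto intro!: integrable_real_indicator emeasure_bounded_finite)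
  moreover have "(LINT x|(lborel :: (real^'n) measure). c * indicator (ball 0 (\<epsilon>/2)) x) = c * measure lborel (ball 0 (\<epsilon>/2) :: (real^'n) set)"
    by simp
  moreover have "0 < measure lborel (ball 0 (\<epsilon>/2) :: (real^'n) set)" using assms by simp
  ultimately show ?thesis using c by (smt (verit) mult_pos_pos)
qed

lemma bump_pderiv: fixes i :: "'n::finite" shows "pderiv_along i (bump \<epsilon>) (dbump \<epsilon> i)"
  unfolding pderiv_along_def
proof
  fix x :: "real^'n"
  have "((\<lambda>t. \<epsilon>\<^sup>2 - (x + t *\<^sub>R axis i 1) \<bullet> (x + t *\<^sub>R axis i 1)) has_real_derivative - 2 * x $ i) (at 0)"
    by (auto intro!: derivative_eq_intros simp: inner_axis inner_axis' inner_add_left inner_add_right inner_axis_axis)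
  from DERIV_chain2[OF flat_exp_has_real_derivative this, of 0]
  have "((\<lambda>t. bump \<epsilon> (x + t *\<^sub>R axis i 1)) has_real_derivative dbump \<epsilon> i x) (at 0)"
    by (simp add: bump_def dbump_def numeral_2_eq_2 mult.commute)
  then show "((\<lambda>t. bump \<epsilon> (x + t *\<^sub>R axis i 1)) has_vector_derivative dbump \<epsilon> i x) (at 0)"
    by (simp add: has_real_derivative_iff_has_vector_derivative)
qed

definition mollify :: "real \<Rightarrow> (real^'n::finite \<Rightarrow> complex) \<Rightarrow> real^'n \<Rightarrow> complex" where
  "mollify \<epsilon> f x = (LINT y|lborel. of_real (bump \<epsilon> (y - x) / bump_mass TYPE('n) \<epsilon>) * f y)"

definition dmollify :: "'n \<Rightarrow> real \<Rightarrow> (real^'n::finite \<Rightarrow> complex) \<Rightarrow> real^'n \<Rightarrow> complex" where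
  "dmollify i \<epsilon> f x = (LINT y|lborel. of_real (- dbump \<epsilon> i (y - x) / bump_mass TYPE('n) \<epsilon>) * f y)"

lemma mollify_measurable [measurable]:
  assumes [measurable]: "f \<in> borel_measurable borel"
  shows "mollify \<epsilon> f \<in> borel_measurable borel" "dmollify i \<epsilon> f \<in> borel_measurable borel"
  unfolding mollify_def[abs_def] dmollify_def[abs_def] by measurable

lemma kernel_integrable:
  fixes f :: "real^'n::finite \<Rightarrow> complex"
  assumes f: "integrable lborel f" and \<phi>: "\<phi> \<in> borel_measurable borel" "\<And>y. norm (\<phi> y) \<le> B"
  shows "integrable lborel (\<lambda>y. of_real (\<phi> y) * f y)"
    and "norm (LINT y|lborel. of_real (\<phi> y) * f y) \<le> B * (LINT y|lborel. norm (f y))"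
proof -
  note [measurable] = \<phi>(1)
  have i: "integrable lborel (\<lambda>y. B * norm (f y))" using f by simp
  have b: "norm (of_real (\<phi> y) * f y) \<le> B * norm (f y)" for y
    using \<phi>(2)[of y] by (simp add: norm_mult mult_right_mono)
  show 1: "integrable lborel (\<lambda>y. of_real (\<phi> y) * f y)"
    by (rule Bochner_Integration.integrable_bound[OF i]) (use f b in \<open>auto intro!: AE_I2 order_trans[OF _ abs_ge_self]\<close>)
  have "norm (LINT y|lborel. of_real (\<phi> y) * f y) \<le> (LINT y|lborel. B * norm (f y))"
    by (rule order_trans[OF integral_norm_bound integral_mono[OF integrable_norm[OF 1] i]]) (rule b)
  then show "norm (LINT y|lborel. of_real (\<phi> y) * f y) \<le> B * (LINT y|lborel. norm (f y))" by simp
qed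

lemma mollify_pderiv:
  fixes f :: "real^'n::finite \<Rightarrow> complex"
  assumes f: "integrable lborel f" and \<epsilon>: "0 < \<epsilon>"
  shows "pderiv_along i (mollify \<epsilon> f) (dmollify i \<epsilon> f)"
    and "\<exists>B. \<forall>x. norm (mollify \<epsilon> f x) \<le> B" and "\<exists>B. \<forall>x. norm (dmollify i \<epsilon> f x) \<le> B"
proof -
  let ?m = "bump_mass TYPE('n) \<epsilon>"
  have m: "0 < ?m" by (rule bump_mass_pos[OF \<epsilon>])
  have fm [measurable]: "f \<in> borel_measurable borel" using f by auto
  have b1: "norm (bump \<epsilon> z / ?m) \<le> 1 / ?m" for z :: "real^'n"
    using m by (simp add: bump_nonneg bump_le divide_right_mono)
  have b2: "norm (- dbump \<epsilon> i z / ?m) \<le> 4 * \<epsilon> / ?m" for z :: "real^'n"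
    using m \<epsilon> dbump_le[of \<epsilon> i z] by (simp add: divide_right_mono)
  have i1: "integrable lborel (\<lambda>y. of_real (bump \<epsilon> (y - x) / ?m) * f y)" for x
    by (rule kernel_integrable(1)[OF f _ b1]) measurable
  show "\<exists>B. \<forall>x. norm (mollify \<epsilon> f x) \<le> B"
    unfolding mollify_def by (intro exI allI, rule kernel_integrable(2)[OF f _ b1]) measurable
  show "\<exists>B. \<forall>x. norm (dmollify i \<epsilon> f x) \<le> B"
    unfolding dmollify_def by (intro exI allI, rule kernel_integrable(2)[OF f _ b2]) measurable
  show "pderiv_along i (mollify \<epsilon> f) (dmollify i \<epsilon> f)"
  proof (rule pderiv_along_seqI)
    fix x :: "real^'n" and h :: "nat \<Rightarrow> real" assume h: "\<And>k. h k \<noteq> 0" "h \<longlonglongrightarrow> 0"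
    define Q where "Q k y = (bump \<epsilon> (y - x + (- h k) *\<^sub>R axis i 1) - bump \<epsilon> (y - x)) / h k" for k y
    have "(\<lambda>k. LINT y|lborel. of_real (Q k y / ?m) * f y) \<longlonglongrightarrow> (LINT y|lborel. of_real (- dbump \<epsilon> i (y - x) / ?m) * f y)"
    proof (rule integral_dominated_convergence[where w = "\<lambda>y. 4 * \<epsilon> / ?m * norm (f y)"])
      show "(\<lambda>y. of_real (Q k y / ?m) * f y) \<in> borel_measurable lborel" for k
        unfolding Q_def by measurable
      show "AE y in lborel. (\<lambda>k. of_real (Q k y / ?m) * f y) \<longlonglongrightarrow> of_real (- dbump \<epsilon> i (y - x) / ?m) * f y"
      proof (rule AE_I2)
        fix y
        have "(\<lambda>k. (bump \<epsilon> ((y - x) + (- h k) *\<^sub>R axis i 1) - bump \<epsilon> (y - x)) /\<^sub>R (- h k)) \<longlonglongrightarrow> dbump \<epsilon> i (y - x)"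
          by (rule pderiv_along_seq[OF bump_pderiv]) (use h tendsto_minus[OF h(2)] in auto)
        from tendsto_minus[OF this] have "(\<lambda>k. Q k y) \<longlonglongrightarrow> - dbump \<epsilon> i (y - x)"
          by (simp add: Q_def divide_inverse mult.commute)
        then show "(\<lambda>k. of_real (Q k y / ?m) * f y) \<longlonglongrightarrow> of_real (- dbump \<epsilon> i (y - x) / ?m) * f y"
          using m by (intro tendsto_intros) auto
      qed
      show "AE y in lborel. norm (of_real (Q k y / ?m) * f y) \<le> 4 * \<epsilon> / ?m * norm (f y)" for k
      proof (rule AE_I2)
        fix y
        have "\<bar>bump \<epsilon> (y - x + (- h k) *\<^sub>R axis i 1) - bump \<epsilon> (y - x)\<bar> \<le> 4 * \<epsilon> * \<bar>h k\<bar>"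
          using pderiv_along_lipschitz[OF bump_pderiv, of \<epsilon> i "4 * \<epsilon>" "y - x" "- h k"] dbump_le[of \<epsilon> i] \<epsilon> by simp
        then have "\<bar>Q k y\<bar> \<le> 4 * \<epsilon>" using h(1)[of k] by (simp add: Q_def abs_divide divide_le_eq)
        then show "norm (of_real (Q k y / ?m) * f y) \<le> 4 * \<epsilon> / ?m * norm (f y)"
          using m by (simp add: norm_mult norm_divide mult_right_mono divide_right_mono)
      qed
    qed (use f in auto)
    moreover have "(LINT y|lborel. of_real (Q k y / ?m) * f y) = (mollify \<epsilon> f (x + h k *\<^sub>R axis i 1) - mollify \<epsilon> f x) /\<^sub>R h k" for k
    proof -
      have "mollify \<epsilon> f (x + h k *\<^sub>R axis i 1) - mollify \<epsilon> f x =
         (LINT y|lborel. of_real (bump \<epsilon> (y - (x + h k *\<^sub>R axis i 1)) / ?m) * f y - of_real (bump \<epsilon> (y - x) / ?m) * f y)"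
        unfolding mollify_def by (rule Bochner_Integration.integral_diff[OF i1 i1, symmetric])
      also have "\<dots> = (LINT y|lborel. h k *\<^sub>R (of_real (Q k y / ?m) * f y))"
        using h(1)[of k] by (intro Bochner_Integration.integral_cong)
          (auto simp: Q_def scaleR_conv_of_real diff_divide_distrib algebra_simps)
      also have "\<dots> = h k *\<^sub>R (LINT y|lborel. of_real (Q k y / ?m) * f y)" by (rule integral_scaleR_right)
      finally show ?thesis using h(1)[of k] by simp
    qed
    ultimately show "(\<lambda>k. (mollify \<epsilon> f (x + h k *\<^sub>R axis i 1) - mollify \<epsilon> f x) /\<^sub>R h k) \<longlonglongrightarrow> dmollify i \<epsilon> f x"
      by (simp add: dmollify_def)
  qed
qed

text \<open>The kernel has total mass one, so the error is an average of increments of \<open>f\<close>, and the power \<open>q\<close> may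
  be moved inside the average by convexity.\<close>

lemma mollify_minus_bound:
  fixes f :: "real^'n::finite \<Rightarrow> complex"
  assumes f: "integrable lborel f" and f2: "q = 1 \<or> q = 2 \<and> integrable lborel (\<lambda>x. (norm (f x))\<^sup>2)"
    and \<epsilon>: "0 < \<epsilon>"
  shows "ennreal (norm (mollify \<epsilon> f x - f x) ^ q) \<le>
     (\<integral>\<^sup>+ h. ennreal (bump \<epsilon> h / bump_mass TYPE('n) \<epsilon>) * ennreal (norm (f (h + x) - f x) ^ q) \<partial>lborel)"
proof -
  let ?m = "bump_mass TYPE('n) \<epsilon>"
  define \<kappa> where "\<kappa> h = bump \<epsilon> h / ?m" for h :: "real^'n"
  have m: "0 < ?m" by (rule bump_mass_pos[OF \<epsilon>])
  have fm [measurable]: "f \<in> borel_measurable borel" using f by auto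
  have [measurable]: "\<kappa> \<in> borel_measurable borel" unfolding \<kappa>_def[abs_def] by measurable
  have \<kappa>0: "0 \<le> \<kappa> h" for h using m by (simp add: \<kappa>_def bump_nonneg)
  have \<kappa>b: "norm (\<kappa> h) \<le> 1 / ?m" for h
    using m by (simp add: \<kappa>_def bump_nonneg bump_le divide_right_mono)
  have \<kappa>i: "integrable lborel \<kappa>" unfolding \<kappa>_def using \<epsilon> by (simp add: bump_integrable)
  have \<kappa>1: "(LINT h|lborel. \<kappa> h) = 1" using m by (simp add: \<kappa>_def bump_mass_def)
  have sh: "integrable lborel (\<lambda>h. f (h + x))"
    using integral_lborel_shift(2)[OF fm, of x] f by (simp add: add.commute)
  have i1: "integrable lborel (\<lambda>h. of_real (\<kappa> h) * f (h + x))"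
    by (rule kernel_integrable(1)[OF sh _ \<kappa>b]) measurable
  have i2: "integrable lborel (\<lambda>h. of_real (\<kappa> h) * f x)" using \<kappa>i by simp
  have "mollify \<epsilon> f x = (LINT h|lborel. of_real (\<kappa> h) * f (h + x))"
    using integral_lborel_shift(1)[of "\<lambda>y. of_real (\<kappa> (y - x)) * f y" x]
    by (auto simp: mollify_def \<kappa>_def add.commute)
  moreover have "f x = (LINT h|lborel. of_real (\<kappa> h) * f x)"
    using \<kappa>1 by (simp add: integral_complex_of_real)
  ultimately have "mollify \<epsilon> f x - f x = (LINT h|lborel. of_real (\<kappa> h) * f (h + x)) - (LINT h|lborel. of_real (\<kappa> h) * f x)"
    by simp
  also have "\<dots> = (LINT h|lborel. of_real (\<kappa> h) * (f (h + x) - f x))"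
    by (subst Bochner_Integration.integral_diff[OF i1 i2, symmetric]) (simp add: right_diff_distrib)
  finally have eq: "mollify \<epsilon> f x - f x = (LINT h|lborel. of_real (\<kappa> h) * (f (h + x) - f x))" .
  have i3: "integrable lborel (\<lambda>h. of_real (\<kappa> h) * (f (h + x) - f x))"
    using Bochner_Integration.integrable_diff[OF i1 i2] by (simp add: right_diff_distrib)
  define G where "G h = norm (f (h + x) - f x)" for h
  have [measurable]: "G \<in> borel_measurable borel" unfolding G_def[abs_def] by measurable
  have i4: "integrable lborel (\<lambda>h. \<kappa> h * G h)"
    using integrable_norm[OF i3] by (simp add: norm_mult \<kappa>0 G_def)
  have n1: "norm (mollify \<epsilon> f x - f x) \<le> (LINT h|lborel. \<kappa> h * G h)"
    unfolding eq using integral_norm_bound[of lborel "\<lambda>h. of_real (\<kappa> h) * (f (h + x) - f x)"]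
    by (simp add: norm_mult \<kappa>0 G_def)
  have main: "norm (mollify \<epsilon> f x - f x) ^ q \<le> (LINT h|lborel. \<kappa> h * G h ^ q) \<and> integrable lborel (\<lambda>h. \<kappa> h * G h ^ q)"
  proof (cases "q = 1")
    case True
    then show ?thesis using n1 i4 by simp
  next
    case False
    with f2 have q: "q = 2" and f2: "integrable lborel (\<lambda>x. (norm (f x))\<^sup>2)" by auto
    have sh2: "integrable lborel (\<lambda>h. (norm (f (h + x)))\<^sup>2)"
      using integral_lborel_shift(2)[of "\<lambda>x. (norm (f x))\<^sup>2" x] f2 by (simp add: add.commute)
    have dom: "integrable lborel (\<lambda>h. 2 / ?m * (norm (f (h + x)))\<^sup>2 + \<kappa> h * (2 * (norm (f x))\<^sup>2))"
      using sh2 \<kappa>i by simp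
    have i5: "integrable lborel (\<lambda>h. \<kappa> h * (G h)\<^sup>2)"
    proof (rule Bochner_Integration.integrable_bound[OF dom])
      show "AE h in lborel. norm (\<kappa> h * (G h)\<^sup>2) \<le> norm (2 / ?m * (norm (f (h + x)))\<^sup>2 + \<kappa> h * (2 * (norm (f x))\<^sup>2))"
      proof (rule AE_I2)
        fix h
        have "(G h)\<^sup>2 \<le> (norm (f (h + x)) + norm (f x))\<^sup>2"
          unfolding G_def by (intro power_mono norm_triangle_ineq4) auto
        also have "\<dots> \<le> 2 * (norm (f (h + x)))\<^sup>2 + 2 * (norm (f x))\<^sup>2"
          using sum_squares_bound[of "norm (f (h + x))" "norm (f x)"] by (simp add: power2_sum)
        finally have "\<kappa> h * (G h)\<^sup>2 \<le> \<kappa> h * (2 * (norm (f (h + x)))\<^sup>2) + \<kappa> h * (2 * (norm (f x))\<^sup>2)"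
          unfolding distrib_left[symmetric] by (rule mult_left_mono[OF _ \<kappa>0])
        also have "\<kappa> h * (2 * (norm (f (h + x)))\<^sup>2) \<le> 1 / ?m * (2 * (norm (f (h + x)))\<^sup>2)"
          using \<kappa>b[of h] \<kappa>0[of h] by (intro mult_right_mono) auto
        finally show "norm (\<kappa> h * (G h)\<^sup>2) \<le> norm (2 / ?m * (norm (f (h + x)))\<^sup>2 + \<kappa> h * (2 * (norm (f x))\<^sup>2))"
          using \<kappa>0[of h] by simp
      qed
    qed measurable
    define A where "A = (LINT h|lborel. \<kappa> h * G h)"
    \<comment> \<open>Jensen for the square: the variance of the increments under the kernel is nonnegative\<close>
    have "0 \<le> (LINT h|lborel. \<kappa> h * (G h - A)\<^sup>2)" using \<kappa>0 by simp
    also have "\<dots> = (LINT h|lborel. \<kappa> h * (G h)\<^sup>2 - 2 * A * (\<kappa> h * G h) + A\<^sup>2 * \<kappa> h)"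
      by (simp add: power2_eq_square algebra_simps)
    also have "\<dots> = (LINT h|lborel. \<kappa> h * (G h)\<^sup>2) - 2 * A * A + A\<^sup>2 * 1"
      using i4 i5 \<kappa>i \<kappa>1 by (simp add: A_def)
    finally have "A\<^sup>2 \<le> (LINT h|lborel. \<kappa> h * (G h)\<^sup>2)" by (simp add: power2_eq_square)
    moreover have "(norm (mollify \<epsilon> f x - f x))\<^sup>2 \<le> A\<^sup>2"
      using n1 unfolding A_def by (intro power_mono) auto
    ultimately show ?thesis using i5 q by simp
  qed
  then have "ennreal (norm (mollify \<epsilon> f x - f x) ^ q) \<le> ennreal (LINT h|lborel. \<kappa> h * G h ^ q)"
    by (simp add: ennreal_leI)
  also have "\<dots> = (\<integral>\<^sup>+ h. ennreal (\<kappa> h * G h ^ q) \<partial>lborel)"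
    by (rule nn_integral_eq_integral[symmetric]) (use main \<kappa>0 in \<open>auto simp: G_def\<close>)
  also have "\<dots> = (\<integral>\<^sup>+ h. ennreal (\<kappa> h) * ennreal (G h ^ q) \<partial>lborel)"
    by (intro nn_integral_cong ennreal_mult) (auto simp: \<kappa>0 G_def)
  finally show ?thesis by (simp add: \<kappa>_def G_def)
qed

text \<open>By Fubini the averaged increments are bounded by the translation modulus of \<open>f\<close> at lengths below \<open>\<epsilon>\<close>.\<close>

lemma mollify_converges:
  fixes f :: "real^'n::finite \<Rightarrow> complex"
  assumes f: "integrable lborel f" and f2: "q = 1 \<or> q = 2 \<and> integrable lborel (\<lambda>x. (norm (f x))\<^sup>2)"
    and \<delta>: "0 < \<delta>"
  shows "\<exists>d>0. \<forall>\<epsilon>. 0 < \<epsilon> \<and> \<epsilon> < d \<longrightarrow> (\<integral>\<^sup>+ x. ennreal (norm (mollify \<epsilon> f x - f x) ^ q) \<partial>lborel) \<le> ennreal \<delta>"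
proof -
  have "shift_continuous q f"
    using f2 shift_continuous_L1[OF f] shift_continuous_L2[OF f] by auto
  from shift_continuousD[OF this \<delta>]
  obtain d where d: "d > 0" "\<And>h. norm h < d \<Longrightarrow> shift_modulus q f h \<le> ennreal \<delta>" by auto
  have fm [measurable]: "f \<in> borel_measurable borel" using f by auto
  have "(\<integral>\<^sup>+ x. ennreal (norm (mollify \<epsilon> f x - f x) ^ q) \<partial>lborel) \<le> ennreal \<delta>" if \<epsilon>: "0 < \<epsilon>" "\<epsilon> < d" for \<epsilon>
  proof -
    define \<kappa> where "\<kappa> h = bump \<epsilon> h / bump_mass TYPE('n) \<epsilon>" for h :: "real^'n"
    have m: "0 < bump_mass TYPE('n) \<epsilon>" by (rule bump_mass_pos[OF \<epsilon>(1)])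
    have [measurable]: "\<kappa> \<in> borel_measurable borel" unfolding \<kappa>_def[abs_def] by measurable
    have \<kappa>0: "0 \<le> \<kappa> h" for h using m by (simp add: \<kappa>_def bump_nonneg)
    have \<kappa>i: "integrable lborel \<kappa>" unfolding \<kappa>_def using \<epsilon> by (simp add: bump_integrable)
    have \<kappa>1: "(LINT h|lborel. \<kappa> h) = 1" using m by (simp add: \<kappa>_def bump_mass_def)
    have "(\<integral>\<^sup>+ x. ennreal (norm (mollify \<epsilon> f x - f x) ^ q) \<partial>lborel)
        \<le> (\<integral>\<^sup>+ x. (\<integral>\<^sup>+ h. ennreal (\<kappa> h) * ennreal (norm (f (h + x) - f x) ^ q) \<partial>lborel) \<partial>lborel)"
      unfolding \<kappa>_def by (intro nn_integral_mono mollify_minus_bound[OF f f2 \<epsilon>(1)])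
    also have "\<dots> = (\<integral>\<^sup>+ h. (\<integral>\<^sup>+ x. ennreal (\<kappa> h) * ennreal (norm (f (h + x) - f x) ^ q) \<partial>lborel) \<partial>lborel)"
      by (rule lborel_pair.Fubini') measurable
    also have "\<dots> = (\<integral>\<^sup>+ h. ennreal (\<kappa> h) * shift_modulus q f h \<partial>lborel)"
      unfolding shift_modulus_def by (intro nn_integral_cong nn_integral_cmult) measurable
    also have "\<dots> \<le> (\<integral>\<^sup>+ h. ennreal (\<kappa> h) * ennreal \<delta> \<partial>lborel)"
    proof (rule nn_integral_mono)
      fix h :: "real^'n"
      show "ennreal (\<kappa> h) * shift_modulus q f h \<le> ennreal (\<kappa> h) * ennreal \<delta>"
      proof (cases "norm h < d")
        case True
        then show ?thesis by (intro mult_left_mono d(2)) auto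
      next
        case False
        then show ?thesis using \<epsilon> by (simp add: \<kappa>_def bump_eq_0)
      qed
    qed
    also have "\<dots> = (\<integral>\<^sup>+ h. ennreal (\<kappa> h) \<partial>lborel) * ennreal \<delta>"
      by (rule nn_integral_multc) measurable
    also have "(\<integral>\<^sup>+ h. ennreal (\<kappa> h) \<partial>lborel) = 1"
      using nn_integral_eq_integral[OF \<kappa>i] \<kappa>0 \<kappa>1 by simp
    finally show ?thesis by simp
  qed
  with d(1) show ?thesis by blast
qed

section \<open>Weak derivatives on the unit ball\<close>

abbreviation ballL :: "(real^'n::finite) measure" where
  "ballL \<equiv> lebesgue_on (ball 0 1)"

lemma cball_in_borel [measurable]: "cball c R \<in> sets borel"
  by simp

text \<open>Elements of the function spaces are Lebesgue measurable on the ball, whereas convolution and Fubini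
  work with Borel functions on the whole space; this and the next lemma translate between the two.\<close>

lemma borel_version:
  fixes f :: "real^'n::finite \<Rightarrow> complex"
  assumes f: "f \<in> borel_measurable ballL"
  shows "\<exists>f'\<in>borel_measurable borel. AE x in lborel. f' x = indicator (ball 0 1) x *\<^sub>R f x"
proof -
  have m: "(\<lambda>x. indicator (ball 0 1) x *\<^sub>R f x) \<in> borel_measurable lebesgue"
    using f by (subst (asm) borel_measurable_restrict_space_iff) auto
  have "(\<lambda>x. Re (indicator (ball 0 1) x *\<^sub>R f x)) \<in> borel_measurable (completion lborel)"
    "(\<lambda>x. Im (indicator (ball 0 1) x *\<^sub>R f x)) \<in> borel_measurable (completion lborel)"
    using m by measurable
  from this[THEN completion_ex_borel_measurable_real]
  obtain a b where a: "a \<in> borel_measurable lborel" "AE x in lborel. Re (indicator (ball 0 1) x *\<^sub>R f x) = a x"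
    and b: "b \<in> borel_measurable lborel" "AE x in lborel. Im (indicator (ball 0 1) x *\<^sub>R f x) = b x"
    by blast
  have "AE x in lborel. Complex (a x) (b x) = indicator (ball 0 1) x *\<^sub>R f x"
    using a(2) b(2) by eventually_elim (simp add: complex_eq_iff)
  moreover have "(\<lambda>x. Complex (a x) (b x)) \<in> borel_measurable borel"
    using a(1) b(1) by (subst borel_measurable_complex_iff) simp
  ultimately show ?thesis by (rule bexI)
qed

lemma ballL_integral:
  fixes h h' :: "real^'n::finite \<Rightarrow> 'b::{banach, second_countable_topology}"
  assumes h: "h \<in> borel_measurable ballL" and h': "h' \<in> borel_measurable borel"
    and eq: "AE x in lborel. h' x = indicator (ball 0 1) x *\<^sub>R h x"
  shows "(LINT x|ballL. h x) = (LINT x|lborel. h' x)" and "integrable ballL h \<longleftrightarrow> integrable lborel h'"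
proof -
  have m: "(\<lambda>x. indicator (ball 0 1) x *\<^sub>R h x) \<in> borel_measurable lebesgue"
    using h by (subst (asm) borel_measurable_restrict_space_iff) auto
  have h'': "h' \<in> borel_measurable lebesgue" using h' by (simp add: measurable_completion)
  have "(LINT x|ballL. h x) = (LINT x|lebesgue. indicator (ball 0 1) x *\<^sub>R h x)"
    by (rule integral_restrict_space) auto
  also have "\<dots> = (LINT x|lebesgue. h' x)"
    by (rule integral_cong_AE[OF m h'']) (use AE_completion[OF eq] in \<open>auto elim: eventually_mono\<close>)
  also have "\<dots> = (LINT x|lborel. h' x)" by (rule integral_completion) (use h' in simp)
  finally show "(LINT x|ballL. h x) = (LINT x|lborel. h' x)" .
  have "integrable ballL h \<longleftrightarrow> integrable lebesgue (\<lambda>x. indicator (ball 0 1) x *\<^sub>R h x)"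
    by (rule integrable_restrict_space) auto
  also have "\<dots> \<longleftrightarrow> integrable lebesgue h'"
    by (rule integrable_cong_AE[OF m h'']) (use AE_completion[OF eq] in \<open>auto elim: eventually_mono\<close>)
  also have "\<dots> \<longleftrightarrow> integrable lborel h'" by (rule integrable_completion) (use h' in simp)
  finally show "integrable ballL h \<longleftrightarrow> integrable lborel h'" .
qed

lemma ballL_borel: "f \<in> borel_measurable borel \<Longrightarrow> f \<in> borel_measurable ballL"
  by (rule measurable_restrict_space1) (simp add: measurable_completion)

lemma AE_ballL_iff: "(AE x in ballL. P x) \<longleftrightarrow> (AE x in lebesgue. x \<in> ball (0::real^'n::finite) 1 \<longrightarrow> P x)"
  by (rule AE_restrict_space_iff) auto

text \<open>A weak derivative tested only against translates of the standard bump.  This is implied by the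
  usual definition, and mollification shows that it is already strong enough.\<close>

definition weakp :: "'n::finite \<Rightarrow> (real^'n \<Rightarrow> complex) \<Rightarrow> (real^'n \<Rightarrow> complex) \<Rightarrow> bool" where
  "weakp i f w \<longleftrightarrow> f \<in> borel_measurable ballL \<and> w \<in> borel_measurable ballL \<and>
     (\<forall>x \<epsilon>. 0 < \<epsilon> \<longrightarrow> norm x + \<epsilon> < 1 \<longrightarrow>
        (LINT y|ballL. f y * of_real (dbump \<epsilon> i (y - x))) = - (LINT y|ballL. w y * of_real (bump \<epsilon> (y - x))))"

text \<open>Functions are controlled only on balls of radius \<open>R < 1\<close>, so every approximation statement is about
  such truncations.\<close>

abbreviation cut :: "real \<Rightarrow> (real^'n::finite \<Rightarrow> complex) \<Rightarrow> real^'n \<Rightarrow> complex" where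
  "cut R f \<equiv> (\<lambda>x. indicator (cball 0 R) x * f x)"

definition loc2 :: "(real^'n::finite \<Rightarrow> complex) \<Rightarrow> bool" where
  "loc2 f \<longleftrightarrow> f \<in> borel_measurable ballL \<and> (\<forall>R<1. cut R f \<in> square_integrable ballL)"

definition loc1 :: "(real^'n::finite \<Rightarrow> complex) \<Rightarrow> bool" where
  "loc1 f \<longleftrightarrow> f \<in> borel_measurable ballL \<and> (\<forall>R<1. integrable ballL (cut R f))"

lemma finite_measure_ballL: "finite_measure (ballL :: (real^'n::finite) measure)"
  by (rule finite_measure_lebesgue_on) auto

lemma square_integrable_ballL_integrable:
  assumes "f \<in> square_integrable (ballL :: (real^'n::finite) measure)"
  shows "integrable ballL f"
proof -
  interpret finite_measure "ballL :: (real^'n) measure" by (rule finite_measure_ballL)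
  have "(\<lambda>_. 1) \<in> square_integrable (ballL :: (real^'n) measure)"
    by (simp add: square_integrable_def)
  from integrable_prod[OF this assms] show ?thesis by simp
qed

lemma loc2_imp_loc1: "loc2 f \<Longrightarrow> loc1 f"
  by (simp add: loc1_def loc2_def square_integrable_ballL_integrable)

text \<open>A Borel function that agrees with \<open>f\<close> on the ball of radius \<open>R\<close> and vanishes outside.\<close>

lemma borel_cut:
  fixes f :: "real^'n::finite \<Rightarrow> complex"
  assumes f: "f \<in> borel_measurable ballL" and R: "R < 1"
  obtains f0 where "f0 \<in> borel_measurable borel" "AE x in lborel. f0 x = indicator (ball 0 1) x *\<^sub>R cut R f x"
proof -
  obtain f' where f': "f' \<in> borel_measurable borel" "AE x in lborel. f' x = indicator (ball 0 1) x *\<^sub>R f x"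
    using borel_version[OF f] by blast
  show ?thesis
  proof (rule that[of "cut R f'"])
    show "cut R f' \<in> borel_measurable borel" using f'(1) by measurable
    show "AE x in lborel. cut R f' x = indicator (ball 0 1) x *\<^sub>R cut R f x"
      using f'(2) by eventually_elim simp
  qed
qed

lemma cut_measurable [measurable]: "f \<in> borel_measurable ballL \<Longrightarrow> cut R f \<in> borel_measurable ballL"
proof -
  assume [measurable]: "f \<in> borel_measurable ballL"
  have [measurable]: "indicator (cball 0 R) \<in> borel_measurable (ballL :: (real^'a) measure)" by (rule ballL_borel) measurable
  show ?thesis by measurable
qed

lemma borel_cut_integral:
  fixes f f0 :: "real^'n::finite \<Rightarrow> complex"
  assumes f: "f \<in> borel_measurable ballL" and f0: "f0 \<in> borel_measurable borel"
    "AE x in lborel. f0 x = indicator (ball 0 1) x *\<^sub>R cut R f x"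
    and \<psi>: "\<psi> \<in> borel_measurable borel" "\<And>y. R < norm y \<Longrightarrow> \<psi> y = (0::real)"
  shows "(LINT y|lborel. of_real (\<psi> y) * f0 y) = (LINT y|ballL. f y * of_real (\<psi> y))"
proof (rule ballL_integral(1)[symmetric])
  have [measurable]: "\<psi> \<in> borel_measurable ballL" using \<psi>(1) by (rule ballL_borel)
  show "(\<lambda>y. f y * of_real (\<psi> y)) \<in> borel_measurable ballL" using f by measurable
  show "(\<lambda>y. of_real (\<psi> y) * f0 y) \<in> borel_measurable borel" using f0 \<psi> by measurable
  show "AE x in lborel. of_real (\<psi> x) * f0 x = indicator (ball 0 1) x *\<^sub>R (f x * of_real (\<psi> x))"
    using f0(2) by eventually_elim (use \<psi>(2) in \<open>auto simp: indicator_def\<close>)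
qed

lemma mollify_cut:
  fixes f f0 :: "real^'n::finite \<Rightarrow> complex"
  assumes f: "f \<in> borel_measurable ballL" and f0: "f0 \<in> borel_measurable borel"
    "AE x in lborel. f0 x = indicator (ball 0 1) x *\<^sub>R cut R f x"
    and \<epsilon>: "0 < \<epsilon>" "norm x + \<epsilon> \<le> R"
  shows "mollify \<epsilon> f0 x = (LINT y|ballL. f y * of_real (bump \<epsilon> (y - x))) / of_real (bump_mass TYPE('n) \<epsilon>)"
    and "dmollify i \<epsilon> f0 x = - (LINT y|ballL. f y * of_real (dbump \<epsilon> i (y - x))) / of_real (bump_mass TYPE('n) \<epsilon>)"
proof -
  have z: "\<epsilon> \<le> norm (y - x)" if "R < norm y" for y
    using norm_triangle_ineq2[of y x] that \<epsilon> by linarith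
  have "mollify \<epsilon> f0 x = (LINT y|ballL. f y * of_real (bump \<epsilon> (y - x) / bump_mass TYPE('n) \<epsilon>))"
    unfolding mollify_def by (rule borel_cut_integral[OF f f0]) (use z \<epsilon> in \<open>auto simp: bump_eq_0\<close>)
  then show "mollify \<epsilon> f0 x = (LINT y|ballL. f y * of_real (bump \<epsilon> (y - x))) / of_real (bump_mass TYPE('n) \<epsilon>)"
    by (simp add: times_divide_eq_right)
  have "dmollify i \<epsilon> f0 x = (LINT y|ballL. f y * of_real (- dbump \<epsilon> i (y - x) / bump_mass TYPE('n) \<epsilon>))"
    unfolding dmollify_def by (rule borel_cut_integral[OF f f0]) (use z \<epsilon> in \<open>auto simp: bump_eq_0\<close>)
  then show "dmollify i \<epsilon> f0 x = - (LINT y|ballL. f y * of_real (dbump \<epsilon> i (y - x))) / of_real (bump_mass TYPE('n) \<epsilon>)"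
    by (simp add: times_divide_eq_right)
qed

text \<open>The hypothesis says that all mollifications vanish away from the boundary sphere, and they converge
  in mean to the function.\<close>

lemma bump_orthogonal_imp_zero:
  fixes z :: "real^'n::finite \<Rightarrow> complex"
  assumes z: "loc1 z"
    and orth: "\<And>x \<epsilon>. 0 < \<epsilon> \<Longrightarrow> norm x + \<epsilon> < 1 \<Longrightarrow> (LINT y|ballL. z y * of_real (bump \<epsilon> (y - x))) = 0"
  shows "AE x in ballL. z x = 0"
proof -
  have zm: "z \<in> borel_measurable ballL" using z by (simp add: loc1_def)
  have loc: "AE x in lborel. norm x \<le> R \<longrightarrow> z x = 0" if R: "R < 1" for R
  proof -
    define R' where "R' = (R + 1) / 2"
    have R': "R < R'" "R' < 1" using R by (auto simp: R'_def)
    obtain z0 where z0: "z0 \<in> borel_measurable borel" "AE x in lborel. z0 x = indicator (ball 0 1) x *\<^sub>R cut R' z x"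
      by (rule borel_cut[OF zm R'(2)])
    note [measurable] = z0(1)
    have zi: "integrable lborel z0"
      using ballL_integral(2)[OF cut_measurable[OF zm] z0] z R' by (simp add: loc1_def)
    have small: "(\<integral>\<^sup>+ x. ennreal (norm (indicator (cball 0 R) x * z0 x)) \<partial>lborel) \<le> ennreal \<delta>" if \<delta>: "0 < \<delta>" for \<delta>
    proof -
      obtain d where d: "d > 0" "\<And>\<epsilon>. 0 < \<epsilon> \<Longrightarrow> \<epsilon> < d \<Longrightarrow>
          (\<integral>\<^sup>+ x. ennreal (norm (mollify \<epsilon> z0 x - z0 x) ^ 1) \<partial>lborel) \<le> ennreal \<delta>"
        using mollify_converges[OF zi _ \<delta>, of 1] by auto
      define \<epsilon> where "\<epsilon> = min (d/2) (R' - R)"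
      have \<epsilon>: "0 < \<epsilon>" "\<epsilon> < d" "\<epsilon> \<le> R' - R" using d R' by (auto simp: \<epsilon>_def min_def)
      have "ennreal (norm (indicator (cball 0 R) x * z0 x)) \<le> ennreal (norm (mollify \<epsilon> z0 x - z0 x) ^ 1)" for x
      proof (cases "norm x \<le> R")
        case True
        have "norm x + \<epsilon> \<le> R'" using True \<epsilon> by simp
        moreover from this have "norm x + \<epsilon> < 1" using R' by simp
        ultimately have "mollify \<epsilon> z0 x = 0"
          using mollify_cut(1)[OF zm z0 \<epsilon>(1)] orth[OF \<epsilon>(1)] by simp
        then show ?thesis using True by simp
      qed simp
      then have "(\<integral>\<^sup>+ x. ennreal (norm (indicator (cball 0 R) x * z0 x)) \<partial>lborel)
          \<le> (\<integral>\<^sup>+ x. ennreal (norm (mollify \<epsilon> z0 x - z0 x) ^ 1) \<partial>lborel)"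
        by (rule nn_integral_mono)
      also have "\<dots> \<le> ennreal \<delta>" by (rule d(2)[OF \<epsilon>(1,2)])
      finally show ?thesis .
    qed
    have "(\<integral>\<^sup>+ x. ennreal (norm (indicator (cball 0 R) x * z0 x)) \<partial>lborel) = 0"
      by (rule antisym, rule ennreal_le_epsilon) (use small in auto)
    then have "AE x in lborel. indicator (cball 0 R) x * z0 x = 0"
      by (subst (asm) nn_integral_0_iff_AE) auto
    with z0(2) show ?thesis
    proof eventually_elim
      case (elim x)
      then show ?case using R R' by (auto simp: indicator_def)
    qed
  qed
  have "AE x in lborel. \<forall>k::nat. norm x \<le> 1 - 1 / real (k + 2) \<longrightarrow> z x = 0"
    unfolding AE_all_countable by (intro allI loc) simp
  then have "AE x in lborel. x \<in> ball 0 1 \<longrightarrow> z x = 0"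
  proof eventually_elim
    case (elim x)
    show ?case
    proof
      assume "x \<in> ball 0 1"
      then have "0 < 1 - norm x" by simp
      then obtain k where "inverse (real (Suc k)) < 1 - norm x" using reals_Archimedean by blast
      moreover have "1 / real (k + 2) \<le> inverse (real (Suc k))" by (simp add: field_simps)
      ultimately have "norm x \<le> 1 - 1 / real (k + 2)" by linarith
      with elim show "z x = 0" by blast
    qed
  qed
  then show ?thesis unfolding AE_ballL_iff by (rule AE_completion)
qed

lemma cut_distance_le:
  fixes f f0 F :: "real^'n::finite \<Rightarrow> complex"
  assumes f: "loc2 f" and f0: "f0 \<in> borel_measurable borel"
    "AE x in lborel. f0 x = indicator (ball 0 1) x *\<^sub>R cut R' f x" and R: "R \<le> R'" "R' < 1"
    and F: "F \<in> borel_measurable borel" and le: "(\<integral>\<^sup>+ x. ennreal ((norm (F x - f0 x))\<^sup>2) \<partial>lborel) \<le> ennreal \<delta>" "0 \<le> \<delta>"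
  shows "cut R F \<in> square_integrable ballL" "(l2norm ballL (\<lambda>x. cut R F x - cut R f x))\<^sup>2 \<le> \<delta>"
proof -
  note [measurable] = f0(1) F
  have fm [measurable]: "f \<in> borel_measurable ballL" using f by (simp add: loc2_def)
  have Fm [measurable]: "F \<in> borel_measurable ballL" using F by (rule ballL_borel)
  define h' where "h' x = (norm (indicator (cball 0 R) x * (F x - f0 x) :: complex))\<^sup>2" for x
  have [measurable]: "h' \<in> borel_measurable borel" unfolding h'_def[abs_def] by measurable
  have n: "(\<integral>\<^sup>+ x. ennreal (h' x) \<partial>lborel) \<le> ennreal \<delta>"
    by (rule order_trans[OF nn_integral_mono le(1)]) (auto simp: h'_def indicator_def)
  then have hi: "integrable lborel h'"
    by (intro integrableI_bounded) (auto simp: h'_def[abs_def] intro: le_less_trans)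
  have hv: "(LINT x|lborel. h' x) \<le> \<delta>"
    using n le(2) nn_integral_eq_integral[OF hi] by (simp add: h'_def[abs_def])
  have dm: "(\<lambda>x. cut R F x - cut R f x) \<in> borel_measurable ballL"
    by (intro borel_measurable_diff cut_measurable) measurable
  have ae: "AE x in lborel. h' x = indicator (ball 0 1) x *\<^sub>R (norm (cut R F x - cut R f x))\<^sup>2"
    using f0(2) by eventually_elim (use R in \<open>auto simp: h'_def indicator_def\<close>)
  have e1: "(LINT x|ballL. (norm (cut R F x - cut R f x))\<^sup>2) = (LINT x|lborel. h' x)"
    and e2: "integrable ballL (\<lambda>x. (norm (cut R F x - cut R f x))\<^sup>2) \<longleftrightarrow> integrable lborel h'"
    by (rule ballL_integral[OF _ _ ae], use dm in measurable)+
  show "(l2norm ballL (\<lambda>x. cut R F x - cut R f x))\<^sup>2 \<le> \<delta>"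
    using e1 hv by (simp add: l2norm_power2)
  have "(\<lambda>x. cut R F x - cut R f x) \<in> square_integrable ballL"
    using e2 hi dm by (simp add: square_integrable_def)
  from square_integrable_add[OF this, of "cut R f"] f R
  show "cut R F \<in> square_integrable ballL" by (simp add: loc2_def)
qed

lemma loc2_borel_cut_integrable:
  fixes f f0 :: "real^'n::finite \<Rightarrow> complex"
  assumes f: "loc2 f" and f0: "f0 \<in> borel_measurable borel"
    "AE x in lborel. f0 x = indicator (ball 0 1) x *\<^sub>R cut R f x" and R: "R < 1"
  shows "integrable lborel f0" "integrable lborel (\<lambda>x. (norm (f0 x))\<^sup>2)"
proof -
  have fm: "f \<in> borel_measurable ballL" using f by (simp add: loc2_def)
  show "integrable lborel f0"
    using ballL_integral(2)[OF cut_measurable[OF fm] f0] f R loc2_imp_loc1 by (auto simp: loc1_def)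
  have ae: "AE x in lborel. (norm (f0 x))\<^sup>2 = indicator (ball 0 1) x *\<^sub>R (norm (cut R f x))\<^sup>2"
    using f0(2) by eventually_elim (auto simp: indicator_def)
  show "integrable lborel (\<lambda>x. (norm (f0 x))\<^sup>2)"
    using ballL_integral(2)[OF _ _ ae] f0(1) cut_measurable[OF fm] f R
    by (simp add: loc2_def square_integrable_def)
qed

text \<open>Mollification commutes with the weak derivative as long as the bump stays inside the ball.  One and
  the same mollified sequence thus approximates the function and its derivative on the smaller ball.\<close>

lemma smooth_approximation:
  fixes f w :: "real^'n::finite \<Rightarrow> complex"
  assumes f: "loc2 f" and w: "loc2 w" and fw: "weakp i f w" and R: "R < 1"
  obtains F F' where
    "\<And>k::nat. pderiv_along i (F k) (F' k)" "\<And>k. F k \<in> borel_measurable borel" "\<And>k. F' k \<in> borel_measurable borel"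
    "\<And>k. \<exists>B. \<forall>x. norm (F k x) \<le> B" "\<And>k. \<exists>B. \<forall>x. norm (F' k x) \<le> B"
    "l2_tendsto ballL sequentially (\<lambda>k. cut R (F k)) (cut R f)"
    "l2_tendsto ballL sequentially (\<lambda>k. cut R (F' k)) (cut R w)"
proof -
  define R' where "R' = (R + 1) / 2"
  have R': "R < R'" "R' < 1" using R by (auto simp: R'_def)
  have fm: "f \<in> borel_measurable ballL" and wm: "w \<in> borel_measurable ballL"
    using f w by (auto simp: loc2_def)
  obtain f0 where f0: "f0 \<in> borel_measurable borel" "AE x in lborel. f0 x = indicator (ball 0 1) x *\<^sub>R cut R' f x"
    by (rule borel_cut[OF fm R'(2)])
  obtain w0 where w0: "w0 \<in> borel_measurable borel" "AE x in lborel. w0 x = indicator (ball 0 1) x *\<^sub>R cut R' w x"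
    by (rule borel_cut[OF wm R'(2)])
  note fi = loc2_borel_cut_integrable[OF f f0 R'(2)] and wi = loc2_borel_cut_integrable[OF w w0 R'(2)]
  define \<epsilon> where "\<epsilon> k = (R' - R) * inverse (real (Suc k))" for k
  have \<epsilon>: "0 < \<epsilon> k" "\<epsilon> k \<le> R' - R" for k
  proof -
    show "0 < \<epsilon> k" using R' by (simp add: \<epsilon>_def)
    have "inverse (real (Suc k)) \<le> 1" by (simp add: field_simps)
    then have "(R' - R) * inverse (real (Suc k)) \<le> (R' - R) * 1" using R' by (intro mult_left_mono) auto
    then show "\<epsilon> k \<le> R' - R" by (simp add: \<epsilon>_def)
  qed
  have \<epsilon>0: "\<epsilon> \<longlonglongrightarrow> 0"
    unfolding \<epsilon>_def[abs_def] using tendsto_mult_left[OF LIMSEQ_inverse_real_of_nat, of "R' - R"] by simp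
  have conv: "l2_tendsto ballL sequentially (\<lambda>k. cut R (mollify (\<epsilon> k) g0)) (cut R g)"
    if g: "loc2 g" and g0: "g0 \<in> borel_measurable borel" "AE x in lborel. g0 x = indicator (ball 0 1) x *\<^sub>R cut R' g x" for g g0
  proof -
    note gi = loc2_borel_cut_integrable[OF g g0 R'(2)]
    have ev: "\<forall>\<^sub>F k in sequentially. cut R (mollify (\<epsilon> k) g0) \<in> square_integrable ballL \<and>
         (l2norm ballL (\<lambda>x. cut R (mollify (\<epsilon> k) g0) x - cut R g x))\<^sup>2 \<le> \<delta>" if \<delta>: "0 < \<delta>" for \<delta>
    proof -
      obtain d where d: "d > 0" "\<And>\<epsilon>. 0 < \<epsilon> \<Longrightarrow> \<epsilon> < d \<Longrightarrow>
          (\<integral>\<^sup>+ x. ennreal ((norm (mollify \<epsilon> g0 x - g0 x))\<^sup>2) \<partial>lborel) \<le> ennreal \<delta>"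
        using mollify_converges[OF gi(1) _ \<delta>, of 2] gi(2) by auto
      have "\<forall>\<^sub>F k in sequentially. \<epsilon> k < d" using order_tendstoD(2)[OF \<epsilon>0 d(1)] .
      then show ?thesis
      proof eventually_elim
        case (elim k)
        show ?case
          using cut_distance_le[OF g g0 less_imp_le[OF R'(1)] R'(2) _ d(2)[OF \<epsilon>(1) elim]] \<delta> g0(1)
          by simp
      qed
    qed
    have "((\<lambda>k. (l2norm ballL (\<lambda>x. cut R (mollify (\<epsilon> k) g0) x - cut R g x))\<^sup>2) \<longlongrightarrow> 0) sequentially"
    proof (rule LIMSEQ_I)
      fix r :: real assume "0 < r"
      then have "0 < r/2" by simp
      from ev[OF this] obtain K where "\<forall>k\<ge>K. (l2norm ballL (\<lambda>x. cut R (mollify (\<epsilon> k) g0) x - cut R g x))\<^sup>2 \<le> r/2"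
        by (auto simp: eventually_sequentially)
      then show "\<exists>no. \<forall>n\<ge>no. norm ((l2norm ballL (\<lambda>x. cut R (mollify (\<epsilon> n) g0) x - cut R g x))\<^sup>2 - 0) < r"
        using \<open>0 < r\<close> by (intro exI[of _ K]) (fastforce intro: le_less_trans)
    qed
    from tendsto_real_sqrt[OF this]
    have "((\<lambda>k. l2norm ballL (\<lambda>x. cut R (mollify (\<epsilon> k) g0) x - cut R g x)) \<longlongrightarrow> 0) sequentially"
      by (simp add: l2norm_nonneg)
    then show ?thesis using ev[of 1] g R by (auto simp: l2_tendsto_def loc2_def elim: eventually_mono)
  qed
  \<comment> \<open>the definition of the weak derivative, read as an identity between mollifications\<close>
  have dm: "cut R (dmollify i (\<epsilon> k) f0) = cut R (mollify (\<epsilon> k) w0)" for k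
  proof
    fix x
    show "cut R (dmollify i (\<epsilon> k) f0) x = cut R (mollify (\<epsilon> k) w0) x"
    proof (cases "norm x \<le> R")
      case True
      then have x: "norm x + \<epsilon> k \<le> R'" using \<epsilon>(2)[of k] by linarith
      with R' have "norm x + \<epsilon> k < 1" by linarith
      then have "(LINT y|ballL. f y * of_real (dbump (\<epsilon> k) i (y - x))) = - (LINT y|ballL. w y * of_real (bump (\<epsilon> k) (y - x)))"
        using fw \<epsilon>(1)[of k] by (simp add: weakp_def)
      then show ?thesis
        using mollify_cut(2)[OF fm f0 \<epsilon>(1) x, of i] mollify_cut(1)[OF wm w0 \<epsilon>(1) x] by simp
    qed simp
  qed
  show ?thesis
  proof (rule that[of "\<lambda>k. mollify (\<epsilon> k) f0" "\<lambda>k. dmollify i (\<epsilon> k) f0"])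
    show "l2_tendsto ballL sequentially (\<lambda>k. cut R (mollify (\<epsilon> k) f0)) (cut R f)" by (rule conv[OF f f0])
    show "l2_tendsto ballL sequentially (\<lambda>k. cut R (dmollify i (\<epsilon> k) f0)) (cut R w)"
      unfolding dm by (rule conv[OF w w0])
  qed (use mollify_pderiv[OF fi(1) \<epsilon>(1)] mollify_measurable[OF f0(1)] in auto)
qed

text \<open>For mollified factors the three terms add up to the integral of the derivative of a compactly supported
  function; each term is continuous under mean-square convergence.\<close>

lemma weak_product_rule:
  fixes f w g v :: "real^'n::finite \<Rightarrow> complex" and C dC :: "real^'n \<Rightarrow> real"
  assumes f: "loc2 f" "loc2 w" "weakp i f w" and g: "loc2 g" "loc2 v" "weakp i g v" and R: "R < 1"
    and C: "pderiv_along i C dC" "C \<in> borel_measurable borel" "dC \<in> borel_measurable borel"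
      "\<And>x. \<bar>C x\<bar> \<le> B" "\<And>x. \<bar>dC x\<bar> \<le> B'" "\<And>x. R < norm x \<Longrightarrow> C x = 0" "\<And>x. R < norm x \<Longrightarrow> dC x = 0"
  shows "l2inner ballL (\<lambda>x. of_real (dC x) * cut R f x) (cut R g)
      + l2inner ballL (\<lambda>x. of_real (C x) * cut R w x) (cut R g)
      + l2inner ballL (\<lambda>x. of_real (C x) * cut R f x) (cut R v) = 0"
proof -
  obtain F F' where F: "\<And>k::nat. pderiv_along i (F k) (F' k)" "\<And>k. F k \<in> borel_measurable borel" "\<And>k. F' k \<in> borel_measurable borel"
    "\<And>k. \<exists>B. \<forall>x. norm (F k x) \<le> B" "\<And>k. \<exists>B. \<forall>x. norm (F' k x) \<le> B"
    "l2_tendsto ballL sequentially (\<lambda>k. cut R (F k)) (cut R f)"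
    "l2_tendsto ballL sequentially (\<lambda>k. cut R (F' k)) (cut R w)"
    using smooth_approximation[OF f R] by blast
  obtain G G' where G: "\<And>k::nat. pderiv_along i (G k) (G' k)" "\<And>k. G k \<in> borel_measurable borel" "\<And>k. G' k \<in> borel_measurable borel"
    "\<And>k. \<exists>B. \<forall>x. norm (G k x) \<le> B" "\<And>k. \<exists>B. \<forall>x. norm (G' k x) \<le> B"
    "l2_tendsto ballL sequentially (\<lambda>k. cut R (G k)) (cut R g)"
    "l2_tendsto ballL sequentially (\<lambda>k. cut R (G' k)) (cut R v)"
    using smooth_approximation[OF g R] by blast
  have Cm: "(\<lambda>x. complex_of_real (C x)) \<in> borel_measurable ballL" "(\<lambda>x. complex_of_real (dC x)) \<in> borel_measurable ballL"
    using C(2,3) by (auto intro!: ballL_borel)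
  have Cb: "AE x in ballL. norm (complex_of_real (C x)) \<le> B" "AE x in ballL. norm (complex_of_real (dC x)) \<le> B'"
    using C(4,5) by auto
  have "(\<lambda>k. l2inner ballL (\<lambda>x. of_real (dC x) * cut R (F k) x) (cut R (G k))
      + l2inner ballL (\<lambda>x. of_real (C x) * cut R (F' k) x) (cut R (G k))
      + l2inner ballL (\<lambda>x. of_real (C x) * cut R (F k) x) (cut R (G' k)))
     \<longlonglongrightarrow> l2inner ballL (\<lambda>x. of_real (dC x) * cut R f x) (cut R g)
      + l2inner ballL (\<lambda>x. of_real (C x) * cut R w x) (cut R g)
      + l2inner ballL (\<lambda>x. of_real (C x) * cut R f x) (cut R v)"
    by (intro tendsto_add l2_tendsto_inner l2_tendsto_mult_bounded[OF F(6) Cm(2) Cb(2)]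
        l2_tendsto_mult_bounded[OF F(7) Cm(1) Cb(1)] l2_tendsto_mult_bounded[OF F(6) Cm(1) Cb(1)] G(6,7))
  moreover have "l2inner ballL (\<lambda>x. of_real (dC x) * cut R (F k) x) (cut R (G k))
      + l2inner ballL (\<lambda>x. of_real (C x) * cut R (F' k) x) (cut R (G k))
      + l2inner ballL (\<lambda>x. of_real (C x) * cut R (F k) x) (cut R (G' k)) = 0" for k
  proof -
    note [measurable] = F(2,3)[of k] G(2,3)[of k] C(2,3)
    obtain b1 b2 b3 b4 where b: "\<And>x. norm (F k x) \<le> b1" "\<And>x. norm (F' k x) \<le> b2" "\<And>x. norm (G k x) \<le> b3" "\<And>x. norm (G' k x) \<le> b4"
      using F(4,5)[of k] G(4,5)[of k] by metis
    have B0: "0 \<le> B" "0 \<le> B'" "0 \<le> b1" "0 \<le> b2" "0 \<le> b3" "0 \<le> b4"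
      using C(4,5)[of 0] b(1)[of 0] b(2)[of 0] b(3)[of 0] b(4)[of 0]
      by (meson abs_ge_zero norm_ge_zero order_trans)+
    define \<Phi> where "\<Phi> x = of_real (C x) * (F k x * cnj (G k x))" for x
    define d1 d2 d3 where "d1 x = of_real (dC x) * (F k x * cnj (G k x))"
      and "d2 x = of_real (C x) * (F' k x * cnj (G k x))" and "d3 x = of_real (C x) * (F k x * cnj (G' k x))" for x
    have mm [measurable]: "\<Phi> \<in> borel_measurable borel" "d1 \<in> borel_measurable borel" "d2 \<in> borel_measurable borel" "d3 \<in> borel_measurable borel"
      unfolding \<Phi>_def[abs_def] d1_def[abs_def] d2_def[abs_def] d3_def[abs_def] by measurable
    have "pderiv_along i \<Phi> (\<lambda>x. of_real (C x) * (F k x * cnj (G' k x) + F' k x * cnj (G k x)) + of_real (dC x) * (F k x * cnj (G k x)))"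
      unfolding \<Phi>_def
      by (intro pderiv_along_mult pderiv_along_bounded_linear[OF bounded_linear_of_real C(1)]
          F(1) pderiv_along_bounded_linear[OF bounded_linear_cnj G(1)])
    then have pd: "pderiv_along i \<Phi> (\<lambda>x. d1 x + d2 x + d3 x)"
      by (simp add: d1_def d2_def d3_def algebra_simps)
    have nb: "norm (of_real c * (p * cnj q)) \<le> b * (b' * b'')" if "\<bar>c\<bar> \<le> b" "norm p \<le> b'" "norm q \<le> b''" "0 \<le> b" "0 \<le> b'" for c p q b b' b''
      using that by (auto simp: norm_mult intro!: mult_mono)
    have n: "norm (d1 x) \<le> B' * (b1 * b3)" "norm (d2 x) \<le> B * (b2 * b3)" "norm (d3 x) \<le> B * (b1 * b4)" "norm (\<Phi> x) \<le> B * (b1 * b3)" for x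
      unfolding d1_def d2_def d3_def \<Phi>_def using C(4,5) b B0 by (auto intro!: nb)
    have z: "d1 x = 0" "d2 x = 0" "d3 x = 0" "\<Phi> x = 0" if "R < norm x" for x
      using C(6,7)[OF that] by (auto simp: d1_def d2_def d3_def \<Phi>_def)
    have ii: "integrable lborel d1" "integrable lborel d2" "integrable lborel d3" "integrable lborel \<Phi>"
      by (rule integrable_bounded_support[OF mm(2) n(1) z(1)] integrable_bounded_support[OF mm(3) n(2) z(2)]
          integrable_bounded_support[OF mm(4) n(3) z(3)] integrable_bounded_support[OF mm(1) n(4) z(4)], assumption)+
    have "(LINT x|lborel. d1 x + d2 x + d3 x) = 0"
    proof (rule integral_pderiv_along_eq_0[OF pd _ _ _ z(4) ii(4)])
      show "norm (d1 x + d2 x + d3 x) \<le> B' * (b1 * b3) + B * (b2 * b3) + B * (b1 * b4)" for x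
        using n[of x] by (smt (verit) norm_triangle_ineq)
    qed measurable
    then have s: "(LINT x|lborel. d1 x) + (LINT x|lborel. d2 x) + (LINT x|lborel. d3 x) = 0"
      using ii by simp
    have conv: "l2inner ballL (\<lambda>x. of_real (c x) * cut R p x) (cut R q) = (LINT x|lborel. of_real (c x) * (p x * cnj (q x)))"
      if "c \<in> borel_measurable borel" "p \<in> borel_measurable borel" "q \<in> borel_measurable borel" "\<And>x. R < norm x \<Longrightarrow> c x = 0" for c p q
      unfolding l2inner_def
    proof (rule ballL_integral(1))
      show "(\<lambda>x. of_real (c x) * cut R p x * cnj (cut R q x)) \<in> borel_measurable ballL"
        by (rule ballL_borel) (use that in measurable)
      show "AE x in lborel. of_real (c x) * (p x * cnj (q x)) = indicator (ball 0 1) x *\<^sub>R (of_real (c x) * cut R p x * cnj (cut R q x))"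
      proof (rule AE_I2)
        fix x
        show "of_real (c x) * (p x * cnj (q x)) = indicator (ball 0 1) x *\<^sub>R (of_real (c x) * cut R p x * cnj (cut R q x))"
          using that(4)[of x] R by (cases "norm x \<le> R") auto
      qed
    qed (use that in measurable)
    show ?thesis using s unfolding d1_def d2_def d3_def by (simp add: conv C)
  qed
  ultimately have "(\<lambda>k::nat. 0::complex) \<longlonglongrightarrow> l2inner ballL (\<lambda>x. of_real (dC x) * cut R f x) (cut R g)
      + l2inner ballL (\<lambda>x. of_real (C x) * cut R w x) (cut R g)
      + l2inner ballL (\<lambda>x. of_real (C x) * cut R f x) (cut R v)" by simp
  then show ?thesis by (simp add: LIMSEQ_const_iff)
qed

lemma loc2_cong:
  fixes f g :: "real^'n::finite \<Rightarrow> complex"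
  assumes "loc2 f" "\<And>x. norm x < 1 \<Longrightarrow> f x = g x" shows "loc2 g"
  unfolding loc2_def
proof (intro conjI allI impI)
  have "f \<in> borel_measurable ballL" using assms(1) by (simp add: loc2_def)
  then show "g \<in> borel_measurable ballL"
    by (rule measurable_cong[THEN iffD1, rotated]) (use assms(2) in simp)
  fix R :: real assume "R < 1"
  then have "cut R f \<in> square_integrable ballL" using assms(1) by (simp add: loc2_def)
  then show "cut R g \<in> square_integrable ballL" by (rule square_integrable_cong) (use assms(2) in simp)
qed

section \<open>Products, compositions and the boundary at infinity\<close>

text \<open>Coefficients live on the open ball only and may be singular at the boundary sphere, like the
  conformal factor.\<close>

definition coef_deriv :: "'n::finite \<Rightarrow> (real^'n \<Rightarrow> real) \<Rightarrow> (real^'n \<Rightarrow> real) \<Rightarrow> bool" where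
  "coef_deriv i c dc \<longleftrightarrow> continuous_on (ball 0 1) c \<and> continuous_on (ball 0 1) dc \<and>
     (\<forall>x\<in>ball 0 1. ((\<lambda>t. c (x + t *\<^sub>R axis i 1)) has_real_derivative dc x) (at 0))"

lemma coef_deriv_mult:
  assumes "coef_deriv i c dc" "coef_deriv i e de"
  shows "coef_deriv i (\<lambda>x. c x * e x) (\<lambda>x. c x * de x + dc x * e x)"
  unfolding coef_deriv_def
proof (intro conjI ballI)
  fix x :: "real^'a" assume x: "x \<in> ball 0 1"
  show "((\<lambda>t. c (x + t *\<^sub>R axis i 1) * e (x + t *\<^sub>R axis i 1)) has_real_derivative c x * de x + dc x * e x) (at 0)"
    using DERIV_mult[of "\<lambda>t. c (x + t *\<^sub>R axis i 1)" "dc x" 0 UNIV "\<lambda>t. e (x + t *\<^sub>R axis i 1)" "de x"] assms x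
    by (auto simp: coef_deriv_def add.commute mult.commute)
qed (use assms in \<open>auto simp: coef_deriv_def intro!: continuous_intros\<close>)

lemma continuous_compact_support:
  fixes h :: "real^'n::finite \<Rightarrow> real"
  assumes c: "continuous_on (ball 0 1) h" and R: "R < 1" and z: "\<And>x. R < norm x \<Longrightarrow> h x = 0"
  obtains B where "h \<in> borel_measurable borel" "\<And>x. \<bar>h x\<bar> \<le> B"
proof -
  have "(\<lambda>x. indicator (ball 0 1) x *\<^sub>R h x) \<in> borel_measurable borel"
    by (rule borel_measurable_continuous_on_indicator) (use c in auto)
  also have "(\<lambda>x. indicator (ball 0 1) x *\<^sub>R h x) = h"
    using z R by (fastforce simp: indicator_def)
  finally have m: "h \<in> borel_measurable borel" .
  have "continuous_on (cball 0 R) h"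
    by (rule continuous_on_subset[OF c]) (use R in auto)
  then have "bounded (h ` cball 0 R)"
    by (intro compact_imp_bounded compact_continuous_image) auto
  then obtain B where "\<forall>y\<in>h ` cball 0 R. norm y \<le> B" unfolding bounded_iff by blast
  then have B: "\<bar>h x\<bar> \<le> B" if "x \<in> cball 0 R" for x using that by auto
  have "\<bar>h x\<bar> \<le> max B 0" for x
    using B[of x] z[of x] by (cases "norm x \<le> R") auto
  with m show ?thesis by (rule that)
qed

text \<open>A cutoff factor turns such a coefficient into a bounded function on the whole space, the form needed
  for the product and chain rules.\<close>

lemma coef_deriv_compact_support:
  fixes C dC :: "real^'n::finite \<Rightarrow> real"
  assumes c: "coef_deriv i C dC" and R: "R < 1"
    and z: "\<And>x. R < norm x \<Longrightarrow> C x = 0" "\<And>x. R < norm x \<Longrightarrow> dC x = 0"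
  obtains B where "pderiv_along i C dC" "C \<in> borel_measurable borel" "dC \<in> borel_measurable borel"
      "\<And>x. \<bar>C x\<bar> \<le> B" "\<And>x. \<bar>dC x\<bar> \<le> B"
proof -
  obtain B1 where B1: "C \<in> borel_measurable borel" "\<And>x. \<bar>C x\<bar> \<le> B1"
    by (rule continuous_compact_support[of C, OF _ R z(1)]) (use c in \<open>auto simp: coef_deriv_def\<close>)
  obtain B2 where B2: "dC \<in> borel_measurable borel" "\<And>x. \<bar>dC x\<bar> \<le> B2"
    by (rule continuous_compact_support[of dC, OF _ R z(2)]) (use c in \<open>auto simp: coef_deriv_def\<close>)
  have "pderiv_along i C dC"
    unfolding pderiv_along_def
  proof
    fix x
    show "((\<lambda>t. C (x + t *\<^sub>R axis i 1)) has_vector_derivative dC x) (at 0)"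
    proof (cases "norm x < 1")
      case True
      then show ?thesis using c by (auto simp: coef_deriv_def has_real_derivative_iff_has_vector_derivative)
    next
      case False
      have "open ((\<lambda>t. x + t *\<^sub>R axis i 1) -` (- cball 0 R))"
        by (intro open_vimage continuous_intros) auto
      moreover have "0 \<in> (\<lambda>t. x + t *\<^sub>R axis i 1) -` (- cball 0 R)" using False R by simp
      moreover have "((\<lambda>_. 0) has_vector_derivative dC x) (at (0::real))" using z(2)[of x] False R by simp
      ultimately show ?thesis
        by (elim has_vector_derivative_transform_within_open) (use z(1) in auto)
    qed
  qed
  moreover have "\<bar>C x\<bar> \<le> max B1 B2" "\<bar>dC x\<bar> \<le> max B1 B2" for x
    using B1(2)[of x] B2(2)[of x] by (auto simp: le_max_iff_disj)
  ultimately show ?thesis using that B1(1) B2(1) by blast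
qed

text \<open>The conformal factor: the hyperbolic metric on the ball is \<open>(conf x)\<^sup>2\<close> times the Euclidean one.\<close>

definition conf :: "real^'n::finite \<Rightarrow> real" where
  "conf x = 2 / (1 - x \<bullet> x)"

text \<open>This equals \<open>2 ln (cosh (r/2))\<close>, where \<open>r\<close> is the hyperbolic distance to the origin, hence grows like
  \<open>r\<close> and has hyperbolic gradient of length at most 1.\<close>

definition logdist :: "real^'n::finite \<Rightarrow> real" where
  "logdist x = - ln (1 - x \<bullet> x)"

text \<open>Equal to 0 where \<open>logdist\<close> exceeds \<open>k + 1\<close>.  The square makes the function continuously
  differentiable in spite of the positive part.\<close>

definition cutoff :: "nat \<Rightarrow> real^'n::finite \<Rightarrow> real" where
  "cutoff k x = (if norm x < 1 then (max 0 (1 - logdist x / real (Suc k)))\<^sup>2 else 0)"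

definition dcutoff :: "nat \<Rightarrow> 'n \<Rightarrow> real^'n::finite \<Rightarrow> real" where
  "dcutoff k i x = (if norm x < 1 then - 2 * max 0 (1 - logdist x / real (Suc k)) * (conf x * x $ i) / real (Suc k) else 0)"

lemma one_minus_pos: "norm x < 1 \<Longrightarrow> 0 < 1 - x \<bullet> x"
  for x :: "'a::real_inner"
  using power_strict_mono[of "norm x" 1 2] by (simp add: power2_norm_eq_inner)

lemma logdist_nonneg: "norm x < 1 \<Longrightarrow> 0 \<le> logdist x"
  using one_minus_pos[of x] by (simp add: logdist_def ln_le_zero_iff)

definition cutoff_radius :: "nat \<Rightarrow> real" where
  "cutoff_radius k = sqrt (1 - exp (- real (Suc k)))"

lemma cutoff_radius: "cutoff_radius k < 1"
  by (simp add: cutoff_radius_def)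

lemma cutoff_zero:
  fixes x :: "real^'n::finite"
  assumes "cutoff_radius k < norm x"
  shows "cutoff k x = 0" "dcutoff k i x = 0"
proof -
  have "max 0 (1 - logdist x / real (Suc k)) = 0" if n: "norm x < 1"
  proof -
    have "(cutoff_radius k)\<^sup>2 < (norm x)\<^sup>2"
      by (rule power_strict_mono[OF assms]) (simp_all add: cutoff_radius_def)
    moreover have "(cutoff_radius k)\<^sup>2 = 1 - exp (- real (Suc k))" unfolding cutoff_radius_def by (rule real_sqrt_pow2) simp
    ultimately have "1 - x \<bullet> x < exp (- real (Suc k))" by (simp add: power2_norm_eq_inner)
    then have "ln (1 - x \<bullet> x) < - real (Suc k)"
      using one_minus_pos[OF n] by (metis ln_exp ln_less_cancel_iff exp_gt_zero)
    then have "real (Suc k) \<le> logdist x" by (simp add: logdist_def)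
    then have "1 \<le> logdist x / real (Suc k)" by (subst le_divide_eq) auto
    then show ?thesis by simp
  qed
  then show "cutoff k x = 0" "dcutoff k i x = 0" by (auto simp: cutoff_def dcutoff_def)
qed

lemma max_square_has_derivative: "((\<lambda>t::real. (max 0 t)\<^sup>2) has_real_derivative 2 * max 0 t) (at t)"
proof (cases t "0::real" rule: linorder_cases)
  case less
  have "((\<lambda>_. 0::real) has_real_derivative 0) (at t)" by simp
  then have "((\<lambda>t::real. (max 0 t)\<^sup>2) has_real_derivative 0) (at t)"
    by (rule has_field_derivative_transform_within_open[of _ _ _ "{..<0}"]) (use less in auto)
  then show ?thesis using less by simp
next
  case equal
  have "((\<lambda>h::real. \<bar>h\<bar>) \<longlongrightarrow> 0) (at 0)" using tendsto_rabs[OF tendsto_ident_at, of "0::real"] by simp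
  then have "((\<lambda>h::real. ((max 0 (0 + h))\<^sup>2 - (max 0 0)\<^sup>2) / h) \<longlongrightarrow> 0) (at 0)"
    by (rule Lim_null_comparison[rotated]) (auto intro!: always_eventually simp: max_def power2_eq_square)
  then show ?thesis using equal by (simp add: DERIV_def)
next
  case greater
  have "((\<lambda>t::real. t\<^sup>2) has_real_derivative 2 * t) (at t)" by (auto intro!: derivative_eq_intros)
  then have "((\<lambda>t::real. (max 0 t)\<^sup>2) has_real_derivative 2 * t) (at t)"
    by (rule has_field_derivative_transform_within_open[of _ _ _ "{0<..}"]) (use greater in auto)
  then show ?thesis using greater by simp
qed

lemma inner_along_deriv:
  fixes x :: "real^'n::finite"
  shows "((\<lambda>t. (x + t *\<^sub>R axis i 1) \<bullet> (x + t *\<^sub>R axis i 1)) has_real_derivative 2 * x $ i) (at 0)"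
  by (auto intro!: derivative_eq_intros simp: inner_axis inner_axis' inner_add_left inner_add_right inner_axis_axis)

lemma coord_along_deriv:
  fixes x :: "real^'n::finite"
  shows "((\<lambda>t. (x + t *\<^sub>R axis i 1) $ k) has_real_derivative (if i = k then 1 else 0)) (at 0)"
  by (auto intro!: derivative_eq_intros simp: axis_def)

lemma coef_deriv_radial:
  fixes i :: "'n::finite"
  assumes "\<And>s. 0 \<le> s \<Longrightarrow> s < 1 \<Longrightarrow> (\<phi> has_real_derivative \<phi>' s) (at s)" "continuous_on {0..<1} \<phi>'"
  shows "coef_deriv i (\<lambda>x. \<phi> (x \<bullet> x)) (\<lambda>x. 2 * x $ i * \<phi>' (x \<bullet> x))"
  unfolding coef_deriv_def
proof (intro conjI ballI)
  have r: "x \<bullet> x \<in> {0..<1}" if "x \<in> ball 0 1" for x :: "real^'n"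
    using one_minus_pos[of x] that by simp
  have c: "continuous_on {0..<1} \<phi>"
    by (rule continuous_at_imp_continuous_on) (auto intro!: DERIV_isCont assms(1))
  show "continuous_on (ball 0 1) (\<lambda>x::real^'n. \<phi> (x \<bullet> x))"
    by (rule continuous_on_compose2[OF c]) (use r in \<open>auto intro!: continuous_intros\<close>)
  show "continuous_on (ball 0 1) (\<lambda>x::real^'n. 2 * x $ i * \<phi>' (x \<bullet> x))"
    by (intro continuous_intros continuous_on_compose2[OF assms(2)]) (use r in \<open>auto intro!: continuous_intros\<close>)
  fix x :: "real^'n" assume "x \<in> ball 0 1"
  then have "(\<phi> has_real_derivative \<phi>' (x \<bullet> x)) (at (x \<bullet> x))" using r assms(1) by auto
  then have "(\<phi> has_real_derivative \<phi>' (x \<bullet> x)) (at ((x + 0 *\<^sub>R axis i 1) \<bullet> (x + 0 *\<^sub>R axis i 1)))" by simp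
  from DERIV_chain2[OF this inner_along_deriv]
  show "((\<lambda>t. \<phi> ((x + t *\<^sub>R axis i 1) \<bullet> (x + t *\<^sub>R axis i 1))) has_real_derivative 2 * x $ i * \<phi>' (x \<bullet> x)) (at 0)"
    by (simp add: mult.commute)
qed

lemma coef_deriv_radial_coord:
  fixes i k :: "'n::finite"
  assumes "\<And>s. 0 \<le> s \<Longrightarrow> s < 1 \<Longrightarrow> (\<phi> has_real_derivative \<phi>' s) (at s)" "continuous_on {0..<1} \<phi>'"
  shows "coef_deriv i (\<lambda>x. \<phi> (x \<bullet> x) * x $ k) (\<lambda>x. \<phi> (x \<bullet> x) * (if i = k then 1 else 0) + 2 * x $ i * \<phi>' (x \<bullet> x) * x $ k)"
proof (rule coef_deriv_mult[OF coef_deriv_radial[OF assms]])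
  show "coef_deriv i (\<lambda>x. x $ k) (\<lambda>x. if i = k then 1 else 0)"
    unfolding coef_deriv_def by (intro conjI ballI coord_along_deriv continuous_intros)
qed auto

lemma coef_deriv_cong:
  assumes "coef_deriv i c dc" "\<And>x. x \<in> ball 0 1 \<Longrightarrow> c x = c' x" "\<And>x. x \<in> ball 0 1 \<Longrightarrow> dc x = dc' x"
  shows "coef_deriv i c' dc'"
  unfolding coef_deriv_def
proof (intro conjI ballI)
  show "continuous_on (ball 0 1) c'" "continuous_on (ball 0 1) dc'"
    using assms continuous_on_cong[OF refl, of "ball 0 1" c c'] continuous_on_cong[OF refl, of "ball 0 1" dc dc']
    unfolding coef_deriv_def by blast+
  fix x :: "real^'a" assume x: "x \<in> ball 0 1"
  have o: "open ((\<lambda>t. x + t *\<^sub>R axis i 1) -` ball 0 1)"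
    by (intro open_vimage continuous_intros) auto
  have d: "((\<lambda>t. c (x + t *\<^sub>R axis i 1)) has_real_derivative dc x) (at 0)"
    using assms(1) x by (simp add: coef_deriv_def)
  show "((\<lambda>t. c' (x + t *\<^sub>R axis i 1)) has_real_derivative dc' x) (at 0)"
    using has_field_derivative_transform_within_open[OF d o] x assms(2) assms(3)[OF x] by simp
qed

lemma cutoff_coef: "coef_deriv i (cutoff k) (dcutoff k i :: real^'n::finite \<Rightarrow> real)"
proof (rule coef_deriv_cong[OF coef_deriv_radial])
  fix s :: real assume s: "0 \<le> s" "s < 1"
  have "((\<lambda>s. 1 + ln (1 - s) / real (Suc k)) has_real_derivative - (1 / (1 - s)) / real (Suc k)) (at s)"
  proof -
    have "((\<lambda>s. ln (1 - s)) has_real_derivative - (1 / (1 - s))) (at s)"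
      using s by (auto intro!: derivative_eq_intros)
    from DERIV_add[OF DERIV_const[of 1] DERIV_cdivide[OF this, of "real (Suc k)"]] show ?thesis by simp
  qed
  from DERIV_chain2[OF max_square_has_derivative this]
  show "((\<lambda>s. (max 0 (1 + ln (1 - s) / real (Suc k)))\<^sup>2) has_real_derivative
     2 * max 0 (1 + ln (1 - s) / real (Suc k)) * (- (1 / (1 - s)) / real (Suc k))) (at s)" .
next
  show "continuous_on {0..<1} (\<lambda>s. 2 * max 0 (1 + ln (1 - s) / real (Suc k)) * (- (1 / (1 - s)) / real (Suc k)))"
    by (intro continuous_intros) auto
qed (auto simp: cutoff_def dcutoff_def logdist_def conf_def)

lemma cutoff_bounds: "0 \<le> cutoff k x" "cutoff k x \<le> 1"
proof -
  have "0 \<le> max 0 (1 - logdist x / real (Suc k))" "max 0 (1 - logdist x / real (Suc k)) \<le> 1" if "norm x < 1"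
    using logdist_nonneg[OF that] by auto
  then show "0 \<le> cutoff k x" "cutoff k x \<le> 1" by (auto simp: cutoff_def power_le_one_iff simp del: max.bounded_iff intro!: power_le_one)
qed

lemma dcutoff_bound:
  fixes x :: "real^'n::finite"
  assumes "norm x < 1" shows "\<bar>dcutoff k i x\<bar> \<le> 2 * conf x / real (Suc k)"
proof -
  let ?m = "max 0 (1 - logdist x / real (Suc k))"
  have m: "0 \<le> ?m" "?m \<le> 1" using logdist_nonneg[OF assms] by auto
  have x: "\<bar>x $ i\<bar> \<le> 1" using component_le_norm_cart[of x i] assms by linarith
  have c: "0 \<le> conf x" using one_minus_pos[OF assms] by (simp add: conf_def)
  have "\<bar>dcutoff k i x\<bar> = 2 * (?m * (conf x * \<bar>x $ i\<bar>)) / real (Suc k)"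
    using assms c m by (simp add: dcutoff_def abs_mult)
  also have "\<dots> \<le> 2 * (1 * (conf x * 1)) / real (Suc k)"
    using m x c by (intro divide_right_mono mult_left_mono mult_mono) auto
  finally show ?thesis by simp
qed

lemma cutoff_tendsto: 
  assumes "norm x < 1" shows "(\<lambda>k. cutoff k x) \<longlonglongrightarrow> 1"
proof -
  have "(\<lambda>k. (max 0 (1 - logdist x * inverse (real (Suc k))))\<^sup>2) \<longlonglongrightarrow> (max 0 (1 - logdist x * 0))\<^sup>2"
    by (intro tendsto_intros LIMSEQ_inverse_real_of_nat)
  then show ?thesis using assms by (simp add: cutoff_def divide_inverse)
qed

text \<open>\<open>D\<close> is the weak \<open>i\<close>-th derivative of \<open>Z\<close>, tested against the cutoffs only: for the divergence theorem
  nothing else matters, and this form is stable under sums.\<close>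

definition wdiv :: "'n::finite \<Rightarrow> (real^'n \<Rightarrow> complex) \<Rightarrow> (real^'n \<Rightarrow> complex) \<Rightarrow> bool" where
  "wdiv i Z D \<longleftrightarrow> (\<forall>k. integrable ballL (\<lambda>x. of_real (cutoff k x) * D x) \<and>
      integrable ballL (\<lambda>x. of_real (dcutoff k i x) * Z x) \<and>
      (LINT x|ballL. of_real (cutoff k x) * D x) = - (LINT x|ballL. of_real (dcutoff k i x) * Z x))"

lemma wdiv_add: "wdiv i Z D \<Longrightarrow> wdiv i Z' D' \<Longrightarrow> wdiv i (\<lambda>x. Z x + Z' x) (\<lambda>x. D x + D' x)"
  by (simp add: wdiv_def distrib_left)

lemma wdiv_cmult: "wdiv i Z D \<Longrightarrow> wdiv i (\<lambda>x. c * Z x) (\<lambda>x. c * D x)"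
  by (simp add: wdiv_def mult.left_commute[of _ c])

lemma wdiv_zero: "wdiv i (\<lambda>x. 0) (\<lambda>x. 0)"
  by (simp add: wdiv_def)

lemma wdiv_sum: "(\<And>j. j \<in> J \<Longrightarrow> wdiv i (Z j) (D j)) \<Longrightarrow> wdiv i (\<lambda>x. \<Sum>j\<in>J. Z j x) (\<lambda>x. \<Sum>j\<in>J. D j x)"
  by (induction J rule: infinite_finite_induct) (auto intro!: wdiv_add wdiv_zero)

lemma cut_product_integral:
  fixes f g :: "real^'n::finite \<Rightarrow> complex"
  assumes "loc2 f" "loc2 g" "R < 1" "C \<in> borel_measurable borel" "\<And>x. \<bar>C x\<bar> \<le> B" "\<And>x. R < norm x \<Longrightarrow> C x = (0::real)"
  shows "integrable ballL (\<lambda>x. of_real (C x) * (f x * cnj (g x)))"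
    and "l2inner ballL (\<lambda>x. of_real (C x) * cut R f x) (cut R g) = (LINT x|ballL. of_real (C x) * (f x * cnj (g x)))"
proof -
  have Cm: "(\<lambda>x. complex_of_real (C x)) \<in> borel_measurable ballL" using assms(4) by (auto intro!: ballL_borel)
  have eq: "of_real (C x) * cut R f x * cnj (cut R g x) = of_real (C x) * (f x * cnj (g x))" for x
    using assms(6)[of x] by (cases "norm x \<le> R") auto
  have fR: "cut R f \<in> square_integrable ballL" "cut R g \<in> square_integrable ballL" using assms by (auto simp: loc2_def)
  have "(\<lambda>x. of_real (C x) * cut R f x) \<in> square_integrable ballL"
    by (rule square_integrable_bound[OF fR(1), of _ B])
      (use Cm fR assms(5) in \<open>auto simp: norm_mult square_integrable_def intro!: mult_right_mono\<close>)
  from integrable_prod_cnj[OF this fR(2)] show "integrable ballL (\<lambda>x. of_real (C x) * (f x * cnj (g x)))"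
    by (simp only: eq)
  show "l2inner ballL (\<lambda>x. of_real (C x) * cut R f x) (cut R g) = (LINT x|ballL. of_real (C x) * (f x * cnj (g x)))"
    unfolding l2inner_def eq ..
qed

text \<open>The weak product rule with the cutoff absorbed into the coefficient \<open>c\<close>.\<close>

lemma wdiv_product:
  fixes f w g v :: "real^'n::finite \<Rightarrow> complex"
  assumes f: "loc2 f" "loc2 w" "weakp i f w" and g: "loc2 g" "loc2 v" "weakp i g v" and c: "coef_deriv i c dc"
  shows "wdiv i (\<lambda>x. of_real (c x) * (f x * cnj (g x)))
     (\<lambda>x. of_real (dc x) * (f x * cnj (g x)) + of_real (c x) * (w x * cnj (g x)) + of_real (c x) * (f x * cnj (v x)))"
  unfolding wdiv_def
proof
  fix k
  define R where "R = cutoff_radius k"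
  have R: "R < 1" by (simp add: R_def cutoff_radius)
  define C dC C1 C2 where "C x = cutoff k x * c x" and "dC x = cutoff k x * dc x + dcutoff k i x * c x"
    and "C1 x = cutoff k x * dc x" and "C2 x = dcutoff k i x * c x" for x
  have z: "C x = 0" "dC x = 0" "C1 x = 0" "C2 x = 0" if "R < norm x" for x
    using cutoff_zero[of k x] that by (auto simp: C_def dC_def C1_def C2_def R_def)
  have cd: "coef_deriv i C dC" unfolding C_def dC_def by (rule coef_deriv_mult[OF cutoff_coef c])
  obtain B where B: "pderiv_along i C dC" "C \<in> borel_measurable borel" "dC \<in> borel_measurable borel"
      "\<And>x. \<bar>C x\<bar> \<le> B" "\<And>x. \<bar>dC x\<bar> \<le> B"
    by (rule coef_deriv_compact_support[OF cd R]) (erule z(1), erule z(2), rule that)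
  have cc: "continuous_on (ball 0 1) (cutoff k :: real^'n \<Rightarrow> real)" "continuous_on (ball 0 1) (dcutoff k i)" "continuous_on (ball 0 1) c" "continuous_on (ball 0 1) dc"
    using cutoff_coef[of i k] c by (auto simp: coef_deriv_def)
  obtain B1 where B1: "C1 \<in> borel_measurable borel" "\<And>x. \<bar>C1 x\<bar> \<le> B1"
    by (rule continuous_compact_support[of C1, OF _ R z(3)]) (use cc in \<open>auto simp: C1_def[abs_def] intro!: continuous_intros\<close>)
  obtain B2 where B2: "C2 \<in> borel_measurable borel" "\<And>x. \<bar>C2 x\<bar> \<le> B2"
    by (rule continuous_compact_support[of C2, OF _ R z(4)]) (use cc in \<open>auto simp: C2_def[abs_def] intro!: continuous_intros\<close>)
  note i1 = cut_product_integral[OF f(1) g(1) R B1 z(3)]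
    and i2 = cut_product_integral[OF f(1) g(1) R B2 z(4)]
    and i3 = cut_product_integral[OF f(2) g(1) R B(2,4) z(1)]
    and i4 = cut_product_integral[OF f(1) g(2) R B(2,4) z(1)]
    and i5 = cut_product_integral[OF f(1) g(1) R B(3,5) z(2)]
  have e1: "of_real (cutoff k x) * (of_real (dc x) * (f x * cnj (g x)) + of_real (c x) * (w x * cnj (g x)) + of_real (c x) * (f x * cnj (v x)))
     = of_real (C1 x) * (f x * cnj (g x)) + of_real (C x) * (w x * cnj (g x)) + of_real (C x) * (f x * cnj (v x))" for x
    by (simp add: C1_def C_def algebra_simps)
  have e2: "of_real (dcutoff k i x) * (of_real (c x) * (f x * cnj (g x))) = of_real (C2 x) * (f x * cnj (g x))" for x
    by (simp add: C2_def)
  have e3: "of_real (dC x) * (f x * cnj (g x)) = of_real (C1 x) * (f x * cnj (g x)) + of_real (C2 x) * (f x * cnj (g x))" for x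
    by (simp add: dC_def C1_def C2_def algebra_simps)
  have "(LINT x|ballL. of_real (dC x) * (f x * cnj (g x))) + (LINT x|ballL. of_real (C x) * (w x * cnj (g x)))
     + (LINT x|ballL. of_real (C x) * (f x * cnj (v x))) = 0"
    using weak_product_rule[OF f g R B z(1,2)] i3(2) i4(2) i5(2) by simp
  then have "(LINT x|ballL. of_real (C1 x) * (f x * cnj (g x))) + (LINT x|ballL. of_real (C2 x) * (f x * cnj (g x)))
     + (LINT x|ballL. of_real (C x) * (w x * cnj (g x))) + (LINT x|ballL. of_real (C x) * (f x * cnj (v x))) = 0"
    unfolding e3 using i1(1) i2(1) by simp
  then show "integrable ballL (\<lambda>x. of_real (cutoff k x) * (of_real (dc x) * (f x * cnj (g x)) + of_real (c x) * (w x * cnj (g x)) + of_real (c x) * (f x * cnj (v x)))) \<and>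
      integrable ballL (\<lambda>x. of_real (dcutoff k i x) * (of_real (c x) * (f x * cnj (g x)))) \<and>
      (LINT x|ballL. of_real (cutoff k x) * (of_real (dc x) * (f x * cnj (g x)) + of_real (c x) * (w x * cnj (g x)) + of_real (c x) * (f x * cnj (v x))))
       = - (LINT x|ballL. of_real (dcutoff k i x) * (of_real (c x) * (f x * cnj (g x))))"
    unfolding e1 e2 using i1(1) i2(1) i3(1) i4(1) by (simp add: eq_neg_iff_add_eq_0 algebra_simps)
qed

text \<open>Completeness of hyperbolic space enters here.  The Euclidean derivative of the \<open>k\<close>-th cutoff is bounded by
  a multiple of \<open>conf x / (k + 1)\<close>, so integrability of \<open>conf x\<close> times the flux is what makes the boundary terms
  disappear.\<close>

theorem wdiv_integral_zero:
  fixes Z D :: "'n::finite \<Rightarrow> real^'n \<Rightarrow> complex"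
  assumes w: "\<And>i. wdiv i (Z i) (D i)"
    and D: "integrable ballL (\<lambda>x. \<Sum>i\<in>UNIV. D i x)"
    and Z: "\<And>i. integrable ballL (\<lambda>x. of_real (conf x) * Z i x)"
  shows "(LINT x|ballL. (\<Sum>i\<in>UNIV. D i x)) = 0"
proof -
  let ?S = "\<lambda>x. \<Sum>i\<in>UNIV. D i x"
  have cm: "(\<lambda>x. complex_of_real (cutoff k x)) \<in> borel_measurable (ballL :: (real^'n) measure)" for k
  proof -
    obtain B where "cutoff k \<in> borel_measurable (borel :: (real^'n) measure)"
      by (rule coef_deriv_compact_support[OF cutoff_coef cutoff_radius cutoff_zero]) auto
    then have "(\<lambda>x. complex_of_real (cutoff k x)) \<in> borel_measurable (borel :: (real^'n) measure)" by measurable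
    then show ?thesis by (rule ballL_borel)
  qed
  have sp: "x \<in> space ballL \<Longrightarrow> norm x < 1" for x :: "real^'n" by simp
  have l1: "(\<lambda>k. LINT x|ballL. of_real (cutoff k x) * ?S x) \<longlonglongrightarrow> (LINT x|ballL. ?S x)"
  proof (rule integral_dominated_convergence[where w = "\<lambda>x. norm (?S x)"])
    show "AE x in ballL. (\<lambda>k. of_real (cutoff k x) * ?S x) \<longlonglongrightarrow> ?S x"
    proof (rule AE_I2)
      fix x :: "real^'n" assume "x \<in> space ballL"
      from tendsto_mult_right[OF tendsto_of_real[OF cutoff_tendsto[OF sp[OF this]]], of "?S x"]
      show "(\<lambda>k. of_real (cutoff k x) * ?S x) \<longlonglongrightarrow> ?S x" by simp
    qed
    show "AE x in ballL. norm (of_real (cutoff k x) * ?S x) \<le> norm (?S x)" for k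
      by (intro AE_I2) (simp add: norm_mult cutoff_bounds abs_of_nonneg mult_left_le_one_le)
  qed (use D cm in auto)
  have l2: "norm (LINT x|ballL. of_real (cutoff k x) * ?S x) \<le> (\<Sum>i\<in>UNIV. 2 * (LINT x|ballL. norm (of_real (conf x) * Z i x))) * inverse (real (Suc k))" for k
  proof -
    have "(LINT x|ballL. of_real (cutoff k x) * ?S x) = (\<Sum>i\<in>UNIV. LINT x|ballL. of_real (cutoff k x) * D i x)"
      using w by (simp add: sum_distrib_left wdiv_def)
    also have "\<dots> = (\<Sum>i\<in>UNIV. - (LINT x|ballL. of_real (dcutoff k i x) * Z i x))"
      using w by (simp add: wdiv_def)
    also have "norm \<dots> \<le> (\<Sum>i\<in>UNIV. norm (LINT x|ballL. of_real (dcutoff k i x) * Z i x))"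
      by (rule order_trans[OF norm_sum]) simp
    also have "\<dots> \<le> (\<Sum>i\<in>UNIV. 2 * (LINT x|ballL. norm (of_real (conf x) * Z i x)) * inverse (real (Suc k)))"
    proof (rule sum_mono)
      fix i
      have "norm (LINT x|ballL. of_real (dcutoff k i x) * Z i x) \<le> (LINT x|ballL. norm (of_real (dcutoff k i x) * Z i x))"
        by (rule integral_norm_bound)
      also have "\<dots> \<le> (LINT x|ballL. 2 * inverse (real (Suc k)) * norm (of_real (conf x) * Z i x))"
      proof (rule integral_mono)
        show "integrable ballL (\<lambda>x. norm (of_real (dcutoff k i x) * Z i x))"
          using w by (intro integrable_norm) (simp add: wdiv_def)
        show "integrable ballL (\<lambda>x. 2 * inverse (real (Suc k)) * norm (of_real (conf x) * Z i x))"
          using Z by (intro integrable_mult_right integrable_norm)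
        fix x :: "real^'n" assume "x \<in> space ballL"
        then have n: "norm x < 1" by (rule sp)
        have c: "0 \<le> conf x" using one_minus_pos[OF n] by (simp add: conf_def)
        have "norm (of_real (dcutoff k i x) * Z i x) \<le> 2 * conf x / real (Suc k) * norm (Z i x)"
          unfolding norm_mult using dcutoff_bound[OF n, of k i] by (intro mult_right_mono) auto
        then show "norm (of_real (dcutoff k i x) * Z i x) \<le> 2 * inverse (real (Suc k)) * norm (of_real (conf x) * Z i x)"
          using c by (simp add: norm_mult divide_inverse mult_ac)
      qed
      also have "\<dots> = 2 * (LINT x|ballL. norm (of_real (conf x) * Z i x)) * inverse (real (Suc k))"
        by simp
      finally show "norm (LINT x|ballL. of_real (dcutoff k i x) * Z i x) \<le> 2 * (LINT x|ballL. norm (of_real (conf x) * Z i x)) * inverse (real (Suc k))" .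
    qed
    finally show ?thesis by (simp add: sum_distrib_right)
  qed
  have "(\<lambda>k. LINT x|ballL. of_real (cutoff k x) * ?S x) \<longlonglongrightarrow> 0"
  proof (rule Lim_null_comparison[OF always_eventually])
    show "\<forall>k. norm (LINT x|ballL. of_real (cutoff k x) * ?S x) \<le> (\<Sum>i\<in>UNIV. 2 * (LINT x|ballL. norm (of_real (conf x) * Z i x))) * inverse (real (Suc k))"
      using l2 by blast
    show "(\<lambda>k. (\<Sum>i\<in>UNIV. 2 * (LINT x|ballL. norm (of_real (conf x) * Z i x))) * inverse (real (Suc k))) \<longlonglongrightarrow> 0"
      using tendsto_mult_left[OF LIMSEQ_inverse_real_of_nat, of "\<Sum>i\<in>UNIV. 2 * (LINT x|ballL. norm (of_real (conf x) * Z i x))"] by simp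
  qed
  with l1 show ?thesis using LIMSEQ_unique by blast
qed

text \<open>In this and the following lemmas \<open>N\<close> is the gradient of the real function \<open>G\<close> on the complex plane,
  that is \<open>dG(z) h = Re (cnj (N z) h)\<close>; the Lipschitz bound on \<open>N\<close> makes \<open>G\<close> grow at most quadratically.\<close>

lemma lipschitz_gradient_bound:
  fixes G :: "complex \<Rightarrow> real" and N :: "complex \<Rightarrow> complex"
  assumes G: "\<And>z. (G has_derivative (\<lambda>h. Re (cnj (N z) * h))) (at z)"
    and N: "\<And>z z'. norm (N z - N z') \<le> L * norm (z - z')" "N 0 = 0"
  shows "\<bar>G z - G z'\<bar> \<le> L * (norm z + norm z') * norm (z - z')"
proof -
  have L: "0 \<le> L" using order_trans[OF norm_ge_zero N(1)[of 1 0]] by simp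
  have "norm (G z - G z') \<le> (L * (norm z + norm z')) * norm (z - z')"
  proof (rule differentiable_bound[where S = "closed_segment z z'"])
    show "convex (closed_segment z z')" by simp
    show "(G has_derivative (\<lambda>h. Re (cnj (N y) * h))) (at y within closed_segment z z')" for y
      by (rule has_derivative_at_withinI[OF G])
    fix y assume "y \<in> closed_segment z z'"
    then obtain t where t: "0 \<le> t" "t \<le> 1" "y = (1 - t) *\<^sub>R z + t *\<^sub>R z'" by (auto simp: closed_segment_def)
    have "norm y \<le> (1 - t) * norm z + t * norm z'"
      unfolding t(3) by (rule norm_triangle_le) (use t in simp)
    also have "\<dots> \<le> norm z + norm z'"
      using t by (intro add_mono) (auto simp: mult_left_le_one_le)
    finally have y: "norm y \<le> norm z + norm z'" .
    have "norm (N y) \<le> L * norm y" using N(1)[of y 0] N(2) by simp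
    also have "\<dots> \<le> L * (norm z + norm z')" by (intro mult_left_mono y L)
    finally have "norm (N y) \<le> L * (norm z + norm z')" .
    then show "onorm (\<lambda>h. Re (cnj (N y) * h)) \<le> L * (norm z + norm z')"
      by (intro onorm_le) (metis abs_Re_le_cmod complex_mod_cnj mult_right_mono norm_ge_zero norm_mult order_trans real_norm_def)
  qed auto
  then show ?thesis by simp
qed

lemma l2_tendsto_lipschitz:
  assumes f: "l2_tendsto M F f f0" and N: "\<And>z z'. norm (N z - N z') \<le> L * norm (z - z')" "N 0 = 0"
  shows "l2_tendsto M F (\<lambda>k x. N (f k x)) (\<lambda>x. N (f0 x))"
proof -
  have L: "0 \<le> L" using order_trans[OF norm_ge_zero N(1)[of 1 0]] by simp
  have "continuous_on UNIV N"
    by (rule lipschitz_on_continuous_on[of L]) (use N L in \<open>auto simp: lipschitz_on_def dist_norm\<close>)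
  then have [measurable]: "N \<in> borel_measurable borel" by (rule borel_measurable_continuous_onI)
  have N0: "norm (N z) \<le> L * norm z" for z using N(1)[of z 0] N(2) by simp
  have sq: "(\<lambda>x. N (g x)) \<in> square_integrable M" if "g \<in> square_integrable M" for g
    by (rule square_integrable_bound[OF that, of _ L]) (use square_integrableD(1)[OF that] N0 in auto)
  have f0: "f0 \<in> square_integrable M" and ev: "\<forall>\<^sub>F k in F. f k \<in> square_integrable M"
    and lim: "((\<lambda>s. l2norm M (\<lambda>x. f s x - f0 x)) \<longlongrightarrow> 0) F"
    using f by (auto simp: l2_tendsto_def)
  have "((\<lambda>k. l2norm M (\<lambda>x. N (f k x) - N (f0 x))) \<longlongrightarrow> 0) F"
  proof (rule Lim_null_comparison)
    show "((\<lambda>s. L * l2norm M (\<lambda>x. f s x - f0 x)) \<longlongrightarrow> 0) F"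
      using tendsto_mult_left[OF lim, of L] by simp
    show "\<forall>\<^sub>F k in F. norm (l2norm M (\<lambda>x. N (f k x) - N (f0 x))) \<le> L * l2norm M (\<lambda>x. f k x - f0 x)"
      using ev
    proof eventually_elim
      case (elim k)
      have "(l2norm M (\<lambda>x. N (f k x) - N (f0 x)))\<^sup>2 \<le> (LINT x|M. L\<^sup>2 * (norm (f k x - f0 x))\<^sup>2)"
        unfolding l2norm_power2
      proof (rule integral_mono)
        show "integrable M (\<lambda>x. (norm (N (f k x) - N (f0 x)))\<^sup>2)"
          by (rule square_integrableD(2)[OF square_integrable_diff[OF sq[OF elim] sq[OF f0]]])
        show "integrable M (\<lambda>x. L\<^sup>2 * (norm (f k x - f0 x))\<^sup>2)"
          by (intro integrable_mult_right square_integrableD(2)[OF square_integrable_diff[OF elim f0]])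
        show "(norm (N (f k x) - N (f0 x)))\<^sup>2 \<le> L\<^sup>2 * (norm (f k x - f0 x))\<^sup>2" for x
          using power_mono[OF N(1)[of "f k x" "f0 x"] norm_ge_zero, of 2] by (simp add: power_mult_distrib)
      qed
      also have "\<dots> = (L * l2norm M (\<lambda>x. f k x - f0 x))\<^sup>2" by (simp add: l2norm_power2 power_mult_distrib)
      finally have "(l2norm M (\<lambda>x. N (f k x) - N (f0 x)))\<^sup>2 \<le> (L * l2norm M (\<lambda>x. f k x - f0 x))\<^sup>2" .
      then have "l2norm M (\<lambda>x. N (f k x) - N (f0 x)) \<le> L * l2norm M (\<lambda>x. f k x - f0 x)"
        by (rule power2_le_imp_le) (intro mult_nonneg_nonneg L l2norm_nonneg)
      then show ?case using l2norm_nonneg[of M "\<lambda>x. N (f k x) - N (f0 x)"] by simp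
    qed
  qed
  then show ?thesis using sq f0 ev by (auto simp: l2_tendsto_def elim: eventually_mono)
qed

lemma l2_tendsto_potential:
  fixes G :: "complex \<Rightarrow> real" and N :: "complex \<Rightarrow> complex"
  assumes G: "\<And>z. (G has_derivative (\<lambda>h. Re (cnj (N z) * h))) (at z)" "G 0 = 0"
    and N: "\<And>z z'. norm (N z - N z') \<le> L * norm (z - z')" "N 0 = 0"
    and f: "l2_tendsto M F f f0"
    and c: "c \<in> borel_measurable M" "\<And>x. \<bar>c x\<bar> \<le> B"
  shows "((\<lambda>k. LINT x|M. c x * G (f k x)) \<longlongrightarrow> (LINT x|M. c x * G (f0 x))) F"
    and "g \<in> square_integrable M \<Longrightarrow> integrable M (\<lambda>x. c x * G (g x))"
proof -
  have L: "0 \<le> L" using order_trans[OF norm_ge_zero N(1)[of 1 0]] by simp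
  have B: "0 \<le> B" using c(2)[of undefined] by linarith
  have "continuous_on UNIV G"
    using G(1) by (meson continuous_at_imp_continuous_on has_derivative_continuous)
  then have [measurable]: "G \<in> borel_measurable borel" by (rule borel_measurable_continuous_onI)
  note [measurable] = c(1)
  note lg = lipschitz_gradient_bound[OF G(1) N]
  have int: "integrable M (\<lambda>x. c x * G (g x))" if g: "g \<in> square_integrable M" for g
  proof (rule Bochner_Integration.integrable_bound)
    note [measurable] = square_integrableD(1)[OF g]
    show "integrable M (\<lambda>x. B * (L * (norm (g x))\<^sup>2))"
      using square_integrableD(2)[OF g] by (intro integrable_mult_right)
    show "(\<lambda>x. c x * G (g x)) \<in> borel_measurable M" by measurable
    have "\<bar>c x * G (g x)\<bar> \<le> B * (L * (norm (g x))\<^sup>2)" for x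
    proof -
      have "\<bar>G (g x)\<bar> \<le> L * (norm (g x))\<^sup>2"
        using lg[of "g x" 0] G(2) by (simp add: power2_eq_square mult.assoc)
      then show ?thesis unfolding abs_mult by (intro mult_mono c(2) B) auto
    qed
    then show "AE x in M. norm (c x * G (g x)) \<le> norm (B * (L * (norm (g x))\<^sup>2))"
      by (intro AE_I2) (auto intro: order_trans[OF _ abs_ge_self])
  qed
  show "g \<in> square_integrable M \<Longrightarrow> integrable M (\<lambda>x. c x * G (g x))" by (rule int)
  have f0: "f0 \<in> square_integrable M" and ev: "\<forall>\<^sub>F k in F. f k \<in> square_integrable M"
    and lim: "((\<lambda>s. l2norm M (\<lambda>x. f s x - f0 x)) \<longlongrightarrow> 0) F"
    using f by (auto simp: l2_tendsto_def)
  have "((\<lambda>k. (LINT x|M. c x * G (f k x)) - (LINT x|M. c x * G (f0 x))) \<longlongrightarrow> 0) F"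
  proof (rule Lim_null_comparison)
    let ?d = "\<lambda>s. l2norm M (\<lambda>x. f s x - f0 x)"
    have "((\<lambda>s. B * L * ((?d s + 2 * l2norm M f0) * ?d s)) \<longlongrightarrow> B * L * ((0 + 2 * l2norm M f0) * 0)) F"
      by (intro tendsto_intros lim)
    then show "((\<lambda>s. B * L * ((?d s + 2 * l2norm M f0) * ?d s)) \<longlongrightarrow> 0) F" by simp
    show "\<forall>\<^sub>F k in F. norm ((LINT x|M. c x * G (f k x)) - (LINT x|M. c x * G (f0 x))) \<le> B * L * ((?d k + 2 * l2norm M f0) * ?d k)"
      using ev
    proof eventually_elim
      case (elim k)
      have dsq: "(\<lambda>x. f k x - f0 x) \<in> square_integrable M" by (rule square_integrable_diff[OF elim f0])
      define S where "S x = complex_of_real (norm (f k x) + norm (f0 x))" for x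
      have S: "S \<in> square_integrable M"
      proof -
        have 1: "(\<lambda>x. complex_of_real (norm (g x))) \<in> square_integrable M" if "g \<in> square_integrable M" for g
          using that by (auto simp: square_integrable_def)
        show ?thesis unfolding S_def[abs_def] of_real_add by (intro square_integrable_add 1 elim f0)
      qed
      have Sn: "l2norm M S \<le> ?d k + 2 * l2norm M f0"
      proof -
        have 1: "(\<lambda>x. complex_of_real (norm (g x))) \<in> square_integrable M \<and> l2norm M (\<lambda>x. complex_of_real (norm (g x))) = l2norm M g" if "g \<in> square_integrable M" for g
          using that by (auto simp: square_integrable_def l2norm_def)
        have "l2norm M S \<le> l2norm M (f k) + l2norm M f0"
          unfolding S_def[abs_def] of_real_add using l2norm_triangle[OF conjunct1[OF 1[OF elim]] conjunct1[OF 1[OF f0]]] 1[OF elim] 1[OF f0] by simp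
        moreover have "l2norm M (f k) \<le> ?d k + l2norm M f0"
          using l2norm_triangle[OF dsq f0] by simp
        ultimately show ?thesis by simp
      qed
      have "norm ((LINT x|M. c x * G (f k x)) - (LINT x|M. c x * G (f0 x))) = norm (LINT x|M. c x * G (f k x) - c x * G (f0 x))"
        using int[OF elim] int[OF f0] by simp
      also have "\<dots> \<le> (LINT x|M. norm (c x * G (f k x) - c x * G (f0 x)))"
        by (rule integral_norm_bound)
      also have "\<dots> \<le> (LINT x|M. B * L * norm (S x * (f k x - f0 x)))"
      proof (rule integral_mono)
        show "integrable M (\<lambda>x. norm (c x * G (f k x) - c x * G (f0 x)))"
          using int[OF elim] int[OF f0] by simp
        show "integrable M (\<lambda>x. B * L * norm (S x * (f k x - f0 x)))"
          by (intro integrable_mult_right integrable_norm integrable_prod S dsq)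
        fix x
        have "norm (c x * G (f k x) - c x * G (f0 x)) = \<bar>c x\<bar> * \<bar>G (f k x) - G (f0 x)\<bar>"
          by (simp add: abs_mult flip: right_diff_distrib)
        also have "\<dots> \<le> B * (L * (norm (f k x) + norm (f0 x)) * norm (f k x - f0 x))"
          by (intro mult_mono c(2) lg B) auto
        also have "\<dots> = B * L * norm (S x * (f k x - f0 x))"
          unfolding S_def norm_mult norm_of_real by simp
        finally show "norm (c x * G (f k x) - c x * G (f0 x)) \<le> B * L * norm (S x * (f k x - f0 x))" .
      qed
      also have "\<dots> = B * L * (LINT x|M. norm (S x * (f k x - f0 x)))" by simp
      also have "\<dots> \<le> B * L * (l2norm M S * ?d k)"
        by (intro mult_left_mono integral_norm_prod_le S dsq) (use B L in simp)
      also have "\<dots> \<le> B * L * ((?d k + 2 * l2norm M f0) * ?d k)"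
        by (intro mult_left_mono mult_right_mono Sn l2norm_nonneg) (use B L in simp)
      finally show ?case .
    qed
  qed
  then show "((\<lambda>k. LINT x|M. c x * G (f k x)) \<longlongrightarrow> (LINT x|M. c x * G (f0 x))) F"
    by (simp add: LIM_zero_iff)
qed

text \<open>As for the product rule, through mollified functions; the quadratic bound on \<open>G\<close> and the linear
  bound on its gradient allow the passage to the limit in mean square.\<close>

lemma weak_chain_rule:
  fixes f w :: "real^'n::finite \<Rightarrow> complex" and C dC :: "real^'n \<Rightarrow> real"
    and G :: "complex \<Rightarrow> real" and N :: "complex \<Rightarrow> complex"
  assumes G: "\<And>z. (G has_derivative (\<lambda>h. Re (cnj (N z) * h))) (at z)" "G 0 = 0"
    and N: "\<And>z z'. norm (N z - N z') \<le> L * norm (z - z')" "N 0 = 0"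
    and f: "loc2 f" "loc2 w" "weakp i f w" and R: "R < 1"
    and C: "pderiv_along i C dC" "C \<in> borel_measurable borel" "dC \<in> borel_measurable borel"
      "\<And>x. \<bar>C x\<bar> \<le> B" "\<And>x. \<bar>dC x\<bar> \<le> B'" "\<And>x. R < norm x \<Longrightarrow> C x = 0" "\<And>x. R < norm x \<Longrightarrow> dC x = 0"
  shows "(LINT x|ballL. dC x * G (cut R f x))
      + Re (l2inner ballL (\<lambda>x. of_real (C x) * cut R w x) (\<lambda>x. N (cut R f x))) = 0"
proof -
  obtain F F' where F: "\<And>k::nat. pderiv_along i (F k) (F' k)" "\<And>k. F k \<in> borel_measurable borel" "\<And>k. F' k \<in> borel_measurable borel"
    "\<And>k. \<exists>B. \<forall>x. norm (F k x) \<le> B" "\<And>k. \<exists>B. \<forall>x. norm (F' k x) \<le> B"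
    "l2_tendsto ballL sequentially (\<lambda>k. cut R (F k)) (cut R f)"
    "l2_tendsto ballL sequentially (\<lambda>k. cut R (F' k)) (cut R w)"
    using smooth_approximation[OF f R] by blast
  have cG: "continuous_on UNIV G"
    using G(1) by (meson continuous_at_imp_continuous_on has_derivative_continuous)
  have L: "0 \<le> L" using order_trans[OF norm_ge_zero N(1)[of 1 0]] by simp
  have cN: "continuous_on UNIV N"
    by (rule lipschitz_on_continuous_on[of L]) (use N L in \<open>auto simp: lipschitz_on_def dist_norm\<close>)
  have [measurable]: "G \<in> borel_measurable borel" "N \<in> borel_measurable borel"
    using cG cN by (auto intro: borel_measurable_continuous_onI)
  have Cm: "(\<lambda>x. complex_of_real (C x)) \<in> borel_measurable ballL" "dC \<in> borel_measurable ballL"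
    using C(2,3) by (auto intro!: ballL_borel)
  have Cb: "AE x in ballL. norm (complex_of_real (C x)) \<le> B" using C(4) by auto
  have "(\<lambda>k. (LINT x|ballL. dC x * G (cut R (F k) x))
      + Re (l2inner ballL (\<lambda>x. of_real (C x) * cut R (F' k) x) (\<lambda>x. N (cut R (F k) x))))
      \<longlonglongrightarrow> (LINT x|ballL. dC x * G (cut R f x))
      + Re (l2inner ballL (\<lambda>x. of_real (C x) * cut R w x) (\<lambda>x. N (cut R f x)))"
    by (intro tendsto_add tendsto_Re l2_tendsto_inner l2_tendsto_potential(1)[OF G N F(6) Cm(2) C(5)]
       l2_tendsto_mult_bounded[OF F(7) Cm(1) Cb] l2_tendsto_lipschitz[OF F(6) N])
  moreover have "(LINT x|ballL. dC x * G (cut R (F k) x))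
      + Re (l2inner ballL (\<lambda>x. of_real (C x) * cut R (F' k) x) (\<lambda>x. N (cut R (F k) x))) = 0" for k
  proof -
    note [measurable] = F(2,3)[of k] C(2,3)
    obtain b1 b2 where b: "\<And>x. norm (F k x) \<le> b1" "\<And>x. norm (F' k x) \<le> b2"
      using F(4,5)[of k] by metis
    have B0: "0 \<le> B" "0 \<le> B'" "0 \<le> b1" "0 \<le> b2"
      using C(4,5)[of 0] b(1)[of 0] b(2)[of 0]
      by (meson abs_ge_zero norm_ge_zero order_trans)+
    define \<Phi> where "\<Phi> x = complex_of_real (C x * G (F k x))" for x
    define d1 d2 where "d1 x = complex_of_real (dC x * G (F k x))"
      and "d2 x = complex_of_real (C x * Re (F' k x * cnj (N (F k x))))" for x
    have mm [measurable]: "\<Phi> \<in> borel_measurable borel" "d1 \<in> borel_measurable borel" "d2 \<in> borel_measurable borel"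
      unfolding \<Phi>_def[abs_def] d1_def[abs_def] d2_def[abs_def] by measurable
    have pG: "pderiv_along i (\<lambda>x. G (F k x)) (\<lambda>x. Re (F' k x * cnj (N (F k x))))"
      unfolding pderiv_along_def
    proof
      fix x
      have "((\<lambda>t. F k (x + t *\<^sub>R axis i 1)) has_derivative (\<lambda>h. h *\<^sub>R F' k x)) (at 0)"
        using F(1)[of k] by (simp add: pderiv_along_def has_vector_derivative_def)
      from has_derivative_compose[OF this G(1)]
      show "((\<lambda>t. G (F k (x + t *\<^sub>R axis i 1))) has_vector_derivative Re (F' k x * cnj (N (F k x)))) (at 0)"
        by (simp add: has_vector_derivative_def mult.commute scaleR_conv_of_real algebra_simps)
    qed
    have "pderiv_along i \<Phi> (\<lambda>x. complex_of_real (C x * Re (F' k x * cnj (N (F k x))) + dC x * G (F k x)))"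
      unfolding \<Phi>_def by (intro pderiv_along_bounded_linear[OF bounded_linear_of_real] pderiv_along_mult C(1) pG)
    then have pd: "pderiv_along i \<Phi> (\<lambda>x. d1 x + d2 x)"
      by (simp add: d1_def d2_def add.commute)
    have Gb: "\<bar>G (F k x)\<bar> \<le> L * b1\<^sup>2" for x
    proof -
      have "\<bar>G (F k x)\<bar> \<le> L * (norm (F k x))\<^sup>2"
        using lipschitz_gradient_bound[OF G(1) N, of "F k x" 0] G(2) by (simp add: power2_eq_square mult.assoc)
      also have "\<dots> \<le> L * b1\<^sup>2" using b(1)[of x] L by (intro mult_left_mono power_mono) auto
      finally show ?thesis .
    qed
    have Nb: "\<bar>Re (F' k x * cnj (N (F k x)))\<bar> \<le> b2 * (L * b1)" for x
    proof -
      have "\<bar>Re (F' k x * cnj (N (F k x)))\<bar> \<le> norm (F' k x) * norm (N (F k x))"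
        using abs_Re_le_cmod[of "F' k x * cnj (N (F k x))"] by (simp add: norm_mult)
      also have "\<dots> \<le> b2 * (L * b1)"
      proof (intro mult_mono b B0)
        have "norm (N (F k x)) \<le> L * norm (F k x)" using N(1)[of "F k x" 0] N(2) by simp
        also have "\<dots> \<le> L * b1" by (intro mult_left_mono b L)
        finally show "norm (N (F k x)) \<le> L * b1" .
      qed auto
      finally show ?thesis .
    qed
    have n: "norm (d1 x) \<le> B' * (L * b1\<^sup>2)" "norm (d2 x) \<le> B * (b2 * (L * b1))" "norm (\<Phi> x) \<le> B * (L * b1\<^sup>2)" for x
      unfolding d1_def d2_def \<Phi>_def norm_of_real abs_mult using C(4,5) Gb Nb B0 by (auto intro!: mult_mono)
    have z: "d1 x = 0" "d2 x = 0" "\<Phi> x = 0" if "R < norm x" for x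
      using C(6,7)[OF that] by (auto simp: d1_def d2_def \<Phi>_def)
    have ii: "integrable lborel d1" "integrable lborel d2" "integrable lborel \<Phi>"
      by (rule integrable_bounded_support[OF mm(2) n(1) z(1)] integrable_bounded_support[OF mm(3) n(2) z(2)]
          integrable_bounded_support[OF mm(1) n(3) z(3)], assumption)+
    have "(LINT x|lborel. d1 x + d2 x) = 0"
    proof (rule integral_pderiv_along_eq_0[OF pd _ _ _ z(3) ii(3)])
      show "norm (d1 x + d2 x) \<le> B' * (L * b1\<^sup>2) + B * (b2 * (L * b1))" for x
        using n[of x] by (smt (verit) norm_triangle_ineq)
    qed measurable
    then have s: "(LINT x|lborel. d1 x) + (LINT x|lborel. d2 x) = 0"
      using ii by simp
    have "(LINT x|ballL. complex_of_real (dC x * G (cut R (F k) x))) = (LINT x|lborel. d1 x)"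
    proof (rule ballL_integral(1))
      show "(\<lambda>x. complex_of_real (dC x * G (cut R (F k) x))) \<in> borel_measurable ballL"
        by (rule ballL_borel) measurable
      show "AE x in lborel. d1 x = indicator (ball 0 1) x *\<^sub>R complex_of_real (dC x * G (cut R (F k) x))"
      proof (rule AE_I2)
        fix x
        show "d1 x = indicator (ball 0 1) x *\<^sub>R complex_of_real (dC x * G (cut R (F k) x))"
          using C(7)[of x] R by (cases "norm x \<le> R") (auto simp: d1_def)
      qed
    qed measurable
    then have s1: "complex_of_real (LINT x|ballL. dC x * G (cut R (F k) x)) = (LINT x|lborel. d1 x)"
      by (simp only: integral_complex_of_real)
    have s2: "complex_of_real (Re (l2inner ballL (\<lambda>x. of_real (C x) * cut R (F' k) x) (\<lambda>x. N (cut R (F k) x)))) = (LINT x|lborel. d2 x)"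
    proof -
      have e: "l2inner ballL (\<lambda>x. of_real (C x) * cut R (F' k) x) (\<lambda>x. N (cut R (F k) x))
         = (LINT x|lborel. of_real (C x) * (F' k x * cnj (N (F k x))))"
        unfolding l2inner_def
      proof (rule ballL_integral(1))
        show "(\<lambda>x. of_real (C x) * cut R (F' k) x * cnj (N (cut R (F k) x))) \<in> borel_measurable ballL"
          by (rule ballL_borel) measurable
        show "AE x in lborel. of_real (C x) * (F' k x * cnj (N (F k x))) = indicator (ball 0 1) x *\<^sub>R (of_real (C x) * cut R (F' k) x * cnj (N (cut R (F k) x)))"
        proof (rule AE_I2)
          fix x
          show "of_real (C x) * (F' k x * cnj (N (F k x))) = indicator (ball 0 1) x *\<^sub>R (of_real (C x) * cut R (F' k) x * cnj (N (cut R (F k) x)))"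
            using C(6)[of x] R by (cases "norm x \<le> R") auto
        qed
      qed measurable
      have i: "integrable lborel (\<lambda>x. of_real (C x) * (F' k x * cnj (N (F k x))))"
      proof (rule integrable_bounded_support)
        show "norm (of_real (C x) * (F' k x * cnj (N (F k x)))) \<le> B * (b2 * (L * b1))" for x
        proof -
          have "norm (N (F k x)) \<le> L * norm (F k x)" using N(1)[of "F k x" 0] N(2) by simp
          also have "\<dots> \<le> L * b1" by (intro mult_left_mono b L)
          finally have "norm (N (F k x)) \<le> L * b1" .
          then show ?thesis using b C(4) B0 L by (auto simp: norm_mult intro!: mult_mono)
        qed
        show "of_real (C x) * (F' k x * cnj (N (F k x))) = 0" if "R < norm x" for x using C(6)[OF that] by simp
      qed measurable
      have "Re (LINT x|lborel. of_real (C x) * (F' k x * cnj (N (F k x)))) = (LINT x|lborel. C x * Re (F' k x * cnj (N (F k x))))"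
        by (subst integral_Re[OF i, symmetric]) simp
      then show ?thesis unfolding e d2_def by (simp only: integral_complex_of_real)
    qed
    show ?thesis using s unfolding s1[symmetric] s2[symmetric] of_real_add[symmetric] by (simp only: of_real_eq_0_iff)
  qed
  ultimately have "(\<lambda>k::nat. 0::real) \<longlonglongrightarrow> (LINT x|ballL. dC x * G (cut R f x))
      + Re (l2inner ballL (\<lambda>x. of_real (C x) * cut R w x) (\<lambda>x. N (cut R f x)))" by simp
  then show ?thesis by (simp add: LIMSEQ_const_iff)
qed

section \<open>The radial profile of the virial field\<close>

text \<open>The volume integral of the radial profile in a form that is smooth in \<open>s\<close>, the square of the Euclidean
  radius, down to \<open>s = 0\<close>.\<close>

definition rad_int :: "nat \<Rightarrow> nat \<Rightarrow> real \<Rightarrow> real" where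
  "rad_int j k s = integral {0..1} (\<lambda>\<tau>. \<tau> ^ j / (1 - \<tau>\<^sup>2 * s) ^ k)"

lemma rad_base_pos: "s < 1 \<Longrightarrow> 0 \<le> \<tau> \<Longrightarrow> \<tau> \<le> 1 \<Longrightarrow> 0 < 1 - \<tau>\<^sup>2 * (s::real)"
proof -
  assume a: "s < 1" "0 \<le> \<tau>" "\<tau> \<le> 1"
  have t: "0 \<le> \<tau>\<^sup>2" "\<tau>\<^sup>2 \<le> 1" using a by (auto simp: power_le_one)
  show ?thesis
  proof (cases "0 \<le> s")
    case True
    have "\<tau>\<^sup>2 * s \<le> 1 * s" using t True by (intro mult_right_mono)
    then show ?thesis using a by linarith
  next
    case False
    then have "\<tau>\<^sup>2 * s \<le> 0" using t by (intro mult_nonneg_nonpos) auto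
    then show ?thesis by linarith
  qed
qed

lemma inverse_power_deriv:
  assumes "(f has_real_derivative f') (at x)" "f x \<noteq> 0"
  shows "((\<lambda>y. 1 / f y ^ k) has_real_derivative - (real k * f' / f x ^ Suc k)) (at x)"
proof (cases k)
  case (Suc m)
  have "((\<lambda>y. inverse (f y) ^ Suc m) has_real_derivative real (Suc m) * (- (inverse (f x) * f' * inverse (f x)) * inverse (f x) ^ m)) (at x)"
    using DERIV_power[OF DERIV_inverse_fun[OF assms], of "Suc m"] assms(2) by (simp add: power2_eq_square field_simps mult.assoc)
  moreover have "real (Suc m) * (- (inverse (f x) * f' * inverse (f x)) * inverse (f x) ^ m) = - (real k * f' / f x ^ Suc k)"
    using assms(2) by (simp add: Suc field_simps mult.assoc)
  ultimately show ?thesis by (simp add: Suc power_inverse inverse_eq_divide power_divide mult.assoc)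
qed simp

lemma rad_int_integrable:
  fixes s :: real
  shows "s < 1 \<Longrightarrow> (\<lambda>\<tau>. \<tau> ^ j / (1 - \<tau>\<^sup>2 * s) ^ k) integrable_on {0..1}"
  by (intro integrable_continuous_real continuous_intros) (use rad_base_pos in fastforce)

lemma rad_int_deriv:
  assumes "s < 1"
  shows "(rad_int j k has_real_derivative real k * rad_int (j + 2) (k + 1) s) (at s)"
proof -
  have "((\<lambda>s. integral (cbox 0 1) (\<lambda>\<tau>. \<tau> ^ j / (1 - \<tau>\<^sup>2 * s) ^ k)) has_field_derivative
      integral (cbox 0 1) (\<lambda>\<tau>. real k * \<tau> ^ (j + 2) / (1 - \<tau>\<^sup>2 * s) ^ (k + 1))) (at s within {..<1})"
  proof (rule leibniz_rule_field_derivative)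
    fix s \<tau> :: real assume *: "s \<in> {..<1}" "\<tau> \<in> cbox 0 1"
    have "0 < 1 - \<tau>\<^sup>2 * s" by (rule rad_base_pos) (use * in auto)
    moreover have "((\<lambda>s. 1 - \<tau>\<^sup>2 * s) has_real_derivative - \<tau>\<^sup>2) (at s)"
      by (auto intro!: derivative_eq_intros)
    ultimately have "((\<lambda>s. 1 / (1 - \<tau>\<^sup>2 * s) ^ k) has_real_derivative - (real k * (- \<tau>\<^sup>2) / (1 - \<tau>\<^sup>2 * s) ^ Suc k)) (at s)"
      by (intro inverse_power_deriv) auto
    from DERIV_cmult[OF this, of "\<tau> ^ j"]
    have "((\<lambda>s. \<tau> ^ j / (1 - \<tau>\<^sup>2 * s) ^ k) has_real_derivative real k * \<tau> ^ (j + 2) / (1 - \<tau>\<^sup>2 * s) ^ (k + 1)) (at s)"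
      by (simp add: power2_eq_square mult_ac)
    then show "((\<lambda>s. \<tau> ^ j / (1 - \<tau>\<^sup>2 * s) ^ k) has_real_derivative real k * \<tau> ^ (j + 2) / (1 - \<tau>\<^sup>2 * s) ^ (k + 1)) (at s within {..<1})"
      by (rule has_field_derivative_at_within)
  next
    show "(\<lambda>\<tau>. \<tau> ^ j / (1 - \<tau>\<^sup>2 * s) ^ k) integrable_on cbox 0 1" if "s \<in> {..<1}" for s :: real
      using rad_int_integrable[of s j k] that by simp
    show "continuous_on ({..<1} \<times> cbox 0 1) (\<lambda>(s::real, \<tau>). real k * \<tau> ^ (j + 2) / (1 - \<tau>\<^sup>2 * s) ^ (k + 1))"
      unfolding case_prod_unfold
      by (intro continuous_intros) (use rad_base_pos in fastforce)
  qed (use assms in auto)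
  moreover have "at s within {..<1} = at s" using assms by (intro at_within_open) auto
  ultimately show ?thesis
    by (simp add: rad_int_def[abs_def] mult.assoc flip: times_divide_eq_right)
qed

lemma rad_int_continuous: "continuous_on {..<1} (rad_int j k)"
  by (rule continuous_at_imp_continuous_on) (auto intro!: DERIV_isCont rad_int_deriv)

text \<open>The fundamental theorem of calculus for \<open>\<tau>\<^sup>n / (1 - \<tau>\<^sup>2 s)\<^sup>n\<close>.\<close>

lemma rad_int_ode:
  assumes s: "s < 1" and n: "n \<ge> 1"
  shows "real n * rad_int (n - 1) n s + 2 * s * (real n * rad_int (n + 1) (n + 1) s) = 1 / (1 - s) ^ n"
proof -
  have "((\<lambda>\<tau>. real n * (\<tau> ^ (n - 1) / (1 - \<tau>\<^sup>2 * s) ^ n) + 2 * s * (real n * (\<tau> ^ (n + 1) / (1 - \<tau>\<^sup>2 * s) ^ (n + 1)))) has_integral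
       (1 ^ n * (1 / (1 - 1\<^sup>2 * s) ^ n) - 0 ^ n * (1 / (1 - 0\<^sup>2 * s) ^ n))) {0..1}"
  proof (rule fundamental_theorem_of_calculus)
    fix \<tau> :: real assume t: "\<tau> \<in> {0..1}"
    have p: "0 < 1 - \<tau>\<^sup>2 * s" by (rule rad_base_pos) (use t s in auto)
    have "((\<lambda>\<tau>. 1 - \<tau>\<^sup>2 * s) has_real_derivative - (2 * \<tau> * s)) (at \<tau>)"
      by (auto intro!: derivative_eq_intros)
    from DERIV_mult[OF DERIV_pow[of n \<tau>] inverse_power_deriv[OF this, of n]] p
    have "((\<lambda>\<tau>. \<tau> ^ n * (1 / (1 - \<tau>\<^sup>2 * s) ^ n)) has_real_derivative
        real n * (\<tau> ^ (n - 1) / (1 - \<tau>\<^sup>2 * s) ^ n) + 2 * s * (real n * (\<tau> ^ (n + 1) / (1 - \<tau>\<^sup>2 * s) ^ (n + 1)))) (at \<tau>)"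
      by (simp add: mult_ac)
    then show "((\<lambda>\<tau>. \<tau> ^ n * (1 / (1 - \<tau>\<^sup>2 * s) ^ n)) has_vector_derivative
        real n * (\<tau> ^ (n - 1) / (1 - \<tau>\<^sup>2 * s) ^ n) + 2 * s * (real n * (\<tau> ^ (n + 1) / (1 - \<tau>\<^sup>2 * s) ^ (n + 1)))) (at \<tau> within {0..1})"
      by (auto simp: has_real_derivative_iff_has_vector_derivative[symmetric] intro: has_field_derivative_at_within)
  qed simp
  moreover have "((\<lambda>\<tau>. real n * (\<tau> ^ (n - 1) / (1 - \<tau>\<^sup>2 * s) ^ n) + 2 * s * (real n * (\<tau> ^ (n + 1) / (1 - \<tau>\<^sup>2 * s) ^ (n + 1)))) has_integral
       real n * rad_int (n - 1) n s + 2 * s * (real n * rad_int (n + 1) (n + 1) s)) {0..1}"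
    unfolding rad_int_def
    by (intro has_integral_add has_integral_mult_right integrable_integral rad_int_integrable[OF s])
  ultimately have "real n * rad_int (n - 1) n s + 2 * s * (real n * rad_int (n + 1) (n + 1) s)
     = 1 ^ n * (1 / (1 - 1\<^sup>2 * s) ^ n) - 0 ^ n * (1 / (1 - 0\<^sup>2 * s) ^ n)"
    by (rule has_integral_unique[symmetric])
  then show ?thesis using n by (simp add: power_0_left)
qed

text \<open>Comparison of the volume of a ball with the area of its boundary.  The middle quantity is the integral over
  \<open>[0, 1]\<close> of the derivative of \<open>\<tau>\<^sup>m\<^sup>+\<^sup>1 / ((1 + \<tau>\<^sup>2 s)(1 - \<tau>\<^sup>2 s)\<^sup>m)\<close>, and this derivative is the integrand of
  \<open>rad_int\<close> times a factor between \<open>m\<close> and \<open>m + 1\<close>.\<close>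

lemma rad_int_bounds:
  assumes s: "0 \<le> s" "s < 1"
  shows "real m * rad_int m (Suc m) s \<le> 1 / ((1 + s) * (1 - s) ^ m)"
    and "1 / ((1 + s) * (1 - s) ^ m) \<le> real (Suc m) * rad_int m (Suc m) s"
proof -
  \<comment> \<open>the derivative mentioned above; the subtracted fraction lies between 0 and 1 because \<open>4\<sigma> \<le> (1 + \<sigma>)\<^sup>2\<close>\<close>
  define g where "g \<tau> = (\<tau> ^ m / (1 - \<tau>\<^sup>2 * s) ^ Suc m) * (real (Suc m) - 4 * (\<tau>\<^sup>2 * s) / (1 + \<tau>\<^sup>2 * s)\<^sup>2)" for \<tau>
  have I: "(g has_integral (1 ^ Suc m * (1 / (1 + 1\<^sup>2 * s) * (1 / (1 - 1\<^sup>2 * s) ^ m)) - 0 ^ Suc m * (1 / (1 + 0\<^sup>2 * s) * (1 / (1 - 0\<^sup>2 * s) ^ m)))) {0..1}"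
  proof (rule fundamental_theorem_of_calculus)
    fix \<tau> :: real assume t: "\<tau> \<in> {0..1}"
    define \<sigma> where "\<sigma> = \<tau>\<^sup>2 * s"
    have p: "0 < 1 - \<sigma>" unfolding \<sigma>_def by (rule rad_base_pos) (use t s in auto)
    have p': "0 < 1 + \<sigma>" using s by (simp add: \<sigma>_def add_pos_nonneg)
    have d1: "((\<lambda>\<tau>. 1 - \<tau>\<^sup>2 * s) has_real_derivative - (2 * \<tau> * s)) (at \<tau>)"
      by (auto intro!: derivative_eq_intros)
    have d2: "((\<lambda>\<tau>. 1 / (1 + \<tau>\<^sup>2 * s) ^ 1) has_real_derivative - (real 1 * (2 * \<tau> * s) / (1 + \<tau>\<^sup>2 * s) ^ Suc 1)) (at \<tau>)"
      by (rule inverse_power_deriv) (use p' in \<open>auto intro!: derivative_eq_intros simp: \<sigma>_def\<close>)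
    have d3: "((\<lambda>\<tau>. \<tau> ^ Suc m * (1 / (1 + \<tau>\<^sup>2 * s) ^ 1 * (1 / (1 - \<tau>\<^sup>2 * s) ^ m))) has_real_derivative
        (real (Suc m) * \<tau> ^ m) * (1 / (1 + \<sigma>) ^ 1 * (1 / (1 - \<sigma>) ^ m))
        + (- (real 1 * (2 * \<tau> * s) / (1 + \<sigma>) ^ Suc 1) * (1 / (1 - \<sigma>) ^ m)
           + - (real m * (- (2 * \<tau> * s)) / (1 - \<sigma>) ^ Suc m) * (1 / (1 + \<sigma>) ^ 1)) * \<tau> ^ Suc m) (at \<tau>)"
      using DERIV_mult[OF DERIV_pow[of "Suc m" \<tau>] DERIV_mult[OF d2 inverse_power_deriv[OF d1, of m]]] p
      unfolding \<sigma>_def by simp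
    have "(real (Suc m) * \<tau> ^ m) * (1 / (1 + \<sigma>) ^ 1 * (1 / (1 - \<sigma>) ^ m))
        + (- (real 1 * (2 * \<tau> * s) / (1 + \<sigma>) ^ Suc 1) * (1 / (1 - \<sigma>) ^ m)
           + - (real m * (- (2 * \<tau> * s)) / (1 - \<sigma>) ^ Suc m) * (1 / (1 + \<sigma>) ^ 1)) * \<tau> ^ Suc m
       = \<tau> ^ m * (real (Suc m) / ((1 + \<sigma>) * (1 - \<sigma>) ^ m)
        - 2 * \<sigma> / ((1 + \<sigma>)\<^sup>2 * (1 - \<sigma>) ^ m) + real m * (2 * \<sigma>) / ((1 - \<sigma>) ^ Suc m * (1 + \<sigma>)))"
      by (simp add: \<sigma>_def power2_eq_square algebra_simps)
    also have "\<dots> = g \<tau>"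
    proof -
      have gen: "A / (P * t) - S / (P\<^sup>2 * t) + B / ((M * t) * P) = (A * P * M - S * M + B * P) / (P\<^sup>2 * (M * t))"
        if "P \<noteq> 0" "M \<noteq> 0" "t \<noteq> 0" for A B S P M t :: real
        using that by (simp add: field_simps power2_eq_square)
      have "real (Suc m) / ((1 + \<sigma>) * (1 - \<sigma>) ^ m)
        - 2 * \<sigma> / ((1 + \<sigma>)\<^sup>2 * (1 - \<sigma>) ^ m) + real m * (2 * \<sigma>) / ((1 - \<sigma>) ^ Suc m * (1 + \<sigma>))
        = (real (Suc m) * (1 + \<sigma>) * (1 - \<sigma>) - 2 * \<sigma> * (1 - \<sigma>) + real m * (2 * \<sigma>) * (1 + \<sigma>)) / ((1 + \<sigma>)\<^sup>2 * (1 - \<sigma>) ^ Suc m)"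
        unfolding power_Suc by (rule gen) (use p p' in auto)
      also have "real (Suc m) * (1 + \<sigma>) * (1 - \<sigma>) - 2 * \<sigma> * (1 - \<sigma>) + real m * (2 * \<sigma>) * (1 + \<sigma>)
         = real (Suc m) * (1 + \<sigma>)\<^sup>2 - 4 * \<sigma>"
        by (simp add: power2_eq_square algebra_simps)
      also have "(real (Suc m) * (1 + \<sigma>)\<^sup>2 - 4 * \<sigma>) / ((1 + \<sigma>)\<^sup>2 * (1 - \<sigma>) ^ Suc m)
         = 1 / (1 - \<sigma>) ^ Suc m * (real (Suc m) - 4 * \<sigma> / (1 + \<sigma>)\<^sup>2)"
        using p p' by (simp add: diff_divide_distrib right_diff_distrib mult.commute del: power_Suc)
      finally show ?thesis unfolding g_def \<sigma>_def[symmetric] by simp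
    qed
    finally show "((\<lambda>\<tau>. \<tau> ^ Suc m * (1 / (1 + \<tau>\<^sup>2 * s) * (1 / (1 - \<tau>\<^sup>2 * s) ^ m))) has_vector_derivative g \<tau>) (at \<tau> within {0..1})"
      using d3 by (auto simp: has_real_derivative_iff_has_vector_derivative[symmetric] intro: has_field_derivative_at_within)
  qed simp
  have J: "((\<lambda>\<tau>. \<tau> ^ m / (1 - \<tau>\<^sup>2 * s) ^ Suc m) has_integral rad_int m (Suc m) s) {0..1}"
    unfolding rad_int_def by (rule integrable_integral[OF rad_int_integrable[OF s(2)]])
  have k: "0 \<le> \<tau> ^ m / (1 - \<tau>\<^sup>2 * s) ^ Suc m" if "\<tau> \<in> {0..1}" for \<tau>
    using rad_base_pos[OF s(2), of \<tau>] that by simp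
  have q: "0 \<le> 4 * (\<tau>\<^sup>2 * s) / (1 + \<tau>\<^sup>2 * s)\<^sup>2" "4 * (\<tau>\<^sup>2 * s) / (1 + \<tau>\<^sup>2 * s)\<^sup>2 \<le> 1" for \<tau>
  proof -
    define \<sigma> where "\<sigma> = \<tau>\<^sup>2 * s"
    have \<sigma>: "0 \<le> \<sigma>" using s by (simp add: \<sigma>_def)
    have "4 * \<sigma> \<le> (1 + \<sigma>)\<^sup>2" using zero_le_power2[of "1 - \<sigma>"] by (simp add: power2_eq_square algebra_simps)
    moreover have "0 < (1 + \<sigma>)\<^sup>2" using \<sigma> by simp
    ultimately have "4 * \<sigma> / (1 + \<sigma>)\<^sup>2 \<le> 1" by (simp add: divide_le_eq_1)
    then show "0 \<le> 4 * (\<tau>\<^sup>2 * s) / (1 + \<tau>\<^sup>2 * s)\<^sup>2" "4 * (\<tau>\<^sup>2 * s) / (1 + \<tau>\<^sup>2 * s)\<^sup>2 \<le> 1"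
      using \<sigma> by (simp_all add: \<sigma>_def)
  qed
  have I': "(g has_integral 1 / ((1 + s) * (1 - s) ^ m)) {0..1}" using I by simp
  show "1 / ((1 + s) * (1 - s) ^ m) \<le> real (Suc m) * rad_int m (Suc m) s"
  proof (rule has_integral_le[OF I' has_integral_mult_right[OF J]])
    fix \<tau> :: real assume "\<tau> \<in> {0..1}"
    then have "g \<tau> \<le> (\<tau> ^ m / (1 - \<tau>\<^sup>2 * s) ^ Suc m) * real (Suc m)"
      unfolding g_def using q(1)[of \<tau>] by (intro mult_left_mono k) auto
    then show "g \<tau> \<le> real (Suc m) * (\<tau> ^ m / (1 - \<tau>\<^sup>2 * s) ^ Suc m)" by (simp only: mult.commute)
  qed
  show "real m * rad_int m (Suc m) s \<le> 1 / ((1 + s) * (1 - s) ^ m)"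
  proof (rule has_integral_le[OF has_integral_mult_right[OF J] I'])
    fix \<tau> :: real assume "\<tau> \<in> {0..1}"
    then have "(\<tau> ^ m / (1 - \<tau>\<^sup>2 * s) ^ Suc m) * real m \<le> g \<tau>"
      unfolding g_def using q(2)[of \<tau>] by (intro mult_left_mono k) auto
    then show "real m * (\<tau> ^ m / (1 - \<tau>\<^sup>2 * s) ^ Suc m) \<le> g \<tau>" by (simp only: mult.commute)
  qed
qed

text \<open>In ball coordinates the virial field is \<open>X = vcoef n (x \<bullet> x) \<Sum>\<^sub>i x\<^sub>i \<partial>\<^sub>i\<close>; with \<open>r\<close> the hyperbolic distance to the
  origin, this is \<open>X = F(r) \<partial>\<^sub>r\<close> for \<open>F(r) = (n - 1) (\<integral>\<^sub>0\<^sup>r sinh\<^sup>n\<^sup>-\<^sup>1) / sinh\<^sup>n\<^sup>-\<^sup>1 r\<close>.\<close>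

definition vcoef :: "nat \<Rightarrow> real \<Rightarrow> real" where
  "vcoef n s = (real n - 1) * (1 - s) ^ n * rad_int (n - 1) n s"

definition dvcoef :: "nat \<Rightarrow> real \<Rightarrow> real" where
  "dvcoef n s = (real n - 1) * (real n * ((1 - s) ^ n * rad_int (n + 1) (n + 1) s) - real n * ((1 - s) ^ (n - 1) * rad_int (n - 1) n s))"

lemma vcoef_deriv:
  assumes "s < 1" "n \<ge> 1"
  shows "(vcoef n has_real_derivative dvcoef n s) (at s)"
proof -
  have "((\<lambda>s. (1 - s) ^ n) has_real_derivative - (real n * (1 - s) ^ (n - 1))) (at s)"
    by (auto intro!: derivative_eq_intros)
  moreover have "(rad_int (n - 1) n has_real_derivative real n * rad_int (n + 1) (n + 1) s) (at s)"
    using rad_int_deriv[OF assms(1), of "n - 1" n] assms(2) by simp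
  ultimately have "((\<lambda>s. (1 - s) ^ n * rad_int (n - 1) n s) has_real_derivative
     (- (real n * (1 - s) ^ (n - 1)) * rad_int (n - 1) n s + real n * rad_int (n + 1) (n + 1) s * (1 - s) ^ n)) (at s)"
    by (rule DERIV_mult)
  from DERIV_cmult[OF this, of "real n - 1"] show ?thesis
    by (simp add: vcoef_def[abs_def] dvcoef_def algebra_simps)
qed

lemma dvcoef_continuous: "continuous_on {0..<1} (dvcoef n)"
  unfolding dvcoef_def[abs_def]
  by (intro continuous_intros continuous_on_subset[OF rad_int_continuous]) auto

text \<open>This differential equation expresses that the field has divergence \<open>n - 1\<close>.\<close>

lemma vcoef_ode:
  assumes "s < 1" "n \<ge> 1"
  shows "2 * s * (1 - s) * dvcoef n s = (real n - 1) * (1 - s) - real n * (1 + s) * vcoef n s"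
proof -
  obtain m where m: "n = Suc m" using assms(2) by (cases n) auto
  define t where "t = (1 - s) ^ m"
  have t: "t \<noteq> 0" "(1 - s) ^ n = t * (1 - s)" using assms(1) by (auto simp: t_def m)
  have "2 * s * (real n * rad_int (n + 1) (n + 1) s) = 1 / (t * (1 - s)) - real n * rad_int (n - 1) n s"
    using rad_int_ode[OF assms] unfolding t(2) by linarith
  then have h: "(2 * s * (real n * rad_int (n + 1) (n + 1) s)) * (t * (1 - s)) = 1 - real n * rad_int (n - 1) n s * (t * (1 - s))"
    using t(1) assms(1) by (simp add: left_diff_distrib)
  have "2 * s * (1 - s) * dvcoef n s = (real n - 1) * (1 - s) * ((2 * s * (real n * rad_int (n + 1) (n + 1) s)) * (t * (1 - s)) - 2 * s * real n * t * rad_int (n - 1) n s)"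
    unfolding dvcoef_def t(2) using m by (simp add: t_def algebra_simps)
  also have "\<dots> = (real n - 1) * (1 - s) - real n * (1 + s) * vcoef n s"
    unfolding h vcoef_def t(2) by (simp add: algebra_simps)
  finally show ?thesis .
qed

text \<open>In terms of \<open>c = F coth r = vcoef n s (1 + s)/(1 - s)\<close>, the tangential eigenvalue of the
  covariant derivative of the field, this says \<open>(n - 1)/n \<le> c \<le> 1\<close>.\<close>

lemma vcoef_bounds:
  assumes s: "0 \<le> s" "s < 1" and n: "n \<ge> 1"
  shows "vcoef n s * (1 + s) \<le> 1 - s" "(real n - 1) * (1 - s) \<le> real n * (vcoef n s * (1 + s))" "0 \<le> vcoef n s"
proof -
  obtain m where m: "n = Suc m" using n by (cases n) auto
  define t where "t = (1 + s) * (1 - s) ^ m"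
  have t: "0 < t" using s by (simp add: t_def)
  have v: "vcoef n s * (1 + s) = (1 - s) * (real m * rad_int m (Suc m) s * t)"
    by (simp add: vcoef_def m t_def)
  have b: "real m * rad_int m (Suc m) s * t \<le> 1" "1 \<le> real (Suc m) * rad_int m (Suc m) s * t"
    using rad_int_bounds[OF s, of m] t unfolding t_def[symmetric]
    by (simp_all only: pos_le_divide_eq pos_divide_le_eq)
  have "(1 - s) * (real m * rad_int m (Suc m) s * t) \<le> (1 - s) * 1"
    using b(1) s by (intro mult_left_mono) auto
  then show "vcoef n s * (1 + s) \<le> 1 - s" unfolding v by simp
  have "(real m * (1 - s)) * 1 \<le> (real m * (1 - s)) * (real (Suc m) * rad_int m (Suc m) s * t)"
    using b(2) s by (intro mult_left_mono) auto
  then show "(real n - 1) * (1 - s) \<le> real n * (vcoef n s * (1 + s))" unfolding v by (simp add: m mult_ac)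
  have "0 \<le> rad_int m (Suc m) s"
    unfolding rad_int_def
    by (rule Henstock_Kurzweil_Integration.integral_nonneg[OF rad_int_integrable[OF s(2)]])
      (use rad_base_pos[OF s(2)] in \<open>auto intro!: divide_nonneg_pos simp del: power_Suc\<close>)
  then show "0 \<le> vcoef n s" using s by (simp add: vcoef_def m)
qed

text \<open>The left-hand side is the squared hyperbolic length of the field, which equals \<open>(c tanh r)\<^sup>2\<close>.\<close>

lemma vcoef_length_le_1:
  assumes s: "0 \<le> s" "s < 1" and n: "n \<ge> 1"
  shows "(2 / (1 - s))\<^sup>2 * (vcoef n s)\<^sup>2 * s \<le> 1"
proof -
  define a where "a = vcoef n s"
  define c where "c = a * (1 + s) / (1 - s)"
  have c1: "c \<le> 1" using vcoef_bounds(1)[OF s n] s by (simp add: c_def a_def field_simps)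
  have c0: "0 \<le> c" using vcoef_bounds(3)[OF s n] s by (simp add: c_def a_def)
    have "(2 / (1 - s))\<^sup>2 * a\<^sup>2 * s = c\<^sup>2 * (4 * s / (1 + s)\<^sup>2)"
    proof -
      have gen: "(2 / M)\<^sup>2 * a\<^sup>2 * s = (a * P / M)\<^sup>2 * (4 * s / P\<^sup>2)" if "P \<noteq> 0" for P M
        using that by (simp add: power_divide power_mult_distrib)
      show ?thesis unfolding c_def by (rule gen) (use s in auto)
    qed
    also have "\<dots> \<le> 1 * 1"
    proof (intro mult_mono)
      show "c\<^sup>2 \<le> 1" using c0 c1 by (simp add: power_le_one)
      have "4 * s \<le> (1 + s)\<^sup>2" using zero_le_power2[of "1 - s"] by (simp add: power2_eq_square algebra_simps)
      then show "4 * s / (1 + s)\<^sup>2 \<le> 1" using s by (simp add: divide_le_eq_1)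
    qed (use s in auto)
    finally show ?thesis by (simp add: a_def)
qed

text \<open>With \<open>W = |w|\<^sup>2\<close> and \<open>Y = |\<Sum>\<^sub>i x\<^sub>i w\<^sub>i|\<^sup>2\<close> this is the inequality \<open>(1/n) X \<otimes> X \<le> 1 - \<nabla>X\<close> evaluated on a gradient with coordinates \<open>w\<close>.  In
  the tangential directions the right-hand side is \<open>1 - c \<ge> 0\<close>; in the radial one it is
  \<open>1 - (n - 1)(1 - c) \<ge> 1/n\<close>, which dominates the left-hand side because the field has length at most 1.\<close>

lemma virial_coercive:
  assumes s: "0 \<le> s" "s < 1" and n: "n \<ge> 2" and Y: "0 \<le> Y" "Y \<le> s * W" "0 \<le> W"
  shows "(2 / (1 - s))\<^sup>2 * (vcoef n s)\<^sup>2 * Y / real n \<le> (1 - vcoef n s * (1 + s) / (1 - s)) * W - 2 * dvcoef n s * Y"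
proof -
  define a where "a = vcoef n s"
  define c where "c = a * (1 + s) / (1 - s)"
  have n1: "n \<ge> 1" using n by simp
  have c1: "c \<le> 1" and c2: "(real n - 1) / real n \<le> c"
    using vcoef_bounds(1,2)[OF s n1] s n by (simp_all add: c_def a_def field_simps)
  have c0: "0 \<le> c" using vcoef_bounds(3)[OF s n1] s by (simp add: c_def a_def)
  show ?thesis
  proof (cases "s = 0")
    case True
    then have "Y = 0" using Y by simp
    with True show ?thesis using Y c1 by (simp add: c_def a_def)
  next
    case False
    with s have s0: "0 < s" by simp
    \<comment> \<open>the differential equation of \<open>vcoef\<close>, solved for the derivative; this is where \<open>s = 0\<close> is exceptional\<close>
    have o: "2 * dvcoef n s = ((real n - 1) - real n * c) / s"
      using vcoef_ode[OF s(2) n1] s s0 by (simp add: c_def a_def field_simps)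
    have W: "Y / s \<le> W" using Y s0 by (simp add: field_simps)
    have "(2 / (1 - s))\<^sup>2 * a\<^sup>2 * s \<le> 1" unfolding a_def by (rule vcoef_length_le_1[OF s n1])
    then have "((2 / (1 - s))\<^sup>2 * a\<^sup>2 * s) * (Y / s) \<le> 1 * (Y / s)"
      using Y s0 by (intro mult_right_mono) auto
    then have "(2 / (1 - s))\<^sup>2 * a\<^sup>2 * Y \<le> Y / s" using s0 by simp
    then have "(2 / (1 - s))\<^sup>2 * a\<^sup>2 * Y / real n \<le> (Y / s) / real n" by (intro divide_right_mono) auto
    also have "\<dots> \<le> (Y / s) * ((real n - 1) * c - (real n - 2))"
    proof -
      have "(real n - 1) * ((real n - 1) / real n) \<le> (real n - 1) * c"
        using c2 n by (intro mult_left_mono) auto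
      moreover have "(real n - 1) * ((real n - 1) / real n) - (real n - 2) = 1 / real n"
        using n by (simp add: field_simps)
      ultimately have "1 / real n \<le> (real n - 1) * c - (real n - 2)" by linarith
      then have "(Y / s) * (1 / real n) \<le> (Y / s) * ((real n - 1) * c - (real n - 2))"
        using Y s0 by (intro mult_left_mono) auto
      then show ?thesis by simp
    qed
    also have "\<dots> = (1 - c) * (Y / s) - 2 * dvcoef n s * Y"
    proof -
      have "2 * dvcoef n s * Y = ((real n - 1) - real n * c) * (Y / s)" unfolding o by simp
      moreover have "y * ((real n - 1) * c - (real n - 2)) = (1 - c) * y - ((real n - 1) - real n * c) * y" for y
        by (simp add: algebra_simps)
      ultimately show ?thesis by simp
    qed
    also have "\<dots> \<le> (1 - c) * W - 2 * dvcoef n s * Y"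
      using mult_left_mono[OF W, of "1 - c"] c1 by simp
    finally show ?thesis by (simp add: a_def c_def)
  qed
qed

section \<open>Hyperbolic volume and Green's formula\<close>

definition hypV :: "(real^'n::finite) measure" where
  "hypV = density ballL (\<lambda>x. ennreal (conf x ^ CARD('n)))"

lemma conf_ge_2: "norm x < 1 \<Longrightarrow> 2 \<le> conf x"
  for x :: "real^'n::finite"
  using one_minus_pos[of x] by (simp add: conf_def field_simps)

lemma conf_pos: "norm x < 1 \<Longrightarrow> 0 < conf x"
  for x :: "real^'n::finite"
  using conf_ge_2[of x] by simp

lemma continuous_on_conf: "continuous_on (ball 0 1) (conf :: real^'n::finite \<Rightarrow> real)"
  unfolding conf_def[abs_def] using one_minus_pos by (intro continuous_intros) fastforce

lemma continuous_measurable_ballL: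
  "continuous_on (ball 0 1) (h :: real^'n::finite \<Rightarrow> real) \<Longrightarrow> h \<in> borel_measurable ballL"
  by (rule continuous_imp_measurable_on_sets_lebesgue) auto

lemma conf_measurable [measurable]: "conf \<in> borel_measurable (ballL :: (real^'n::finite) measure)"
  by (rule continuous_measurable_ballL[OF continuous_on_conf])

lemma measurable_hypV [simp]: "measurable hypV N = measurable ballL N" "space hypV = space ballL" "sets hypV = sets ballL"
  by (simp_all add: hypV_def measurable_def)

lemma hypV_integral:
  fixes h :: "real^'n::finite \<Rightarrow> 'b::{banach, second_countable_topology}"
  assumes "h \<in> borel_measurable ballL"
  shows "(LINT x|hypV. h x) = (LINT x|ballL. conf x ^ CARD('n) *\<^sub>R h x)"
    and "integrable hypV h \<longleftrightarrow> integrable ballL (\<lambda>x. conf x ^ CARD('n) *\<^sub>R h x)"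
proof -
  have ae: "AE x in (ballL :: (real^'n) measure). 0 \<le> conf x ^ CARD('n)"
    by (intro AE_I2 zero_le_power) (simp add: less_imp_le[OF conf_pos])
  have m: "(\<lambda>x. conf x ^ CARD('n)) \<in> borel_measurable (ballL :: (real^'n) measure)" by measurable
  show "(LINT x|hypV. h x) = (LINT x|ballL. conf x ^ CARD('n) *\<^sub>R h x)"
    unfolding hypV_def by (rule integral_density[OF assms m ae])
  show "integrable hypV h \<longleftrightarrow> integrable ballL (\<lambda>x. conf x ^ CARD('n) *\<^sub>R h x)"
    unfolding hypV_def by (rule integrable_density[OF assms m ae])
qed

lemma AE_hypV: "(AE x in hypV. P x) \<longleftrightarrow> (AE x in (ballL :: (real^'n::finite) measure). P x)"
proof -
  have "(AE x in hypV. P x) \<longleftrightarrow> (AE x in (ballL :: (real^'n) measure). 0 < ennreal (conf x ^ CARD('n)) \<longrightarrow> P x)"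
    unfolding hypV_def by (rule AE_density) measurable
  also have "\<dots> \<longleftrightarrow> (AE x in (ballL :: (real^'n) measure). P x)"
    by (rule AE_cong) (simp add: conf_pos)
  finally show ?thesis .
qed

lemma loc2_continuous_mult:
  fixes f :: "real^'n::finite \<Rightarrow> complex"
  assumes f: "loc2 f" and c: "continuous_on (ball 0 1) (c :: real^'n \<Rightarrow> real)"
  shows "loc2 (\<lambda>x. of_real (c x) * f x)"
  unfolding loc2_def
proof (intro conjI allI impI)
  have fm: "f \<in> borel_measurable ballL" using f by (simp add: loc2_def)
  have cm [measurable]: "c \<in> borel_measurable ballL" by (rule continuous_measurable_ballL[OF c])
  show m: "(\<lambda>x. of_real (c x) * f x) \<in> borel_measurable ballL" using fm by measurable
  fix R :: real assume R: "R < 1"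
  have "bounded (c ` cball 0 R)"
    by (intro compact_imp_bounded compact_continuous_image continuous_on_subset[OF c]) (use R in auto)
  then obtain B where "\<forall>y\<in>c ` cball 0 R. norm y \<le> B" unfolding bounded_iff by blast
  then have B: "\<bar>c x\<bar> \<le> B" if "x \<in> cball 0 R" for x using that by auto
  show "cut R (\<lambda>x. of_real (c x) * f x) \<in> square_integrable ballL"
  proof (rule square_integrable_bound)
    show "cut R f \<in> square_integrable ballL" using f R by (simp add: loc2_def)
    show "cut R (\<lambda>x. of_real (c x) * f x) \<in> borel_measurable ballL" by (rule cut_measurable[OF m])
    show "AE x in ballL. norm (cut R (\<lambda>x. of_real (c x) * f x) x) \<le> B * norm (cut R f x)"
      using B by (intro AE_I2) (auto simp: indicator_def norm_mult intro: mult_right_mono)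
  qed
qed

lemma loc2_add: "loc2 f \<Longrightarrow> loc2 g \<Longrightarrow> loc2 (\<lambda>x. f x + g x)"
  by (simp add: loc2_def distrib_left square_integrable_add borel_measurable_add)

lemma loc2_uminus: "loc2 f \<Longrightarrow> loc2 (\<lambda>x. - f x)"
  by (simp add: loc2_def square_integrable_uminus)

lemma loc2_diff: "loc2 f \<Longrightarrow> loc2 g \<Longrightarrow> loc2 (\<lambda>x. f x - g x)"
  using loc2_add[OF _ loc2_uminus, of f g] by simp

lemma loc2_sum: "(\<And>i. i \<in> I \<Longrightarrow> loc2 (f i)) \<Longrightarrow> loc2 (\<lambda>x. \<Sum>i\<in>I. f i x)"
proof (induction I rule: infinite_finite_induct)
  case (insert i I)
  then show ?case by (simp add: loc2_add)
qed (simp_all add: loc2_def square_integrable_def)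

lemma square_integrable_hypV_loc2:
  fixes f :: "real^'n::finite \<Rightarrow> complex"
  assumes "f \<in> square_integrable hypV"
  shows "loc2 f"
proof -
  have fm [measurable]: "f \<in> borel_measurable ballL" using square_integrableD(1)[OF assms] by simp
  have i: "integrable ballL (\<lambda>x. conf x ^ CARD('n) *\<^sub>R (norm (f x))\<^sup>2)"
    using square_integrableD(2)[OF assms] hypV_integral(2)[of "\<lambda>x. (norm (f x))\<^sup>2"] by simp
  have "integrable ballL (\<lambda>x. (norm (f x))\<^sup>2)"
  proof (rule Bochner_Integration.integrable_bound[OF i])
    show "AE x in ballL. norm ((norm (f x))\<^sup>2) \<le> norm (conf x ^ CARD('n) *\<^sub>R (norm (f x))\<^sup>2)"
    proof (rule AE_I2)
      fix x :: "real^'n" assume "x \<in> space ballL"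
      then have "1 \<le> conf x ^ CARD('n)" using conf_ge_2[of x] by (intro one_le_power) simp
      then have "1 * (norm (f x))\<^sup>2 \<le> conf x ^ CARD('n) * (norm (f x))\<^sup>2" by (intro mult_right_mono) auto
      then show "norm ((norm (f x))\<^sup>2) \<le> norm (conf x ^ CARD('n) *\<^sub>R (norm (f x))\<^sup>2)" by simp
    qed
  qed measurable
  then have f: "f \<in> square_integrable ballL" using fm by (simp add: square_integrable_def)
  have "cut R f \<in> square_integrable ballL" for R
    by (rule square_integrable_bound[OF f cut_measurable[OF fm], of _ 1]) (auto simp: indicator_def)
  with fm show ?thesis by (simp add: loc2_def)
qed

abbreviation rsq :: "real^'n::finite \<Rightarrow> real" where "rsq x \<equiv> x \<bullet> x"

definition vfield :: "('n::finite \<Rightarrow> real^'n \<Rightarrow> complex) \<Rightarrow> real^'n \<Rightarrow> complex" where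
  "vfield w x = of_real (vcoef CARD('n) (rsq x)) * (\<Sum>i\<in>UNIV. of_real (x $ i) * w i x)"

lemma vfield_diff: "vfield (\<lambda>i x. w i x - v i x) x = vfield w x - vfield v x"
  by (simp add: vfield_def right_diff_distrib sum_subtractf)

text \<open>The Laplace--Beltrami operator of the ball metric, as a function of first and second derivatives that
  need not be the ones chosen by \<^const>\<open>weak_partial\<close>.\<close>

definition lap :: "('n::finite \<Rightarrow> real^'n \<Rightarrow> complex) \<Rightarrow> ('n \<Rightarrow> 'n \<Rightarrow> real^'n \<Rightarrow> complex) \<Rightarrow> real^'n \<Rightarrow> complex" where
  "lap w W x = ((\<Sum>i\<in>UNIV. W i i x) + of_real ((real CARD('n) - 2) * conf x) * (\<Sum>i\<in>UNIV. of_real (x $ i) * w i x)) / of_real ((conf x)\<^sup>2)"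

text \<open>What the integral identities use about a function \<open>f\<close> in \<open>H\<^sup>2\<close> with gradient \<open>w\<close> and second derivatives \<open>W\<close>.
  Dividing \<open>w\<close> by the conformal factor gives the hyperbolic length of the gradient.  Both orders of
  differentiation are recorded, so the second derivatives commute by fiat.\<close>

definition h2data :: "(real^'n::finite \<Rightarrow> complex) \<Rightarrow> ('n \<Rightarrow> real^'n \<Rightarrow> complex) \<Rightarrow> ('n \<Rightarrow> 'n \<Rightarrow> real^'n \<Rightarrow> complex) \<Rightarrow> bool" where
  "h2data f w W \<longleftrightarrow> f \<in> square_integrable hypV \<and> (\<forall>i. (\<lambda>x. w i x / of_real (conf x)) \<in> square_integrable hypV) \<and>
     (\<forall>i j. loc2 (W i j)) \<and> (\<forall>i. weakp i f (w i)) \<and> (\<forall>i j. weakp i (w j) (W i j)) \<and> (\<forall>i j. weakp i (w j) (W j i)) \<and>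
     lap w W \<in> square_integrable hypV"

lemma h2data_loc2:
  assumes "h2data f w W"
  shows "loc2 f" "loc2 (w i)" "loc2 (W i j)"
proof -
  show "loc2 f" using assms by (auto simp: h2data_def intro: square_integrable_hypV_loc2)
  show "loc2 (W i j)" using assms by (auto simp: h2data_def)
  have l: "loc2 (\<lambda>x. w i x / of_real (conf x))" using assms by (auto simp: h2data_def intro: square_integrable_hypV_loc2)
  have "loc2 (\<lambda>x. of_real (conf x) * (w i x / of_real (conf x)))"
    by (rule loc2_continuous_mult[OF l continuous_on_conf])
  moreover have "w i \<in> borel_measurable ballL" using assms by (auto simp: h2data_def weakp_def)
  moreover have "cut R (\<lambda>x. of_real (conf x) * (w i x / of_real (conf x))) \<in> square_integrable ballL \<longleftrightarrow> cut R (w i) \<in> square_integrable ballL" for R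
  proof -
    have eq: "AE x in ballL. cut R (\<lambda>x. of_real (conf x) * (w i x / of_real (conf x))) x = cut R (w i) x"
    proof (rule AE_I2)
      fix x :: "real^'a" assume "x \<in> space ballL"
      then have "conf x \<noteq> 0" using conf_pos[of x] by simp
      then show "cut R (\<lambda>x. of_real (conf x) * (w i x / of_real (conf x))) x = cut R (w i) x" by simp
    qed
    have m: "cut R (w i) \<in> borel_measurable ballL" "cut R (\<lambda>x. of_real (conf x) * (w i x / of_real (conf x))) \<in> borel_measurable ballL"
      using \<open>w i \<in> borel_measurable ballL\<close> \<open>loc2 (\<lambda>x. of_real (conf x) * (w i x / of_real (conf x)))\<close>
      by (auto simp: loc2_def intro!: cut_measurable)
    have eq': "AE x in ballL. cut R (w i) x = cut R (\<lambda>x. of_real (conf x) * (w i x / of_real (conf x))) x"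
      using eq by eventually_elim (rule sym)
    show ?thesis
      by (rule iffI, erule square_integrable_cong_AE[OF _ m(1) eq], erule square_integrable_cong_AE[OF _ m(2) eq'])
  qed
  ultimately show "loc2 (w i)" by (simp add: loc2_def)
qed

lemma h2dataD:
  assumes "h2data f w W"
  shows "f \<in> square_integrable hypV" "(\<lambda>x. w i x / of_real (conf x)) \<in> square_integrable hypV"
    "weakp i f (w i)" "weakp i (w j) (W i j)" "weakp i (w j) (W j i)" "lap w W \<in> square_integrable hypV"
    "f \<in> borel_measurable ballL" "w i \<in> borel_measurable ballL" "W i j \<in> borel_measurable ballL"
  using assms by (auto simp: h2data_def weakp_def)

lemma conf_power_deriv:
  assumes "s < 1"
  shows "((\<lambda>s. (2 / (1 - s)) ^ m) has_real_derivative real m * (2 / (1 - s)) ^ m / (1 - s)) (at s)"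
proof -
  have "((\<lambda>s. 1 - s) has_real_derivative - 1) (at s)" by (auto intro!: derivative_eq_intros)
  from DERIV_cmult[OF inverse_power_deriv[OF this, of m], of "2 ^ m"] assms
  show ?thesis by (simp add: power_divide mult.commute)
qed

lemma coef_conf_power:
  "coef_deriv i (\<lambda>x::real^'n::finite. conf x ^ m) (\<lambda>x. 2 * x $ i * (real m * conf x ^ m / (1 - rsq x)))"
  unfolding conf_def
  by (rule coef_deriv_radial[OF conf_power_deriv]) (auto intro!: continuous_intros)

lemma coef_conf_vcoef:
  assumes n: "n \<ge> 1"
  shows "coef_deriv i (\<lambda>x::real^'n::finite. (conf x ^ m * vcoef n (rsq x)) * x $ k)
    (\<lambda>x. (conf x ^ m * vcoef n (rsq x)) * (if i = k then 1 else 0)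
       + 2 * x $ i * (conf x ^ m * (dvcoef n (rsq x) + real m * vcoef n (rsq x) / (1 - rsq x))) * x $ k)"
  unfolding conf_def
proof (rule coef_deriv_radial_coord)
  fix s :: real assume s: "0 \<le> s" "s < 1"
  from DERIV_mult[OF conf_power_deriv[OF s(2), of m] vcoef_deriv[OF s(2) n]]
  show "((\<lambda>s. (2 / (1 - s)) ^ m * vcoef n s) has_real_derivative
      (2 / (1 - s)) ^ m * (dvcoef n s + real m * vcoef n s / (1 - s))) (at s)"
    by (simp add: algebra_simps)
next
  have "continuous_on {0..<1} (vcoef n)"
    by (rule continuous_at_imp_continuous_on) (auto intro!: DERIV_isCont vcoef_deriv n)
  then show "continuous_on {0..<1} (\<lambda>s. (2 / (1 - s)) ^ m * (dvcoef n s + real m * vcoef n s / (1 - s)))"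
    by (intro continuous_intros dvcoef_continuous) auto
qed

lemma ball_rsq: "norm x < 1 \<Longrightarrow> 0 \<le> rsq x \<and> rsq x < 1"
  for x :: "real^'n::finite"
  using one_minus_pos[of x] by simp

lemma conf_minus: "norm x < 1 \<Longrightarrow> 1 / (1 - rsq x) = conf x / 2"
  for x :: "real^'n::finite"
  using one_minus_pos[of x] by (simp add: conf_def frac_eq_eq)

lemma hypV_inner_integral:
  fixes f g :: "real^'n::finite \<Rightarrow> complex"
  assumes "f \<in> square_integrable hypV" "g \<in> square_integrable hypV"
  shows "l2inner hypV f g = (LINT x|ballL. of_real (conf x ^ CARD('n)) * (f x * cnj (g x)))"
    and "integrable ballL (\<lambda>x. of_real (conf x ^ CARD('n)) * (f x * cnj (g x)))"
proof -
  have m: "(\<lambda>x. f x * cnj (g x)) \<in> borel_measurable ballL"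
    using square_integrableD(1)[OF assms(1)] square_integrableD(1)[OF assms(2)] by simp
  show "l2inner hypV f g = (LINT x|ballL. of_real (conf x ^ CARD('n)) * (f x * cnj (g x)))"
    unfolding l2inner_def using hypV_integral(1)[OF m] by (simp add: scaleR_conv_of_real)
  show "integrable ballL (\<lambda>x. of_real (conf x ^ CARD('n)) * (f x * cnj (g x)))"
    using hypV_integral(2)[OF m] integrable_prod_cnj[OF assms] by (simp add: scaleR_conv_of_real)
qed

text \<open>The divergence theorem for the field \<open>f cnj(\<nabla>g)\<close>.  In ball coordinates its flux density carries the
  factor \<open>conf\<^sup>n\<^sup>-\<^sup>2\<close>, which is where the first order term of the Laplacian comes from.\<close>

lemma green_formula:
  fixes f g :: "real^'n::finite \<Rightarrow> complex"
  assumes n: "CARD('n) \<ge> 2" and f: "h2data f w W" and g: "h2data g v V"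
  shows "(\<Sum>i\<in>UNIV. l2inner hypV (\<lambda>x. w i x / of_real (conf x)) (\<lambda>x. v i x / of_real (conf x))) = - l2inner hypV f (lap v V)"
proof -
  define m where "m = CARD('n) - 2"
  have m: "CARD('n) = m + 2" "real CARD('n) - 2 = real m" using n by (auto simp: m_def)
  define Z where "Z i x = of_real (conf x ^ m) * (f x * cnj (v i x))" for i x
  define D where "D i x = of_real (2 * x $ i * (real m * conf x ^ m / (1 - rsq x))) * (f x * cnj (v i x))
     + of_real (conf x ^ m) * (w i x * cnj (v i x)) + of_real (conf x ^ m) * (f x * cnj (V i i x))" for i x
  have wd: "wdiv i (Z i) (D i)" for i
    unfolding Z_def D_def
    by (rule wdiv_product[OF h2data_loc2(1)[OF f] h2data_loc2(2)[OF f] h2dataD(3)[OF f]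
          h2data_loc2(2)[OF g] h2data_loc2(3)[OF g] h2dataD(4)[OF g] coef_conf_power])
  define P where "P x = of_real (conf x ^ CARD('n)) * (f x * cnj (lap v V x))" for x
  define Q where "Q i x = of_real (conf x ^ CARD('n)) * ((w i x / of_real (conf x)) * cnj (v i x / of_real (conf x)))" for i x
  have eq: "(\<Sum>i\<in>UNIV. D i x) = P x + (\<Sum>i\<in>UNIV. Q i x)" if x: "x \<in> space ballL" for x
  proof -
    define l where "l = complex_of_real (conf x)"
    have l: "l \<noteq> 0" using conf_pos[of x] x by (simp add: l_def)
    have lc: "cnj l = l" by (simp add: l_def)
    have D: "D i x = l ^ m * (f x * (of_real (real m) * l * cnj (of_real (x $ i) * v i x) + cnj (V i i x)) + w i x * cnj (v i x))" for i
    proof -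
      have "complex_of_real (2 * x $ i * (real m * conf x ^ m / (1 - rsq x))) = of_real (x $ i) * of_real (real m) * l ^ m * l"
        using conf_minus[of x] x by (simp add: l_def conf_def)
      then show ?thesis unfolding D_def by (simp add: l_def algebra_simps)
    qed
    have "(\<Sum>i\<in>UNIV. D i x) = l ^ m * (f x * (of_real (real m) * l * cnj (\<Sum>i\<in>UNIV. of_real (x $ i) * v i x) + cnj (\<Sum>i\<in>UNIV. V i i x)) + (\<Sum>i\<in>UNIV. w i x * cnj (v i x)))"
      unfolding D by (simp add: sum_distrib_left sum.distrib cnj_sum algebra_simps)
    also have "\<dots> = P x + (\<Sum>i\<in>UNIV. Q i x)"
    proof -
      have "P x = l ^ m * (f x * (of_real (real m) * l * cnj (\<Sum>i\<in>UNIV. of_real (x $ i) * v i x) + cnj (\<Sum>i\<in>UNIV. V i i x)))"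
        unfolding P_def lap_def m using l by (simp add: l_def[symmetric] lc power_add power2_eq_square field_simps)
      moreover have "Q i x = l ^ m * (w i x * cnj (v i x))" for i
        unfolding Q_def m using l by (simp add: l_def[symmetric] lc power_add power2_eq_square field_simps)
      ultimately show ?thesis by (simp add: sum_distrib_left algebra_simps)
    qed
    finally show ?thesis .
  qed
  note iP = hypV_inner_integral[OF h2dataD(1)[OF f] h2dataD(6)[OF g]]
  note iQ = hypV_inner_integral[OF h2dataD(2)[OF f] h2dataD(2)[OF g]]
  have iPQ: "integrable ballL (\<lambda>x. P x + (\<Sum>i\<in>UNIV. Q i x))"
    unfolding P_def Q_def using iP(2) iQ(2) by (intro Bochner_Integration.integrable_add Bochner_Integration.integrable_sum)
  have "(LINT x|ballL. (\<Sum>i\<in>UNIV. D i x)) = 0"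
  proof (rule wdiv_integral_zero[OF wd])
    show "integrable ballL (\<lambda>x. \<Sum>i\<in>UNIV. D i x)"
      by (subst Bochner_Integration.integrable_cong[OF refl eq]) (use iPQ in auto)
    show "integrable ballL (\<lambda>x. of_real (conf x) * Z i x)" for i
    proof (subst Bochner_Integration.integrable_cong[OF refl])
      show "integrable ballL (\<lambda>x. of_real (conf x ^ CARD('n)) * (f x * cnj (v i x / of_real (conf x))))"
        by (rule hypV_inner_integral(2)[OF h2dataD(1)[OF f] h2dataD(2)[OF g]])
      fix x :: "real^'n" assume "x \<in> space ballL"
      then have "conf x \<noteq> 0" using conf_pos[of x] by simp
      then show "of_real (conf x) * Z i x = of_real (conf x ^ CARD('n)) * (f x * cnj (v i x / of_real (conf x)))"
        unfolding Z_def m by (simp add: power_add power2_eq_square field_simps)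
    qed
  qed
  then have "(LINT x|ballL. P x + (\<Sum>i\<in>UNIV. Q i x)) = 0"
    by (subst (asm) Bochner_Integration.integral_cong[OF refl eq]) auto
  then have "(LINT x|ballL. P x) + (\<Sum>i\<in>UNIV. LINT x|ballL. Q i x) = 0"
    unfolding P_def Q_def using iP(2) iQ(2) by (simp add: Bochner_Integration.integrable_sum)
  then show ?thesis using iP(1) iQ(1) unfolding P_def Q_def by (simp add: eq_neg_iff_add_eq_0 add.commute)
qed

section \<open>Virial identities\<close>

text \<open>The coordinate divergence theorem, rewritten for a hyperbolic density \<open>p\<close>.  The bound on \<open>Z\<close> says that
  the hyperbolic length of the flux is dominated by an integrable function \<open>h\<close>.\<close>

lemma divergence_theorem_hyp:
  fixes Z D :: "'n::finite \<Rightarrow> real^'n \<Rightarrow> complex"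
  assumes wd: "\<And>i. wdiv i (Z i) (D i)"
    and eq: "\<And>x. x \<in> space ballL \<Longrightarrow> (\<Sum>i\<in>UNIV. D i x) = of_real (conf x ^ CARD('n)) * p x"
    and p: "integrable hypV p"
    and Zm: "\<And>i. Z i \<in> borel_measurable ballL"
    and Zb: "\<And>i x. x \<in> space ballL \<Longrightarrow> norm (of_real (conf x) * Z i x) \<le> conf x ^ CARD('n) * h x"
    and h: "integrable hypV h"
  shows "(LINT x|hypV. p x) = 0"
proof -
  have pm: "p \<in> borel_measurable ballL" and hm: "h \<in> borel_measurable ballL"
    using borel_measurable_integrable[OF p] borel_measurable_integrable[OF h] by simp_all
  have ip: "integrable ballL (\<lambda>x. of_real (conf x ^ CARD('n)) * p x)"
    using p hypV_integral(2)[OF pm] by (simp add: scaleR_conv_of_real)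
  have ih: "integrable ballL (\<lambda>x. conf x ^ CARD('n) * h x)"
    using h hypV_integral(2)[OF hm] by simp
  have "(LINT x|ballL. (\<Sum>i\<in>UNIV. D i x)) = 0"
  proof (rule wdiv_integral_zero[OF wd])
    show "integrable ballL (\<lambda>x. \<Sum>i\<in>UNIV. D i x)"
      by (subst Bochner_Integration.integrable_cong[OF refl eq]) (use ip in auto)
    show "integrable ballL (\<lambda>x. of_real (conf x) * Z i x)" for i
    proof (rule Bochner_Integration.integrable_bound[OF ih])
      show "(\<lambda>x. of_real (conf x) * Z i x) \<in> borel_measurable ballL" using Zm[of i] by measurable
      show "AE x in ballL. norm (of_real (conf x) * Z i x) \<le> norm (conf x ^ CARD('n) * h x)"
        using Zb by (intro AE_I2) (auto intro: order_trans[OF _ abs_ge_self])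
    qed
  qed
  then have "(LINT x|ballL. of_real (conf x ^ CARD('n)) * p x) = 0"
    by (subst (asm) Bochner_Integration.integral_cong[OF refl eq]) auto
  then show ?thesis using hypV_integral(1)[OF pm] by (simp add: scaleR_conv_of_real)
qed

lemma norm_coord_sum_le:
  fixes w :: "'n::finite \<Rightarrow> complex" and x :: "real^'n"
  shows "(norm (\<Sum>i\<in>UNIV. of_real (x $ i) * w i))\<^sup>2 \<le> rsq x * (\<Sum>i\<in>UNIV. (norm (w i))\<^sup>2)"
proof -
  have "norm (\<Sum>i\<in>UNIV. of_real (x $ i) * w i) \<le> (\<Sum>i\<in>UNIV. \<bar>x $ i\<bar> * norm (w i))"
    by (rule order_trans[OF norm_sum]) (simp add: norm_mult)
  then have "(norm (\<Sum>i\<in>UNIV. of_real (x $ i) * w i))\<^sup>2 \<le> (\<Sum>i\<in>UNIV. \<bar>x $ i\<bar> * norm (w i))\<^sup>2"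
    by (intro power_mono) auto
  also have "\<dots> \<le> (\<Sum>i\<in>UNIV. \<bar>x $ i\<bar>\<^sup>2) * (\<Sum>i\<in>UNIV. (norm (w i))\<^sup>2)"
    by (rule Cauchy_Schwarz_ineq_sum)
  also have "(\<Sum>i\<in>UNIV. \<bar>x $ i\<bar>\<^sup>2) = rsq x"
    by (simp add: inner_vec_def power2_eq_square)
  finally show ?thesis .
qed

lemma vcoef_conf_le:
  fixes x :: "real^'n::finite"
  assumes "norm x < 1" "n \<ge> 1"
  shows "(conf x * vcoef n (rsq x))\<^sup>2 * rsq x \<le> 1" "conf x * vcoef n (rsq x) * \<bar>x $ i\<bar> \<le> 1" "0 \<le> vcoef n (rsq x)"
proof -
  have r: "0 \<le> rsq x" "rsq x < 1" using ball_rsq[OF assms(1)] by auto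
  show a: "0 \<le> vcoef n (rsq x)" by (rule vcoef_bounds(3)[OF r assms(2)])
  show 1: "(conf x * vcoef n (rsq x))\<^sup>2 * rsq x \<le> 1"
    using vcoef_length_le_1[OF r assms(2)] by (simp add: conf_def power_mult_distrib power_divide)
  have "(x $ i)\<^sup>2 \<le> rsq x"
    using power_mono[OF component_le_norm_cart[of x i] abs_ge_zero, of 2] by (simp add: power2_norm_eq_inner)
  then have "(conf x * vcoef n (rsq x) * \<bar>x $ i\<bar>)\<^sup>2 \<le> (conf x * vcoef n (rsq x))\<^sup>2 * rsq x"
    unfolding power_mult_distrib[of _ "\<bar>x $ i\<bar>"] by (intro mult_left_mono) auto
  with 1 have "(conf x * vcoef n (rsq x) * \<bar>x $ i\<bar>)\<^sup>2 \<le> 1\<^sup>2" by simp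
  then show "conf x * vcoef n (rsq x) * \<bar>x $ i\<bar> \<le> 1" by (rule power2_le_imp_le) simp
qed

lemma vfield_bound:
  fixes x :: "real^'n::finite"
  assumes "norm x < 1"
  shows "(norm (vfield w x))\<^sup>2 \<le> (\<Sum>i\<in>UNIV. (norm (w i x / of_real (conf x)))\<^sup>2)"
proof -
  let ?a = "vcoef CARD('n) (rsq x)"
  have n: "CARD('n) \<ge> 1" by (simp add: Suc_leI)
  have cp: "0 < conf x" by (rule conf_pos[OF assms])
  have "(norm (vfield w x))\<^sup>2 = ?a\<^sup>2 * (norm (\<Sum>i\<in>UNIV. of_real (x $ i) * w i x))\<^sup>2"
    by (simp add: vfield_def norm_mult power_mult_distrib)
  also have "\<dots> \<le> ?a\<^sup>2 * (rsq x * (\<Sum>i\<in>UNIV. (norm (w i x))\<^sup>2))"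
    by (intro mult_left_mono norm_coord_sum_le) auto
  also have "\<dots> = ((conf x * ?a)\<^sup>2 * rsq x) * (\<Sum>i\<in>UNIV. (norm (w i x / of_real (conf x)))\<^sup>2)"
    using cp by (simp add: norm_divide power_divide power_mult_distrib flip: sum_divide_distrib)
  also have "\<dots> \<le> 1 * (\<Sum>i\<in>UNIV. (norm (w i x / of_real (conf x)))\<^sup>2)"
    by (intro mult_right_mono vcoef_conf_le[OF assms n]) (auto intro: sum_nonneg)
  finally show ?thesis by simp
qed

lemma vcoef_measurable [measurable]:
  assumes "n \<ge> 1" shows "(\<lambda>x. vcoef n (rsq x)) \<in> borel_measurable (ballL :: (real^'n::finite) measure)"
proof -
  have "coef_deriv (undefined :: 'n) (\<lambda>x. vcoef n (rsq x)) (\<lambda>x. 2 * x $ undefined * dvcoef n (rsq x))"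
    by (rule coef_deriv_radial[OF vcoef_deriv dvcoef_continuous]) (use assms in auto)
  then show ?thesis by (intro continuous_measurable_ballL) (simp add: coef_deriv_def)
qed

lemma coord_measurable [measurable]: "(\<lambda>x. x $ i) \<in> borel_measurable (ballL :: (real^'n::finite) measure)"
  by (rule continuous_measurable_ballL) (intro continuous_intros)

lemma vfield_measurable:
  fixes w :: "'n::finite \<Rightarrow> real^'n \<Rightarrow> complex"
  assumes [measurable]: "\<And>i. w i \<in> borel_measurable ballL"
  shows "vfield w \<in> borel_measurable ballL"
proof -
  have [measurable]: "(\<lambda>x. vcoef CARD('n) (rsq x)) \<in> borel_measurable (ballL :: (real^'n) measure)"
    by (rule vcoef_measurable) (simp add: Suc_leI)
  show ?thesis unfolding vfield_def[abs_def] by measurable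
qed

lemma vfield_square_integrable:
  fixes w :: "'n::finite \<Rightarrow> real^'n \<Rightarrow> complex"
  assumes wm: "\<And>i. w i \<in> borel_measurable ballL"
    and w: "\<And>i. (\<lambda>x. w i x / of_real (conf x)) \<in> square_integrable hypV"
  shows "vfield w \<in> square_integrable hypV"
    and "(l2norm hypV (vfield w))\<^sup>2 \<le> (\<Sum>i\<in>UNIV. (l2norm hypV (\<lambda>x. w i x / of_real (conf x)))\<^sup>2)"
proof -
  have m: "vfield w \<in> borel_measurable hypV" using vfield_measurable[OF wm] by simp
  have i: "integrable hypV (\<lambda>x. \<Sum>i\<in>UNIV. (norm (w i x / of_real (conf x)))\<^sup>2)"
    using w by (intro Bochner_Integration.integrable_sum) (simp add: square_integrable_def)
  have b: "(norm (vfield w x))\<^sup>2 \<le> (\<Sum>i\<in>UNIV. (norm (w i x / of_real (conf x)))\<^sup>2)" if "x \<in> space hypV" for x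
    using vfield_bound[of x w] that by simp
  have "integrable hypV (\<lambda>x. (norm (vfield w x))\<^sup>2)"
    by (rule Bochner_Integration.integrable_bound[OF i])
      (use m b in \<open>auto intro!: AE_I2 order_trans[OF _ abs_ge_self]\<close>)
  then show 1: "vfield w \<in> square_integrable hypV" using m by (simp add: square_integrable_def)
  have "(LINT x|hypV. (norm (vfield w x))\<^sup>2) \<le> (LINT x|hypV. (\<Sum>i\<in>UNIV. (norm (w i x / of_real (conf x)))\<^sup>2))"
    by (rule integral_mono[OF square_integrableD(2)[OF 1] i]) (use b in auto)
  also have "\<dots> = (\<Sum>i\<in>UNIV. (LINT x|hypV. (norm (w i x / of_real (conf x)))\<^sup>2))"
    using w by (intro Bochner_Integration.integral_sum) (simp add: square_integrable_def)
  finally show "(l2norm hypV (vfield w))\<^sup>2 \<le> (\<Sum>i\<in>UNIV. (l2norm hypV (\<lambda>x. w i x / of_real (conf x)))\<^sup>2)"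
    by (simp add: l2norm_power2)
qed

text \<open>The coordinate components of the virial field times the hyperbolic volume density, so that the ordinary
  coordinate divergence of \<open>vflux\<close> is the density times the Riemannian divergence of the field.\<close>

definition vflux :: "'n::finite \<Rightarrow> real^'n \<Rightarrow> real" where
  "vflux i x = conf x ^ CARD('n) * vcoef CARD('n) (rsq x) * x $ i"

definition dvflux :: "'n::finite \<Rightarrow> real^'n \<Rightarrow> real" where
  "dvflux i x = conf x ^ CARD('n) * vcoef CARD('n) (rsq x)
     + 2 * (x $ i)\<^sup>2 * (conf x ^ CARD('n) * (dvcoef CARD('n) (rsq x) + real CARD('n) * vcoef CARD('n) (rsq x) / (1 - rsq x)))"

lemma coef_deriv_vflux:
  fixes i :: "'n::finite"
  shows "coef_deriv i (vflux i) (dvflux i)"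
  by (rule coef_deriv_cong[OF coef_conf_vcoef[of "CARD('n)" i "CARD('n)" i]])
    (simp_all add: vflux_def dvflux_def power2_eq_square Suc_leI)

lemma vflux_divergence:
  fixes x :: "real^'n::finite"
  assumes "norm x < 1"
  shows "(\<Sum>i\<in>UNIV. dvflux i x) = (real CARD('n) - 1) * conf x ^ CARD('n)"
proof -
  define s a d n where "s = rsq x" and "a = vcoef CARD('n) s" and "d = dvcoef CARD('n) s" and "n = real CARD('n)"
  have s: "s < 1" using ball_rsq[OF assms] by (simp add: s_def)
  have n1: "CARD('n) \<ge> 1" by (simp add: Suc_leI)
  have ode: "2 * s * (1 - s) * d = (n - 1) * (1 - s) - n * (1 + s) * a"
    using vcoef_ode[OF s n1] by (simp add: d_def a_def n_def)
  have "(\<Sum>i\<in>UNIV. h + 2 * (x $ i)\<^sup>2 * k) = n * h + 2 * k * s" for h k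
    by (simp add: sum.distrib n_def s_def inner_vec_def sum_distrib_left power2_eq_square mult_ac)
  then have "(\<Sum>i\<in>UNIV. dvflux i x) = n * (conf x ^ CARD('n) * a) + 2 * (conf x ^ CARD('n) * (d + n * a / (1 - s))) * s"
    unfolding dvflux_def a_def d_def n_def s_def .
  also have "\<dots> = conf x ^ CARD('n) * (n * a + 2 * s * d + 2 * s * n * a / (1 - s))"
    by (simp add: algebra_simps)
  also have "n * a + 2 * s * d + 2 * s * n * a / (1 - s) = n - 1"
  proof -
    have "(n * a + 2 * s * d + 2 * s * n * a / (1 - s)) * (1 - s) = n * a * (1 - s) + 2 * s * (1 - s) * d + 2 * s * n * a"
      using s by (simp add: field_simps)
    also have "\<dots> = (n - 1) * (1 - s)" unfolding ode by (simp add: algebra_simps)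
    finally show ?thesis using s by simp
  qed
  finally show ?thesis by (simp add: n_def)
qed

lemma vflux_bound:
  fixes x :: "real^'n::finite"
  assumes "norm x < 1"
  shows "conf x * \<bar>vflux i x\<bar> \<le> conf x ^ CARD('n)"
proof -
  have c: "0 \<le> conf x" using conf_pos[OF assms] by simp
  have n1: "CARD('n) \<ge> 1" by (simp add: Suc_leI)
  note v = vcoef_conf_le(2,3)[OF assms n1]
  have "conf x * \<bar>vflux i x\<bar> = conf x ^ CARD('n) * (conf x * vcoef CARD('n) (rsq x) * \<bar>x $ i\<bar>)"
    using c v(2) by (simp add: vflux_def abs_mult power_abs mult_ac)
  also have "\<dots> \<le> conf x ^ CARD('n) * 1" using c by (intro mult_left_mono v(1)) auto
  finally show ?thesis by simp
qed

lemma vflux_measurable [measurable]: "vflux i \<in> borel_measurable (ballL :: (real^'n::finite) measure)"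
proof -
  have [measurable]: "(\<lambda>x. vcoef CARD('n) (rsq x)) \<in> borel_measurable (ballL :: (real^'n) measure)"
    by (rule vcoef_measurable) (simp add: Suc_leI)
  show ?thesis unfolding vflux_def[abs_def] by measurable
qed

lemma sum_vflux: "(\<Sum>i\<in>UNIV. of_real (vflux i x) * w i x) = of_real (conf x ^ CARD('n)) * vfield w x"
  for x :: "real^'n::finite"
  by (simp add: vflux_def vfield_def sum_distrib_left mult_ac)

text \<open>The divergence theorem for \<open>f cnj(g) X\<close>: the adjoint of \<open>X\<close> is \<open>- X - (n - 1)\<close>.\<close>

lemma vfield_integration_by_parts:
  fixes f g :: "real^'n::finite \<Rightarrow> complex"
  assumes f: "h2data f w W" and g: "h2data g v V"
  shows "l2inner hypV (vfield w) g + l2inner hypV f (vfield v) = - of_real (real CARD('n) - 1) * l2inner hypV f g"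
proof -
  let ?n = "CARD('n)"
  define Z where "Z i x = of_real (vflux i x) * (f x * cnj (g x))" for i x
  define D where "D i x = of_real (dvflux i x) * (f x * cnj (g x)) + of_real (vflux i x) * (w i x * cnj (g x))
      + of_real (vflux i x) * (f x * cnj (v i x))" for i x
  define p where "p x = of_real (real ?n - 1) * (f x * cnj (g x)) + vfield w x * cnj (g x) + f x * cnj (vfield v x)" for x
  note vw = vfield_square_integrable(1)[OF h2dataD(8)[OF f] h2dataD(2)[OF f]]
  note vv = vfield_square_integrable(1)[OF h2dataD(8)[OF g] h2dataD(2)[OF g]]
  note fsq = h2dataD(1)[OF f] and gsq = h2dataD(1)[OF g]
  note [measurable] = h2dataD(7)[OF f] h2dataD(7)[OF g]
  note ints = integrable_prod_cnj[OF fsq gsq] integrable_prod_cnj[OF vw gsq] integrable_prod_cnj[OF fsq vv]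
  have "(LINT x|hypV. p x) = 0"
  proof (rule divergence_theorem_hyp)
    show "wdiv i (Z i) (D i)" for i
      unfolding Z_def D_def
      by (rule wdiv_product[OF h2data_loc2(1,2)[OF f] h2dataD(3)[OF f] h2data_loc2(1,2)[OF g] h2dataD(3)[OF g] coef_deriv_vflux])
    show "integrable hypV p" unfolding p_def using ints by simp
    show "Z i \<in> borel_measurable ballL" for i unfolding Z_def by measurable
    show "integrable hypV (\<lambda>x. norm (f x * cnj (g x)))" using ints(1) by (rule integrable_norm)
    show "(\<Sum>i\<in>UNIV. D i x) = of_real (conf x ^ ?n) * p x" if x: "x \<in> space ballL" for x
    proof -
      have "(\<Sum>i\<in>UNIV. D i x) = of_real (\<Sum>i\<in>UNIV. dvflux i x) * (f x * cnj (g x))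
          + (\<Sum>i\<in>UNIV. of_real (vflux i x) * w i x) * cnj (g x) + f x * cnj (\<Sum>i\<in>UNIV. of_real (vflux i x) * v i x)"
        by (simp add: D_def sum.distrib sum_distrib_right sum_distrib_left cnj_sum mult_ac)
      moreover have "(\<Sum>i\<in>UNIV. dvflux i x) = (real ?n - 1) * conf x ^ ?n" using x by (intro vflux_divergence) simp
      ultimately show ?thesis unfolding sum_vflux by (simp add: p_def algebra_simps)
    qed
    show "norm (of_real (conf x) * Z i x) \<le> conf x ^ ?n * norm (f x * cnj (g x))" if x: "x \<in> space ballL" for i x
    proof -
      have nx: "norm x < 1" using x by simp
      have "norm (of_real (conf x) * Z i x) = (conf x * \<bar>vflux i x\<bar>) * norm (f x * cnj (g x))"
        using conf_pos[OF nx] by (simp add: Z_def norm_mult)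
      also have "\<dots> \<le> conf x ^ ?n * norm (f x * cnj (g x))" by (intro mult_right_mono vflux_bound nx) simp
      finally show ?thesis .
    qed
  qed
  moreover have "(LINT x|hypV. p x) = of_real (real ?n - 1) * l2inner hypV f g + l2inner hypV (vfield w) g + l2inner hypV f (vfield v)"
    unfolding p_def l2inner_def using ints by simp
  ultimately show ?thesis by (simp add: eq_neg_iff_add_eq_0 algebra_simps)
qed

text \<open>The weak chain rule with the cutoff absorbed into the coefficient \<open>c\<close>.\<close>

lemma wdiv_chain:
  fixes f w :: "real^'n::finite \<Rightarrow> complex"
    and G :: "complex \<Rightarrow> real" and N :: "complex \<Rightarrow> complex"
  assumes G: "\<And>z. (G has_derivative (\<lambda>h. Re (cnj (N z) * h))) (at z)" "G 0 = 0"
    and N: "\<And>z z'. norm (N z - N z') \<le> L * norm (z - z')" "N 0 = 0"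
    and f: "loc2 f" "loc2 w" "weakp i f w" and c: "coef_deriv i c dc"
  shows "wdiv i (\<lambda>x. of_real (c x * G (f x))) (\<lambda>x. of_real (dc x * G (f x) + c x * Re (w x * cnj (N (f x)))))"
  unfolding wdiv_def
proof
  fix k
  define R where "R = cutoff_radius k"
  have R: "R < 1" by (simp add: R_def cutoff_radius)
  define C dC C1 C2 where "C x = cutoff k x * c x" and "dC x = cutoff k x * dc x + dcutoff k i x * c x"
    and "C1 x = cutoff k x * dc x" and "C2 x = dcutoff k i x * c x" for x
  have z: "C x = 0" "dC x = 0" "C1 x = 0" "C2 x = 0" if "R < norm x" for x
    using cutoff_zero[of k x] that by (auto simp: C_def dC_def C1_def C2_def R_def)
  have cd: "coef_deriv i C dC" unfolding C_def dC_def by (rule coef_deriv_mult[OF cutoff_coef c])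
  obtain B where B: "pderiv_along i C dC" "C \<in> borel_measurable borel" "dC \<in> borel_measurable borel"
      "\<And>x. \<bar>C x\<bar> \<le> B" "\<And>x. \<bar>dC x\<bar> \<le> B"
    by (rule coef_deriv_compact_support[OF cd R]) (erule z(1), erule z(2), rule that)
  have cc: "continuous_on (ball 0 1) (cutoff k :: real^'n \<Rightarrow> real)" "continuous_on (ball 0 1) (dcutoff k i)" "continuous_on (ball 0 1) c" "continuous_on (ball 0 1) dc"
    using cutoff_coef[of i k] c by (auto simp: coef_deriv_def)
  obtain B1 where B1: "C1 \<in> borel_measurable borel" "\<And>x. \<bar>C1 x\<bar> \<le> B1"
    by (rule continuous_compact_support[of C1, OF _ R z(3)]) (use cc in \<open>auto simp: C1_def[abs_def] intro!: continuous_intros\<close>)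
  obtain B2 where B2: "C2 \<in> borel_measurable borel" "\<And>x. \<bar>C2 x\<bar> \<le> B2"
    by (rule continuous_compact_support[of C2, OF _ R z(4)]) (use cc in \<open>auto simp: C2_def[abs_def] intro!: continuous_intros\<close>)
  have fR: "cut R f \<in> square_integrable ballL" and wR: "cut R w \<in> square_integrable ballL" using f R by (auto simp: loc2_def)
  have i1: "integrable ballL (\<lambda>x. C1 x * G (cut R f x))"
    by (rule l2_tendsto_potential(2)[OF G N l2_tendsto_const[OF fR, of sequentially] ballL_borel[OF B1(1)] B1(2) fR])
  have i2: "integrable ballL (\<lambda>x. C2 x * G (cut R f x))"
    by (rule l2_tendsto_potential(2)[OF G N l2_tendsto_const[OF fR, of sequentially] ballL_borel[OF B2(1)] B2(2) fR])
  have NR: "(\<lambda>x. N (cut R f x)) \<in> square_integrable ballL"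
    using l2_tendsto_lipschitz[OF l2_tendsto_const[OF fR, of sequentially] N] by (simp add: l2_tendsto_def)
  have Cm: "(\<lambda>x. complex_of_real (C x)) \<in> borel_measurable ballL" using B(2) by (auto intro!: ballL_borel)
  have CwR: "(\<lambda>x. of_real (C x) * cut R w x) \<in> square_integrable ballL"
    by (rule square_integrable_bound[OF wR, of _ B])
      (use Cm wR B(4) in \<open>auto simp: norm_mult square_integrable_def intro!: mult_right_mono\<close>)
  note i3c = integrable_prod_cnj[OF CwR NR]
  have i3: "integrable ballL (\<lambda>x. Re (of_real (C x) * cut R w x * cnj (N (cut R f x))))"
    using i3c by (rule integrable_Re)
  have e1: "cutoff k x * (dc x * G (f x) + c x * Re (w x * cnj (N (f x)))) = C1 x * G (cut R f x) + Re (of_real (C x) * cut R w x * cnj (N (cut R f x)))" for x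
  proof (cases "norm x \<le> R")
    case True
    then show ?thesis by (simp add: C1_def C_def algebra_simps)
  next
    case False
    then show ?thesis using cutoff_zero[of k x] by (simp add: C1_def C_def R_def)
  qed
  have e2: "dcutoff k i x * (c x * G (f x)) = C2 x * G (cut R f x)" for x
  proof (cases "norm x \<le> R")
    case True
    then show ?thesis by (simp add: C2_def)
  next
    case False
    then show ?thesis using cutoff_zero[of k x] by (simp add: C2_def R_def)
  qed
  have e3: "dC x * G (cut R f x) = C1 x * G (cut R f x) + C2 x * G (cut R f x)" for x
    by (simp add: dC_def C1_def C2_def algebra_simps)
  have zz: "R < norm x \<Longrightarrow> C x = 0" "R < norm x \<Longrightarrow> dC x = 0" for x by (fact z)+
  have "(LINT x|ballL. dC x * G (cut R f x)) + Re (l2inner ballL (\<lambda>x. of_real (C x) * cut R w x) (\<lambda>x. N (cut R f x))) = 0"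
    by (rule weak_chain_rule[OF G N f R B zz])
  then have s: "(LINT x|ballL. C1 x * G (cut R f x)) + (LINT x|ballL. C2 x * G (cut R f x))
      + (LINT x|ballL. Re (of_real (C x) * cut R w x * cnj (N (cut R f x)))) = 0"
    unfolding e3 l2inner_def integral_Re[OF i3c, symmetric] using i1 i2 by simp
  have r1: "of_real (cutoff k x) * complex_of_real (dc x * G (f x) + c x * Re (w x * cnj (N (f x))))
     = complex_of_real (C1 x * G (cut R f x) + Re (of_real (C x) * cut R w x * cnj (N (cut R f x))))" for x
    unfolding e1[symmetric] by simp
  have r2: "of_real (dcutoff k i x) * complex_of_real (c x * G (f x)) = complex_of_real (C2 x * G (cut R f x))" for x
    unfolding e2[symmetric] by simp
  have i13: "integrable ballL (\<lambda>x. C1 x * G (cut R f x) + Re (of_real (C x) * cut R w x * cnj (N (cut R f x))))"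
    using i1 i3 by (rule Bochner_Integration.integrable_add)
  have "(LINT x|ballL. C1 x * G (cut R f x) + Re (of_real (C x) * cut R w x * cnj (N (cut R f x)))) = - (LINT x|ballL. C2 x * G (cut R f x))"
    using s Bochner_Integration.integral_add[OF i1 i3] by linarith
  then show "integrable ballL (\<lambda>x. of_real (cutoff k x) * complex_of_real (dc x * G (f x) + c x * Re (w x * cnj (N (f x))))) \<and>
      integrable ballL (\<lambda>x. of_real (dcutoff k i x) * complex_of_real (c x * G (f x))) \<and>
      (LINT x|ballL. of_real (cutoff k x) * complex_of_real (dc x * G (f x) + c x * Re (w x * cnj (N (f x)))))
        = - (LINT x|ballL. of_real (dcutoff k i x) * complex_of_real (c x * G (f x)))"
    unfolding r1 r2 using integrable_of_real[OF i13] integrable_of_real[OF i2]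
    by (simp only: integral_complex_of_real of_real_minus simp_thms)
qed

text \<open>Along \<open>X\<close> the function \<open>G(f)\<close> has derivative \<open>Re (X f cnj(N f))\<close>, so this is the divergence theorem for \<open>G(f) X\<close>.\<close>

lemma vfield_potential:
  fixes f :: "real^'n::finite \<Rightarrow> complex"
    and G :: "complex \<Rightarrow> real" and N :: "complex \<Rightarrow> complex"
  assumes G: "\<And>z. (G has_derivative (\<lambda>h. Re (cnj (N z) * h))) (at z)" "G 0 = 0"
    and N: "\<And>z z'. norm (N z - N z') \<le> L * norm (z - z')" "N 0 = 0"
    and f: "h2data f w W"
  shows "Re (l2inner hypV (vfield w) (\<lambda>x. N (f x))) = - (real CARD('n) - 1) * (LINT x|hypV. G (f x))"
proof -
  let ?n = "CARD('n)"
  define Z where "Z i x = complex_of_real (vflux i x * G (f x))" for i x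
  define D where "D i x = complex_of_real (dvflux i x * G (f x) + vflux i x * Re (w i x * cnj (N (f x))))" for i x
  define p where "p x = complex_of_real ((real ?n - 1) * G (f x) + Re (vfield w x * cnj (N (f x))))" for x
  note vw = vfield_square_integrable(1)[OF h2dataD(8)[OF f] h2dataD(2)[OF f]]
  note fsq = h2dataD(1)[OF f]
  have Nsq: "(\<lambda>x. N (f x)) \<in> square_integrable hypV"
    using l2_tendsto_lipschitz[OF l2_tendsto_const[OF fsq, of sequentially] N] by (simp add: l2_tendsto_def)
  have Gi: "integrable hypV (\<lambda>x. G (f x))"
    using l2_tendsto_potential(2)[OF G N l2_tendsto_const[OF fsq, of sequentially] _ _ fsq, of "\<lambda>_. 1" 1] by simp
  note vNi = integrable_prod_cnj[OF vw Nsq]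
  have Gm: "(\<lambda>x. G (f x)) \<in> borel_measurable ballL" using borel_measurable_integrable[OF Gi] by simp
  have "(LINT x|hypV. p x) = 0"
  proof (rule divergence_theorem_hyp)
    show "wdiv i (Z i) (D i)" for i
      unfolding Z_def D_def
      by (rule wdiv_chain[OF G N h2data_loc2(1,2)[OF f] h2dataD(3)[OF f] coef_deriv_vflux])
    show "integrable hypV p" unfolding p_def using Gi integrable_Re[OF vNi]
      by (intro integrable_of_real Bochner_Integration.integrable_add integrable_mult_right)
    show "Z i \<in> borel_measurable ballL" for i unfolding Z_def using Gm by measurable
    show "integrable hypV (\<lambda>x. \<bar>G (f x)\<bar>)" using Gi by simp
    show "(\<Sum>i\<in>UNIV. D i x) = of_real (conf x ^ ?n) * p x" if x: "x \<in> space ballL" for x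
    proof -
      have "(\<Sum>i\<in>UNIV. vflux i x * Re (w i x * cnj (N (f x)))) = Re ((\<Sum>i\<in>UNIV. of_real (vflux i x) * w i x) * cnj (N (f x)))"
        unfolding sum_distrib_right Re_sum mult.assoc by simp
      also have "\<dots> = conf x ^ ?n * Re (vfield w x * cnj (N (f x)))"
        unfolding sum_vflux mult.assoc by simp
      finally have "(\<Sum>i\<in>UNIV. D i x) = of_real ((\<Sum>i\<in>UNIV. dvflux i x) * G (f x) + conf x ^ ?n * Re (vfield w x * cnj (N (f x))))"
        by (simp only: D_def of_real_sum[symmetric] sum.distrib sum_distrib_right)
      moreover have "(\<Sum>i\<in>UNIV. dvflux i x) = (real ?n - 1) * conf x ^ ?n" using x by (intro vflux_divergence) simp
      ultimately show ?thesis by (simp add: p_def algebra_simps)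
    qed
    show "norm (of_real (conf x) * Z i x) \<le> conf x ^ ?n * \<bar>G (f x)\<bar>" if x: "x \<in> space ballL" for i x
    proof -
      have nx: "norm x < 1" using x by simp
      have "norm (of_real (conf x) * Z i x) = (conf x * \<bar>vflux i x\<bar>) * \<bar>G (f x)\<bar>"
        using conf_pos[OF nx] by (simp add: Z_def norm_mult abs_mult)
      also have "\<dots> \<le> conf x ^ ?n * \<bar>G (f x)\<bar>" by (intro mult_right_mono vflux_bound nx) simp
      finally show ?thesis .
    qed
  qed
  then have "(LINT x|hypV. (real ?n - 1) * G (f x) + Re (vfield w x * cnj (N (f x)))) = 0"
    unfolding p_def integral_complex_of_real by (simp only: of_real_eq_0_iff)
  then have "(real ?n - 1) * (LINT x|hypV. G (f x)) + Re (l2inner hypV (vfield w) (\<lambda>x. N (f x))) = 0"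
    unfolding l2inner_def integral_Re[OF vNi, symmetric] using Gi integrable_Re[OF vNi] by simp
  then show ?thesis by linarith
qed

text \<open>The divergence of the stress tensor of \<open>f\<close> contracted with the field \<open>E(x) \<Sum>\<^sub>k x\<^sub>k \<partial>\<^sub>k\<close>.  With the component
  \<open>\<Sum>\<^sub>k E x\<^sub>k (w\<^sub>k cnj(w\<^sub>i) + w\<^sub>i cnj(w\<^sub>k)) - E x\<^sub>i |w|\<^sup>2\<close> in direction \<open>i\<close>, the second derivatives of \<open>f\<close> cancel except
  for the Laplacian \<open>L\<close>.  The number \<open>E1\<close> stands for the derivative of \<open>E\<close> with respect to \<open>x \<bullet> x\<close>.\<close>

lemma pohozaev_algebra:
  fixes w :: "'n::finite \<Rightarrow> complex" and W :: "'n \<Rightarrow> 'n \<Rightarrow> complex" and x :: "real^'n" and E E1 :: real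
  defines "X \<equiv> \<Sum>k\<in>UNIV. of_real (x $ k) * w k" and "S \<equiv> \<Sum>k\<in>UNIV. w k * cnj (w k)" and "L \<equiv> \<Sum>i\<in>UNIV. W i i"
    and "dc \<equiv> \<lambda>i k. E * (if i = k then 1 else 0) + 2 * x $ i * E1 * x $ k"
  shows "(\<Sum>i\<in>UNIV. \<Sum>k\<in>UNIV.
      (of_real (dc i k) * (w k * cnj (w i)) + of_real (E * x $ k) * (W i k * cnj (w i)) + of_real (E * x $ k) * (w k * cnj (W i i)))
    + (of_real (dc i k) * (w i * cnj (w k)) + of_real (E * x $ k) * (W i i * cnj (w k)) + of_real (E * x $ k) * (w i * cnj (W i k)))
    + (- 1) * (of_real (dc i i) * (w k * cnj (w k)) + of_real (E * x $ i) * (W k i * cnj (w k)) + of_real (E * x $ i) * (w k * cnj (W k i))))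
   = of_real E * (X * cnj L + cnj X * L) + 4 * of_real E1 * (X * cnj X) + of_real (2 * E - real CARD('n) * E - 2 * rsq x * E1) * S"
proof -
  have S1: "(\<Sum>i\<in>UNIV. \<Sum>k\<in>UNIV. of_real (dc i k) * (w k * cnj (w i))) = of_real E * S + 2 * of_real E1 * (X * cnj X)"
  proof -
    have "of_real (dc i k) * (w k * cnj (w i)) = (if i = k then of_real E * (w k * cnj (w i)) else 0)
       + 2 * of_real E1 * ((of_real (x $ k) * w k) * cnj (of_real (x $ i) * w i))" for i k
      by (simp add: dc_def algebra_simps)
    then have "(\<Sum>i\<in>UNIV. \<Sum>k\<in>UNIV. of_real (dc i k) * (w k * cnj (w i))) =
       (\<Sum>i\<in>UNIV. of_real E * (w i * cnj (w i))) + 2 * of_real E1 * (\<Sum>i\<in>UNIV. \<Sum>k\<in>UNIV. (of_real (x $ k) * w k) * cnj (of_real (x $ i) * w i))"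
      by (simp add: sum.distrib sum_distrib_left)
    also have "(\<Sum>i\<in>UNIV. \<Sum>k\<in>UNIV. (of_real (x $ k) * w k) * cnj (of_real (x $ i) * w i)) = X * cnj X"
      unfolding X_def cnj_sum by (subst sum.swap) (simp only: sum_product)
    finally show ?thesis by (simp add: S_def sum_distrib_left)
  qed
  have S4: "(\<Sum>i\<in>UNIV. \<Sum>k\<in>UNIV. of_real (dc i k) * (w i * cnj (w k))) = of_real E * S + 2 * of_real E1 * (X * cnj X)"
  proof -
    have "dc i k = dc k i" for i k by (simp add: dc_def)
    then show ?thesis using S1 by (subst sum.swap) simp
  qed
  have S7: "(\<Sum>i\<in>UNIV. \<Sum>k\<in>UNIV. of_real (dc i i) * (w k * cnj (w k))) = of_real (real CARD('n) * E + 2 * rsq x * E1) * S"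
  proof -
    have "(\<Sum>i\<in>UNIV. dc i i) = real CARD('n) * E + 2 * E1 * (\<Sum>i\<in>UNIV. x $ i * x $ i)"
      by (simp add: dc_def sum.distrib sum_distrib_left mult_ac)
    also have "(\<Sum>i\<in>UNIV. x $ i * x $ i) = rsq x" by (simp add: inner_vec_def)
    finally have e: "(\<Sum>i\<in>UNIV. dc i i) = real CARD('n) * E + 2 * rsq x * E1" by simp
    show ?thesis unfolding e[symmetric] S_def of_real_sum by (simp only: sum_product)
  qed
  have S28: "(\<Sum>i\<in>UNIV. \<Sum>k\<in>UNIV. of_real (E * x $ i) * (W k i * cnj (w k))) = (\<Sum>i\<in>UNIV. \<Sum>k\<in>UNIV. of_real (E * x $ k) * (W i k * cnj (w i)))"
    by (rule sum.swap)
  have S69: "(\<Sum>i\<in>UNIV. \<Sum>k\<in>UNIV. of_real (E * x $ i) * (w k * cnj (W k i))) = (\<Sum>i\<in>UNIV. \<Sum>k\<in>UNIV. of_real (E * x $ k) * (w i * cnj (W i k)))"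
    by (rule sum.swap)
  have S3: "(\<Sum>i\<in>UNIV. \<Sum>k\<in>UNIV. of_real (E * x $ k) * (w k * cnj (W i i))) = of_real E * (X * cnj L)"
    unfolding X_def L_def cnj_sum sum_product
    by (subst sum.swap) (simp add: sum_distrib_left mult_ac)
  have S5: "(\<Sum>i\<in>UNIV. \<Sum>k\<in>UNIV. of_real (E * x $ k) * (W i i * cnj (w k))) = of_real E * (cnj X * L)"
    unfolding X_def L_def cnj_sum sum_product
    by (subst sum.swap) (simp add: sum_distrib_left mult_ac)
  have split: "(\<Sum>i\<in>UNIV. \<Sum>k\<in>UNIV. (a1 i k + a2 i k + a3 i k) + (a4 i k + a5 i k + a6 i k) + (- 1) * (a7 i k + a8 i k + a9 i k))
    = ((\<Sum>i\<in>UNIV. \<Sum>k\<in>UNIV. a1 i k) + (\<Sum>i\<in>UNIV. \<Sum>k\<in>UNIV. a2 i k) + (\<Sum>i\<in>UNIV. \<Sum>k\<in>UNIV. a3 i k))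
    + ((\<Sum>i\<in>UNIV. \<Sum>k\<in>UNIV. a4 i k) + (\<Sum>i\<in>UNIV. \<Sum>k\<in>UNIV. a5 i k) + (\<Sum>i\<in>UNIV. \<Sum>k\<in>UNIV. a6 i k))
    - ((\<Sum>i\<in>UNIV. \<Sum>k\<in>UNIV. a7 i k) + (\<Sum>i\<in>UNIV. \<Sum>k\<in>UNIV. a8 i k) + (\<Sum>i\<in>UNIV. \<Sum>k\<in>UNIV. a9 i k))"
    for a1 a2 a3 a4 a5 a6 a7 a8 a9 :: "'n \<Rightarrow> 'n \<Rightarrow> complex"
    by (simp add: sum.distrib sum_negf sum_subtractf)
  show ?thesis
    unfolding split S1 S3 S4 S5 S7 S28 S69
    by (simp add: algebra_simps)
qed

text \<open>Integrating the stress tensor identity gives \<open>2 Re\<langle>Xf, \<Delta>f\<rangle> = \<integral> ((n - 1)|\<nabla>f|\<^sup>2 - 2 (\<nabla>X)(\<nabla>f, \<nabla>f))\<close>; the pointwise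
  inequality \<open>\<nabla>X \<le> 1 - (1/n) X \<otimes> X\<close> of \<open>virial_coercive\<close> does the rest.\<close>

lemma virial_lower_bound:
  fixes f :: "real^'n::finite \<Rightarrow> complex"
  assumes n: "CARD('n) \<ge> 2" and f: "h2data f w W"
  shows "2 / real CARD('n) * (l2norm hypV (vfield w))\<^sup>2 \<le>
     2 * Re (l2inner hypV (vfield w) (lap w W))
       - (real CARD('n) - 3) * (\<Sum>i\<in>UNIV. (l2norm hypV (\<lambda>x. w i x / of_real (conf x)))\<^sup>2)"
proof -
  let ?n = "CARD('n)"
  have n1: "?n \<ge> 1" using n by simp
  define m where "m = ?n - 2"
  have m: "?n = m + 2" "real ?n - 2 = real m" using n by (auto simp: m_def)
  \<comment> \<open>two of the \<open>n\<close> conformal factors of the volume are used up by \<open>|\<nabla>f|\<^sup>2\<close>\<close>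
  define E E1 where "E x = conf x ^ m * vcoef ?n (rsq x)"
    and "E1 x = conf x ^ m * (dvcoef ?n (rsq x) + real m * vcoef ?n (rsq x) / (1 - rsq x))" for x :: "real^'n"
  define dc where "dc i k x = E x * (if i = k then 1 else 0) + 2 * x $ i * E1 x * x $ k" for i k and x :: "real^'n"
  have cd: "coef_deriv i (\<lambda>x. E x * x $ k) (dc i k)" for i k
    unfolding E_def dc_def E1_def by (rule coef_conf_vcoef[OF n1])
  define Z where "Z i x = (\<Sum>k\<in>UNIV. of_real (E x * x $ k) * (w k x * cnj (w i x)) + of_real (E x * x $ k) * (w i x * cnj (w k x))
      + (- 1) * (of_real (E x * x $ i) * (w k x * cnj (w k x))))" for i x
  define D where "D i x = (\<Sum>k\<in>UNIV.
      (of_real (dc i k x) * (w k x * cnj (w i x)) + of_real (E x * x $ k) * (W i k x * cnj (w i x)) + of_real (E x * x $ k) * (w k x * cnj (W i i x)))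
    + (of_real (dc i k x) * (w i x * cnj (w k x)) + of_real (E x * x $ k) * (W i i x * cnj (w k x)) + of_real (E x * x $ k) * (w i x * cnj (W i k x)))
    + (- 1) * (of_real (dc i i x) * (w k x * cnj (w k x)) + of_real (E x * x $ i) * (W k i x * cnj (w k x)) + of_real (E x * x $ i) * (w k x * cnj (W k i x))))" for i x
  define S where "S x = (\<Sum>k\<in>UNIV. (norm (w k x))\<^sup>2)" for x
  define X where "X x = (\<Sum>k\<in>UNIV. of_real (x $ k) * w k x)" for x
  \<comment> \<open>\<open>c\<close> is the tangential eigenvalue of \<open>\<nabla>X\<close>; \<open>- B / conf\<^sup>2\<close> is \<open>(n - 1)|\<nabla>f|\<^sup>2 - 2 (\<nabla>X)(\<nabla>f, \<nabla>f)\<close>\<close>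
  define c where "c x = vcoef ?n (rsq x) * (1 + rsq x) / (1 - rsq x)" for x :: "real^'n"
  define B where "B x = 4 * dvcoef ?n (rsq x) * (norm (X x))\<^sup>2 - ((real ?n - 1) - 2 * c x) * S x" for x
  define p where "p x = 2 * Re (vfield w x * cnj (lap w W x)) + B x / (conf x)\<^sup>2" for x
  define K where "K x = (\<Sum>i\<in>UNIV. (norm (w i x / of_real (conf x)))\<^sup>2)" for x
  note wl = h2data_loc2(2)[OF f] and Wl = h2data_loc2(3)[OF f]
  note [measurable] = h2dataD(8)[OF f] h2dataD(9)[OF f]
  note vw = vfield_square_integrable(1)[OF h2dataD(8)[OF f] h2dataD(2)[OF f]]
  note vLi = integrable_prod_cnj[OF vw h2dataD(6)[OF f]]
  have Ki: "integrable hypV K"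
    unfolding K_def using h2dataD(2)[OF f] by (intro Bochner_Integration.integrable_sum) (simp add: square_integrable_def)
  have KS: "K x = S x / (conf x)\<^sup>2" for x
    by (simp add: K_def S_def norm_divide power_divide sum_divide_distrib)
  have vm [measurable]: "(\<lambda>x. vcoef ?n (rsq x)) \<in> borel_measurable (ballL :: (real^'n) measure)"
    by (rule vcoef_measurable[OF n1])
  have rm [measurable]: "(\<lambda>x. rsq x) \<in> borel_measurable (ballL :: (real^'n) measure)"
    by (rule continuous_measurable_ballL) (intro continuous_intros)
  have dm [measurable]: "(\<lambda>x. dvcoef ?n (rsq x)) \<in> borel_measurable (ballL :: (real^'n) measure)"
    by (rule continuous_measurable_ballL, rule continuous_on_compose2[OF dvcoef_continuous])
      (use ball_rsq in \<open>auto intro!: continuous_intros\<close>)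
  have facts: "0 \<le> rsq x \<and> rsq x < 1 \<and> 0 < conf x \<and> 0 \<le> c x \<and> c x \<le> 1 \<and> 2 * rsq x * dvcoef ?n (rsq x) = (real ?n - 1) - real ?n * c x
     \<and> (norm (X x))\<^sup>2 \<le> rsq x * S x \<and> 0 \<le> S x" if x: "x \<in> space ballL" for x
  proof -
    have nx: "norm x < 1" using x by simp
    have r: "0 \<le> rsq x" "rsq x < 1" using ball_rsq[OF nx] by auto
    have "2 * rsq x * dvcoef ?n (rsq x) = (real ?n - 1) - real ?n * c x"
      using vcoef_ode[OF r(2) n1] r(2) by (simp add: c_def field_simps)
    moreover have "0 \<le> c x" "c x \<le> 1" using vcoef_bounds(1,3)[OF r n1] r by (simp_all add: c_def)
    moreover have "(norm (X x))\<^sup>2 \<le> rsq x * S x" unfolding X_def S_def by (rule norm_coord_sum_le)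
    ultimately show ?thesis using r conf_pos[OF nx] by (simp add: S_def sum_nonneg)
  qed
  have Bb: "\<bar>B x / (conf x)\<^sup>2\<bar> \<le> 4 * real ?n * K x" if x: "x \<in> space ballL" for x
  proof -
    note fx = facts[OF x]
    have n2: "2 \<le> real ?n" using n by simp
    have nc: "real ?n * c x \<le> real ?n * 1" using fx by (intro mult_left_mono) auto
    have nc0: "0 \<le> real ?n * c x" using fx by (intro mult_nonneg_nonneg) auto
    have a1: "\<bar>4 * dvcoef ?n (rsq x) * (norm (X x))\<^sup>2\<bar> \<le> 2 * real ?n * S x"
    proof -
      have "\<bar>4 * dvcoef ?n (rsq x) * (norm (X x))\<^sup>2\<bar> = 4 * \<bar>dvcoef ?n (rsq x)\<bar> * (norm (X x))\<^sup>2" by (simp add: abs_mult)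
      also have "\<dots> \<le> 4 * \<bar>dvcoef ?n (rsq x)\<bar> * (rsq x * S x)" using fx by (intro mult_left_mono) auto
      also have "\<dots> = 2 * \<bar>2 * rsq x * dvcoef ?n (rsq x)\<bar> * S x"
      proof -
        have "0 \<le> rsq x" by simp
        then show ?thesis by (simp add: abs_mult)
      qed
      also have "\<dots> \<le> 2 * real ?n * S x"
      proof (intro mult_right_mono)
        have "2 * rsq x * dvcoef ?n (rsq x) = (real ?n - 1) - real ?n * c x" using fx by blast
        then have "\<bar>2 * rsq x * dvcoef ?n (rsq x)\<bar> \<le> real ?n" using nc nc0 n2 by linarith
        then show "2 * \<bar>2 * rsq x * dvcoef ?n (rsq x)\<bar> \<le> 2 * real ?n" by linarith
      qed (use fx in auto)
      finally show ?thesis .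
    qed
    have a2: "\<bar>((real ?n - 1) - 2 * c x) * S x\<bar> \<le> 2 * real ?n * S x"
    proof -
      have "\<bar>(real ?n - 1) - 2 * c x\<bar> \<le> 2 * real ?n" using fx n2 by linarith
      then show ?thesis using fx by (simp add: abs_mult mult_right_mono)
    qed
    have "\<bar>B x\<bar> \<le> 4 * real ?n * S x" unfolding B_def using a1 a2 by linarith
    then have "\<bar>B x\<bar> / (conf x)\<^sup>2 \<le> 4 * real ?n * S x / (conf x)\<^sup>2" by (intro divide_right_mono) auto
    then show ?thesis by (simp add: KS abs_divide)
  qed
  have Bm: "(\<lambda>x. B x / (conf x)\<^sup>2) \<in> borel_measurable ballL"
    unfolding B_def S_def X_def c_def by measurable
  have Bi: "integrable hypV (\<lambda>x. B x / (conf x)\<^sup>2)"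
  proof (rule Bochner_Integration.integrable_bound)
    show "integrable hypV (\<lambda>x. 4 * real ?n * K x)" using Ki by simp
    show "(\<lambda>x. B x / (conf x)\<^sup>2) \<in> borel_measurable hypV" using Bm by simp
    show "AE x in hypV. norm (B x / (conf x)\<^sup>2) \<le> norm (4 * real ?n * K x)"
      using Bb by (intro AE_I2) (auto intro: order_trans[OF _ abs_ge_self])
  qed
  have pi: "integrable hypV p"
    unfolding p_def using Bi integrable_Re[OF vLi] by (intro Bochner_Integration.integrable_add integrable_mult_right)
  have "(LINT x|hypV. complex_of_real (p x)) = 0"
  proof (rule divergence_theorem_hyp)
    show "wdiv i (Z i) (D i)" for i
      unfolding Z_def D_def
      by (intro wdiv_sum wdiv_add wdiv_cmult wdiv_product wl Wl h2dataD(4)[OF f] h2dataD(5)[OF f] cd)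
    show "integrable hypV (\<lambda>x. complex_of_real (p x))" using pi by (rule integrable_of_real)
    show "Z i \<in> borel_measurable ballL" for i unfolding Z_def E_def by measurable
    show "integrable hypV (\<lambda>x. 3 * real ?n * K x)" using Ki by simp
    show "(\<Sum>i\<in>UNIV. D i x) = of_real (conf x ^ ?n) * complex_of_real (p x)" if x: "x \<in> space ballL" for x
    proof -
      note fx = facts[OF x]
      define L where "L = (\<Sum>i\<in>UNIV. W i i x)"
      have SS: "(\<Sum>k\<in>UNIV. w k x * cnj (w k x)) = of_real (S x)"
        by (simp only: S_def of_real_sum complex_norm_square)
      have XX: "X x * cnj (X x) = of_real ((norm (X x))\<^sup>2)" by (simp only: complex_norm_square)
      have 1: "(\<Sum>i\<in>UNIV. D i x) = of_real (E x) * (X x * cnj L + cnj (X x) * L) + 4 * of_real (E1 x) * of_real ((norm (X x))\<^sup>2)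
         + of_real (2 * E x - real ?n * E x - 2 * rsq x * E1 x) * of_real (S x)"
        using pohozaev_algebra[where w = "\<lambda>k. w k x" and W = "\<lambda>i k. W i k x" and x = x and E = "E x" and ?E1.0 = "E1 x"]
        unfolding D_def dc_def X_def[symmetric] SS L_def[symmetric] XX .
      have XL: "X x * cnj L + cnj (X x) * L = of_real (2 * Re (X x * cnj L))"
      proof -
        have "cnj (X x) * L = cnj (X x * cnj L)" by simp
        then show ?thesis by (simp only: complex_add_cnj)
      qed
      have 2: "(\<Sum>i\<in>UNIV. D i x) = of_real (E x * (2 * Re (X x * cnj L)) + 4 * E1 x * (norm (X x))\<^sup>2
         + (2 * E x - real ?n * E x - 2 * rsq x * E1 x) * S x)"
        unfolding 1 XL by simp
      have vl: "vfield w x * cnj (lap w W x) = of_real (vcoef ?n (rsq x) / (conf x)\<^sup>2) * (X x * cnj L + of_real (real m * conf x) * (X x * cnj (X x)))"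
        unfolding vfield_def lap_def m(2) X_def[symmetric] L_def[symmetric] using fx
        by (simp add: field_simps)
      have vl2: "Re (vfield w x * cnj (lap w W x)) = vcoef ?n (rsq x) / (conf x)\<^sup>2 * (Re (X x * cnj L) + real m * conf x * (norm (X x))\<^sup>2)"
      proof -
        have "vfield w x * cnj (lap w W x) = of_real (vcoef ?n (rsq x) / (conf x)\<^sup>2) * (X x * cnj L + of_real (real m * conf x * (norm (X x))\<^sup>2))"
          unfolding vl XX by simp
        moreover have "Re (of_real r * z) = r * Re z" for r z by simp
        ultimately show ?thesis by (simp only: plus_complex.sel Re_complex_of_real)
      qed
      \<comment> \<open>from here on the identity is one between real numbers, linear in \<open>t\<close>, \<open>y\<close> and \<open>b\<close>\<close>
      define l s a d b y t r where "l = conf x" and "s = rsq x" and "a = vcoef ?n (rsq x)" and "d = dvcoef ?n (rsq x)"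
        and "b = S x" and "y = (norm (X x))\<^sup>2" and "t = Re (X x * cnj L)" and "r = real m"
      have s: "s < 1" using fx by (simp add: s_def)
      have l: "l = 2 / (1 - s)" by (simp add: l_def s_def conf_def)
      have nr: "real ?n = r + 2" using m by (simp add: r_def)
      have ode: "2 * s * d = (r + 1) - (r + 2) * (a * (1 + s) / (1 - s))"
        using fx unfolding c_def nr s_def d_def a_def by simp
      have h1: "l ^ m * (a * (2 * t) + 4 * (d + r * a / (1 - s)) * y + (2 * a - (r + 2) * a - 2 * s * (d + r * a / (1 - s))) * b)
          = l ^ m * (2 * (a * (t + r * l * y)) + (4 * d * y - ((r + 1) - 2 * (a * (1 + s) / (1 - s))) * b))"
      proof -
        have e1: "4 * (r * a / (1 - s)) * y = 2 * (a * (r * l * y))" using s by (simp add: l field_simps)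
        have e2: "2 * a - (r + 2) * a - 2 * s * (d + r * a / (1 - s)) = - ((r + 1) - 2 * (a * (1 + s) / (1 - s)))"
        proof -
          have "2 * a - (r + 2) * a - 2 * s * (d + q) = - (r * a) - 2 * s * d - 2 * s * q" for q
            by (simp add: algebra_simps)
          then have "2 * a - (r + 2) * a - 2 * s * (d + r * a / (1 - s)) = - (r * a) - 2 * s * d - 2 * s * (r * a / (1 - s))" .
          also have "\<dots> = - (r * a) - ((r + 1) - (r + 2) * (a * (1 + s) / (1 - s))) - 2 * s * (r * a / (1 - s))" unfolding ode ..
          also have "\<dots> = - ((r + 1) - 2 * (a * (1 + s) / (1 - s))) + (r * (a * (1 + s) / (1 - s)) - r * a - 2 * s * (r * a / (1 - s)))"
          proof -
            have "- (r * a) - ((r + 1) - (r + 2) * q) - z = - ((r + 1) - 2 * q) + (r * q - r * a - z)" for q z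
              by (simp add: algebra_simps)
            then show ?thesis .
          qed
          also have "r * (a * (1 + s) / (1 - s)) - r * a - 2 * s * (r * a / (1 - s)) = 0"
            using s by (simp add: field_simps)
          finally show ?thesis by simp
        qed
        have "4 * (d + r * a / (1 - s)) * y = 4 * d * y + 2 * (a * (r * l * y))"
          using e1 by (simp add: distrib_left distrib_right)
        then show ?thesis unfolding e2 by (simp add: algebra_simps)
      qed
      have h2: "conf x ^ ?n * p x = l ^ m * (2 * (a * (t + r * l * y)) + (4 * d * y - ((r + 1) - 2 * (a * (1 + s) / (1 - s))) * b))"
      proof -
        have l0: "l \<noteq> 0" using fx by (simp add: l_def)
        have "p x = (2 * (a * (t + r * l * y)) + (4 * d * y - ((r + 1) - 2 * (a * (1 + s) / (1 - s))) * b)) / l\<^sup>2"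
          unfolding p_def vl2 B_def c_def nr l_def s_def a_def d_def b_def y_def t_def r_def
          by (simp add: add_divide_distrib)
        moreover have "conf x ^ ?n = l ^ m * l\<^sup>2" unfolding m(1) l_def by (rule power_add)
        ultimately show ?thesis using l0 by simp
      qed
      have h3: "E x * (2 * t) + 4 * E1 x * y + (2 * E x - real ?n * E x - 2 * s * E1 x) * b
        = l ^ m * (a * (2 * t) + 4 * (d + r * a / (1 - s)) * y + (2 * a - (r + 2) * a - 2 * s * (d + r * a / (1 - s))) * b)"
        unfolding E_def E1_def nr l_def[symmetric] s_def[symmetric] a_def[symmetric, folded s_def] d_def[symmetric, folded s_def] r_def[symmetric]
        by (simp add: algebra_simps)
      have "conf x ^ ?n * p x = E x * (2 * t) + 4 * E1 x * y + (2 * E x - real ?n * E x - 2 * s * E1 x) * b"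
        by (rule trans[OF h2 trans[OF h1[symmetric] h3[symmetric]]])
      then show ?thesis unfolding 2 t_def y_def s_def b_def of_real_mult[symmetric] by simp
    qed
    show "norm (of_real (conf x) * Z i x) \<le> conf x ^ ?n * (3 * real ?n * K x)" if x: "x \<in> space ballL" for i x
    proof -
      note fx = facts[OF x]
      have nx: "norm x < 1" using x by simp
      have cm: "0 \<le> conf x ^ m" using fx by simp
      have wS: "norm (w k x) * norm (w j x) \<le> S x" for k j
      proof -
        have 1: "(norm (w k x))\<^sup>2 \<le> S x" for k unfolding S_def by (rule member_le_sum) auto
        then have "norm (w k x) \<le> sqrt (S x)" for k by (rule real_le_rsqrt)
        then have "norm (w k x) * norm (w j x) \<le> sqrt (S x) * sqrt (S x)" by (intro mult_mono) (auto simp: fx)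
        then show ?thesis using fx by simp
      qed
      have b: "norm (of_real (conf x) * (of_real (E x * x $ k) * (w j x * cnj (w l x)))) \<le> conf x ^ m * S x" for k j l
      proof -
        have "norm (of_real (conf x) * (of_real (E x * x $ k) * (w j x * cnj (w l x))))
          = (conf x ^ m * (norm (w j x) * norm (w l x))) * (conf x * vcoef ?n (rsq x) * \<bar>x $ k\<bar>)"
          using fx vcoef_conf_le(3)[OF nx n1] by (simp add: E_def norm_mult norm_power abs_mult mult_ac power_abs)
        also have "\<dots> \<le> (conf x ^ m * (norm (w j x) * norm (w l x))) * 1"
          using cm by (intro mult_left_mono vcoef_conf_le[OF nx n1]) auto
        also have "\<dots> \<le> conf x ^ m * S x" using cm wS by (simp add: mult_left_mono)
        finally show ?thesis .
      qed
      have "norm (of_real (conf x) * Z i x) \<le> (\<Sum>k\<in>(UNIV::'n set). 3 * (conf x ^ m * S x))"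
        unfolding Z_def sum_distrib_left
      proof (rule order_trans[OF norm_sum sum_mono])
        fix k
        have "norm (of_real (conf x) * (of_real (E x * x $ k) * (w k x * cnj (w i x)) + of_real (E x * x $ k) * (w i x * cnj (w k x))
              + (- 1) * (of_real (E x * x $ i) * (w k x * cnj (w k x)))))
          \<le> norm (of_real (conf x) * (of_real (E x * x $ k) * (w k x * cnj (w i x)))) + norm (of_real (conf x) * (of_real (E x * x $ k) * (w i x * cnj (w k x))))
             + norm (of_real (conf x) * (of_real (E x * x $ i) * (w k x * cnj (w k x))))"
        proof -
          have "norm (c * (p + q + (- 1) * r)) \<le> norm (c * p) + norm (c * q) + norm (c * r)" for c p q r :: complex
          proof -
            have "c * (p + q + (- 1) * r) = (c * p + c * q) - c * r" by (simp add: algebra_simps)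
            then show ?thesis
              using norm_triangle_ineq4[of "c * p + c * q" "c * r"] norm_triangle_ineq[of "c * p" "c * q"] by simp
          qed
          then show ?thesis .
        qed
        also have "\<dots> \<le> conf x ^ m * S x + conf x ^ m * S x + conf x ^ m * S x" by (intro add_mono b)
        also have "\<dots> = 3 * (conf x ^ m * S x)" by simp
        finally show "norm (of_real (conf x) * (of_real (E x * x $ k) * (w k x * cnj (w i x)) + of_real (E x * x $ k) * (w i x * cnj (w k x))
              + (- 1) * (of_real (E x * x $ i) * (w k x * cnj (w k x))))) \<le> 3 * (conf x ^ m * S x)" .
      qed
      also have "\<dots> = conf x ^ ?n * (3 * real ?n * K x)"
      proof -
        have "conf x ^ ?n = conf x ^ m * (conf x)\<^sup>2" unfolding m(1) by (rule power_add)
        moreover have "(conf x)\<^sup>2 \<noteq> 0" using fx by simp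
        ultimately have "conf x ^ ?n * (3 * real ?n * K x) = conf x ^ m * (3 * real ?n * S x)"
          unfolding KS by simp
        then show ?thesis by simp
      qed
      finally show ?thesis .
    qed
  qed
  then have p0: "(LINT x|hypV. p x) = 0" unfolding integral_complex_of_real by (simp only: of_real_eq_0_iff)
  have "2 / real ?n * (l2norm hypV (vfield w))\<^sup>2 = (LINT x|hypV. 2 / real ?n * (norm (vfield w x))\<^sup>2)"
    by (simp add: l2norm_power2)
  also have "\<dots> \<le> (LINT x|hypV. 2 * Re (vfield w x * cnj (lap w W x)) - (real ?n - 3) * K x - p x)"
  proof (rule integral_mono)
    show "integrable hypV (\<lambda>x. 2 / real ?n * (norm (vfield w x))\<^sup>2)"
      using square_integrableD(2)[OF vw] by (rule integrable_mult_right)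
    show "integrable hypV (\<lambda>x. 2 * Re (vfield w x * cnj (lap w W x)) - (real ?n - 3) * K x - p x)"
      using pi Ki integrable_Re[OF vLi] by (intro Bochner_Integration.integrable_diff integrable_mult_right)
    fix x :: "real^'n" assume "x \<in> space hypV"
    then have x: "x \<in> space ballL" by simp
    note fx = facts[OF x]
    have "(2 / (1 - rsq x))\<^sup>2 * (vcoef ?n (rsq x))\<^sup>2 * (norm (X x))\<^sup>2 / real ?n \<le> (1 - c x) * S x - 2 * dvcoef ?n (rsq x) * (norm (X x))\<^sup>2"
      unfolding c_def by (rule virial_coercive) (use fx n in auto)
    then have "(2 / (1 - rsq x))\<^sup>2 * (vcoef ?n (rsq x))\<^sup>2 * (norm (X x))\<^sup>2 * (2 / real ?n) \<le> 2 * (1 - c x) * S x - 4 * dvcoef ?n (rsq x) * (norm (X x))\<^sup>2"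
      by (simp add: algebra_simps)
    moreover have "(2 / (1 - rsq x))\<^sup>2 * (vcoef ?n (rsq x))\<^sup>2 * (norm (X x))\<^sup>2 = (conf x)\<^sup>2 * (norm (vfield w x))\<^sup>2"
      by (simp add: conf_def vfield_def X_def norm_mult power_mult_distrib)
    ultimately have "(conf x)\<^sup>2 * (norm (vfield w x))\<^sup>2 * (2 / real ?n) \<le> 2 * (1 - c x) * S x - 4 * dvcoef ?n (rsq x) * (norm (X x))\<^sup>2" by simp
    then have "(conf x)\<^sup>2 * (norm (vfield w x))\<^sup>2 * (2 / real ?n) / (conf x)\<^sup>2 \<le> (2 * (1 - c x) * S x - 4 * dvcoef ?n (rsq x) * (norm (X x))\<^sup>2) / (conf x)\<^sup>2"
      by (intro divide_right_mono) auto
    moreover have "(2 * (1 - c x) * S x - 4 * dvcoef ?n (rsq x) * (norm (X x))\<^sup>2) / (conf x)\<^sup>2 = - (real ?n - 3) * K x - B x / (conf x)\<^sup>2"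
    proof -
      have "2 * (1 - c x) * S x - 4 * dvcoef ?n (rsq x) * (norm (X x))\<^sup>2 = - (real ?n - 3) * S x - B x"
        unfolding B_def by (simp add: algebra_simps)
      then show ?thesis unfolding KS by (simp add: diff_divide_distrib)
    qed
    moreover have "(conf x)\<^sup>2 * (norm (vfield w x))\<^sup>2 * (2 / real ?n) / (conf x)\<^sup>2 = 2 / real ?n * (norm (vfield w x))\<^sup>2"
      using fx by simp
    ultimately have "2 / real ?n * (norm (vfield w x))\<^sup>2 \<le> - (real ?n - 3) * K x - B x / (conf x)\<^sup>2" by simp
    then show "2 / real ?n * (norm (vfield w x))\<^sup>2 \<le> 2 * Re (vfield w x * cnj (lap w W x)) - (real ?n - 3) * K x - p x"
      unfolding p_def by (simp add: algebra_simps)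
  qed
  also have "\<dots> = 2 * (LINT x|hypV. Re (vfield w x * cnj (lap w W x))) - (real ?n - 3) * (LINT x|hypV. K x)"
  proof -
    have gen: "(LINT x|hypV. 2 * R x - c * K x - p x) = 2 * (LINT x|hypV. R x) - c * (LINT x|hypV. K x)"
      if "integrable hypV R" for R :: "real^'n \<Rightarrow> real" and c
      using that pi Ki p0 by simp
    show ?thesis by (rule gen[OF integrable_Re[OF vLi]])
  qed
  also have "(LINT x|hypV. Re (vfield w x * cnj (lap w W x))) = Re (l2inner hypV (vfield w) (lap w W))"
    unfolding l2inner_def by (rule integral_Re[OF vLi])
  also have "(LINT x|hypV. K x) = (\<Sum>i\<in>UNIV. (l2norm hypV (\<lambda>x. w i x / of_real (conf x)))\<^sup>2)"
    unfolding K_def l2norm_power2 using h2dataD(2)[OF f]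
    by (intro Bochner_Integration.integral_sum) (simp add: square_integrable_def)
  finally show ?thesis .
qed

section \<open>The Poincare ball metric\<close>

lemma mat_mult_mat: "(mat a :: real^'n^'n::finite) ** mat b = mat (a * b)"
  by (simp add: matrix_matrix_mult_def mat_def vec_eq_iff mult_delta_left)

lemma matrix_inv_mat:
  assumes "a \<noteq> 0" shows "matrix_inv (mat a :: real^'n^'n::finite) = mat (1 / a)"
  unfolding matrix_inv_def
proof (rule some_equality)
  show "mat a ** mat (1 / a) = (mat 1 :: real^'n^'n) \<and> mat (1 / a) ** mat a = (mat 1 :: real^'n^'n)"
    using assms by (simp add: mat_mult_mat)
  fix B :: "real^'n^'n" assume B: "mat a ** B = mat 1 \<and> B ** mat a = mat 1"
  have "B = (mat (1 / a) ** mat a) ** B" using assms by (simp add: mat_mult_mat)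
  also have "\<dots> = mat (1 / a) ** (mat a ** B)" by (rule matrix_mul_assoc[symmetric])
  finally show "B = mat (1 / a)" using B by simp
qed

lemma det_mat: "det (mat a :: real^'n^'n::finite) = a ^ CARD('n)"
proof -
  have "det (mat a :: real^'n^'n) = prod (\<lambda>i. (mat a :: real^'n^'n) $ i $ i) UNIV"
    by (rule det_diagonal) (simp add: mat_def)
  then show ?thesis by (simp add: mat_def)
qed

lemma hyp_metric_conf: "hyp_metric x = mat ((conf x)\<^sup>2)"
  for x :: "real^'n::finite"
  by (simp add: hyp_metric_def conf_def power_divide power2_norm_eq_inner)

lemma riem_vol_hyp: "riem_vol hyp_domain hyp_metric = (hypV :: (real^'n::finite) measure)"
  unfolding riem_vol_def hypV_def hyp_domain_def
proof (rule density_cong)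
  show "AE x in (ballL :: (real^'n) measure). ennreal (sqrt (det (hyp_metric x))) = ennreal (conf x ^ CARD('n))"
  proof (rule AE_I2)
    fix x :: "real^'n" assume "x \<in> space ballL"
    then have "0 \<le> conf x" using conf_pos[of x] by simp
    moreover have "((conf x)\<^sup>2) ^ CARD('n) = (conf x ^ CARD('n))\<^sup>2" by (simp add: power_mult[symmetric] mult.commute)
    ultimately have "sqrt (((conf x)\<^sup>2) ^ CARD('n)) = conf x ^ CARD('n)" by simp
    then show "ennreal (sqrt (det (hyp_metric x))) = ennreal (conf x ^ CARD('n))"
      by (simp add: hyp_metric_conf det_mat)
  qed
  have m: "(\<lambda>x. conf x ^ CARD('n)) \<in> borel_measurable (ballL :: (real^'n) measure)" by measurable
  show "(\<lambda>x. ennreal (conf x ^ CARD('n))) \<in> borel_measurable (ballL :: (real^'n) measure)" using m by measurable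
  have "(\<lambda>x. sqrt (((conf x)\<^sup>2) ^ CARD('n))) \<in> borel_measurable (ballL :: (real^'n) measure)" by measurable
  then show "(\<lambda>x. ennreal (sqrt (det (hyp_metric x)))) \<in> borel_measurable (ballL :: (real^'n) measure)"
    unfolding hyp_metric_conf det_mat by measurable
qed

lemma cometric_hyp:
  fixes x :: "real^'n::finite"
  assumes "norm x < 1"
  shows "cometric hyp_metric x i j = (if i = j then 1 / (conf x)\<^sup>2 else 0)"
  unfolding cometric_def hyp_metric_conf
  by (subst matrix_inv_mat) (use conf_pos[OF assms] in \<open>auto simp: mat_def\<close>)

lemma partial_hyp_metric:
  fixes x :: "real^'n::finite"
  assumes "norm x < 1"
  shows "partial i (\<lambda>y. hyp_metric y $ j $ l) x = (if j = l then 2 * conf x ^ 3 * x $ i else 0)"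
proof (cases "j = l")
  case True
  have nz: "1 - x \<bullet> x \<noteq> 0" using one_minus_pos[OF assms] by simp
  have d1: "((\<lambda>y. 1 - y \<bullet> y) has_derivative (\<lambda>h. - 2 * (x \<bullet> h))) (at x)"
    by (auto intro!: derivative_eq_intros simp: inner_commute)
  have "((\<lambda>t. 4 / t\<^sup>2) has_real_derivative - 8 / t ^ 3) (at t)" if "t \<noteq> 0" for t :: real
    using that by (auto intro!: derivative_eq_intros simp: power2_eq_square power3_eq_cube field_simps)
  from this[OF nz]
  have d2: "((\<lambda>t. 4 / t\<^sup>2) has_real_derivative - 8 / (1 - x \<bullet> x) ^ 3) (at (1 - x \<bullet> x))" .
  have "((\<lambda>y. 4 / (1 - y \<bullet> y)\<^sup>2) has_derivative (\<lambda>h. (- 8 / (1 - x \<bullet> x) ^ 3) * (- 2 * (x \<bullet> h)))) (at x)"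
    using has_derivative_compose[OF d1 d2[unfolded has_field_derivative_def]] by simp
  moreover have "(\<lambda>y::real^'n. hyp_metric y $ j $ l) = (\<lambda>y. 4 / (1 - y \<bullet> y)\<^sup>2)"
    using True by (simp add: hyp_metric_def mat_def power2_norm_eq_inner fun_eq_iff)
  ultimately have "partial i (\<lambda>y::real^'n. hyp_metric y $ j $ l) x = (- 8 / (1 - x \<bullet> x) ^ 3) * (- 2 * (x \<bullet> axis i 1))"
    using partial_eq by (metis (no_types, lifting))
  also have "\<dots> = 2 * conf x ^ 3 * x $ i"
    by (simp add: inner_axis conf_def power_divide)
  finally show ?thesis using True by simp
next
  case False
  have "((\<lambda>y::real^'n. hyp_metric y $ j $ l) has_derivative (\<lambda>h. 0)) (at x)"
    using False by (simp add: hyp_metric_def mat_def)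
  from partial_eq[OF this] False show ?thesis by simp
qed

lemma christoffel_hyp:
  fixes x :: "real^'n::finite"
  assumes "norm x < 1"
  shows "christoffel hyp_metric x k i j = conf x *
    ((if j = k then x $ i else 0) + (if i = k then x $ j else 0) - (if i = j then x $ k else 0))"
proof -
  have c: "conf x \<noteq> 0" using conf_pos[OF assms] by simp
  have "christoffel hyp_metric x k i j = (1/2) * (1 / (conf x)\<^sup>2 *
     ((if j = k then 2 * conf x ^ 3 * x $ i else 0) + (if i = k then 2 * conf x ^ 3 * x $ j else 0) - (if i = j then 2 * conf x ^ 3 * x $ k else 0)))"
    unfolding christoffel_def cometric_hyp[OF assms] partial_hyp_metric[OF assms]
    by (simp add: mult_delta_left)
  also have "\<dots> = conf x * ((if j = k then x $ i else 0) + (if i = k then x $ j else 0) - (if i = j then x $ k else 0))"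
    using c by (simp add: power2_eq_square power3_eq_cube field_simps)
  finally show ?thesis .
qed

abbreviation wpar :: "'n::finite \<Rightarrow> (real^'n \<Rightarrow> complex) \<Rightarrow> real^'n \<Rightarrow> complex" where
  "wpar \<equiv> weak_partial hyp_domain"

abbreviation hwp :: "'n::finite \<Rightarrow> (real^'n \<Rightarrow> complex) \<Rightarrow> (real^'n \<Rightarrow> complex) \<Rightarrow> bool" where
  "hwp \<equiv> has_weak_partial hyp_domain"

lemma wpar_works: "hwp i f w \<Longrightarrow> hwp i f (wpar i f)"
  unfolding weak_partial_def by (rule someI_ex[of "hwp i f"]) (rule exI)

lemma grad_sq_hyp:
  fixes x :: "real^'n::finite"
  assumes "norm x < 1"
  shows "grad_sq hyp_domain hyp_metric f x = (\<Sum>i\<in>UNIV. (norm (wpar i f x / of_real (conf x)))\<^sup>2)"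
proof -
  have "grad_sq hyp_domain hyp_metric f x = Re (\<Sum>i\<in>UNIV. of_real (1 / (conf x)\<^sup>2) * (wpar i f x * cnj (wpar i f x)))"
  proof -
    have "(\<Sum>i\<in>UNIV. \<Sum>j\<in>UNIV. of_real (cometric hyp_metric x i j) * (wpar i f x * cnj (wpar j f x)))
      = (\<Sum>i\<in>UNIV. \<Sum>j\<in>UNIV. if i = j then of_real (1 / (conf x)\<^sup>2) * (wpar i f x * cnj (wpar j f x)) else 0)"
      unfolding cometric_hyp[OF assms] by (intro sum.cong refl) auto
    then show ?thesis unfolding grad_sq_def by simp
  qed
  also have "\<dots> = (\<Sum>i\<in>UNIV. (norm (wpar i f x / of_real (conf x)))\<^sup>2)"
    unfolding Re_sum
  proof (rule sum.cong[OF refl])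
    fix i
    have "of_real (1 / (conf x)\<^sup>2) * (wpar i f x * cnj (wpar i f x)) = complex_of_real (1 / (conf x)\<^sup>2 * (norm (wpar i f x))\<^sup>2)"
      by (simp only: complex_norm_square of_real_mult)
    then show "Re (of_real (1 / (conf x)\<^sup>2) * (wpar i f x * cnj (wpar i f x))) = (norm (wpar i f x / of_real (conf x)))\<^sup>2"
      by (simp only: Re_complex_of_real) (simp add: norm_divide power_divide)
  qed
  finally show ?thesis .
qed

text \<open>The covariant Hessian with the Christoffel symbols of the ball metric inserted.  Unlike \<^const>\<open>hess\<close>, which
  agrees with it on the ball, it is an explicit formula on the whole space, so measurability is immediate.\<close>

definition hessf :: "(real^'n::finite \<Rightarrow> complex) \<Rightarrow> 'n \<Rightarrow> 'n \<Rightarrow> real^'n \<Rightarrow> complex" where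
  "hessf f i j x = wpar i (wpar j f) x - of_real (conf x) * (of_real (x $ i) * wpar j f x + of_real (x $ j) * wpar i f x
      - (if i = j then \<Sum>k\<in>UNIV. of_real (x $ k) * wpar k f x else 0))"

lemma hess_hyp:
  fixes x :: "real^'n::finite"
  assumes "norm x < 1"
  shows "hess hyp_domain hyp_metric f x i j = hessf f i j x"
proof -
  have "(\<Sum>k\<in>UNIV. of_real (christoffel hyp_metric x k i j) * wpar k f x)
     = of_real (conf x) * ((\<Sum>k\<in>UNIV. (if j = k then of_real (x $ i) * wpar k f x else 0)) + (\<Sum>k\<in>UNIV. (if i = k then of_real (x $ j) * wpar k f x else 0))
        - (\<Sum>k\<in>UNIV. (if i = j then of_real (x $ k) * wpar k f x else 0)))"
    unfolding christoffel_hyp[OF assms] sum_distrib_left sum.distrib[symmetric] sum_subtractf[symmetric]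
    by (intro sum.cong refl) (auto simp: algebra_simps)
  then show ?thesis unfolding hess_def hessf_def by simp
qed

lemma hess_sq_hyp:
  fixes x :: "real^'n::finite"
  assumes "norm x < 1"
  shows "hess_sq hyp_domain hyp_metric f x = (\<Sum>i\<in>UNIV. \<Sum>j\<in>UNIV. (norm (hessf f i j x / of_real ((conf x)\<^sup>2)))\<^sup>2)"
proof -
  have "hess_sq hyp_domain hyp_metric f x = Re (\<Sum>i\<in>UNIV. \<Sum>j\<in>UNIV. of_real (1 / (conf x)\<^sup>2 * (1 / (conf x)\<^sup>2)) * (hessf f i j x * cnj (hessf f i j x)))"
  proof -
    have "(\<Sum>k\<in>UNIV. \<Sum>l\<in>UNIV. of_real (cometric hyp_metric x i k * cometric hyp_metric x j l) * (hessf f i j x * cnj (hessf f k l x)))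
       = of_real (1 / (conf x)\<^sup>2 * (1 / (conf x)\<^sup>2)) * (hessf f i j x * cnj (hessf f i j x))" for i j
    proof -
      have "(\<Sum>k\<in>UNIV. \<Sum>l\<in>UNIV. of_real (cometric hyp_metric x i k * cometric hyp_metric x j l) * (hessf f i j x * cnj (hessf f k l x)))
        = (\<Sum>k\<in>UNIV. if i = k then (\<Sum>l\<in>UNIV. if j = l then of_real (1 / (conf x)\<^sup>2 * (1 / (conf x)\<^sup>2)) * (hessf f i j x * cnj (hessf f k l x)) else 0) else 0)"
      proof (rule sum.cong[OF refl])
        fix k
        show "(\<Sum>l\<in>UNIV. of_real (cometric hyp_metric x i k * cometric hyp_metric x j l) * (hessf f i j x * cnj (hessf f k l x)))
          = (if i = k then (\<Sum>l\<in>UNIV. if j = l then of_real (1 / (conf x)\<^sup>2 * (1 / (conf x)\<^sup>2)) * (hessf f i j x * cnj (hessf f k l x)) else 0) else 0)"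
        proof (cases "i = k")
          case True
          have "of_real (cometric hyp_metric x i k * cometric hyp_metric x j l) * (hessf f i j x * cnj (hessf f k l x))
             = (if j = l then of_real (1 / (conf x)\<^sup>2 * (1 / (conf x)\<^sup>2)) * (hessf f i j x * cnj (hessf f k l x)) else 0)" for l
            unfolding cometric_hyp[OF assms] using True by (cases "j = l") simp_all
          then show ?thesis using True by simp
        qed (simp add: cometric_hyp[OF assms])
      qed
      then show ?thesis by simp
    qed
    then show ?thesis unfolding hess_sq_def hess_hyp[OF assms] by simp
  qed
  also have "\<dots> = (\<Sum>i\<in>UNIV. \<Sum>j\<in>UNIV. (norm (hessf f i j x / of_real ((conf x)\<^sup>2)))\<^sup>2)"
    unfolding Re_sum
  proof (intro sum.cong refl)
    fix i j
    have "of_real (1 / (conf x)\<^sup>2 * (1 / (conf x)\<^sup>2)) * (hessf f i j x * cnj (hessf f i j x))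
      = complex_of_real (1 / (conf x)\<^sup>2 * (1 / (conf x)\<^sup>2) * (norm (hessf f i j x))\<^sup>2)"
      by (simp only: complex_norm_square of_real_mult)
    then show "Re (of_real (1 / (conf x)\<^sup>2 * (1 / (conf x)\<^sup>2)) * (hessf f i j x * cnj (hessf f i j x))) = (norm (hessf f i j x / of_real ((conf x)\<^sup>2)))\<^sup>2"
      by (simp only: Re_complex_of_real) (simp add: norm_divide norm_mult power_divide power2_eq_square)
  qed
  finally show ?thesis .
qed

text \<open>The trace of the Christoffel term leaves \<open>n - 2\<close> copies of the radial derivative.\<close>

lemma laplace_hyp:
  fixes x :: "real^'n::finite"
  assumes "norm x < 1"
  shows "laplace_beltrami hyp_domain hyp_metric f x = (\<Sum>i\<in>UNIV. hessf f i i x / of_real ((conf x)\<^sup>2))"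
    and "laplace_beltrami hyp_domain hyp_metric f x = lap (\<lambda>i. wpar i f) (\<lambda>i j. wpar i (wpar j f)) x"
proof -
  have c: "conf x \<noteq> 0" using conf_pos[OF assms] by simp
  have "laplace_beltrami hyp_domain hyp_metric f x = (\<Sum>i\<in>UNIV. \<Sum>j\<in>UNIV. if i = j then of_real (1 / (conf x)\<^sup>2) * hessf f i j x else 0)"
    unfolding laplace_beltrami_def hess_hyp[OF assms] cometric_hyp[OF assms] by (intro sum.cong refl) auto
  then show 1: "laplace_beltrami hyp_domain hyp_metric f x = (\<Sum>i\<in>UNIV. hessf f i i x / of_real ((conf x)\<^sup>2))" by simp
  have "(\<Sum>i\<in>UNIV. hessf f i i x) = (\<Sum>i\<in>UNIV. wpar i (wpar i f) x) - of_real (conf x) * (2 * (\<Sum>i\<in>UNIV. of_real (x $ i) * wpar i f x)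
      - of_nat CARD('n) * (\<Sum>i\<in>UNIV. of_real (x $ i) * wpar i f x))"
    unfolding hessf_def by (simp add: sum_subtractf sum.distrib algebra_simps flip: sum_distrib_left)
  also have "\<dots> = (\<Sum>i\<in>UNIV. wpar i (wpar i f) x) + of_real ((real CARD('n) - 2) * conf x) * (\<Sum>i\<in>UNIV. of_real (x $ i) * wpar i f x)"
    by (simp add: algebra_simps)
  finally show "laplace_beltrami hyp_domain hyp_metric f x = lap (\<lambda>i. wpar i f) (\<lambda>i j. wpar i (wpar j f)) x"
    unfolding 1 lap_def sum_divide_distrib[symmetric] by simp
qed

lemma locally_integrable_loc1:
  fixes f :: "real^'n::finite \<Rightarrow> complex"
  assumes "locally_integrable hyp_domain f"
  shows "loc1 f"
proof -
  have s: "integrable lebesgue (\<lambda>x. indicator (cball 0 R) x *\<^sub>R f x)" if "R < 1" for R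
  proof -
    have "cball 0 R \<subseteq> (hyp_domain :: (real^'n) set)" using that by (auto simp: hyp_domain_def)
    then show ?thesis using assms by (auto simp: locally_integrable_def set_integrable_def)
  qed
  have m: "cut R f \<in> borel_measurable ballL" if "R < 1" for R
    using borel_measurable_integrable[OF s[OF that]]
    by (intro measurable_restrict_space1) (simp add: scaleR_conv_of_real of_real_indicator)
  have fm: "f \<in> borel_measurable ballL"
  proof (rule borel_measurable_LIMSEQ_metric)
    show "cut (1 - inverse (real (Suc k))) f \<in> borel_measurable ballL" for k
      by (rule m) simp
    fix x :: "real^'n" assume "x \<in> space ballL"
    then have "0 < 1 - norm x" by simp
    then have "\<forall>\<^sub>F k in sequentially. inverse (real (Suc k)) < 1 - norm x"
      by (rule order_tendstoD(2)[OF LIMSEQ_inverse_real_of_nat])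
    then have "\<forall>\<^sub>F k in sequentially. cut (1 - inverse (real (Suc k))) f x = f x"
      by eventually_elim simp
    then show "(\<lambda>k. cut (1 - inverse (real (Suc k))) f x) \<longlonglongrightarrow> f x" by (rule tendsto_eventually)
  qed
  have "integrable ballL (cut R f)" if "R < 1" for R
  proof -
    have "integrable lebesgue (\<lambda>x. indicator (ball 0 1) x *\<^sub>R cut R f x) \<longleftrightarrow> integrable lebesgue (\<lambda>x. indicator (cball 0 R) x *\<^sub>R f x)"
      by (rule Bochner_Integration.integrable_cong) (use that in \<open>auto simp: indicator_def\<close>)
    then show ?thesis using s[OF that] by (subst integrable_restrict_space) auto
  qed
  with fm show ?thesis by (simp add: loc1_def)
qed

lemma test_function_integrable:
  fixes f \<phi> :: "real^'n::finite \<Rightarrow> complex"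
  assumes f: "locally_integrable hyp_domain f" and K: "compact K" "K \<subseteq> ball 0 1"
    and \<phi>: "continuous_on UNIV \<phi>" "\<And>x. x \<notin> K \<Longrightarrow> \<phi> x = 0"
  shows "integrable ballL (\<lambda>x. f x * \<phi> x)"
proof -
  have fm: "f \<in> borel_measurable ballL" using locally_integrable_loc1[OF f] by (simp add: loc1_def)
  have \<phi>m: "\<phi> \<in> borel_measurable ballL" by (intro ballL_borel borel_measurable_continuous_onI \<phi>)
  have "bounded (\<phi> ` K)" by (intro compact_imp_bounded compact_continuous_image continuous_on_subset[OF \<phi>(1)] K) auto
  then obtain B where "\<forall>y\<in>\<phi> ` K. norm y \<le> B" unfolding bounded_iff by blast
  then have B: "norm (\<phi> x) \<le> B" if "x \<in> K" for x using that by auto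
  have "integrable lebesgue (\<lambda>x. indicator K x *\<^sub>R f x)"
    using f K by (auto simp: locally_integrable_def hyp_domain_def set_integrable_def)
  moreover have "(\<lambda>x. indicator (ball 0 1) x *\<^sub>R (indicator K x *\<^sub>R f x)) = (\<lambda>x. indicator K x *\<^sub>R f x)"
    using K(2) by (auto simp: fun_eq_iff indicator_def)
  ultimately have "integrable ballL (\<lambda>x. indicator K x *\<^sub>R f x)"
    by (subst integrable_restrict_space) simp_all
  then have "integrable ballL (\<lambda>x. B * norm (indicator K x *\<^sub>R f x))"
    by (intro integrable_mult_right integrable_norm)
  then show ?thesis
  proof (rule Bochner_Integration.integrable_bound)
    show "(\<lambda>x. f x * \<phi> x) \<in> borel_measurable ballL" using fm \<phi>m by measurable
    show "AE x in ballL. norm (f x * \<phi> x) \<le> norm (B * norm (indicator K x *\<^sub>R f x))"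
    proof (rule AE_I2)
      fix x
      show "norm (f x * \<phi> x) \<le> norm (B * norm (indicator K x *\<^sub>R f x))"
      proof (cases "x \<in> K")
        case True
        then have "norm (f x * \<phi> x) \<le> norm (f x) * B" unfolding norm_mult by (intro mult_left_mono B) auto
        then show ?thesis using True by (simp add: mult.commute)
      qed (simp add: \<phi>)
    qed
  qed
qed

lemma test_functionD:
  fixes \<phi> :: "real^'n::finite \<Rightarrow> complex"
  assumes "\<phi> \<in> test_functions hyp_domain"
  obtains K where "compact K" "K \<subseteq> ball 0 1" "continuous_on UNIV \<phi>" "continuous_on UNIV (partial i \<phi>)"
    "\<And>x. x \<notin> K \<Longrightarrow> \<phi> x = 0" "\<And>x. x \<notin> K \<Longrightarrow> partial i \<phi> x = 0"
proof (rule that[of "closure {x. \<phi> x \<noteq> 0}"])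
  have C: "Ck k \<phi>" for k using assms by (simp add: test_functions_def)
  show "compact (closure {x. \<phi> x \<noteq> 0})" "closure {x. \<phi> x \<noteq> 0} \<subseteq> ball 0 1"
    using assms by (auto simp: test_functions_def hyp_domain_def)
  show "continuous_on UNIV \<phi>" using C[of 0] by simp
  show "continuous_on UNIV (partial i \<phi>)" using C[of 1] by simp
  show z: "\<phi> x = 0" if "x \<notin> closure {x. \<phi> x \<noteq> 0}" for x
  proof (rule ccontr)
    assume "\<phi> x \<noteq> 0"
    then have "x \<in> {x. \<phi> x \<noteq> 0}" by simp
    from subsetD[OF closure_subset this] that show False by simp
  qed
  show "partial i \<phi> x = 0" if x: "x \<notin> closure {x. \<phi> x \<noteq> 0}" for x
  proof -
    have "((\<lambda>_. 0) has_derivative (\<lambda>h. 0)) (at x)" by simp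
    then have "(\<phi> has_derivative (\<lambda>h. 0)) (at x)"
    proof (rule has_derivative_transform_within_open)
      show "open (- closure {x. \<phi> x \<noteq> 0})" by (rule open_Compl) simp
      show "x \<in> - closure {x. \<phi> x \<noteq> 0}" using x by simp
      show "0 = \<phi> y" if "y \<in> - closure {x. \<phi> x \<noteq> 0}" for y
        by (rule z[symmetric]) (use that in simp)
    qed
    from partial_eq[OF this] show ?thesis .
  qed
qed

lemma hwp_diff:
  fixes f g w v :: "real^'n::finite \<Rightarrow> complex"
  assumes f: "hwp i f w" and g: "hwp i g v"
  shows "hwp i (\<lambda>x. f x - g x) (\<lambda>x. w x - v x)"
  unfolding has_weak_partial_def
proof (intro conjI ballI)
  have li: "locally_integrable hyp_domain f" "locally_integrable hyp_domain w" "locally_integrable hyp_domain g" "locally_integrable hyp_domain v"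
    using f g by (auto simp: has_weak_partial_def)
  show "locally_integrable hyp_domain (\<lambda>x. f x - g x)" "locally_integrable hyp_domain (\<lambda>x. w x - v x)"
    using li unfolding locally_integrable_def by (auto intro!: set_integral_diff(1))
  fix \<phi> :: "real^'n \<Rightarrow> complex" assume \<phi>: "\<phi> \<in> test_functions hyp_domain"
  obtain K where K: "compact K" "K \<subseteq> ball 0 1" "continuous_on UNIV \<phi>" "continuous_on UNIV (partial i \<phi>)"
    "\<And>x. x \<notin> K \<Longrightarrow> \<phi> x = 0" "\<And>x. x \<notin> K \<Longrightarrow> partial i \<phi> x = 0"
    using test_functionD[OF \<phi>] by metis
  note ii = test_function_integrable[OF _ K(1,2,3,5)] test_function_integrable[OF _ K(1,2,4,6)]
  have "(LINT x|ballL. (f x - g x) * partial i \<phi> x) = (LINT x|ballL. f x * partial i \<phi> x) - (LINT x|ballL. g x * partial i \<phi> x)"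
    unfolding left_diff_distrib by (intro Bochner_Integration.integral_diff ii li)
  also have "\<dots> = - ((LINT x|ballL. w x * \<phi> x) - (LINT x|ballL. v x * \<phi> x))"
    using f g \<phi> by (simp add: has_weak_partial_def hyp_domain_def)
  also have "(LINT x|ballL. w x * \<phi> x) - (LINT x|ballL. v x * \<phi> x) = (LINT x|ballL. (w x - v x) * \<phi> x)"
    unfolding left_diff_distrib by (intro Bochner_Integration.integral_diff[symmetric] ii li)
  finally show "(LINT x|lebesgue_on hyp_domain. (f x - g x) * partial i \<phi> x) = - (LINT x|lebesgue_on hyp_domain. (w x - v x) * \<phi> x)"
    by (simp add: hyp_domain_def)
qed

section \<open>Sobolev functions on hyperbolic space\<close>

lemma hwp_loc1: "hwp i f w \<Longrightarrow> loc1 f" "hwp i f w \<Longrightarrow> loc1 w"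
  by (auto simp: has_weak_partial_def intro: locally_integrable_loc1)

lemma bump_test:
  fixes x :: "real^'n::finite"
  assumes "0 < \<epsilon>" "norm x + \<epsilon> < 1"
  shows "(\<lambda>y. complex_of_real (bump \<epsilon> (y - x))) \<in> test_functions hyp_domain"
    "(\<lambda>y. complex_of_real (dbump \<epsilon> j (y - x))) \<in> test_functions hyp_domain"
proof -
  have "cball x \<epsilon> \<subseteq> hyp_domain"
  proof
    fix y assume "y \<in> cball x \<epsilon>"
    then show "y \<in> hyp_domain"
      using assms norm_triangle_ineq2[of y x] by (simp add: hyp_domain_def dist_norm norm_minus_commute)
  qed
  then show "(\<lambda>y. complex_of_real (bump \<epsilon> (y - x))) \<in> test_functions hyp_domain"
    "(\<lambda>y. complex_of_real (dbump \<epsilon> j (y - x))) \<in> test_functions hyp_domain"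
    using assms by (auto intro!: bump_algebra_test_function[OF bump_in_algebra] bump_algebra_test_function[OF dbump_in_algebra])
qed

lemma hwp_bump:
  fixes f w :: "real^'n::finite \<Rightarrow> complex"
  assumes "hwp i f w" "0 < \<epsilon>" "norm x + \<epsilon> < 1"
  shows "(LINT y|ballL. f y * of_real (dbump \<epsilon> i (y - x))) = - (LINT y|ballL. w y * of_real (bump \<epsilon> (y - x)))"
    "(LINT y|ballL. f y * partial i (\<lambda>y. complex_of_real (dbump \<epsilon> j (y - x))) y) = - (LINT y|ballL. w y * of_real (dbump \<epsilon> j (y - x)))"
  using assms(1) bump_test[OF assms(2,3)] partial_bump[of i \<epsilon> x]
  by (auto simp: has_weak_partial_def hyp_domain_def)

lemma hwp_weakp: "hwp i f w \<Longrightarrow> weakp i f w"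
  using hwp_loc1[of i f w] hwp_bump(1)[of i f w] by (auto simp: weakp_def loc1_def)

text \<open>The first derivatives of a bump are themselves test functions, with symmetric derivatives, so the two
  orders of weak differentiation have the same effect on bumps.\<close>

lemma hwp_weakp_swap:
  fixes f :: "real^'n::finite \<Rightarrow> complex"
  assumes "hwp i f wi" "hwp j f wj" "hwp j wi W"
  shows "weakp i wj W"
  unfolding weakp_def
proof (intro conjI allI impI)
  show "wj \<in> borel_measurable ballL" "W \<in> borel_measurable ballL"
    using hwp_loc1[OF assms(2)] hwp_loc1[OF assms(3)] by (auto simp: loc1_def)
  fix x :: "real^'n" and \<epsilon> :: real assume e: "0 < \<epsilon>" "norm x + \<epsilon> < 1"
  have "(LINT y|ballL. wj y * of_real (dbump \<epsilon> i (y - x))) = - (LINT y|ballL. f y * partial j (\<lambda>y. complex_of_real (dbump \<epsilon> i (y - x))) y)"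
    using hwp_bump(2)[OF assms(2) e, of i] by simp
  also have "\<dots> = - (LINT y|ballL. f y * partial i (\<lambda>y. complex_of_real (dbump \<epsilon> j (y - x))) y)"
    by (simp add: partial_dbump_commute[of j])
  also have "\<dots> = (LINT y|ballL. wi y * of_real (dbump \<epsilon> j (y - x)))"
    using hwp_bump(2)[OF assms(1) e, of j] by simp
  also have "\<dots> = - (LINT y|ballL. W y * of_real (bump \<epsilon> (y - x)))"
    by (rule hwp_bump(1)[OF assms(3) e])
  finally show "(LINT y|ballL. wj y * of_real (dbump \<epsilon> i (y - x))) = - (LINT y|ballL. W y * of_real (bump \<epsilon> (y - x)))" .
qed

text \<open>The difference of two weak derivatives is orthogonal to every bump.\<close>

lemma hwp_unique:
  fixes f g w v :: "real^'n::finite \<Rightarrow> complex"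
  assumes f: "hwp i f w" and g: "hwp i g v" and eq: "AE x in ballL. f x = g x"
  shows "AE x in ballL. w x = v x"
proof -
  have h: "hwp i (\<lambda>x. f x - g x) (\<lambda>x. w x - v x)" by (rule hwp_diff[OF f g])
  have fm: "f \<in> borel_measurable ballL" "g \<in> borel_measurable ballL"
    using hwp_loc1[OF f] hwp_loc1[OF g] by (auto simp: loc1_def)
  have "AE x in ballL. w x - v x = 0"
  proof (rule bump_orthogonal_imp_zero)
    show "loc1 (\<lambda>x. w x - v x)" by (rule hwp_loc1(2)[OF h])
    fix x :: "real^'n" and \<epsilon> :: real assume e: "0 < \<epsilon>" "norm x + \<epsilon> < 1"
    have dm: "(\<lambda>y. complex_of_real (dbump \<epsilon> i (y - x))) \<in> borel_measurable ballL"
      by (rule ballL_borel) measurable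
    have "(LINT y|ballL. (f y - g y) * of_real (dbump \<epsilon> i (y - x))) = (LINT y|(ballL :: (real^'n) measure). 0)"
      by (rule integral_cong_AE) (use fm dm eq in \<open>auto elim: eventually_mono\<close>)
    then show "(LINT y|ballL. (w y - v y) * of_real (bump \<epsilon> (y - x))) = 0"
      using hwp_bump(1)[OF h e] by simp
  qed
  then show ?thesis by eventually_elim simp
qed

lemma hwp_cong_AE:
  fixes f g w :: "real^'n::finite \<Rightarrow> complex"
  assumes f: "hwp i f w" and g: "locally_integrable hyp_domain g" and eq: "AE x in ballL. f x = g x"
  shows "hwp i g w"
  unfolding has_weak_partial_def
proof (intro conjI ballI g)
  show "locally_integrable hyp_domain w" using f by (simp add: has_weak_partial_def)
  fix \<phi> :: "real^'n \<Rightarrow> complex" assume \<phi>: "\<phi> \<in> test_functions hyp_domain"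
  have "Ck 1 \<phi>" using \<phi> by (simp add: test_functions_def)
  then have pm: "partial i \<phi> \<in> borel_measurable ballL"
    by (intro ballL_borel borel_measurable_continuous_onI) simp
  have fm: "f \<in> borel_measurable ballL" "g \<in> borel_measurable ballL"
    using hwp_loc1[OF f] locally_integrable_loc1[OF g] by (auto simp: loc1_def)
  have "(LINT x|ballL. g x * partial i \<phi> x) = (LINT x|ballL. f x * partial i \<phi> x)"
    by (rule integral_cong_AE) (use fm pm eq in \<open>auto elim: eventually_mono\<close>)
  also have "\<dots> = - (LINT x|ballL. w x * \<phi> x)" using f \<phi> by (simp add: has_weak_partial_def hyp_domain_def)
  finally show "(LINT x|lebesgue_on hyp_domain. g x * partial i \<phi> x) = - (LINT x|lebesgue_on hyp_domain. w x * \<phi> x)"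
    by (simp add: hyp_domain_def)
qed

abbreviation H2 :: "(real^'n::finite \<Rightarrow> complex) set" where "H2 \<equiv> H2_space hyp_domain hyp_metric"

text \<open>The choice operator behind \<^const>\<open>weak_partial\<close> is resolved here: the chosen derivatives exist, and each
  component is dominated by the pointwise norm of the gradient or Hessian.\<close>

lemma H2D:
  fixes f :: "real^'n::finite \<Rightarrow> complex"
  assumes "f \<in> H2"
  shows "f \<in> square_integrable hypV" "hwp i f (wpar i f)" "hwp i (wpar j f) (wpar i (wpar j f))"
    "(\<lambda>x. wpar i f x / of_real (conf x)) \<in> square_integrable hypV"
    "(\<lambda>x. hessf f i j x / of_real ((conf x)\<^sup>2)) \<in> square_integrable hypV"
proof -
  have a: "f \<in> square_integrable hypV" "\<And>i. \<exists>w. hwp i f w" "\<And>i j. \<exists>w. hwp i (wpar j f) w"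
    "integrable hypV (grad_sq hyp_domain hyp_metric f)" "integrable hypV (hess_sq hyp_domain hyp_metric f)"
    using assms unfolding H2_space_def H1_space_def mem_Collect_eq riem_vol_hyp Lp_space_2 by blast+
  show "f \<in> square_integrable hypV" by (rule a)
  show 1: "hwp i f (wpar i f)" for i unfolding weak_partial_def by (rule someI_ex[OF a(2)])
  show 2: "hwp i (wpar j f) (wpar i (wpar j f))" for i j
    unfolding weak_partial_def[of hyp_domain i "wpar j f"] by (rule someI_ex[OF a(3)])
  have m1 [measurable]: "wpar i f \<in> borel_measurable ballL" for i using hwp_loc1(2)[OF 1] by (simp add: loc1_def)
  have m2 [measurable]: "wpar i (wpar j f) \<in> borel_measurable ballL" for i j using hwp_loc1(2)[OF 2] by (simp add: loc1_def)
  have m3 [measurable]: "hessf f i j \<in> borel_measurable ballL" for i j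
    unfolding hessf_def[abs_def] by measurable
  have g: "integrable hypV (\<lambda>x. \<Sum>i\<in>UNIV. (norm (wpar i f x / of_real (conf x)))\<^sup>2)"
    using a(4) by (subst Bochner_Integration.integrable_cong[OF refl grad_sq_hyp[symmetric]]) auto
  have h: "integrable hypV (\<lambda>x. \<Sum>i\<in>UNIV. \<Sum>j\<in>UNIV. (norm (hessf f i j x / of_real ((conf x)\<^sup>2)))\<^sup>2)"
    using a(5) by (subst Bochner_Integration.integrable_cong[OF refl hess_sq_hyp[symmetric]]) auto
  have m4: "(\<lambda>x. wpar i f x / of_real (conf x)) \<in> borel_measurable ballL" by measurable
  have m5: "(\<lambda>x. hessf f i j x / of_real ((conf x)\<^sup>2)) \<in> borel_measurable ballL" by measurable
  have "integrable hypV (\<lambda>x. (norm (wpar i f x / of_real (conf x)))\<^sup>2)"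
  proof (rule Bochner_Integration.integrable_bound[OF g])
    show "(\<lambda>x. (norm (wpar i f x / of_real (conf x)))\<^sup>2) \<in> borel_measurable hypV" using m4 by simp
    show "AE x in hypV. norm ((norm (wpar i f x / of_real (conf x)))\<^sup>2) \<le> norm (\<Sum>i\<in>UNIV. (norm (wpar i f x / of_real (conf x)))\<^sup>2)"
    proof (rule AE_I2)
      fix x
      have "(norm (wpar i f x / of_real (conf x)))\<^sup>2 \<le> (\<Sum>i\<in>UNIV. (norm (wpar i f x / of_real (conf x)))\<^sup>2)"
        by (rule member_le_sum) auto
      then show "norm ((norm (wpar i f x / of_real (conf x)))\<^sup>2) \<le> norm (\<Sum>i\<in>UNIV. (norm (wpar i f x / of_real (conf x)))\<^sup>2)"
        unfolding real_norm_def by (smt (verit) zero_le_power2)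
    qed
  qed
  then show "(\<lambda>x. wpar i f x / of_real (conf x)) \<in> square_integrable hypV" using m4 by (simp add: square_integrable_def)
  have "integrable hypV (\<lambda>x. (norm (hessf f i j x / of_real ((conf x)\<^sup>2)))\<^sup>2)"
  proof (rule Bochner_Integration.integrable_bound[OF h])
    show "(\<lambda>x. (norm (hessf f i j x / of_real ((conf x)\<^sup>2)))\<^sup>2) \<in> borel_measurable hypV" using m5 by simp
    show "AE x in hypV. norm ((norm (hessf f i j x / of_real ((conf x)\<^sup>2)))\<^sup>2) \<le> norm (\<Sum>i\<in>UNIV. \<Sum>j\<in>UNIV. (norm (hessf f i j x / of_real ((conf x)\<^sup>2)))\<^sup>2)"
    proof (rule AE_I2)
      fix x
      have "(norm (hessf f i j x / of_real ((conf x)\<^sup>2)))\<^sup>2 \<le> (\<Sum>j\<in>UNIV. (norm (hessf f i j x / of_real ((conf x)\<^sup>2)))\<^sup>2)"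
        by (rule member_le_sum) auto
      also have "\<dots> \<le> (\<Sum>i\<in>UNIV. \<Sum>j\<in>UNIV. (norm (hessf f i j x / of_real ((conf x)\<^sup>2)))\<^sup>2)"
        by (rule member_le_sum[of i UNIV "\<lambda>i. \<Sum>j\<in>UNIV. (norm (hessf f i j x / of_real ((conf x)\<^sup>2)))\<^sup>2"]) (auto intro: sum_nonneg)
      finally show "norm ((norm (hessf f i j x / of_real ((conf x)\<^sup>2)))\<^sup>2) \<le> norm (\<Sum>i\<in>UNIV. \<Sum>j\<in>UNIV. (norm (hessf f i j x / of_real ((conf x)\<^sup>2)))\<^sup>2)"
        unfolding real_norm_def by (smt (verit) zero_le_power2)
    qed
  qed
  then show "(\<lambda>x. hessf f i j x / of_real ((conf x)\<^sup>2)) \<in> square_integrable hypV" using m5 by (simp add: square_integrable_def)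
qed

abbreviation wgrad :: "(real^'n::finite \<Rightarrow> complex) \<Rightarrow> 'n \<Rightarrow> real^'n \<Rightarrow> complex" where
  "wgrad f \<equiv> (\<lambda>i. wpar i f)"
abbreviation whess :: "(real^'n::finite \<Rightarrow> complex) \<Rightarrow> 'n \<Rightarrow> 'n \<Rightarrow> real^'n \<Rightarrow> complex" where
  "whess f \<equiv> (\<lambda>i j. wpar i (wpar j f))"

lemma lap_hessf:
  fixes x :: "real^'n::finite"
  assumes "norm x < 1"
  shows "lap (wgrad f) (whess f) x = (\<Sum>i\<in>UNIV. hessf f i i x / of_real ((conf x)\<^sup>2))"
  using laplace_hyp[OF assms, of f] by simp

text \<open>A bound on the covariant Hessian controls the coordinate second derivatives locally, because the
  Christoffel symbols are continuous on the open ball.\<close>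

lemma H2_h2data:
  fixes f :: "real^'n::finite \<Rightarrow> complex"
  assumes f: "f \<in> H2"
  shows "h2data f (wgrad f) (whess f)"
proof -
  note F = H2D[OF f]
  have lw: "loc2 (wpar i f)" for i
  proof (rule loc2_cong)
    show "loc2 (\<lambda>x. of_real (conf x) * (wpar i f x / of_real (conf x)))"
      by (rule loc2_continuous_mult[OF square_integrable_hypV_loc2[OF F(4)] continuous_on_conf])
    show "of_real (conf x) * (wpar i f x / of_real (conf x)) = wpar i f x" if "norm x < 1" for x
      using conf_pos[OF that] by simp
  qed
  have lh: "loc2 (hessf f i j)" for i j
  proof (rule loc2_cong)
    show "loc2 (\<lambda>x. of_real ((conf x)\<^sup>2) * (hessf f i j x / of_real ((conf x)\<^sup>2)))"
      by (rule loc2_continuous_mult[OF square_integrable_hypV_loc2[OF F(5)]]) (intro continuous_intros continuous_on_conf)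
    show "of_real ((conf x)\<^sup>2) * (hessf f i j x / of_real ((conf x)\<^sup>2)) = hessf f i j x" if "norm x < 1" for x
      using conf_pos[OF that] by simp
  qed
  have lc: "loc2 (\<lambda>x. of_real (x $ i) * g x)" if "loc2 g" for g :: "real^'n \<Rightarrow> complex" and i
    by (rule loc2_continuous_mult[OF that]) (intro continuous_intros)
  have lW: "loc2 (wpar i (wpar j f))" for i j
  proof (rule loc2_cong)
    have l3: "loc2 (\<lambda>x. (if i = j then \<Sum>k\<in>UNIV. of_real (x $ k) * wpar k f x else 0))"
      proof (cases "i = j")
      case True
      have "loc2 (\<lambda>x. \<Sum>k\<in>UNIV. of_real (x $ k) * wpar k f x)" by (intro loc2_sum lc lw)
      with True show ?thesis by simp
    qed (simp add: loc2_def square_integrable_def)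
    show "loc2 (\<lambda>x. hessf f i j x + of_real (conf x) * (of_real (x $ i) * wpar j f x + of_real (x $ j) * wpar i f x
      - (if i = j then \<Sum>k\<in>UNIV. of_real (x $ k) * wpar k f x else 0)))"
      by (intro loc2_add lh loc2_continuous_mult[OF _ continuous_on_conf] loc2_diff lc lw l3)
    show "hessf f i j x + of_real (conf x) * (of_real (x $ i) * wpar j f x + of_real (x $ j) * wpar i f x
      - (if i = j then \<Sum>k\<in>UNIV. of_real (x $ k) * wpar k f x else 0)) = wpar i (wpar j f) x" for x
      unfolding hessf_def by simp
  qed
  have L: "lap (wgrad f) (whess f) \<in> square_integrable hypV"
  proof (rule square_integrable_cong)
    show "(\<lambda>x. \<Sum>i\<in>UNIV. hessf f i i x / of_real ((conf x)\<^sup>2)) \<in> square_integrable hypV"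
      by (intro square_integrable_sum F(5))
    show "(\<Sum>i\<in>UNIV. hessf f i i x / of_real ((conf x)\<^sup>2)) = lap (wgrad f) (whess f) x" if "x \<in> space hypV" for x
      using lap_hessf[of x f] that by simp
  qed
  show ?thesis unfolding h2data_def
    using F(1,4) lW L hwp_weakp[OF F(2)] hwp_weakp[OF F(3)] hwp_weakp_swap[OF F(2) F(2) F(3)] by simp
qed

lemma H2_norm_bounds:
  fixes f :: "real^'n::finite \<Rightarrow> complex"
  assumes f: "f \<in> H2"
  shows "l2norm hypV f \<le> H2_norm hyp_domain hyp_metric f"
    "l2norm hypV (\<lambda>x. wpar i f x / of_real (conf x)) \<le> H2_norm hyp_domain hyp_metric f"
    "l2norm hypV (\<lambda>x. hessf f i j x / of_real ((conf x)\<^sup>2)) \<le> H2_norm hyp_domain hyp_metric f"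
proof -
  note F = H2D[OF f]
  define g where "g x = (\<Sum>i\<in>UNIV. (norm (wpar i f x / of_real (conf x)))\<^sup>2)" for x
  define h where "h x = (\<Sum>i\<in>UNIV. \<Sum>j\<in>UNIV. (norm (hessf f i j x / of_real ((conf x)\<^sup>2)))\<^sup>2)" for x
  have i0: "integrable hypV (\<lambda>x. (norm (f x))\<^sup>2)" using F(1) by (rule square_integrableD)
  have ig: "integrable hypV g" unfolding g_def by (intro Bochner_Integration.integrable_sum square_integrableD F(4))
  have ih: "integrable hypV h" unfolding h_def by (intro Bochner_Integration.integrable_sum square_integrableD F(5))
  have "(LINT x|hypV. (norm (f x))\<^sup>2 + grad_sq hyp_domain hyp_metric f x + hess_sq hyp_domain hyp_metric f x) = (LINT x|hypV. (norm (f x))\<^sup>2 + g x + h x)"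
    by (intro Bochner_Integration.integral_cong refl) (simp add: grad_sq_hyp hess_sq_hyp g_def h_def)
  then have N: "H2_norm hyp_domain hyp_metric f = sqrt (LINT x|hypV. (norm (f x))\<^sup>2 + g x + h x)"
    by (simp add: H2_norm_def riem_vol_hyp)
  have gn: "0 \<le> g x" "0 \<le> h x" for x by (auto simp: g_def h_def intro!: sum_nonneg)
  have le: "l2norm hypV q \<le> H2_norm hyp_domain hyp_metric f"
    if "q \<in> square_integrable hypV" "\<And>x. (norm (q x))\<^sup>2 \<le> (norm (f x))\<^sup>2 + g x + h x" for q
    unfolding N l2norm_def
    by (intro real_sqrt_le_mono integral_mono square_integrableD(2)[OF that(1)] that(2) Bochner_Integration.integrable_add i0 ig ih)
  show "l2norm hypV f \<le> H2_norm hyp_domain hyp_metric f"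
    using gn by (intro le F(1)) (simp add: add.assoc)
  have "(norm (wpar i f x / of_real (conf x)))\<^sup>2 \<le> g x" for x
    unfolding g_def by (rule member_le_sum) auto
  then show "l2norm hypV (\<lambda>x. wpar i f x / of_real (conf x)) \<le> H2_norm hyp_domain hyp_metric f"
    using gn by (intro le F(4)) (smt (verit) zero_le_power2)
  have "(norm (hessf f i j x / of_real ((conf x)\<^sup>2)))\<^sup>2 \<le> h x" for x
  proof -
    have "(norm (hessf f i j x / of_real ((conf x)\<^sup>2)))\<^sup>2 \<le> (\<Sum>j\<in>UNIV. (norm (hessf f i j x / of_real ((conf x)\<^sup>2)))\<^sup>2)"
      by (rule member_le_sum) auto
    also have "\<dots> \<le> h x" unfolding h_def
      by (rule member_le_sum[of i UNIV "\<lambda>i. \<Sum>j\<in>UNIV. (norm (hessf f i j x / of_real ((conf x)\<^sup>2)))\<^sup>2"]) (auto intro: sum_nonneg)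
    finally show ?thesis .
  qed
  then show "l2norm hypV (\<lambda>x. hessf f i j x / of_real ((conf x)\<^sup>2)) \<le> H2_norm hyp_domain hyp_metric f"
    using gn by (intro le F(5)) (smt (verit) zero_le_power2)
qed

lemma wpar_diff:
  fixes f g :: "real^'n::finite \<Rightarrow> complex"
  assumes f: "f \<in> H2" and g: "g \<in> H2"
  shows "hwp i (\<lambda>x. f x - g x) (wpar i (\<lambda>x. f x - g x))"
    "AE x in ballL. wpar i (\<lambda>x. f x - g x) x = wpar i f x - wpar i g x"
    "hwp j (wpar i (\<lambda>x. f x - g x)) (wpar j (wpar i (\<lambda>x. f x - g x)))"
    "AE x in ballL. wpar j (wpar i (\<lambda>x. f x - g x)) x = wpar j (wpar i f) x - wpar j (wpar i g) x"
proof -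
  let ?d = "\<lambda>x. f x - g x"
  have h1: "hwp i ?d (\<lambda>x. wpar i f x - wpar i g x)" by (rule hwp_diff[OF H2D(2)[OF f] H2D(2)[OF g]])
  show 1: "hwp i ?d (wpar i ?d)" by (rule wpar_works[OF h1])
  show 2: "AE x in ballL. wpar i ?d x = wpar i f x - wpar i g x" by (rule hwp_unique[OF 1 h1]) simp
  have h2: "hwp j (\<lambda>x. wpar i f x - wpar i g x) (\<lambda>x. wpar j (wpar i f) x - wpar j (wpar i g) x)"
    by (rule hwp_diff[OF H2D(3)[OF f] H2D(3)[OF g]])
  have "AE x in ballL. wpar i f x - wpar i g x = wpar i ?d x" using 2 by eventually_elim simp
  from hwp_cong_AE[OF h2 _ this] 1
  have h3: "hwp j (wpar i ?d) (\<lambda>x. wpar j (wpar i f) x - wpar j (wpar i g) x)" by (simp add: has_weak_partial_def)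
  show 3: "hwp j (wpar i ?d) (wpar j (wpar i ?d))" by (rule wpar_works[OF h3])
  show "AE x in ballL. wpar j (wpar i ?d) x = wpar j (wpar i f) x - wpar j (wpar i g) x"
    by (rule hwp_unique[OF 3 h3]) simp
qed

lemma hessf_diff:
  fixes f g :: "real^'n::finite \<Rightarrow> complex"
  assumes f: "f \<in> H2" and g: "g \<in> H2"
  shows "AE x in ballL. hessf (\<lambda>x. f x - g x) i j x = hessf f i j x - hessf g i j x"
proof -
  have "AE x in ballL. \<forall>k. wpar k (\<lambda>x. f x - g x) x = wpar k f x - wpar k g x"
    by (rule eventually_all_finite[OF wpar_diff(2)[OF f g]])
  with wpar_diff(4)[OF f g, of i j] show ?thesis
  proof eventually_elim
    case (elim x)
    have s: "(\<Sum>k\<in>UNIV. of_real (x $ k) * (wpar k f x - wpar k g x))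
        = (\<Sum>k\<in>UNIV. of_real (x $ k) * wpar k f x) - (\<Sum>k\<in>UNIV. of_real (x $ k) * wpar k g x)"
      by (simp add: right_diff_distrib sum_subtractf)
    have e: "\<And>k. wpar k (\<lambda>x. f x - g x) x = wpar k f x - wpar k g x" using elim by blast
    show ?case unfolding hessf_def elim(1) e s by (simp add: algebra_simps)
  qed
qed

lemma H2_diff:
  fixes f g :: "real^'n::finite \<Rightarrow> complex"
  assumes f: "f \<in> H2" and g: "g \<in> H2"
  shows "(\<lambda>x. f x - g x) \<in> H2"
proof -
  let ?d = "\<lambda>x. f x - g x"
  note W = wpar_diff[OF f g]
  have dsq: "?d \<in> square_integrable hypV" by (rule square_integrable_diff[OF H2D(1)[OF f] H2D(1)[OF g]])
  have m1 [measurable]: "wpar i ?d \<in> borel_measurable ballL" for i using hwp_loc1(2)[OF W(1)] by (simp add: loc1_def)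
  have m2 [measurable]: "wpar i (wpar j ?d) \<in> borel_measurable ballL" for i j using hwp_loc1(2)[OF W(3)] by (simp add: loc1_def)
  have m3 [measurable]: "hessf ?d i j \<in> borel_measurable ballL" for i j
    unfolding hessf_def[abs_def] by measurable
  have g1: "(\<lambda>x. wpar i ?d x / of_real (conf x)) \<in> square_integrable hypV" for i
  proof (rule square_integrable_cong_AE[OF square_integrable_diff[OF H2D(4)[OF f, of i] H2D(4)[OF g, of i]]])
    have "(\<lambda>x. wpar i ?d x / of_real (conf x)) \<in> borel_measurable ballL" by measurable
    then show "(\<lambda>x. wpar i ?d x / of_real (conf x)) \<in> borel_measurable hypV" by simp
    show "AE x in hypV. wpar i f x / of_real (conf x) - wpar i g x / of_real (conf x) = wpar i ?d x / of_real (conf x)"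
      unfolding AE_hypV using W(2)[of i] by eventually_elim (simp add: diff_divide_distrib)
  qed
  have h1: "(\<lambda>x. hessf ?d i j x / of_real ((conf x)\<^sup>2)) \<in> square_integrable hypV" for i j
  proof (rule square_integrable_cong_AE[OF square_integrable_diff[OF H2D(5)[OF f, of i j] H2D(5)[OF g, of i j]]])
    have "(\<lambda>x. hessf ?d i j x / of_real ((conf x)\<^sup>2)) \<in> borel_measurable ballL" by measurable
    then show "(\<lambda>x. hessf ?d i j x / of_real ((conf x)\<^sup>2)) \<in> borel_measurable hypV" by simp
    show "AE x in hypV. hessf f i j x / of_real ((conf x)\<^sup>2) - hessf g i j x / of_real ((conf x)\<^sup>2) = hessf ?d i j x / of_real ((conf x)\<^sup>2)"
      unfolding AE_hypV using hessf_diff[OF f g, of i j] by eventually_elim (simp add: diff_divide_distrib)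
  qed
  have "integrable hypV (grad_sq hyp_domain hyp_metric ?d)"
    by (subst Bochner_Integration.integrable_cong[OF refl grad_sq_hyp])
      (auto intro!: Bochner_Integration.integrable_sum square_integrableD g1)
  moreover have "integrable hypV (hess_sq hyp_domain hyp_metric ?d)"
    by (subst Bochner_Integration.integrable_cong[OF refl hess_sq_hyp])
      (simp, intro Bochner_Integration.integrable_sum square_integrableD(2)[OF h1])
  ultimately show ?thesis
    using dsq W(1,3) by (auto simp: H2_space_def H1_space_def riem_vol_hyp Lp_space_2)
qed

text \<open>The Sobolev norm of a difference bounds the differences of all quantities in the virial identity.  The
  derivatives chosen for \<open>f - g\<close> agree with those of \<open>f\<close> minus those of \<open>g\<close> up to a null set.\<close>

lemma H2_distance_bounds:
  fixes f g :: "real^'n::finite \<Rightarrow> complex"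
  assumes f: "f \<in> H2" and g: "g \<in> H2"
  defines "\<delta> \<equiv> H2_norm hyp_domain hyp_metric (\<lambda>x. f x - g x)"
  shows "l2norm hypV (\<lambda>x. f x - g x) \<le> \<delta>"
    "l2norm hypV (\<lambda>x. wpar i f x / of_real (conf x) - wpar i g x / of_real (conf x)) \<le> \<delta>"
    "l2norm hypV (\<lambda>x. lap (wgrad f) (whess f) x - lap (wgrad g) (whess g) x) \<le> real CARD('n) * \<delta>"
proof -
  let ?d = "\<lambda>x. f x - g x"
  have d: "?d \<in> H2" by (rule H2_diff[OF f g])
  note B = H2_norm_bounds[OF d]
  show "l2norm hypV ?d \<le> \<delta>" unfolding \<delta>_def by (rule B)
  have "l2norm hypV (\<lambda>x. wpar i f x / of_real (conf x) - wpar i g x / of_real (conf x)) = l2norm hypV (\<lambda>x. wpar i ?d x / of_real (conf x))"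
  proof (rule l2norm_cong_AE)
    show "AE x in hypV. wpar i f x / of_real (conf x) - wpar i g x / of_real (conf x) = wpar i ?d x / of_real (conf x)"
      unfolding AE_hypV using wpar_diff(2)[OF f g, of i] by eventually_elim (simp add: diff_divide_distrib)
  qed (intro square_integrableD(1)[OF square_integrable_diff[OF H2D(4)[OF f] H2D(4)[OF g]]] square_integrableD(1)[OF H2D(4)[OF d]])+
  then show "l2norm hypV (\<lambda>x. wpar i f x / of_real (conf x) - wpar i g x / of_real (conf x)) \<le> \<delta>"
    using B(2)[of i] by (simp add: \<delta>_def)
  define h where "h i x = hessf ?d i i x / of_real ((conf x)\<^sup>2)" for i x
  have hs: "h i \<in> square_integrable hypV" for i unfolding h_def by (rule H2D(5)[OF d])
  have lsq: "(\<lambda>x. lap (wgrad f) (whess f) x - lap (wgrad g) (whess g) x) \<in> square_integrable hypV"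
    by (intro square_integrable_diff h2dataD(6)[OF H2_h2data[OF f]] h2dataD(6)[OF H2_h2data[OF g]])
  have "l2norm hypV (\<lambda>x. lap (wgrad f) (whess f) x - lap (wgrad g) (whess g) x) = l2norm hypV (\<lambda>x. \<Sum>i\<in>UNIV. h i x)"
  proof (rule l2norm_cong_AE)
    show "(\<lambda>x. lap (wgrad f) (whess f) x - lap (wgrad g) (whess g) x) \<in> borel_measurable hypV" by (rule square_integrableD(1)[OF lsq])
    show "(\<lambda>x. \<Sum>i\<in>UNIV. h i x) \<in> borel_measurable hypV" by (rule square_integrableD(1)[OF square_integrable_sum[OF hs]])
    have "AE x in (ballL :: (real^'n) measure). \<forall>i. hessf ?d i i x = hessf f i i x - hessf g i i x"
      by (rule eventually_all_finite[OF hessf_diff[OF f g]])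
    moreover have "AE x in (ballL :: (real^'n) measure). norm x < 1" by (rule AE_I2) simp
    ultimately show "AE x in hypV. lap (wgrad f) (whess f) x - lap (wgrad g) (whess g) x = (\<Sum>i\<in>UNIV. h i x)"
      unfolding AE_hypV by eventually_elim (simp add: lap_hessf h_def diff_divide_distrib sum_subtractf)
  qed
  also have "\<dots> \<le> (\<Sum>i\<in>UNIV. l2norm hypV (h i))"
  proof -
    have "l2norm hypV (\<lambda>x. \<Sum>i\<in>I. h i x) \<le> (\<Sum>i\<in>I. l2norm hypV (h i))" if "finite I" for I
      using that
    proof (induction I)
      case empty
      then show ?case by (simp add: l2norm_def)
    next
      case (insert i I)
      then show ?case using l2norm_triangle[OF hs[of i] square_integrable_sum[of I h, OF hs]] by simp
    qed
    then show ?thesis by simp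
  qed
  also have "\<dots> \<le> (\<Sum>i\<in>(UNIV::'n set). \<delta>)"
    unfolding h_def \<delta>_def by (intro sum_mono B(3))
  finally show "l2norm hypV (\<lambda>x. lap (wgrad f) (whess f) x - lap (wgrad g) (whess g) x) \<le> real CARD('n) * \<delta>" by simp
qed

section \<open>The power nonlinearity\<close>

text \<open>The graph of \<open>x \<mapsto> x\<^sup>a\<close> lies above its tangent at \<open>y\<close>; in the form of Young's inequality this
  includes the endpoint \<open>y = 0\<close>.\<close>

lemma powr_tangent:
  fixes x y a :: real
  assumes "1 < a" "0 \<le> x" "0 \<le> y"
  shows "y powr a + a * y powr (a - 1) * (x - y) \<le> x powr a"
proof -
  have q: "1 < a / (a - 1)" "1 / a + 1 / (a / (a - 1)) = 1" using assms(1) by (auto simp: field_simps)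
  have "x * y powr (a - 1) \<le> x powr a / a + (y powr (a - 1)) powr (a / (a - 1)) / (a / (a - 1))"
    by (rule Youngs_inequality) (use assms q in auto)
  also have "(y powr (a - 1)) powr (a / (a - 1)) = y powr a" using assms(1) by (simp add: powr_powr)
  finally have "a * (x * y powr (a - 1)) \<le> a * (x powr a / a + y powr a / (a / (a - 1)))"
    using assms(1) by (intro mult_left_mono) auto
  also have "\<dots> = x powr a + (a - 1) * y powr a" using assms(1) by (simp add: field_simps)
  finally have "a * (x * y powr (a - 1)) \<le> x powr a + (a - 1) * y powr a" .
  moreover have "y powr (a - 1) * y = y powr a"
  proof (cases "y = 0")
    case False
    then show ?thesis using assms(3) powr_mult_base[of y "a - 1"] by (simp add: mult.commute)
  qed simp
  ultimately show ?thesis by (simp add: algebra_simps)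
qed

definition power_nl :: "real \<Rightarrow> complex \<Rightarrow> complex" where
  "power_nl p z = of_real (norm z powr (p - 1)) * z"

lemma power_nl_norm: "norm (power_nl p z) = norm z powr p"
proof (cases "z = 0")
  case False
  then show ?thesis using powr_mult_base[of "norm z" "p - 1"] by (simp add: power_nl_def norm_mult mult.commute)
qed (simp add: power_nl_def)

lemma power_nl_self: "power_nl p z * cnj z = of_real (norm z powr (p + 1))"
proof (cases "z = 0")
  case False
  have "power_nl p z * cnj z = of_real (norm z powr (p - 1) * (norm z)\<^sup>2)"
    by (simp only: power_nl_def of_real_mult complex_norm_square mult.assoc)
  also have "norm z powr (p - 1) * (norm z)\<^sup>2 = norm z powr (p + 1)"
    using False powr_add[of "norm z" "p - 1" 2] by (simp add: powr_numeral add.commute)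
  finally show ?thesis .
qed (simp add: power_nl_def)

text \<open>Convexity of \<open>|z|\<^sup>p\<^sup>+\<^sup>1\<close>, whose real gradient at \<open>a\<close> is \<open>p + 1\<close> times the nonlinearity.\<close>

lemma power_nl_convex:
  assumes p: "1 < p"
  shows "norm a powr (p + 1) + (p + 1) * Re ((b - a) * cnj (power_nl p a)) \<le> norm b powr (p + 1)"
proof -
  have "Re (b * cnj (power_nl p a)) \<le> norm b * norm a powr p"
    using complex_Re_le_cmod[of "b * cnj (power_nl p a)"] by (simp add: norm_mult power_nl_norm)
  moreover have "Re (a * cnj (power_nl p a)) = norm a powr (p + 1)"
  proof -
    have "a * cnj (power_nl p a) = cnj (power_nl p a * cnj a)" by (simp add: mult.commute)
    then show ?thesis unfolding power_nl_self by simp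
  qed
  moreover have "norm a * norm a powr p = norm a powr (p + 1)"
    using powr_mult_base[of "norm a" p] by (simp add: add.commute)
  ultimately have "Re ((b - a) * cnj (power_nl p a)) \<le> norm a powr p * (norm b - norm a)"
    by (simp add: left_diff_distrib right_diff_distrib mult.commute)
  then have "(p + 1) * Re ((b - a) * cnj (power_nl p a)) \<le> (p + 1) * (norm a powr p * (norm b - norm a))"
    using p by (intro mult_left_mono) auto
  moreover have "norm a powr (p + 1) + (p + 1) * (norm a powr p * (norm b - norm a)) \<le> norm b powr (p + 1)"
    using powr_tangent[of "p + 1" "norm b" "norm a"] p by (simp add: mult.assoc)
  ultimately show ?thesis by linarith
qed

text \<open>The nonlinearity with the modulus in the factor \<open>|z|\<^sup>p\<^sup>-\<^sup>1\<close> capped at \<open>m\<close>: it is globally Lipschitz and still a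
  gradient.\<close>

definition trunc_nl :: "real \<Rightarrow> real \<Rightarrow> complex \<Rightarrow> complex" where
  "trunc_nl p m z = of_real (min (norm z) m powr (p - 1)) * z"

text \<open>Split the difference into a change of direction, weighted by at most \<open>m\<^sup>p\<^sup>-\<^sup>1\<close>, and a radial change, which the
  tangent inequality bounds by \<open>p m\<^sup>p\<^sup>-\<^sup>1\<close> times the distance.\<close>

lemma trunc_nl_lipschitz:
  assumes p: "1 < p" and m: "0 < m"
  shows "norm (trunc_nl p m z - trunc_nl p m z') \<le> (p + 1) * m powr (p - 1) * norm (z - z')"
proof -
  define q where "q = p - 1"
  have q: "0 < q" using p by (simp add: q_def)
  have key: "norm (trunc_nl p m z - trunc_nl p m z') \<le> (q + 2) * m powr q * norm (z - z')"
    if le: "norm z' \<le> norm z" for z z'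
  proof -
    define r' \<rho> where "r' = norm z'" and "\<rho> = min (norm z) m"
    have d: "norm z - r' \<le> norm (z - z')" using norm_triangle_ineq2[of z z'] by (simp add: r'_def)
    have \<rho>m: "0 \<le> \<rho>" "\<rho> powr q \<le> m powr q" using m q by (auto simp: \<rho>_def intro!: powr_mono2)
    have t: "(\<rho> powr q - min r' m powr q) * r' \<le> (q + 1) * m powr q * norm (z - z')"
    proof (cases "r' \<le> m")
      case True
      then have rr: "r' \<le> \<rho>" "0 \<le> r'" using le by (auto simp: \<rho>_def r'_def)
      have "\<rho> powr q * r' \<le> \<rho> powr q * \<rho>" by (intro mult_left_mono rr) simp
      also have "\<dots> = \<rho> powr (q + 1)" using powr_mult_base[OF \<rho>m(1), of q] by (simp add: mult.commute add.commute)
      finally have 1: "\<rho> powr q * r' \<le> \<rho> powr (q + 1)" .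
      have "(\<rho> powr q - r' powr q) * r' = \<rho> powr q * r' - r' powr (q + 1)"
        using powr_mult_base[OF rr(2), of q] by (simp add: algebra_simps)
      also have "\<dots> \<le> (q + 1) * \<rho> powr q * (\<rho> - r')"
        using 1 powr_tangent[of "q + 1" r' \<rho>] q rr \<rho>m(1) by (simp add: algebra_simps)
      also have "\<dots> \<le> (q + 1) * m powr q * norm (z - z')"
        using q \<rho>m rr d by (intro mult_mono) (auto simp: \<rho>_def)
      finally show ?thesis using True by simp
    next
      case False
      then have "\<rho> = m" using le by (simp add: \<rho>_def r'_def)
      then show ?thesis using False q by simp
    qed
    have mono: "min r' m powr q \<le> \<rho> powr q"
      using le m q by (intro powr_mono2) (auto simp: r'_def \<rho>_def)
    have "trunc_nl p m z - trunc_nl p m z' = of_real (\<rho> powr q) * (z - z') + of_real (\<rho> powr q - min r' m powr q) * z'"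
      by (simp add: trunc_nl_def q_def \<rho>_def r'_def algebra_simps)
    then have "norm (trunc_nl p m z - trunc_nl p m z')
        \<le> norm (of_real (\<rho> powr q) * (z - z')) + norm (of_real (\<rho> powr q - min r' m powr q) * z')"
      by (simp only: norm_triangle_ineq)
    also have "\<dots> = \<rho> powr q * norm (z - z') + (\<rho> powr q - min r' m powr q) * r'"
      using mono by (simp only: norm_mult norm_of_real r'_def) simp
    also have "\<dots> \<le> m powr q * norm (z - z') + (q + 1) * m powr q * norm (z - z')"
      by (intro add_mono t mult_right_mono \<rho>m) simp
    finally show ?thesis by (simp add: algebra_simps)
  qed
  have "norm (trunc_nl p m z - trunc_nl p m z') \<le> (q + 2) * m powr q * norm (z - z')"
  proof (cases "norm z' \<le> norm z")
    case False
    then show ?thesis using key[of z z'] by (simp add: norm_minus_commute)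
  qed (rule key)
  then show ?thesis by (simp add: q_def add.commute)
qed

text \<open>The derivative of the truncated potential with respect to \<open>s = |z|\<^sup>2\<close>.  It is extended by 0 to
  negative \<open>s\<close>, so that the potential, an integral starting at \<open>-1\<close>, is differentiable at \<open>z = 0\<close> as well.\<close>

definition trunc_density :: "real \<Rightarrow> real \<Rightarrow> real \<Rightarrow> real" where
  "trunc_density p m s = (min (max s 0) (m\<^sup>2)) powr ((p - 1) / 2) / 2"

definition trunc_potential :: "real \<Rightarrow> real \<Rightarrow> complex \<Rightarrow> real" where
  "trunc_potential p m z = integral {-1..(norm z)\<^sup>2} (trunc_density p m)"

lemma trunc_potential_has_derivative:
  assumes p: "1 < p" and m: "0 < m"
  shows "(trunc_potential p m has_derivative (\<lambda>h. Re (cnj (trunc_nl p m z) * h))) (at z)"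
proof -
  let ?k = "trunc_density p m" and ?s = "(norm z)\<^sup>2"
  have c: "continuous_on {-1..?s + 1} ?k" unfolding trunc_density_def[abs_def]
    using p by (intro continuous_on_powr' continuous_intros) auto
  have "((\<lambda>x. integral {-1..x} ?k) has_real_derivative ?k ?s) (at ?s within {-1..?s + 1})"
    by (rule integral_has_real_derivative[OF c]) (simp, smt (verit) zero_le_power2)
  moreover have "?s \<in> interior {-1..?s + 1}" by (simp add: interior_atLeastAtMost_real) (smt (verit) zero_le_power2)
  ultimately have d1: "((\<lambda>x. integral {-1..x} ?k) has_real_derivative ?k ?s) (at ?s)" by (simp only: at_within_interior)
  have d2: "((\<lambda>z. (norm z)\<^sup>2) has_derivative (\<lambda>h. 2 * (z \<bullet> h))) (at z)"
    unfolding power2_norm_eq_inner by (auto intro!: derivative_eq_intros simp: inner_commute)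
  have "(min ?s (m\<^sup>2)) powr ((p - 1) / 2) = min (norm z) m powr (p - 1)"
  proof -
    have "min ?s (m\<^sup>2) = (min (norm z) m)\<^sup>2"
      using m by (auto simp: min_def abs_le_square_iff[symmetric] power2_le_iff_abs_le)
    also have "\<dots> powr ((p - 1) / 2) = (min (norm z) m powr 2) powr ((p - 1) / 2)" using m by (simp add: powr_numeral)
    also have "\<dots> = min (norm z) m powr (p - 1)"
    proof -
      have "2 * ((p - 1) / 2) = p - 1" by argo
      then show ?thesis by (simp only: powr_powr)
    qed
    finally show ?thesis .
  qed
  then have k: "?k ?s = min (norm z) m powr (p - 1) / 2" by (simp add: trunc_density_def)
  have "(trunc_potential p m has_derivative (\<lambda>h. ?k ?s * (2 * (z \<bullet> h)))) (at z)"
    unfolding trunc_potential_def[abs_def]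
    using has_derivative_compose[OF d2 d1[unfolded has_field_derivative_def]] .
  moreover have "(\<lambda>h. ?k ?s * (2 * (z \<bullet> h))) = (\<lambda>h. Re (cnj (trunc_nl p m z) * h))"
    by (simp add: fun_eq_iff k trunc_nl_def inner_complex_def algebra_simps)
  ultimately show ?thesis by simp
qed

lemma trunc_potential_bounds:
  assumes p: "1 < p" and m: "0 < m"
  shows "0 \<le> trunc_potential p m z" "trunc_potential p m z \<le> norm z powr (p + 1) / (p + 1)"
    "norm z \<le> m \<Longrightarrow> trunc_potential p m z = norm z powr (p + 1) / (p + 1)"
proof -
  define \<alpha> s where "\<alpha> = (p - 1) / 2" and "s = (norm z)\<^sup>2"
  have \<alpha>: "0 < \<alpha>" "p + 1 = 2 * (\<alpha> + 1)" using p by (simp_all add: \<alpha>_def field_simps)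
  have s: "0 \<le> s" by (simp add: s_def)
  let ?k = "trunc_density p m" and ?e = "\<lambda>x::real. (max x 0) powr \<alpha> / 2"
  have "((\<lambda>x. x powr \<alpha> / 2) has_integral (s powr (\<alpha> + 1) / (\<alpha> + 1)) / 2) {0..s}"
    by (intro has_integral_divide has_integral_powr_from_0 s) (use \<alpha> in auto)
  then have 1: "(?e has_integral (s powr (\<alpha> + 1) / (\<alpha> + 1)) / 2) {0..s}"
    by (rule has_integral_eq[rotated]) auto
  have 2: "(?e has_integral 0) {-1..0}" by (rule has_integral_is_0) (auto simp: max_def)
  have "s powr (\<alpha> + 1) = (norm z powr 2) powr (\<alpha> + 1)" by (simp add: s_def powr_numeral)
  also have "\<dots> = norm z powr (p + 1)" unfolding powr_powr \<alpha>(2) by simp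
  finally have e: "(?e has_integral norm z powr (p + 1) / (p + 1)) {-1..s}"
    using has_integral_combine[OF _ s 2 1] by (simp add: \<alpha>(2) mult.commute)
  have ki: "?k integrable_on {-1..s}"
    unfolding trunc_density_def[abs_def] using p by (intro integrable_continuous_real continuous_on_powr' continuous_intros) auto
  show "0 \<le> trunc_potential p m z" unfolding trunc_potential_def
    by (rule integral_nonneg) (use ki in \<open>auto simp: s_def trunc_density_def\<close>)
  have "integral {-1..s} ?k \<le> integral {-1..s} ?e"
    by (rule integral_le[OF ki has_integral_integrable[OF e]])
      (use \<alpha>(1) in \<open>auto simp: trunc_density_def \<alpha>_def[symmetric] intro!: powr_mono2 divide_right_mono\<close>)
  then show "trunc_potential p m z \<le> norm z powr (p + 1) / (p + 1)"
    unfolding trunc_potential_def s_def[symmetric] integral_unique[OF e] .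
  assume "norm z \<le> m"
  then have "s \<le> m\<^sup>2" unfolding s_def by (intro power_mono) auto
  then have "integral {-1..s} ?k = integral {-1..s} ?e"
    using s by (intro integral_cong) (simp add: trunc_density_def \<alpha>_def)
  then show "trunc_potential p m z = norm z powr (p + 1) / (p + 1)"
    unfolding trunc_potential_def s_def[symmetric] integral_unique[OF e] .
qed

text \<open>Apply the identity for potentials with Lipschitz gradient to the truncations and let the cap tend to
  infinity; the untruncated quantities dominate.\<close>

lemma vfield_power:
  fixes f :: "real^'n::finite \<Rightarrow> complex"
  assumes p: "1 < p" and f: "h2data f w W"
    and fp: "integrable hypV (\<lambda>x. norm (f x) powr (p + 1))"
    and N: "(\<lambda>x. power_nl p (f x)) \<in> square_integrable hypV"
  shows "Re (l2inner hypV (vfield w) (\<lambda>x. power_nl p (f x)))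
    = - (real CARD('n) - 1) / (p + 1) * (LINT x|hypV. norm (f x) powr (p + 1))"
proof -
  let ?T = "\<lambda>k. trunc_nl p (real (Suc k))" and ?G = "\<lambda>k. trunc_potential p (real (Suc k))"
  have fm [measurable]: "f \<in> borel_measurable hypV" by (rule square_integrableD(1)[OF h2dataD(1)[OF f]])
  have X: "vfield w \<in> square_integrable hypV" by (rule vfield_square_integrable(1)[OF h2dataD(8)[OF f] h2dataD(2)[OF f]])
  note Xm [measurable] = square_integrableD(1)[OF X] and Nm [measurable] = square_integrableD(1)[OF N]
  have id: "Re (l2inner hypV (vfield w) (\<lambda>x. ?T k (f x))) = - (real CARD('n) - 1) * (LINT x|hypV. ?G k (f x))" for k
  proof (rule vfield_potential[OF trunc_potential_has_derivative _ trunc_nl_lipschitz _ f])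
    show "trunc_potential p (real (Suc k)) 0 = 0"
      using trunc_potential_bounds(3)[OF p, of "real (Suc k)" 0] by simp
  qed (use p in \<open>auto simp: trunc_nl_def\<close>)
  have ev: "\<forall>\<^sub>F k in sequentially. norm z \<le> real (Suc k)" for z :: complex
  proof -
    obtain k0 where "norm z \<le> real k0" using real_arch_simple by blast
    then show ?thesis by (intro eventually_sequentiallyI[of k0]) simp
  qed
  have "continuous_on UNIV (?T k)" for k
    unfolding trunc_nl_def[abs_def] using p by (intro continuous_on_powr' continuous_intros) auto
  then have Tm [measurable]: "?T k \<in> borel_measurable borel" for k by (rule borel_measurable_continuous_onI)
  have "continuous_on UNIV (?G k)" for k
    using trunc_potential_has_derivative[OF p, of "real (Suc k)"]
    by (intro continuous_at_imp_continuous_on ballI has_derivative_continuous) auto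
  then have Gm [measurable]: "?G k \<in> borel_measurable borel" for k by (rule borel_measurable_continuous_onI)
  have L: "(\<lambda>k. l2inner hypV (vfield w) (\<lambda>x. ?T k (f x))) \<longlonglongrightarrow> l2inner hypV (vfield w) (\<lambda>x. power_nl p (f x))"
    unfolding l2inner_def
  proof (rule integral_dominated_convergence)
    show "integrable hypV (\<lambda>x. norm (vfield w x * cnj (power_nl p (f x))))"
      by (rule integrable_norm[OF integrable_prod_cnj[OF X N]])
    show "AE x in hypV. (\<lambda>k. vfield w x * cnj (?T k (f x))) \<longlonglongrightarrow> vfield w x * cnj (power_nl p (f x))"
    proof (intro AE_I2 tendsto_eventually)
      fix x show "\<forall>\<^sub>F k in sequentially. vfield w x * cnj (?T k (f x)) = vfield w x * cnj (power_nl p (f x))"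
        using ev[of "f x"] by eventually_elim (simp add: trunc_nl_def power_nl_def)
    qed
    show "AE x in hypV. norm (vfield w x * cnj (?T k (f x))) \<le> norm (vfield w x * cnj (power_nl p (f x)))" for k
    proof (rule AE_I2)
      fix x
      have "norm (?T k (f x)) \<le> norm (power_nl p (f x))"
        using p by (auto simp: trunc_nl_def power_nl_def norm_mult intro!: mult_right_mono powr_mono2)
      then show "norm (vfield w x * cnj (?T k (f x))) \<le> norm (vfield w x * cnj (power_nl p (f x)))"
        by (simp add: norm_mult mult_left_mono)
    qed
  qed measurable
  have G: "(\<lambda>k. LINT x|hypV. ?G k (f x)) \<longlonglongrightarrow> (LINT x|hypV. norm (f x) powr (p + 1) / (p + 1))"
  proof (rule integral_dominated_convergence)
    show "integrable hypV (\<lambda>x. norm (f x) powr (p + 1) / (p + 1))" using fp by simp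
    show "AE x in hypV. (\<lambda>k. ?G k (f x)) \<longlonglongrightarrow> norm (f x) powr (p + 1) / (p + 1)"
    proof (intro AE_I2 tendsto_eventually)
      fix x show "\<forall>\<^sub>F k in sequentially. ?G k (f x) = norm (f x) powr (p + 1) / (p + 1)"
        using ev[of "f x"] by eventually_elim (intro trunc_potential_bounds(3)[OF p], auto)
    qed
    show "AE x in hypV. norm (?G k (f x)) \<le> norm (f x) powr (p + 1) / (p + 1)" for k
      by (intro AE_I2) (use trunc_potential_bounds(1,2)[OF p, of "real (Suc k)"] in simp)
  qed measurable
  have "(\<lambda>k. - (real CARD('n) - 1) * (LINT x|hypV. ?G k (f x))) \<longlonglongrightarrow> Re (l2inner hypV (vfield w) (\<lambda>x. power_nl p (f x)))"
    using tendsto_Re[OF L] unfolding id .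
  moreover have "(\<lambda>k. - (real CARD('n) - 1) * (LINT x|hypV. ?G k (f x))) \<longlonglongrightarrow> - (real CARD('n) - 1) * (LINT x|hypV. norm (f x) powr (p + 1) / (p + 1))"
    by (intro tendsto_mult_left G)
  ultimately have "Re (l2inner hypV (vfield w) (\<lambda>x. power_nl p (f x))) = - (real CARD('n) - 1) * (LINT x|hypV. norm (f x) powr (p + 1) / (p + 1))"
    by (rule LIMSEQ_unique)
  then show ?thesis by simp
qed

section \<open>Conservation laws and blow-up\<close>

text \<open>A solution on all of \<open>[0, \<infinity>)\<close>, which negative energy will exclude.\<close>

locale global_nls_flow =
  fixes p :: real and u ut :: "real \<Rightarrow> real^'n::finite \<Rightarrow> complex"
  assumes dim: "CARD('n) \<ge> 3" and p: "1 < p"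
    and u_H2: "0 \<le> t \<Longrightarrow> u t \<in> H2"
    and u_Lp: "0 \<le> t \<Longrightarrow> integrable hypV (\<lambda>x. norm (u t x) powr (p + 1))"
    and u_H2_cont: "continuous_wrt (H2_norm hyp_domain hyp_metric) {0..} u"
    and u_C1: "C1_L2_curve hypV {0..} u ut"
    and equation: "0 \<le> t \<Longrightarrow> AE x in hypV. \<i> * ut t x = lap (wgrad (u t)) (whess (u t)) x + power_nl p (u t x)"
begin

abbreviation L :: "real \<Rightarrow> real^'n \<Rightarrow> complex" where "L t \<equiv> lap (wgrad (u t)) (whess (u t))"
abbreviation P :: "real \<Rightarrow> real^'n \<Rightarrow> complex" where "P t \<equiv> (\<lambda>x. power_nl p (u t x))"
abbreviation X :: "real \<Rightarrow> real^'n \<Rightarrow> complex" where "X t \<equiv> vfield (wgrad (u t))"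
abbreviation D :: "real \<Rightarrow> real \<Rightarrow> real^'n \<Rightarrow> complex" where
  "D t s \<equiv> (\<lambda>x. of_real (1 / (s - t)) * (u s x - u t x))"
abbreviation ip :: "(real^'n \<Rightarrow> complex) \<Rightarrow> (real^'n \<Rightarrow> complex) \<Rightarrow> complex" where "ip \<equiv> l2inner hypV"
abbreviation SQ :: "(real^'n \<Rightarrow> complex) set" where "SQ \<equiv> square_integrable hypV"

definition mass :: "real \<Rightarrow> real" where "mass t = (l2norm hypV (u t))\<^sup>2"
text \<open>Division by the conformal factor turns coordinate components into hyperbolic lengths.\<close>

definition kin :: "real \<Rightarrow> real" where
  "kin t = (\<Sum>i\<in>UNIV. (l2norm hypV (\<lambda>x. wpar i (u t) x / of_real (conf x)))\<^sup>2)"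
definition pot :: "real \<Rightarrow> real" where "pot t = (LINT x|hypV. norm (u t x) powr (p + 1))"
definition energy :: "real \<Rightarrow> real" where "energy t = kin t - 2 / (p + 1) * pot t"
definition J :: "real \<Rightarrow> real" where "J t = Im (ip (X t) (u t))"

lemma eventually_nonneg_time: "(\<And>s. 0 \<le> s \<Longrightarrow> s \<noteq> t \<Longrightarrow> Q s) \<Longrightarrow> eventually Q (at t within {0..})"
  by (simp add: eventually_at_filter)

lemma u_h2data: "0 \<le> t \<Longrightarrow> h2data (u t) (wgrad (u t)) (whess (u t))"
  by (intro H2_h2data u_H2)

lemma u_sq: "0 \<le> t \<Longrightarrow> u t \<in> SQ"
  by (rule H2D(1)[OF u_H2])

lemma L_sq: "0 \<le> t \<Longrightarrow> L t \<in> SQ"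
  by (rule h2dataD(6)[OF u_h2data])

lemma X_sq: "0 \<le> t \<Longrightarrow> X t \<in> SQ"
  by (rule vfield_square_integrable(1)[OF h2dataD(8)[OF u_h2data] h2dataD(2)[OF u_h2data]])

lemma ut_sq: "0 \<le> t \<Longrightarrow> ut t \<in> SQ"
  using u_C1 by (simp add: C1_L2_curve_def Lp_space_2)

lemma power_nl_measurable [measurable]: "power_nl p \<in> borel_measurable borel"
proof (rule borel_measurable_continuous_onI)
  show "continuous_on UNIV (power_nl p)" unfolding power_nl_def[abs_def]
    using p by (intro continuous_on_powr' continuous_intros) auto
qed

lemma P_measurable: "0 \<le> t \<Longrightarrow> P t \<in> borel_measurable hypV"
  using square_integrableD(1)[OF u_sq] by measurable

lemma P_eq:
  assumes t: "0 \<le> t" shows "AE x in hypV. \<i> * ut t x - L t x = P t x"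
  using equation[OF t] by eventually_elim simp

lemma P_sq: "0 \<le> t \<Longrightarrow> P t \<in> SQ"
  by (rule square_integrable_cong_AE[OF _ P_measurable P_eq])
    (intro square_integrable_diff square_integrable_cmult ut_sq L_sq)

lemma D_sq: "0 \<le> t \<Longrightarrow> 0 \<le> s \<Longrightarrow> D t s \<in> SQ"
  by (intro square_integrable_diff square_integrable_cmult u_sq)

lemma u_cont:
  assumes t: "0 \<le> t" shows "l2_tendsto hypV (at t within {0..}) u (u t)"
proof (rule l2_tendsto_bound[OF u_sq[OF t]])
  show "((\<lambda>s. H2_norm hyp_domain hyp_metric (\<lambda>x. u s x - u t x)) \<longlongrightarrow> 0) (at t within {0..})"
    using u_H2_cont t by (simp add: continuous_wrt_def)
qed (auto intro!: eventually_nonneg_time u_sq H2_distance_bounds(1) u_H2 t)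

text \<open>This and the next two lemmas make every factor of the virial identity continuous in time with values
  in \<open>L\<^sup>2\<close>.\<close>

lemma L_cont:
  assumes t: "0 \<le> t" shows "l2_tendsto hypV (at t within {0..}) L (L t)"
proof (rule l2_tendsto_bound[OF L_sq[OF t]])
  have "((\<lambda>s. H2_norm hyp_domain hyp_metric (\<lambda>x. u s x - u t x)) \<longlongrightarrow> 0) (at t within {0..})"
    using u_H2_cont t by (simp add: continuous_wrt_def)
  then show "((\<lambda>s. real CARD('n) * H2_norm hyp_domain hyp_metric (\<lambda>x. u s x - u t x)) \<longlongrightarrow> 0) (at t within {0..})"
    by (rule tendsto_mult_right_zero)
qed (auto intro!: eventually_nonneg_time L_sq H2_distance_bounds(3) u_H2 t)

lemma X_cont:
  assumes t: "0 \<le> t" shows "l2_tendsto hypV (at t within {0..}) X (X t)"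
proof (rule l2_tendsto_bound[OF X_sq[OF t]])
  let ?\<delta> = "\<lambda>s. H2_norm hyp_domain hyp_metric (\<lambda>x. u s x - u t x)"
  have "(?\<delta> \<longlongrightarrow> 0) (at t within {0..})" using u_H2_cont t by (simp add: continuous_wrt_def)
  then show "((\<lambda>s. real CARD('n) * ?\<delta> s) \<longlongrightarrow> 0) (at t within {0..})"
    by (rule tendsto_mult_right_zero)
  show "\<forall>\<^sub>F s in at t within {0..}. X s \<in> SQ" by (intro eventually_nonneg_time X_sq)
  show "\<forall>\<^sub>F s in at t within {0..}. l2norm hypV (\<lambda>x. X s x - X t x) \<le> real CARD('n) * ?\<delta> s"
  proof (rule eventually_nonneg_time)
    fix s :: real assume s: "0 \<le> s"
    define w where "w i x = wpar i (u s) x - wpar i (u t) x" for i x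
    have wc: "(\<lambda>x. w i x / of_real (conf x)) = (\<lambda>x. wpar i (u s) x / of_real (conf x) - wpar i (u t) x / of_real (conf x))" for i
      by (simp add: w_def diff_divide_distrib)
    have w1: "w i \<in> borel_measurable ballL" for i
      unfolding w_def[abs_def] by (intro borel_measurable_diff h2dataD(8)[OF u_h2data] s t)
    have w2: "(\<lambda>x. w i x / of_real (conf x)) \<in> SQ" for i
      unfolding wc by (intro square_integrable_diff H2D(4) u_H2 s t)
    have b: "l2norm hypV (\<lambda>x. w i x / of_real (conf x)) \<le> ?\<delta> s" for i
      unfolding wc by (rule H2_distance_bounds(2)[OF u_H2[OF s] u_H2[OF t]])
    have "0 \<le> ?\<delta> s" using order_trans[OF l2norm_nonneg b] .
    have "l2norm hypV (\<lambda>x. X s x - X t x) = l2norm hypV (vfield w)"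
      by (simp add: w_def[abs_def] vfield_diff[abs_def])
    moreover have "l2norm hypV (vfield w) \<le> real CARD('n) * ?\<delta> s"
    proof (rule power2_le_imp_le)
      show "0 \<le> real CARD('n) * ?\<delta> s" using \<open>0 \<le> ?\<delta> s\<close> by (intro mult_nonneg_nonneg) auto
      have "(l2norm hypV (vfield w))\<^sup>2 \<le> (\<Sum>i\<in>(UNIV::'n set). (l2norm hypV (\<lambda>x. w i x / of_real (conf x)))\<^sup>2)"
        by (rule vfield_square_integrable(2)[OF w1 w2])
      also have "\<dots> \<le> (\<Sum>i\<in>(UNIV::'n set). (?\<delta> s)\<^sup>2)" by (intro sum_mono power_mono b l2norm_nonneg)
      also have "\<dots> = real CARD('n) * (?\<delta> s)\<^sup>2" by simp
      also have "\<dots> \<le> (real CARD('n))\<^sup>2 * (?\<delta> s)\<^sup>2"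
        using dim by (intro mult_right_mono) (auto simp: power2_eq_square)
      finally show "(l2norm hypV (vfield w))\<^sup>2 \<le> (real CARD('n) * ?\<delta> s)\<^sup>2" unfolding power_mult_distrib .
    qed
    ultimately show "l2norm hypV (\<lambda>x. X s x - X t x) \<le> real CARD('n) * ?\<delta> s" by (simp only:)
  qed
qed

text \<open>The nonlinear term is read off from the equation as \<open>i u' - \<Delta>u\<close>, both parts of which are continuous in
  \<open>L\<^sup>2\<close>.\<close>

lemma P_cont:
  assumes t: "0 \<le> t" shows "l2_tendsto hypV (at t within {0..}) P (P t)"
proof (rule l2_tendsto_bound[OF P_sq[OF t]])
  have "((\<lambda>s. l2norm hypV (\<lambda>x. ut s x - ut t x)) \<longlongrightarrow> 0) (at t within {0..})"
    using u_C1 t by (simp add: C1_L2_curve_def continuous_wrt_def Lp_norm_2)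
  moreover have "((\<lambda>s. l2norm hypV (\<lambda>x. L s x - L t x)) \<longlongrightarrow> 0) (at t within {0..})"
    using L_cont[OF t] by (simp add: l2_tendsto_def)
  ultimately show "((\<lambda>s. l2norm hypV (\<lambda>x. ut s x - ut t x) + l2norm hypV (\<lambda>x. L s x - L t x)) \<longlongrightarrow> 0) (at t within {0..})"
    by (rule tendsto_add_zero)
  show "\<forall>\<^sub>F s in at t within {0..}. P s \<in> SQ" by (intro eventually_nonneg_time P_sq)
  show "\<forall>\<^sub>F s in at t within {0..}. l2norm hypV (\<lambda>x. P s x - P t x)
      \<le> l2norm hypV (\<lambda>x. ut s x - ut t x) + l2norm hypV (\<lambda>x. L s x - L t x)"
  proof (rule eventually_nonneg_time)
    fix s :: real assume s: "0 \<le> s"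
    have a: "(\<lambda>x. ut s x - ut t x) \<in> SQ" "(\<lambda>x. L s x - L t x) \<in> SQ"
      by (intro square_integrable_diff ut_sq L_sq s t)+
    have "l2norm hypV (\<lambda>x. P s x - P t x) = l2norm hypV (\<lambda>x. \<i> * (ut s x - ut t x) - (L s x - L t x))"
    proof (rule l2norm_cong_AE)
      show "(\<lambda>x. P s x - P t x) \<in> borel_measurable hypV" by (intro borel_measurable_diff P_measurable s t)
      show "(\<lambda>x. \<i> * (ut s x - ut t x) - (L s x - L t x)) \<in> borel_measurable hypV"
        by (intro square_integrableD(1) square_integrable_diff[OF square_integrable_cmult] a)
      show "AE x in hypV. P s x - P t x = \<i> * (ut s x - ut t x) - (L s x - L t x)"
        using P_eq[OF s] P_eq[OF t] by eventually_elim (simp add: algebra_simps)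
    qed
    also have "\<dots> \<le> l2norm hypV (\<lambda>x. \<i> * (ut s x - ut t x)) + l2norm hypV (\<lambda>x. L s x - L t x)"
      by (intro l2norm_triangle_diff square_integrable_cmult a)
    finally show "l2norm hypV (\<lambda>x. P s x - P t x)
      \<le> l2norm hypV (\<lambda>x. ut s x - ut t x) + l2norm hypV (\<lambda>x. L s x - L t x)" by (simp add: l2norm_cmult)
  qed
qed

lemma D_tendsto:
  assumes t: "0 \<le> t" shows "l2_tendsto hypV (at t within {0..}) (D t) (ut t)"
  unfolding l2_tendsto_def
proof (intro conjI ut_sq t eventually_nonneg_time D_sq)
  have "((\<lambda>s. l2norm hypV (\<lambda>x. (u s x - u t x) /\<^sub>R (s - t) - ut t x)) \<longlongrightarrow> 0) (at t within {0..})"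
    using u_C1 t by (simp add: C1_L2_curve_def derivative_wrt_def Lp_norm_2)
  then show "((\<lambda>s. l2norm hypV (\<lambda>x. D t s x - ut t x)) \<longlongrightarrow> 0) (at t within {0..})"
    by (simp add: scaleR_conv_of_real inverse_eq_divide)
qed

lemma ip_D:
  assumes "0 \<le> t" "0 \<le> s" "g \<in> SQ"
  shows "ip (D t s) g = (ip (u s) g - ip (u t) g) / of_real (s - t)"
  unfolding l2inner_cmult_left l2inner_diff_left[OF u_sq[OF assms(2)] u_sq[OF assms(1)] assms(3)] by simp

lemma Re_ip_D:
  assumes "0 \<le> t" "0 \<le> s" "g \<in> SQ"
  shows "Re (ip (D t s) g) = (Re (ip (u s) g) - Re (ip (u t) g)) / (s - t)"
  unfolding ip_D[OF assms] by (simp only: Re_divide_of_real minus_complex.sel)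

lemma Im_ip_D:
  assumes "0 \<le> t" "0 \<le> s" "g \<in> SQ"
  shows "Im (ip (D t s) g) = (Im (ip (u s) g) - Im (ip (u t) g)) / (s - t)"
  unfolding ip_D[OF assms] by (simp only: Im_divide_of_real minus_complex.sel)

lemma ip_ut:
  assumes t: "0 \<le> t" and g: "g \<in> SQ"
  shows "ip (ut t) g = - \<i> * (ip (L t) g + ip (P t) g)"
proof -
  have "ip (ut t) g = ip (\<lambda>x. - \<i> * (L t x + P t x)) g"
  proof (rule l2inner_cong_AE)
    show "(\<lambda>x. - \<i> * (L t x + P t x)) \<in> borel_measurable hypV"
      by (intro square_integrableD(1) square_integrable_cmult square_integrable_add L_sq P_sq t)
    show "AE x in hypV. ut t x = - \<i> * (L t x + P t x)"
      using equation[OF t]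
    proof eventually_elim
      case (elim x)
      show ?case unfolding elim[symmetric] by simp
    qed
  qed (intro square_integrableD(1) ut_sq t g AE_I2 refl)+
  then show ?thesis unfolding l2inner_cmult_left l2inner_add_left[OF L_sq[OF t] P_sq[OF t] g] .
qed

lemma green: "0 \<le> s \<Longrightarrow> 0 \<le> t \<Longrightarrow>
   (\<Sum>i\<in>UNIV. ip (\<lambda>x. wpar i (u s) x / of_real (conf x)) (\<lambda>x. wpar i (u t) x / of_real (conf x))) = - ip (u s) (L t)"
  by (rule green_formula[OF _ u_h2data u_h2data]) (use dim in auto)

lemma kin_eq: "0 \<le> t \<Longrightarrow> ip (u t) (L t) = - of_real (kin t)"
  using green[of t t] by (simp add: l2inner_self kin_def)

lemma pot_eq: "ip (P t) (u t) = of_real (pot t)"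
  unfolding l2inner_def power_nl_self integral_complex_of_real pot_def ..

lemma ip_ut_u:
  assumes t: "0 \<le> t" shows "ip (ut t) (u t) = - \<i> * of_real (pot t - kin t)"
proof -
  have "ip (L t) (u t) = - of_real (kin t)" using kin_eq[OF t] l2inner_commute[of hypV "L t" "u t"] by simp
  then show ?thesis using ip_ut[OF t u_sq[OF t]] by (simp add: pot_eq)
qed

lemma mass_derivative:
  assumes t: "0 \<le> t" shows "(mass has_real_derivative 0) (at t within {0..})"
  unfolding has_field_derivative_iff
proof (rule Lim_transform_eventually)
  have "((\<lambda>s. Re (ip (D t s) (u s)) + Re (ip (D t s) (u t))) \<longlongrightarrow> Re (ip (ut t) (u t)) + Re (ip (ut t) (u t))) (at t within {0..})"
    by (intro tendsto_intros l2_tendsto_inner D_tendsto u_cont l2_tendsto_const u_sq t)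
  then show "((\<lambda>s. Re (ip (D t s) (u s)) + Re (ip (D t s) (u t))) \<longlongrightarrow> 0) (at t within {0..})"
    unfolding ip_ut_u[OF t] by simp
  show "\<forall>\<^sub>F s in at t within {0..}. Re (ip (D t s) (u s)) + Re (ip (D t s) (u t)) = (mass s - mass t) / (s - t)"
  proof (rule eventually_nonneg_time)
    fix s :: real assume s: "0 \<le> s" "s \<noteq> t"
    have "Re (ip (u s) (u t)) = Re (ip (u t) (u s))" using l2inner_commute[of hypV "u s" "u t"] by simp
    moreover have "mass r = Re (ip (u r) (u r))" for r by (simp add: mass_def l2inner_self)
    ultimately show "Re (ip (D t s) (u s)) + Re (ip (D t s) (u t)) = (mass s - mass t) / (s - t)"
      unfolding Re_ip_D[OF t s(1) u_sq[OF s(1)]] Re_ip_D[OF t s(1) u_sq[OF t]] by (simp flip: add_divide_distrib)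
  qed
qed

text \<open>Green's formula for the times \<open>s\<close> and \<open>t\<close> in both slots gives
  \<open>kin s - kin t = - Re \<langle>u(s) - u(t), L(s) + L(t)\<rangle>\<close>, so the gradient need not be differentiated in time.\<close>

lemma kin_derivative:
  assumes t: "0 \<le> t" shows "(kin has_real_derivative - 2 * Re (ip (ut t) (L t))) (at t within {0..})"
  unfolding has_field_derivative_iff
proof (rule Lim_transform_eventually)
  have "((\<lambda>s. - (Re (ip (D t s) (L s)) + Re (ip (D t s) (L t)))) \<longlongrightarrow> - (Re (ip (ut t) (L t)) + Re (ip (ut t) (L t)))) (at t within {0..})"
    by (intro tendsto_intros l2_tendsto_inner D_tendsto L_cont l2_tendsto_const L_sq t)
  then show "((\<lambda>s. - (Re (ip (D t s) (L s)) + Re (ip (D t s) (L t)))) \<longlongrightarrow> - 2 * Re (ip (ut t) (L t))) (at t within {0..})"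
    by simp
  show "\<forall>\<^sub>F s in at t within {0..}. - (Re (ip (D t s) (L s)) + Re (ip (D t s) (L t))) = (kin s - kin t) / (s - t)"
  proof (rule eventually_nonneg_time)
    fix s :: real assume s: "0 \<le> s" "s \<noteq> t"
    have "ip (u s) (L t) = cnj (ip (u t) (L s))"
    proof -
      have "- ip (u s) (L t) = cnj (- ip (u t) (L s))"
        unfolding green[OF s(1) t, symmetric] green[OF t s(1), symmetric] cnj_sum
        by (intro sum.cong refl l2inner_commute)
      then show ?thesis by simp
    qed
    then have "Re (ip (u s) (L t)) = Re (ip (u t) (L s))" by simp
    moreover have "kin r = - Re (ip (u r) (L r))" if "0 \<le> r" for r using kin_eq[OF that] by simp
    note this[OF s(1)] this[OF t]
    ultimately show "- (Re (ip (D t s) (L s)) + Re (ip (D t s) (L t))) = (kin s - kin t) / (s - t)"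
      unfolding Re_ip_D[OF t s(1) L_sq[OF s(1)]] Re_ip_D[OF t s(1) L_sq[OF t]] add_divide_distrib[symmetric] minus_divide_left
      by (intro arg_cong[where f = "\<lambda>a. a / (s - t)"]) linarith
  qed
qed

lemma pot_increment:
  assumes t: "0 \<le> t" and s: "0 \<le> s"
  shows "(p + 1) * Re (ip (u s) (P t) - ip (u t) (P t)) \<le> pot s - pot t"
proof -
  have d: "(\<lambda>x. u s x - u t x) \<in> SQ" by (intro square_integrable_diff u_sq s t)
  have i: "integrable hypV (\<lambda>x. (u s x - u t x) * cnj (P t x))" by (rule integrable_prod_cnj[OF d P_sq[OF t]])
  have "(p + 1) * Re (ip (u s) (P t) - ip (u t) (P t)) = (p + 1) * (LINT x|hypV. Re ((u s x - u t x) * cnj (P t x)))"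
    unfolding l2inner_diff_left[OF u_sq[OF s] u_sq[OF t] P_sq[OF t], symmetric] unfolding l2inner_def
    by (simp only: integral_Re[OF i])
  also have "\<dots> = (LINT x|hypV. (p + 1) * Re ((u s x - u t x) * cnj (P t x)))" by simp
  also have "\<dots> \<le> (LINT x|hypV. norm (u s x) powr (p + 1) - norm (u t x) powr (p + 1))"
  proof (rule integral_mono)
    show "integrable hypV (\<lambda>x. (p + 1) * Re ((u s x - u t x) * cnj (P t x)))" using i by (intro integrable_mult_right integrable_Re)
    show "integrable hypV (\<lambda>x. norm (u s x) powr (p + 1) - norm (u t x) powr (p + 1))"
      by (intro Bochner_Integration.integrable_diff u_Lp s t)
    show "(p + 1) * Re ((u s x - u t x) * cnj (P t x)) \<le> norm (u s x) powr (p + 1) - norm (u t x) powr (p + 1)" for x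
      using power_nl_convex[OF p, of "u t x" "u s x"] by simp
  qed
  also have "\<dots> = pot s - pot t" unfolding pot_def by (intro Bochner_Integration.integral_diff u_Lp s t)
  finally show ?thesis .
qed

text \<open>By convexity the increment of the potential energy lies between \<open>(p + 1) Re \<langle>u(s) - u(t), P(t)\<rangle>\<close> and the same
  expression with \<open>P(s)\<close>, for either order of \<open>s\<close> and \<open>t\<close>; both have the same limit after division.\<close>

lemma pot_derivative:
  assumes t: "0 \<le> t" shows "(pot has_real_derivative (p + 1) * Re (ip (ut t) (P t))) (at t within {0..})"
  unfolding has_field_derivative_iff
proof (rule Lim_transform)
  let ?a = "\<lambda>s. (p + 1) * Re (ip (D t s) (P t))" and ?b = "\<lambda>s. (p + 1) * Re (ip (D t s) (P s))"
  have a: "(?a \<longlongrightarrow> (p + 1) * Re (ip (ut t) (P t))) (at t within {0..})"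
    by (intro tendsto_intros l2_tendsto_inner D_tendsto l2_tendsto_const P_sq t)
  have b: "(?b \<longlongrightarrow> (p + 1) * Re (ip (ut t) (P t))) (at t within {0..})"
    by (intro tendsto_intros l2_tendsto_inner D_tendsto P_cont t)
  show "(?a \<longlongrightarrow> (p + 1) * Re (ip (ut t) (P t))) (at t within {0..})" by (rule a)
  show "((\<lambda>s. (pot s - pot t) / (s - t) - ?a s) \<longlongrightarrow> 0) (at t within {0..})"
  proof (rule Lim_null_comparison)
    show "((\<lambda>s. \<bar>?b s - ?a s\<bar>) \<longlongrightarrow> 0) (at t within {0..})"
      using tendsto_rabs[OF tendsto_diff[OF b a]] by simp
    show "\<forall>\<^sub>F s in at t within {0..}. norm ((pot s - pot t) / (s - t) - ?a s) \<le> \<bar>?b s - ?a s\<bar>"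
    proof (rule eventually_nonneg_time)
      fix s :: real assume s: "0 \<le> s" "s \<noteq> t"
      define A B where "A = (p + 1) * Re (ip (u s) (P t) - ip (u t) (P t))" and "B = (p + 1) * Re (ip (u s) (P s) - ip (u t) (P s))"
      have "?a s = A / (s - t)" "?b s = B / (s - t)"
        unfolding Re_ip_D[OF t s(1) P_sq[OF s(1)]] Re_ip_D[OF t s(1) P_sq[OF t]] by (simp_all add: A_def B_def)
      moreover have "A \<le> pot s - pot t" unfolding A_def by (rule pot_increment[OF t s(1)])
      moreover have "pot s - pot t \<le> B" using pot_increment[OF s(1) t] unfolding B_def
        by (simp add: right_diff_distrib)
      ultimately have "norm ((pot s - pot t) / (s - t) - ?a s) = \<bar>pot s - pot t - A\<bar> / \<bar>s - t\<bar>"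
          "\<bar>?b s - ?a s\<bar> = \<bar>B - A\<bar> / \<bar>s - t\<bar>" "\<bar>pot s - pot t - A\<bar> \<le> \<bar>B - A\<bar>"
        by (simp_all flip: diff_divide_distrib)
      then show "norm ((pot s - pot t) / (s - t) - ?a s) \<le> \<bar>?b s - ?a s\<bar>" by (simp only: divide_right_mono abs_ge_zero)
    qed
  qed
qed

text \<open>The two derivatives add up to \<open>- 2 Re \<langle>u', i u'\<rangle> = 0\<close>.\<close>

lemma energy_derivative:
  assumes t: "0 \<le> t" shows "(energy has_real_derivative 0) (at t within {0..})"
proof -
  have "- \<i> * (ip (L t) (ut t) + ip (P t) (ut t)) = of_real ((l2norm hypV (ut t))\<^sup>2)"
    using ip_ut[OF t ut_sq[OF t]] by (simp add: l2inner_self)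
  then have "Im (- \<i> * (ip (L t) (ut t) + ip (P t) (ut t))) = 0" by (simp only: Im_complex_of_real)
  then have "Re (ip (L t) (ut t)) + Re (ip (P t) (ut t)) = 0" by simp
  then have z: "Re (ip (ut t) (L t)) + Re (ip (ut t) (P t)) = 0"
    using l2inner_commute[of hypV "ut t" "L t"] l2inner_commute[of hypV "ut t" "P t"] by simp
  have "(energy has_real_derivative - 2 * Re (ip (ut t) (L t)) - 2 / (p + 1) * ((p + 1) * Re (ip (ut t) (P t)))) (at t within {0..})"
    unfolding energy_def[abs_def] by (intro DERIV_diff kin_derivative DERIV_cmult pot_derivative t)
  moreover have "- 2 * Re (ip (ut t) (L t)) - 2 / (p + 1) * ((p + 1) * Re (ip (ut t) (P t))) = 0"
    using z p by simp
  ultimately show ?thesis by simp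
qed

text \<open>Moving \<open>X\<close> off the increment of \<open>u\<close> by the adjoint formula gives
  \<open>J(s) - J(t) = - Im ((n - 1) \<langle>d, u(s)\<rangle> + \<langle>d, X u(s)\<rangle> + \<langle>d, X u(t)\<rangle>)\<close> for \<open>d = u(s) - u(t)\<close>.\<close>

lemma J_derivative:
  assumes t: "0 \<le> t"
  shows "(J has_real_derivative 2 * Re (ip (X t) (L t)) + 2 * Re (ip (X t) (P t)) - (real CARD('n) - 1) * (kin t - pot t)) (at t within {0..})"
  unfolding has_field_derivative_iff
proof (rule Lim_transform_eventually)
  let ?c = "real CARD('n) - 1"
  let ?q = "\<lambda>s. - (?c * Im (ip (D t s) (u s)) + Im (ip (D t s) (X s)) + Im (ip (D t s) (X t)))"
  have l: "(?q \<longlongrightarrow> - (?c * Im (ip (ut t) (u t)) + Im (ip (ut t) (X t)) + Im (ip (ut t) (X t)))) (at t within {0..})"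
    by (intro tendsto_intros l2_tendsto_inner D_tendsto X_cont u_cont l2_tendsto_const X_sq t)
  have "Im (ip (ut t) (X t)) = - (Re (ip (L t) (X t)) + Re (ip (P t) (X t)))"
    unfolding ip_ut[OF t X_sq[OF t]] by simp
  also have "\<dots> = - (Re (ip (X t) (L t)) + Re (ip (X t) (P t)))"
    using l2inner_commute[of hypV "X t" "L t"] l2inner_commute[of hypV "X t" "P t"] by simp
  finally have "- (?c * Im (ip (ut t) (u t)) + Im (ip (ut t) (X t)) + Im (ip (ut t) (X t)))
     = 2 * Re (ip (X t) (L t)) + 2 * Re (ip (X t) (P t)) - ?c * (kin t - pot t)"
    unfolding ip_ut_u[OF t] by (simp add: algebra_simps)
  with l show "(?q \<longlongrightarrow> 2 * Re (ip (X t) (L t)) + 2 * Re (ip (X t) (P t)) - ?c * (kin t - pot t)) (at t within {0..})"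
    by simp
  show "\<forall>\<^sub>F s in at t within {0..}. ?q s = (J s - J t) / (s - t)"
  proof (rule eventually_nonneg_time)
    fix s :: real assume s: "0 \<le> s" "s \<noteq> t"
    have ibp: "ip (X a) (u b) + ip (u a) (X b) = - of_real ?c * ip (u a) (u b)" if "0 \<le> a" "0 \<le> b" for a b
      by (rule vfield_integration_by_parts[OF u_h2data[OF that(1)] u_h2data[OF that(2)]])
    have "Im (ip (X a) (u b)) + Im (ip (u a) (X b)) = - ?c * Im (ip (u a) (u b))" if "0 \<le> a" "0 \<le> b" for a b
      using arg_cong[OF ibp[OF that], of Im] by simp
    note I = this[OF s(1) s(1)] this[OF t s(1)]
    have "Im (ip (X t) (u r)) = - Im (ip (u r) (X t))" for r
      using l2inner_commute[of hypV "X t" "u r"] by simp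
    note X = this[of s] this[of t]
    have "J s - J t = - (?c * (Im (ip (u s) (u s)) - Im (ip (u t) (u s)))
       + (Im (ip (u s) (X s)) - Im (ip (u t) (X s))) + (Im (ip (u s) (X t)) - Im (ip (u t) (X t))))"
      unfolding J_def using I X by (simp add: algebra_simps)
    then show "?q s = (J s - J t) / (s - t)"
      unfolding Im_ip_D[OF t s(1) u_sq[OF s(1)]] Im_ip_D[OF t s(1) X_sq[OF s(1)]] Im_ip_D[OF t s(1) X_sq[OF t]]
        times_divide_eq_right add_divide_distrib[symmetric] minus_divide_left
      by (intro arg_cong[where f = "\<lambda>a. a / (s - t)"]) (rule sym)
  qed
qed

lemma conserved:
  assumes "0 \<le> t" shows "mass t = mass 0" "energy t = energy 0"
proof -
  have "\<exists>c. \<forall>t\<in>{0..}. mass t = c" "\<exists>c. \<forall>t\<in>{0..}. energy t = c"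
    by (intro has_field_derivative_zero_constant mass_derivative energy_derivative; simp)+
  then show "mass t = mass 0" "energy t = energy 0" using assms by auto
qed

text \<open>The right-hand side is the derivative of \<open>J\<close>.  Expressing the potential energy through the conserved energy leaves
  \<open>(2/n) \<parallel>Xu\<parallel>\<^sup>2 + (\<kappa> - 2) kin + \<kappa> |E|\<close> with \<open>\<kappa> = (n - 1)(p - 1)/2\<close>, and the lower bound on \<open>p\<close> is \<open>\<kappa> \<ge> 2\<close>.  Adding 1 to the
  mass in the denominator avoids a separate case of mass zero.\<close>

lemma virial_growth:
  assumes t: "0 \<le> t" and pn: "1 + 4 / (real CARD('n) - 1) \<le> p" and E: "energy 0 < 0"
  shows "2 / (real CARD('n) * (mass 0 + 1)) * (J t)\<^sup>2 + 2 * (- energy 0)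
    \<le> 2 * Re (ip (X t) (L t)) + 2 * Re (ip (X t) (P t)) - (real CARD('n) - 1) * (kin t - pot t)" (is "_ \<le> ?J'")
proof -
  let ?n = "real CARD('n)"
  define \<kappa> where "\<kappa> = (?n - 1) * (p - 1) / 2"
  have n: "3 \<le> ?n" using dim by simp
  have "4 / (?n - 1) \<le> p - 1" using pn by simp
  then have \<kappa>: "2 \<le> \<kappa>" using n by (simp add: \<kappa>_def field_simps)
  have kin0: "0 \<le> kin t" by (simp add: kin_def sum_nonneg)
  have "(J t)\<^sup>2 \<le> (norm (ip (X t) (u t)))\<^sup>2"
    unfolding J_def using abs_Im_le_cmod[of "ip (X t) (u t)"] by (simp add: abs_le_square_iff[symmetric])
  also have "\<dots> \<le> (l2norm hypV (X t) * l2norm hypV (u t))\<^sup>2"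
    by (intro power_mono norm_l2inner_le X_sq u_sq t) simp
  also have "\<dots> = (l2norm hypV (X t))\<^sup>2 * mass 0" using conserved(1)[OF t] by (simp add: mass_def power_mult_distrib)
  also have "\<dots> \<le> (l2norm hypV (X t))\<^sup>2 * (mass 0 + 1)" by (intro mult_left_mono) auto
  finally have "(J t)\<^sup>2 / (mass 0 + 1) \<le> (l2norm hypV (X t))\<^sup>2"
    by (subst divide_le_eq) (simp add: mass_def add_nonneg_pos)
  then have "2 / ?n * ((J t)\<^sup>2 / (mass 0 + 1)) \<le> 2 / ?n * (l2norm hypV (X t))\<^sup>2"
    using n by (intro mult_left_mono) auto
  also have "\<dots> \<le> 2 * Re (ip (X t) (L t)) - (?n - 3) * kin t"
    unfolding kin_def by (rule virial_lower_bound[OF _ u_h2data[OF t]]) (use dim in simp)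
  finally have 1: "2 / (?n * (mass 0 + 1)) * (J t)\<^sup>2 \<le> 2 * Re (ip (X t) (L t)) - (?n - 3) * kin t" by simp
  have "Re (ip (X t) (P t)) = - (?n - 1) / (p + 1) * pot t"
    unfolding pot_def by (rule vfield_power[OF p u_h2data[OF t] u_Lp[OF t] P_sq[OF t]])
  then have "2 * Re (ip (X t) (P t)) + (?n - 1) * pot t = \<kappa> * (2 / (p + 1) * pot t)"
    using p by (simp add: \<kappa>_def field_simps)
  also have "2 / (p + 1) * pot t = kin t - energy 0" using conserved(2)[OF t] by (simp add: energy_def)
  finally have 2: "2 * Re (ip (X t) (P t)) + (?n - 1) * pot t = \<kappa> * kin t + \<kappa> * (- energy 0)" by (simp add: algebra_simps)
  have "2 * kin t \<le> \<kappa> * kin t" "2 * (- energy 0) \<le> \<kappa> * (- energy 0)"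
    using \<kappa> kin0 E by (intro mult_right_mono; simp)+
  with 1 2 show ?thesis by (simp add: algebra_simps)
qed

end

text \<open>After rescaling, \<open>arctan\<close> of a solution grows at least linearly, yet it is bounded.\<close>

lemma riccati_not_global:
  fixes y y' :: "real \<Rightarrow> real"
  assumes ab: "0 < a" "0 < b"
    and d: "\<And>t. 0 \<le> t \<Longrightarrow> (y has_real_derivative y' t) (at t within {0..})"
    and le: "\<And>t. 0 \<le> t \<Longrightarrow> a * (y t)\<^sup>2 + b \<le> y' t"
  shows False
proof -
  define k where "k = sqrt (a / b)"
  have k: "0 < k" "k\<^sup>2 = a / b" using ab by (simp_all add: k_def)
  define \<phi> where "\<phi> t = arctan (k * y t) - k * b * t" for t
  have \<phi>': "(\<phi> has_real_derivative inverse (1 + (k * y t)\<^sup>2) * (k * y' t) - k * b) (at t within {0..})" if "0 \<le> t" for t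
    unfolding \<phi>_def[abs_def] by (auto intro!: derivative_eq_intros d that)
  have pos: "0 \<le> inverse (1 + (k * y t)\<^sup>2) * (k * y' t) - k * b" if "0 \<le> t" for t
  proof -
    have "b * (1 + (k * y t)\<^sup>2) = a * (y t)\<^sup>2 + b" using ab by (simp add: power_mult_distrib k(2) field_simps)
    with le[OF that] have "k * (b * (1 + (k * y t)\<^sup>2)) \<le> k * y' t" using k by (intro mult_left_mono) auto
    moreover have "0 < 1 + (k * y t)\<^sup>2" by (simp add: add_pos_nonneg)
    ultimately show ?thesis by (simp add: field_simps)
  qed
  \<comment> \<open>by this time the linear growth has used up the whole range of \<open>arctan\<close>\<close>
  define t where "t = pi / (k * b)"
  have t: "0 \<le> t" "k * b * t = pi" using ab k by (simp_all add: t_def)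
  have "\<phi> 0 \<le> \<phi> t"
  proof (rule DERIV_nonneg_imp_increasing_open[OF t(1)])
    fix r assume r: "0 < r" "r < t"
    then have "at r within {0..} = at r" by (intro at_within_interior) simp
    then show "\<exists>z. (\<phi> has_real_derivative z) (at r) \<and> 0 \<le> z" using \<phi>'[of r] pos[of r] r by auto
  next
    have "continuous_on {0..} \<phi>"
      using \<phi>' by (intro DERIV_continuous_on) auto
    then show "continuous_on {0..t} \<phi>" by (rule continuous_on_subset) auto
  qed
  then show False using arctan_bounded[of "k * y 0"] arctan_bounded[of "k * y t"] t by (simp add: \<phi>_def)
qed

theorem (in global_nls_flow) no_negative_energy:
  assumes "1 + 4 / (real CARD('n) - 1) \<le> p" shows "0 \<le> energy 0"
proof (rule ccontr)
  assume "\<not> 0 \<le> energy 0"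
  then have E: "energy 0 < 0" by simp
  show False
  proof (rule riccati_not_global[OF _ _ J_derivative virial_growth[OF _ assms E]])
    show "0 < 2 / (real CARD('n) * (mass 0 + 1))" using dim by (simp add: mass_def add_nonneg_pos)
    show "0 < 2 * (- energy 0)" using E by simp
  qed
qed

text \<open>The initial value is attained almost everywhere only, and the chosen weak derivatives of the two
  representatives may differ on a null set.\<close>

lemma nls_energy_hyp:
  fixes f g :: "real^'n::finite \<Rightarrow> complex"
  assumes f: "f \<in> H1_space hyp_domain hyp_metric" and g: "g \<in> H2"
    and gp: "integrable hypV (\<lambda>x. norm (g x) powr (p + 1))" and eq: "AE x in hypV. g x = f x"
  shows "nls_energy hyp_domain hyp_metric p f
    = (\<Sum>i\<in>UNIV. (l2norm hypV (\<lambda>x. wpar i g x / of_real (conf x)))\<^sup>2) - 2 / (p + 1) * (LINT x|hypV. norm (g x) powr (p + 1))"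
proof -
  have f1: "f \<in> borel_measurable hypV" "\<exists>w. hwp i f w" for i
    using f unfolding H1_space_def riem_vol_hyp Lp_space_2 by (auto dest: square_integrableD)
  have fw: "hwp i f (wpar i f)" for i unfolding weak_partial_def by (rule someI_ex[OF f1(2)])
  have ae: "AE x in ballL. wpar i f x = wpar i g x" for i
    by (rule hwp_unique[OF fw H2D(2)[OF g]]) (use eq in \<open>auto simp: AE_hypV elim: eventually_mono\<close>)
  have aea: "AE x in (ballL :: (real^'n) measure). \<forall>i. wpar i f x = wpar i g x"
    by (rule eventually_all_finite[OF ae])
  have [measurable]: "wpar i f \<in> borel_measurable ballL" "wpar i g \<in> borel_measurable ballL" for i
    using hwp_loc1(2)[OF fw[of i]] hwp_loc1(2)[OF H2D(2)[OF g, of i]] by (auto simp: loc1_def)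
  have [measurable]: "f \<in> borel_measurable ballL" "g \<in> borel_measurable ballL"
    using f1(1) square_integrableD(1)[OF H2D(1)[OF g]] by simp_all
  have "nls_energy hyp_domain hyp_metric p f
    = (LINT x|hypV. (\<Sum>i\<in>UNIV. (norm (wpar i f x / of_real (conf x)))\<^sup>2) - 2 / (p + 1) * norm (f x) powr (p + 1))"
    unfolding nls_energy_def riem_vol_hyp by (intro Bochner_Integration.integral_cong refl) (simp add: grad_sq_hyp)
  also have "\<dots> = (LINT x|hypV. (\<Sum>i\<in>UNIV. (norm (wpar i g x / of_real (conf x)))\<^sup>2) - 2 / (p + 1) * norm (g x) powr (p + 1))"
  proof (rule integral_cong_AE)
    show "(\<lambda>x. (\<Sum>i\<in>UNIV. (norm (wpar i f x / of_real (conf x)))\<^sup>2) - 2 / (p + 1) * norm (f x) powr (p + 1)) \<in> borel_measurable hypV"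
      "(\<lambda>x. (\<Sum>i\<in>UNIV. (norm (wpar i g x / of_real (conf x)))\<^sup>2) - 2 / (p + 1) * norm (g x) powr (p + 1)) \<in> borel_measurable hypV"
      unfolding measurable_hypV by measurable
    show "AE x in hypV. (\<Sum>i\<in>UNIV. (norm (wpar i f x / of_real (conf x)))\<^sup>2) - 2 / (p + 1) * norm (f x) powr (p + 1)
      = (\<Sum>i\<in>UNIV. (norm (wpar i g x / of_real (conf x)))\<^sup>2) - 2 / (p + 1) * norm (g x) powr (p + 1)"
      using aea[folded AE_hypV] eq by eventually_elim simp
  qed
  also have "\<dots> = (\<Sum>i\<in>UNIV. LINT x|hypV. (norm (wpar i g x / of_real (conf x)))\<^sup>2) - 2 / (p + 1) * (LINT x|hypV. norm (g x) powr (p + 1))"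
    using square_integrableD(2)[OF H2D(4)[OF g]] gp
    by (subst Bochner_Integration.integral_diff) (auto intro!: Bochner_Integration.integral_sum)
  finally show ?thesis by (simp add: l2norm_power2)
qed

theorem theorem14:
  fixes p :: real and T :: ereal
    and u0 :: "real^'n::finite \<Rightarrow> complex" and u :: "real \<Rightarrow> real^'n \<Rightarrow> complex"
  assumes "CARD('n) \<ge> 3"
    and "p \<ge> 1 + 4 / (real CARD('n) - 1)"
    and "u0 \<in> H1_space hyp_domain hyp_metric"
    and "0 < T"
    and "maximal_nls_solution hyp_domain hyp_metric p u0 T u"
    and "nls_energy hyp_domain hyp_metric p u0 < 0"
  shows "T < \<infinity>"
proof (rule ccontr)
  assume "\<not> T < \<infinity>"
  then have T: "time_interval T = {0..}" by (auto simp: time_interval_def)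
  have "0 < 4 / (real CARD('n) - 1)" using assms(1) by simp
  then have p: "1 < p" using assms(2) by linarith
  have sol: "nls_solution hyp_domain hyp_metric p u0 T u" using assms(5) by (simp add: maximal_nls_solution_def)
  then obtain ut where C1: "C1_L2_curve hypV {0..} u ut"
    and eq: "\<And>t. t \<in> {0..} \<Longrightarrow> AE x in hypV. \<i> * ut t x =
             laplace_beltrami hyp_domain hyp_metric (u t) x + of_real (norm (u t x) powr (p - 1)) * u t x"
    unfolding nls_solution_def T riem_vol_hyp by blast
  have u: "u t \<in> H2" "integrable hypV (\<lambda>x. norm (u t x) powr (p + 1))" if "0 \<le> t" for t
    using sol that unfolding nls_solution_def T riem_vol_hyp Lp_space_def by auto
  interpret global_nls_flow p u ut
  proof
    show "continuous_wrt (H2_norm hyp_domain hyp_metric) {0..} u"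
      using sol unfolding nls_solution_def T by blast
    fix t :: real assume t: "0 \<le> t"
    have "AE x in (hypV :: (real^'n) measure). norm x < 1" by (rule AE_I2) simp
    moreover have "AE x in hypV. \<i> * ut t x =
             laplace_beltrami hyp_domain hyp_metric (u t) x + of_real (norm (u t x) powr (p - 1)) * u t x"
      using eq t by simp
    ultimately show "AE x in hypV. \<i> * ut t x = lap (wgrad (u t)) (whess (u t)) x + power_nl p (u t x)"
      by eventually_elim (simp add: laplace_hyp(2) power_nl_def)
  qed (use assms(1) p u C1 in auto)
  have "AE x in hypV. u 0 x = u0 x" using sol unfolding nls_solution_def riem_vol_hyp by blast
  then have "nls_energy hyp_domain hyp_metric p u0 = energy 0"
    unfolding energy_def kin_def pot_def by (intro nls_energy_hyp assms(3) u) auto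
  with no_negative_energy[OF assms(2)] assms(6) show False by simp
qed

end
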